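(* Let $n\ge 5$ be an integer and $\alpha,\beta,p,\lambda,\mu\in\mathbb{R}$ with $-n<\alpha<n-4$, $p>1$ and $$\frac{n+\alpha}{2}+\frac{n+\beta}{p+1}=n-2.$$ Assume that at least one of the following three conditions holds: $(C_1)$ $\mu\ge 0$ and $\lambda\le (n-2)(2+\alpha)-2\sqrt{\mu}$; $(C_2)$ $0\le\mu\le\left(\frac{n-4-\alpha}{2}\right)^4$ and $(n-2)(2+\alpha)+2\sqrt{\mu}\le\lambda\le\frac{4\mu}{(n-4-\alpha)^2}+\frac{(n+\alpha)^2}{4}$; $(C_3)$ $\mu\le 0$ and $\lambda\le\frac{4\mu}{(n-4-\alpha)^2}+\frac{(n+\alpha)^2}{4}$. Let $$S_p^{rad}(\alpha,\beta)=\inf_{u\in\mathcal{N}^2_{rad}(\mathbb{R}^n,\alpha)\setminus\{0\}}\frac{\int_{\mathbb{R}^n}\left(|x|^{-\alpha}|\Delta u|^2-\lambda|x|^{-\alpha-2}|\nabla u|^2+\mu|x|^{-\alpha-4}u^2\right)dx}{\left(\int_{\mathbb{R}^n}|x|^\beta|u|^{p+1}dx\right)^{\frac{2}{p+1}}}.$$ Then: (i) $S_p^{rad}(\alpha,\beta)>0$, and $S_p^{rad}(\alpha,\beta)$ is achieved in $\mathcal{N}^2_{rad}(\mathbb{R}^n,\alpha)$. (ii) If $\alpha=\beta>-2$ and, for one of the two choices of sign, $$\frac{\lambda}{(n-2)^2}=\frac{(p+1)^4-16\pm\sqrt{[(p+1)^4-16]^2+(p+1)^2(p+3)^4[(p+1)^2+4]^2\frac{\mu}{(n-2)^4}}}{2(p+1)^2(p+3)^2},$$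 then $S_p^{rad}(\alpha,\alpha)=\omega_n^{\frac{2(2+\alpha)}{n+\alpha}}\phi_{1,p}(\alpha)$, where $$\phi_{1,p}(\alpha)=\nu_1^{\frac{2(2n+\alpha-2)}{n+\alpha}}m_1(m_1-1)(m_1-2)(m_1-3)\left[\frac{4m_1(m_1-1)}{(2m_1-1)(2m_1-3)}B\left(-m_1,\tfrac12\right)\right]^{\frac{2(2+\alpha)}{n+\alpha}},$$ and it is achieved by $$u_1(x)=\frac{C_1}{2^{m_1}}|x|^{-\left(\frac{n-4-\alpha}{2}+\nu_1m_1\right)}(1+|x|^{2\nu_1})^{m_1},$$ with $m_1=-\frac{n-4-\alpha}{2+\alpha}$, $\nu_1=\frac{2+\alpha}{2}\sqrt{1-\frac{2\lambda}{(n-2)^2+(2+\alpha)^2}}$, $C_1>0$, $C_1^{p-1}=m_1(m_1-1)(m_1-2)(m_1-3)\nu_1^4$. (iii) If $(n+\alpha)(n+\beta)=(n-4-\alpha)^2$ with $\alpha<-2$ and, for one of the two choices of sign, $$\frac{\lambda}{(n-2)^2}=\frac{(p+1)^2[16-(p+1)^4]\pm\sqrt{(p+1)^4[(p+1)^4-16]^2+16(p+1)^2(p+3)^4[(p+1)^2+4]^2\frac{\mu}{(n-2)^4}}}{8(p+1)^2(p+3)^2},$$ then $S_p^{rad}(\alpha,\beta)=\omega_n^{-\frac{2(2+\alpha)}{n-4-\alpha}}\phi_{2,p}(\alpha)$, where $$\phi_{2,p}(\alpha)=\nu_2^{\frac{2(2n-\alpha-6)}{n-4-\alpha}}m_2(m_2-1)(m_2-2)(m_2-3)\left[\frac{4m_2(m_2-1)}{(2m_2-1)(2m_2-3)}B\left(-m_2,\tfrac12\right)\right]^{-\frac{2(2+\alpha)}{n-4-\alpha}},$$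 and it is achieved by $$u_2(x)=\frac{C_2}{2^{m_2}}|x|^{-\left(\frac{n-4-\alpha}{2}+\nu_2m_2\right)}(1+|x|^{2\nu_2})^{m_2},$$ with $m_2=\frac{n+\alpha}{2+\alpha}$, $\nu_2=-\frac{2+\alpha}{2}\sqrt{1-\frac{2\lambda}{(n-2)^2+(2+\alpha)^2}}$, $C_2>0$, $C_2^{p-1}=m_2(m_2-1)(m_2-2)(m_2-3)\nu_2^4$.
   Context: For radial $u\in C_0^\infty(\mathbb{R}^n\setminus\{0\})$ put $$\|u\|_\alpha^2:=\int_{\mathbb{R}^n}\left(|x|^{-\alpha}|\Delta u|^2-\lambda|x|^{-\alpha-2}|\nabla u|^2+\mu|x|^{-\alpha-4}u^2\right)dx .$$ Under any of the conditions $(C_1)$–$(C_3)$, $\|\cdot\|_\alpha$ is a norm on $C^\infty_{0,rad}(\mathbb{R}^n\setminus\{0\})=\{u\in C_0^\infty(\mathbb{R}^n\setminus\{0\}):u(x)=u(|x|)\}$. The space $\mathcal{N}^2_{rad}(\mathbb{R}^n,\alpha)$ is the completion of $C^\infty_{0,rad}(\mathbb{R}^n\setminus\{0\})$ in the norm $\|\cdot\|_\alpha$ (it depends on $\lambda,\mu$). Here $\omega_n$ is the surface measure of the unit sphere $\mathbb{S}^{n-1}$, and $B(\cdot,\cdot)$ is the Euler Beta function.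
   Formalization: The endpoint λ = 4μ/(n−4−α)² + (n+α)²/4 in (C₂), (C₃) is in effect excluded: the completion is required to be a space of functions modulo a.e. equality, and there it is not one; spread-out test functions give S = 0 there, so (i) fails as stated. *)

theory Defs
  imports "HOL-Analysis.Analysis"
begin

section \<open>Radial test functions on the punctured space\<close>

definition partial_deriv ::
    "'a::euclidean_space \<Rightarrow> ('a \<Rightarrow> real) \<Rightarrow> 'a \<Rightarrow> real" where
  "partial_deriv b u x = frechet_derivative u (at x) b"

fun iter_partial_deriv ::
    "'a::euclidean_space list \<Rightarrow> ('a \<Rightarrow> real) \<Rightarrow> 'a \<Rightarrow> real" where
  "iter_partial_deriv [] u = u"
| "iter_partial_deriv (b # bs) u = partial_deriv b (iter_partial_deriv bs u)"

definition gradient :: "('a::euclidean_space \<Rightarrow> real) \<Rightarrow> 'a \<Rightarrow> 'a" where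
  "gradient u x = (\<Sum>b\<in>Basis. partial_deriv b u x *\<^sub>R b)"

definition laplacian :: "('a::euclidean_space \<Rightarrow> real) \<Rightarrow> 'a \<Rightarrow> real" where
  "laplacian u x = (\<Sum>b\<in>Basis. partial_deriv b (partial_deriv b u) x)"

definition smooth :: "('a::euclidean_space \<Rightarrow> real) \<Rightarrow> bool" where
  "smooth u \<longleftrightarrow>
     (\<forall>bs. set bs \<subseteq> Basis \<longrightarrow> iter_partial_deriv bs u differentiable_on UNIV)"

definition support :: "('a::euclidean_space \<Rightarrow> real) \<Rightarrow> 'a set" where
  "support u = closure {x. u x \<noteq> 0}"

definition radial :: "('a::euclidean_space \<Rightarrow> real) \<Rightarrow> bool" where
  "radial u \<longleftrightarrow> (\<forall>x y. norm x = norm y \<longrightarrow> u x = u y)"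

text \<open>
  A smooth function with compact support in the punctured space is identified with its
  extension by 0 to the whole space, which is again smooth.
\<close>

definition punctured_test_rad :: "('a::euclidean_space \<Rightarrow> real) set" where
  "punctured_test_rad = {u. smooth u \<and> compact (support u) \<and> 0 \<notin> support u \<and> radial u}"

definition alpha_norm ::
    "real \<Rightarrow> real \<Rightarrow> real \<Rightarrow> ('a::euclidean_space \<Rightarrow> real) \<Rightarrow> real" where
  "alpha_norm \<alpha> lam \<mu> u =
     sqrt (LINT x|lebesgue.
       norm x powr (-\<alpha>) * \<bar>laplacian u x\<bar>\<^sup>2
       - lam * norm x powr (-\<alpha> - 2) * (norm (gradient u x))\<^sup>2
       + \<mu> * norm x powr (-\<alpha> - 4) * (u x)\<^sup>2)"


section \<open>Completion of a normed space of functions\<close>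

text \<open>
  \<open>function_completion V nrm N ext_nrm\<close>: the space \<open>N\<close>, with norm \<open>ext_nrm\<close>, is the completion
  of \<open>(V, nrm)\<close>, its elements being functions modulo equality almost everywhere.
  The last assumption ties the elements of \<open>N\<close>, as functions, to the Cauchy sequences in \<open>V\<close>
  which they are limits of.  Without it a completion is determined only up to isometry, and
  integrals such as \<open>\<integral>|x|\<^sup>\<beta>|u|\<^sup>p\<^sup>+\<^sup>1\<close> have no meaning for its elements.
  With it, the completion is unique (see \<open>function_completion_unique\<close>), but it need not
  exist: for the norm \<open>alpha_norm \<alpha> lam \<mu>\<close> in dimension \<open>n\<close> it does not at the endpoint
  \<open>lam = 4\<mu>/(n-4-\<alpha>)\<^sup>2 + (n+\<alpha>)\<^sup>2/4\<close>.  There some test functions with norms tending to 0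
  converge pointwise to \<open>|x|\<close> to the power \<open>-(n-4-\<alpha>)/2\<close>.
\<close>

locale function_completion =
  fixes V :: "('a::euclidean_space \<Rightarrow> real) set"
    and nrm :: "('a \<Rightarrow> real) \<Rightarrow> real"
    and N :: "('a \<Rightarrow> real) set"
    and ext_nrm :: "('a \<Rightarrow> real) \<Rightarrow> real"
  assumes measurable: "\<And>u. u \<in> N \<Longrightarrow> u \<in> borel_measurable lebesgue"
    and AE_closed: "\<And>u w. u \<in> N \<Longrightarrow> AE x in lebesgue. w x = u x \<Longrightarrow> w \<in> N"
    and add_closed: "\<And>u w. u \<in> N \<Longrightarrow> w \<in> N \<Longrightarrow> (\<lambda>x. u x + w x) \<in> N"
    and scale_closed: "\<And>c u. u \<in> N \<Longrightarrow> (\<lambda>x. c * u x) \<in> N"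
    and norm_eq_0: "\<And>u. u \<in> N \<Longrightarrow> ext_nrm u = 0 \<longleftrightarrow> (AE x in lebesgue. u x = 0)"
    and norm_scale: "\<And>c u. u \<in> N \<Longrightarrow> ext_nrm (\<lambda>x. c * u x) = \<bar>c\<bar> * ext_nrm u"
    and norm_triangle:
      "\<And>u w. u \<in> N \<Longrightarrow> w \<in> N \<Longrightarrow> ext_nrm (\<lambda>x. u x + w x) \<le> ext_nrm u + ext_nrm w"
    and subset: "V \<subseteq> N"
    and extends: "\<And>u. u \<in> V \<Longrightarrow> ext_nrm u = nrm u"
    and dense: "\<And>u. u \<in> N \<Longrightarrow>
      \<exists>s. (\<forall>k::nat. s k \<in> V) \<and> (\<lambda>k. ext_nrm (\<lambda>x. s k x - u x)) \<longlonglongrightarrow> 0"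
    and complete: "\<And>s :: nat \<Rightarrow> 'a \<Rightarrow> real. (\<And>k. s k \<in> N) \<Longrightarrow>
      (\<forall>e>0. \<exists>K. \<forall>j\<ge>K. \<forall>k\<ge>K. ext_nrm (\<lambda>x. s j x - s k x) < e) \<Longrightarrow>
      \<exists>u\<in>N. (\<lambda>k. ext_nrm (\<lambda>x. s k x - u x)) \<longlonglongrightarrow> 0"
    and AE_limit: "\<And>(s :: nat \<Rightarrow> 'a \<Rightarrow> real) u. (\<And>k. s k \<in> N) \<Longrightarrow> u \<in> N \<Longrightarrow>
      (\<lambda>k. ext_nrm (\<lambda>x. s k x - u x)) \<longlonglongrightarrow> 0 \<Longrightarrow>
      \<exists>r. strict_mono r \<and> (AE x in lebesgue. (\<lambda>k. s (r k) x) \<longlonglongrightarrow> u x)"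
begin

lemma diff_closed: "u \<in> N \<Longrightarrow> w \<in> N \<Longrightarrow> (\<lambda>x. u x - w x) \<in> N"
  using add_closed[OF _ scale_closed[of w "-1"], of u] by simp

lemma norm_minus: "u \<in> N \<Longrightarrow> w \<in> N \<Longrightarrow> ext_nrm (\<lambda>x. u x - w x) = ext_nrm (\<lambda>x. w x - u x)"
  using norm_scale[OF diff_closed, of w u "-1"] by simp

lemma norm_diff: "u \<in> N \<Longrightarrow> w \<in> N \<Longrightarrow> ext_nrm u \<le> ext_nrm w + ext_nrm (\<lambda>x. u x - w x)"
  using norm_triangle[of w "\<lambda>x. u x - w x"] diff_closed[of u w] by simp

lemma norm_limit:
  assumes s: "\<And>k::nat. s k \<in> N" and u: "u \<in> N"
    and lim: "(\<lambda>k. ext_nrm (\<lambda>x. s k x - u x)) \<longlonglongrightarrow> 0"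
  shows "(\<lambda>k. ext_nrm (s k)) \<longlonglongrightarrow> ext_nrm u"
proof -
  have "norm (ext_nrm (s k) - ext_nrm u) \<le> ext_nrm (\<lambda>x. s k x - u x)" for k
    using norm_diff[OF s[of k] u] norm_diff[OF u s[of k]] norm_minus[OF s[of k] u] by auto
  then have "(\<lambda>k. ext_nrm (s k) - ext_nrm u) \<longlonglongrightarrow> 0"
    by (intro Lim_null_comparison[OF _ lim]) auto
  then show ?thesis by (simp add: LIM_zero_iff)
qed

end

lemma function_completion_le:
  assumes P: "function_completion V nrm N e" and Q: "function_completion V nrm N' e'"
    and V: "\<And>u w. u \<in> V \<Longrightarrow> w \<in> V \<Longrightarrow> (\<lambda>x. u x - w x) \<in> V"
    and u: "u \<in> N"
  shows "u \<in> N' \<and> e' u = e u"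
proof -
  interpret P: function_completion V nrm N e by (fact P)
  interpret Q: function_completion V nrm N' e' by (fact Q)
  obtain s where s: "\<And>k::nat. s k \<in> V" and lim: "(\<lambda>k. e (\<lambda>x. s k x - u x)) \<longlonglongrightarrow> 0"
    using P.dense[OF u] by blast
  have sN: "\<And>k. s k \<in> N" "\<And>k. s k \<in> N'" using s P.subset Q.subset by auto
  have tri: "e' (\<lambda>x. s j x - s k x) \<le> e (\<lambda>x. s j x - u x) + e (\<lambda>x. s k x - u x)" for j k
  proof -
    have "e' (\<lambda>x. s j x - s k x) = e (\<lambda>x. s j x - s k x)"
      using V[OF s[of j] s[of k]] by (simp add: P.extends Q.extends)
    also have "\<dots> \<le> e (\<lambda>x. s j x - u x) + e (\<lambda>x. u x - s k x)"
      using P.norm_triangle[OF P.diff_closed[OF sN(1)[of j] u] P.diff_closed[OF u sN(1)[of k]]]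
      by simp
    finally show ?thesis using P.norm_minus[OF u sN(1)[of k]] by simp
  qed
  have "\<exists>w\<in>N'. (\<lambda>k. e' (\<lambda>x. s k x - w x)) \<longlonglongrightarrow> 0"
  proof (rule Q.complete[OF sN(2)], intro allI impI)
    fix d :: real assume "d > 0"
    then have "eventually (\<lambda>k. e (\<lambda>x. s k x - u x) < d / 2) sequentially"
      using order_tendstoD(2)[OF lim, of "d / 2"] by simp
    then obtain K where "\<And>k. k \<ge> K \<Longrightarrow> e (\<lambda>x. s k x - u x) < d / 2"
      by (auto simp: eventually_sequentially)
    then have "\<forall>j\<ge>K. \<forall>k\<ge>K. e' (\<lambda>x. s j x - s k x) < d"
      using tri by (smt (verit) field_sum_of_halves)
    then show "\<exists>K. \<forall>j\<ge>K. \<forall>k\<ge>K. e' (\<lambda>x. s j x - s k x) < d" ..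
  qed
  then obtain w where w: "w \<in> N'" and limw: "(\<lambda>k. e' (\<lambda>x. s k x - w x)) \<longlonglongrightarrow> 0" by blast
  obtain r where r: "strict_mono r" "AE x in lebesgue. (\<lambda>k. s (r k) x) \<longlonglongrightarrow> w x"
    using Q.AE_limit[OF sN(2) w limw] by blast
  have "(\<lambda>k. e (\<lambda>x. s (r k) x - u x)) \<longlonglongrightarrow> 0"
    using LIMSEQ_subseq_LIMSEQ[OF lim r(1)] by (simp add: o_def)
  then obtain q where q: "strict_mono q" "AE x in lebesgue. (\<lambda>k. s (r (q k)) x) \<longlonglongrightarrow> u x"
    using P.AE_limit[OF sN(1) u, of "r"] by blast
  have eq: "AE x in lebesgue. u x = w x"
    using r(2) q(2)
  proof eventually_elim
    case (elim x)
    have "(\<lambda>k. s (r (q k)) x) \<longlonglongrightarrow> w x"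
      using LIMSEQ_subseq_LIMSEQ[OF elim(1) q(1)] by (simp add: o_def)
    then show ?case using elim(2) LIMSEQ_unique by blast
  qed
  have uN': "u \<in> N'" by (rule Q.AE_closed[OF w eq])
  have "e' (\<lambda>x. u x - w x) = 0"
    using Q.norm_eq_0[OF Q.diff_closed[OF uN' w]] eq by auto
  then have "e' u = e' w"
    using Q.norm_diff[OF uN' w] Q.norm_diff[OF w uN'] Q.norm_minus[OF uN' w] by simp
  moreover have "(\<lambda>k. nrm (s k)) \<longlonglongrightarrow> e u"
    using P.norm_limit[OF sN(1) u lim] by (simp add: P.extends s)
  moreover have "(\<lambda>k. nrm (s k)) \<longlonglongrightarrow> e' w"
    using Q.norm_limit[OF sN(2) w limw] by (simp add: Q.extends s)
  ultimately show ?thesis using uN' LIMSEQ_unique by metis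
qed

lemma function_completion_unique:
  assumes "function_completion V nrm N e" and "function_completion V nrm N' e'"
    and "\<And>u w. u \<in> V \<Longrightarrow> w \<in> V \<Longrightarrow> (\<lambda>x. u x - w x) \<in> V"
  shows "N = N'" and "\<And>u. u \<in> N \<Longrightarrow> e u = e' u"
  using function_completion_le[OF assms(1,2)] function_completion_le[OF assms(2,1)] assms(3)
  by blast+


section \<open>The minimization problem\<close>

definition nonzero :: "('a::euclidean_space \<Rightarrow> real) \<Rightarrow> bool" where
  "nonzero u \<longleftrightarrow> \<not> (AE x in lebesgue. u x = 0)"

text \<open>
  On a completion the quadratic integral in the numerator is the square of the extended norm.
  For nonzero \<open>u\<close> the weighted integral in the denominator is positive or infinite.  If it is
  infinite, the Bochner integral and hence the quotient take the value 0, the value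
  that the quotient has by the usual convention.
\<close>

definition quotient ::
    "real \<Rightarrow> real \<Rightarrow> (('a::euclidean_space \<Rightarrow> real) \<Rightarrow> real) \<Rightarrow> ('a \<Rightarrow> real) \<Rightarrow> real" where
  "quotient \<beta> p e u =
     (e u)\<^sup>2 / (LINT x|lebesgue. norm x powr \<beta> * \<bar>u x\<bar> powr (p + 1)) powr (2 / (p + 1))"

definition best_const ::
    "real \<Rightarrow> real \<Rightarrow> ('a::euclidean_space \<Rightarrow> real) set \<Rightarrow> (('a \<Rightarrow> real) \<Rightarrow> real) \<Rightarrow> real" where
  "best_const \<beta> p N e = (INF u\<in>{u \<in> N. nonzero u}. quotient \<beta> p e u)"

definition best_const_achieved_by ::
    "real \<Rightarrow> real \<Rightarrow> ('a::euclidean_space \<Rightarrow> real) set \<Rightarrow> (('a \<Rightarrow> real) \<Rightarrow> real) \<Rightarrow>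
     ('a \<Rightarrow> real) \<Rightarrow> bool" where
  "best_const_achieved_by \<beta> p N e u \<longleftrightarrow>
     u \<in> N \<and> nonzero u \<and> quotient \<beta> p e u = best_const \<beta> p N e"

text \<open>The surface measure of \<open>A \<subseteq> \<S>\<^sup>n\<^sup>-\<^sup>1\<close>, from the Lebesgue measure of the cone over \<open>A\<close>.\<close>

definition surface_measure :: "'a::euclidean_space set \<Rightarrow> real" where
  "surface_measure A =
     real DIM('a) * measure lebesgue {r *\<^sub>R x | r x. 0 < r \<and> r \<le> 1 \<and> x \<in> A}"

text \<open>
  The formulas for \<open>\<phi>\<^sub>1\<^sub>,\<^sub>p\<close>, \<open>\<phi>\<^sub>2\<^sub>,\<^sub>p\<close> and for \<open>u\<^sub>1\<close>, \<open>u\<^sub>2\<close> differ only in \<open>m\<close>, \<open>\<nu>\<close> and the exponents: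
  \<open>a\<close> is the exponent of \<open>\<nu>\<close>, \<open>b\<close> that of the bracket.
\<close>

definition phi :: "real \<Rightarrow> real \<Rightarrow> real \<Rightarrow> real \<Rightarrow> real" where
  "phi m \<nu> a b =
     \<nu> powr a * (m * (m - 1) * (m - 2) * (m - 3)) *
     (4 * m * (m - 1) / ((2 * m - 1) * (2 * m - 3)) * Beta (- m) (1 / 2)) powr b"

definition extremal ::
    "real \<Rightarrow> real \<Rightarrow> real \<Rightarrow> real \<Rightarrow> 'a::euclidean_space \<Rightarrow> real" where
  "extremal \<alpha> C m \<nu> x =
     C / 2 powr m * norm x powr (- ((real DIM('a) - 4 - \<alpha>) / 2 + \<nu> * m))
       * (1 + norm x powr (2 * \<nu>)) powr m"

end

theory Submission
  imports Defs "HOL-Complex_Analysis.Great_Picard" "HOL-Real_Asymp.Real_Asymp"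
begin

text \<open>
  With \<open>g = (n - 4 - \<alpha>) / 2\<close> and \<open>u(x) = |x|\<^sup>-\<^sup>g v(ln |x|)\<close> the quadratic form becomes the area of the sphere
  times \<open>\<integral> v''\<^sup>2 + A v'\<^sup>2 + B v\<^sup>2\<close>, and the weighted integral becomes the area times \<open>\<integral> |v|\<^sup>p\<^sup>+\<^sup>1\<close>.
  The three conditions give \<open>A, B > 0\<close> except at the endpoint \<open>B = 0\<close>, where no completion by
  functions exists.  A minimizing sequence of profiles, translated so that it does not vanish at 0, converges
  weakly to a minimizer by the Brezis--Lieb lemma and strict subadditivity.

  On the two parameter curves \<open>A = a\<^sup>2 + b\<^sup>2\<close> and \<open>B = a\<^sup>2 b\<^sup>2\<close> with \<open>a = - m \<nu>\<close>, \<open>b = (2 - m) \<nu>\<close>,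
  and \<open>C cosh(\<nu> t)\<^sup>m\<close> solves \<open>v'''' - A v'' + B v = v\<^sup>p\<close>.  Any minimizer is a classical
  solution of this equation that tends to 0.  If its maximum differs from that of the explicit solution,
  scale the one with the larger maximum down: the conserved energy makes its graph flatter at the maximum,
  and since \<open>(- d\<^sup>2 + a\<^sup>2) (- d\<^sup>2 + b\<^sup>2)\<close> preserves order the difference would grow without bound.  Hence the
  maxima agree, and the same argument with a Gronwall estimate shows that the two solutions are equal.
\<close>

section \<open>Smooth functions on the line\<close>

text \<open>The completion supplies no derivatives: an element is known only as a limit of test
  functions. On the line the energy controls \<open>\<bar>v t\<bar>\<close> uniformly, so every
  class has a continuous representative and norm limits are uniform limits;
  \<open>profile_space\<close> records this as its evaluation bound. The price is weak compactness
  by hand, through midpoint hulls, and regularity by duality: the Euler--Lagrange equation is tested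
  with Green potentials, which truncation places in the space.

  The noncompactness comes from dilations of x, that is translations of t; the relation between the
  exponents makes both integrals invariant under them.

  The sharp constant is not read off from an inequality: a minimizer exists and solves the equation,
  so uniqueness identifies it, after normalization, with the explicit solution. It may a priori
  change sign, so uniqueness asks positivity only of the explicit solution. The shape of that
  solution comes from \<open>m * p = m - 4\<close>: each factor
  \<open>- d\<^sup>2 + a\<^sup>2\<close>, \<open>- d\<^sup>2 + b\<^sup>2\<close> lowers the power of
  \<open>cosh\<close> by 2, and \<open>b - a = 2 \<nu>\<close> makes the two factors
  distinct.\<close>

definition smooth_real :: "(real \<Rightarrow> real) \<Rightarrow> bool" where
  "smooth_real f \<longleftrightarrow>
     (\<exists>S. f \<in> S \<and> (\<forall>g\<in>S. \<exists>g'\<in>S. \<forall>t. (g has_real_derivative g' t) (at t)))"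

lemma smooth_real_deriv:
  assumes "smooth_real f"
  shows "(f has_real_derivative deriv f t) (at t)" "smooth_real (deriv f)"
proof -
  obtain S where S: "f \<in> S" "\<forall>g\<in>S. \<exists>g'\<in>S. \<forall>t. (g has_real_derivative g' t) (at t)"
    using assms unfolding smooth_real_def by blast
  then obtain f' where f': "f' \<in> S" "\<And>t. (f has_real_derivative f' t) (at t)" by blast
  then have "deriv f = f'" using DERIV_imp_deriv by blast
  then show "(f has_real_derivative deriv f t) (at t)" "smooth_real (deriv f)"
    using f' S(2) unfolding smooth_real_def by auto
qed

text \<open>The coinduction principle for smoothness. Since \<open>smooth_real\<close> asks only for
  a class closed under differentiation, closure under products or composition needs no formula for
  higher derivatives.\<close>

lemma smooth_realI:
  assumes "f \<in> S"
    and "\<And>g. g \<in> S \<Longrightarrow> \<exists>g'\<in>S. \<forall>t. (g has_real_derivative g' t) (at t)"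
  shows "smooth_real f"
  using assms unfolding smooth_real_def by blast

lemma smooth_real_has_derivI:
  assumes "\<And>t. (f has_real_derivative f' t) (at t)" "smooth_real f'"
  shows "smooth_real f"
proof -
  obtain S where S: "f' \<in> S" "\<forall>g\<in>S. \<exists>g'\<in>S. \<forall>t. (g has_real_derivative g' t) (at t)"
    using assms(2) unfolding smooth_real_def by blast
  then show ?thesis using assms(1) by (intro smooth_realI[of _ "insert f S"]) auto
qed

lemma smooth_real_continuous: "smooth_real f \<Longrightarrow> continuous_on A f"
  by (meson DERIV_isCont continuous_at_imp_continuous_on smooth_real_deriv(1))

lemma smooth_real_const [simp]: "smooth_real (\<lambda>t. c)"
  by (rule smooth_realI[of _ "range (\<lambda>c t. c)"]) (auto intro!: derivative_eq_intros exI)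

lemma smooth_real_id [simp]: "smooth_real (\<lambda>t. t)"
  by (rule smooth_real_has_derivI[of _ "\<lambda>_. 1"]) auto

text \<open>The algebra generated by \<open>S\<close>, over an arbitrary domain: it serves functions
  on the line as well as functions on the Euclidean space.\<close>

inductive_set fun_algebra :: "('a \<Rightarrow> real) set \<Rightarrow> ('a \<Rightarrow> real) set" for S where
  base: "f \<in> S \<Longrightarrow> f \<in> fun_algebra S"
| add: "f \<in> fun_algebra S \<Longrightarrow> g \<in> fun_algebra S \<Longrightarrow> (\<lambda>x. f x + g x) \<in> fun_algebra S"
| mult: "f \<in> fun_algebra S \<Longrightarrow> g \<in> fun_algebra S \<Longrightarrow> (\<lambda>x. f x * g x) \<in> fun_algebra S"

text \<open>The sum and product rules carry closure under differentiation from the generators to the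
  whole algebra, so the derivative of a generator may be any expression in generators.\<close>

lemma smooth_real_algebra:
  assumes S: "\<And>g. g \<in> S \<Longrightarrow> \<exists>g'\<in>fun_algebra S. \<forall>t. (g has_real_derivative g' t) (at t)"
    and f: "f \<in> fun_algebra S"
  shows "smooth_real f"
proof (rule smooth_realI[OF f])
  fix g assume "g \<in> fun_algebra S"
  then show "\<exists>g'\<in>fun_algebra S. \<forall>t. (g has_real_derivative g' t) (at t)"
  proof induction
    case (base f)
    then show ?case by (rule S)
  next
    case (add f g)
    then obtain f' g' where "f' \<in> fun_algebra S" "\<forall>t. (f has_real_derivative f' t) (at t)"
      "g' \<in> fun_algebra S" "\<forall>t. (g has_real_derivative g' t) (at t)" by blast
    then show ?case
      by (intro bexI[of _ "\<lambda>t. f' t + g' t"] fun_algebra.add) (auto intro!: DERIV_add)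
  next
    case (mult f g)
    then obtain f' g' where "f' \<in> fun_algebra S" "\<forall>t. (f has_real_derivative f' t) (at t)"
      "g' \<in> fun_algebra S" "\<forall>t. (g has_real_derivative g' t) (at t)" by blast
    with mult show ?case
      by (intro bexI[of _ "\<lambda>t. f' t * g t + g' t * f t"] fun_algebra.add fun_algebra.mult)
         (auto intro!: DERIV_mult)
  qed
qed

lemma smooth_real_algebra':
  assumes "f \<in> fun_algebra {g. smooth_real g}"
  shows "smooth_real f"
proof (rule smooth_real_algebra[OF _ assms])
  fix g :: "real \<Rightarrow> real" assume "g \<in> {g. smooth_real g}"
  then show "\<exists>g'\<in>fun_algebra {g. smooth_real g}. \<forall>t. (g has_real_derivative g' t) (at t)"
    using smooth_real_deriv[of g] by (intro bexI[of _ "deriv g"] fun_algebra.base) auto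
qed

lemma smooth_real_add [intro]: "smooth_real f \<Longrightarrow> smooth_real g \<Longrightarrow> smooth_real (\<lambda>t. f t + g t)"
  by (rule smooth_real_algebra') (auto intro: fun_algebra.intros)

lemma smooth_real_mult [intro]: "smooth_real f \<Longrightarrow> smooth_real g \<Longrightarrow> smooth_real (\<lambda>t. f t * g t)"
  by (rule smooth_real_algebra') (auto intro: fun_algebra.intros)

lemma smooth_real_diff [intro]:
  assumes "smooth_real f" "smooth_real g" shows "smooth_real (\<lambda>t. f t - g t)"
  using smooth_real_add[OF assms(1) smooth_real_mult[OF smooth_real_const[of "-1"] assms(2)]] by simp

text \<open>The generators are all \<open>k (h t)\<close> with smooth \<open>k\<close>, together
  with all smooth functions; the chain rule stays inside their algebra.\<close>

lemma smooth_real_compose: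
  assumes f: "smooth_real f" and h: "smooth_real h"
  shows "smooth_real (\<lambda>t. f (h t))"
proof -
  let ?S = "{\<lambda>t. k (h t) |k. smooth_real k} \<union> {k. smooth_real k}"
  show ?thesis
  proof (rule smooth_real_algebra[of ?S])
    fix g assume "g \<in> ?S"
    then consider k where "g = (\<lambda>t. k (h t))" "smooth_real k" | "smooth_real g" by blast
    then show "\<exists>g'\<in>fun_algebra ?S. \<forall>t. (g has_real_derivative g' t) (at t)"
    proof cases
      case 1
      have "((\<lambda>t. k (h t)) has_real_derivative deriv k (h t) * deriv h t) (at t)" for t
        by (rule DERIV_chain2[OF smooth_real_deriv(1)[OF 1(2)] smooth_real_deriv(1)[OF h]])
      moreover have "(\<lambda>t. deriv k (h t) * deriv h t) \<in> fun_algebra ?S"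
        using smooth_real_deriv(2)[OF 1(2)] smooth_real_deriv(2)[OF h]
        by (intro fun_algebra.mult fun_algebra.base) auto
      ultimately show ?thesis unfolding 1(1) by (intro bexI) auto
    next
      case 2
      then show ?thesis using smooth_real_deriv[OF 2] by (intro bexI[of _ "deriv g"] fun_algebra.base) auto
    qed
  next
    show "(\<lambda>t. f (h t)) \<in> fun_algebra ?S" using f by (intro fun_algebra.base) auto
  qed
qed

lemma smooth_real_exp: "smooth_real f \<Longrightarrow> smooth_real (\<lambda>t. exp (f t))"
  by (rule smooth_real_compose[of exp]) (auto intro: smooth_realI[of _ "{exp}"])

text \<open>The derivative of \<open>1 / f\<close> is \<open>- f'\<close> times the square of
  \<open>1 / f\<close>, a product of the one new generator with smooth functions.\<close>

lemma smooth_real_inverse: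
  assumes f: "smooth_real f" and pos: "\<And>t. f t \<noteq> 0"
  shows "smooth_real (\<lambda>t. inverse (f t))"
proof -
  let ?i = "\<lambda>t. inverse (f t)"
  let ?S = "insert ?i {k. smooth_real k}"
  show ?thesis
  proof (rule smooth_real_algebra[of ?S])
    fix g assume "g \<in> ?S"
    then consider "g = ?i" | "smooth_real g" by blast
    then show "\<exists>g'\<in>fun_algebra ?S. \<forall>t. (g has_real_derivative g' t) (at t)"
    proof cases
      case 1
      have "(?i has_real_derivative (- 1 * deriv f t) * (?i t * ?i t)) (at t)" for t
        using pos[of t] by (auto intro!: derivative_eq_intros smooth_real_deriv(1)[OF f]
            simp: divide_simps power2_eq_square)
      moreover have "(\<lambda>t. (- 1 * deriv f t) * (?i t * ?i t)) \<in> fun_algebra ?S"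
        using smooth_real_deriv(2)[OF f]
        by (intro fun_algebra.mult) (auto intro: fun_algebra.base)
      ultimately show ?thesis unfolding 1(1) by (intro bexI) auto
    next
      case 2
      then show ?thesis using smooth_real_deriv[OF 2] by (intro bexI[of _ "deriv g"] fun_algebra.base) auto
    qed
  next
    show "?i \<in> fun_algebra ?S" by (intro fun_algebra.base) auto
  qed
qed

text \<open>The functions P(1/t) exp(-1/t), extended by 0, form a family closed under
  differentiation: \<open>P\<close> is replaced by \<open>X\<^sup>2 (P - P')\<close>. For
  \<open>P = 1\<close> this is the classical flat function.\<close>

definition flat_exp :: "real poly \<Rightarrow> real \<Rightarrow> real" where
  "flat_exp P t = (if t \<le> 0 then 0 else poly P (inverse t) * exp (- inverse t))"

lemma poly_times_exp_tendsto_0: "((\<lambda>x::real. poly P x * exp (- x)) \<longlongrightarrow> 0) at_top"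
proof (induction P)
  case 0
  then show ?case by simp
next
  case (pCons a P)
  have P: "((\<lambda>x::real. x ^ k * exp (- x)) \<longlongrightarrow> 0) at_top" for k :: nat
    using tendsto_power_div_exp_0[of k] by (simp add: exp_minus field_simps)
  have "((\<lambda>x. poly (pCons a P) x * exp (- x)) \<longlongrightarrow> (\<Sum>i\<le>degree (pCons a P). coeff (pCons a P) i * 0)) at_top"
    unfolding poly_altdef[of "pCons a P"] sum_distrib_right
    by (intro tendsto_sum) (auto simp: mult.assoc intro!: tendsto_mult_right_zero P)
  then show ?case by simp
qed

lemma flat_exp_deriv:
  "(flat_exp P has_real_derivative flat_exp (monom 1 2 * (P - pderiv P)) t) (at t)"
proof -
  consider "t < 0" | "t > 0" | "t = 0" by linarith
  then show ?thesis
  proof cases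
    case 1
    have "((\<lambda>t. 0) has_real_derivative flat_exp (monom 1 2 * (P - pderiv P)) t) (at t)"
      using 1 by (auto simp: flat_exp_def)
    then show ?thesis
      by (rule has_field_derivative_transform_within_open[of _ _ _ "{..<0}"])
         (use 1 in \<open>auto simp: flat_exp_def\<close>)
  next
    case 2
    have "((\<lambda>t. poly P (inverse t) * exp (- inverse t)) has_real_derivative
            flat_exp (monom 1 2 * (P - pderiv P)) t) (at t)"
      using 2 by (auto intro!: derivative_eq_intros DERIV_chain2[OF poly_DERIV]
          simp: flat_exp_def poly_monom field_simps power2_eq_square)
    then show ?thesis
      by (rule has_field_derivative_transform_within_open[of _ _ _ "{0<..}"])
         (use 2 in \<open>auto simp: flat_exp_def\<close>)
  next
    case 3
    \<comment> \<open>With x = 1/t the difference quotient at 0 is x P(x) exp(-x), and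
      \<open>pCons 0 P\<close> is X times \<open>P\<close>.\<close>
    have "((\<lambda>x. poly (pCons 0 P) x * exp (- x)) \<longlongrightarrow> 0) at_top" by (rule poly_times_exp_tendsto_0)
    then have "((\<lambda>t. poly (pCons 0 P) (inverse t) * exp (- inverse t)) \<longlongrightarrow> 0) (at_right 0)"
      using filterlim_compose[OF _ filterlim_inverse_at_top_right] by blast
    then have r: "((\<lambda>t. flat_exp P t / t) \<longlongrightarrow> 0) (at_right 0)"
      by (rule tendsto_cong[THEN iffD1, rotated])
         (auto simp: eventually_at_right_less flat_exp_def field_simps intro!: eventually_at_rightI[of 0 1])
    have l: "((\<lambda>t. flat_exp P t / t) \<longlongrightarrow> 0) (at_left 0)"
      by (rule tendsto_eventually) (auto simp: flat_exp_def intro!: eventually_at_leftI[of "-1" 0])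
    have "((\<lambda>t. flat_exp P t / t) \<longlongrightarrow> 0) (at 0)"
      using l r filterlim_split_at by blast
    then show ?thesis
      unfolding has_field_derivative_iff using 3 by (simp add: flat_exp_def)
  qed
qed

lemma smooth_real_flat_exp: "smooth_real (flat_exp P)"
  by (rule smooth_realI[of _ "range flat_exp"]) (use flat_exp_deriv in auto)

text \<open>\<open>h\<close> is the smooth step from 0 on the nonpositive axis to 1 beyond 1; the
  product of its two reflections is a cutoff that is 1 on [-1, 1] and 0 outside (-2, 2).\<close>

definition plateau :: "real \<Rightarrow> real" where
  "plateau t = (let h = (\<lambda>x. flat_exp 1 x * inverse (flat_exp 1 x + flat_exp 1 (1 - x)))
                in h (2 - t) * h (2 + t))"

lemma flat_exp_pos: "t > 0 \<Longrightarrow> flat_exp 1 t > 0" and flat_exp_nonneg: "flat_exp 1 t \<ge> 0"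
  by (auto simp: flat_exp_def)

lemma smooth_real_plateau: "smooth_real plateau"
proof -
  have 1: "smooth_real (\<lambda>x. flat_exp 1 (1 - x))"
    by (intro smooth_real_compose[OF smooth_real_flat_exp] smooth_real_diff) auto
  have "flat_exp 1 x + flat_exp 1 (1 - x) \<noteq> 0" for x
    using flat_exp_pos[of x] flat_exp_pos[of "1-x"] flat_exp_nonneg[of x] flat_exp_nonneg[of "1-x"]
    by (cases "x > 0") (auto simp: add_nonneg_eq_0_iff)
  then have "smooth_real (\<lambda>x. flat_exp 1 x * inverse (flat_exp 1 x + flat_exp 1 (1 - x)))"
    by (intro smooth_real_mult smooth_real_inverse smooth_real_add smooth_real_flat_exp 1)
  note c = smooth_real_compose[OF this]
  have "smooth_real (\<lambda>t. 2 - t)" "smooth_real (\<lambda>t. 2 + t)"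
    by (intro smooth_real_diff smooth_real_add smooth_real_const smooth_real_id)+
  from smooth_real_mult[OF c[OF this(1)] c[OF this(2)]] show ?thesis
    unfolding plateau_def Let_def .
qed

lemma plateau_eq_1: "\<bar>t\<bar> \<le> 1 \<Longrightarrow> plateau t = 1"
  using flat_exp_pos[of "2-t"] flat_exp_pos[of "2+t"]
  by (auto simp: plateau_def Let_def flat_exp_def[of _ "1 - _"])

lemma plateau_eq_0: "\<bar>t\<bar> \<ge> 2 \<Longrightarrow> plateau t = 0"
  by (auto simp: plateau_def Let_def flat_exp_def abs_if split: if_splits)

lemma plateau_nonneg: "plateau t \<ge> 0"
  unfolding plateau_def Let_def by (intro mult_nonneg_nonneg) (auto simp: flat_exp_nonneg)

definition test_fun :: "(real \<Rightarrow> real) \<Rightarrow> bool" where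
  "test_fun v \<longleftrightarrow> smooth_real v \<and> (\<exists>R. \<forall>t. \<bar>t\<bar> > R \<longrightarrow> v t = 0)"

lemma test_fun_smooth: "test_fun v \<Longrightarrow> smooth_real v" by (simp add: test_fun_def)

lemma test_fun_add: "test_fun v \<Longrightarrow> test_fun w \<Longrightarrow> test_fun (\<lambda>t. v t + w t)"
  unfolding test_fun_def
  by (metis add.right_neutral max_less_iff_conj smooth_real_add)

lemma test_fun_mult: "smooth_real v \<Longrightarrow> test_fun w \<Longrightarrow> test_fun (\<lambda>t. v t * w t)"
  unfolding test_fun_def by (metis mult_zero_right smooth_real_mult)

lemma test_fun_cmult: "test_fun w \<Longrightarrow> test_fun (\<lambda>t. c * w t)"
  by (rule test_fun_mult) auto

lemma test_fun_diff: "test_fun v \<Longrightarrow> test_fun w \<Longrightarrow> test_fun (\<lambda>t. v t - w t)"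
  using test_fun_add[of v "\<lambda>t. -1 * w t"] test_fun_cmult[of w "-1"] by simp

lemma test_fun_deriv:
  assumes "test_fun v"
  shows "(v has_real_derivative deriv v t) (at t)" "test_fun (deriv v)"
    "\<forall>t. \<bar>t\<bar> > R \<longrightarrow> v t = 0 \<Longrightarrow> \<bar>t\<bar> > R \<Longrightarrow> deriv v t = 0"
proof -
  have z: "deriv v t = 0" if "\<forall>t. \<bar>t\<bar> > R \<longrightarrow> v t = 0" "\<bar>t\<bar> > R" for R t
  proof -
    have o: "open {t::real. \<bar>t\<bar> > R}" by (intro open_Collect_less continuous_intros)
    have "(v has_real_derivative 0) (at t)"
    proof (rule has_field_derivative_transform_within_open[OF DERIV_const o])
      show "t \<in> {t. \<bar>t\<bar> > R}" using that(2) by simp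
      show "0 = v x" if "x \<in> {t. \<bar>t\<bar> > R}" for x using \<open>\<forall>t. \<bar>t\<bar> > R \<longrightarrow> v t = 0\<close> that by simp
    qed
    then show ?thesis by (rule DERIV_imp_deriv)
  qed
  show "\<forall>t. \<bar>t\<bar> > R \<longrightarrow> v t = 0 \<Longrightarrow> \<bar>t\<bar> > R \<Longrightarrow> deriv v t = 0" by (rule z)
  note d = smooth_real_deriv[OF test_fun_smooth[OF assms]]
  show "(v has_real_derivative deriv v t) (at t)" by (rule d)
  obtain R where "\<forall>t. \<bar>t\<bar> > R \<longrightarrow> v t = 0" using assms unfolding test_fun_def by blast
  from z[OF this] show "test_fun (deriv v)" unfolding test_fun_def using d(2) by (intro conjI exI[of _ R]) auto
qed

lemma test_fun_shift:
  assumes "test_fun v" shows "test_fun (\<lambda>t. v (t + c))"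
proof -
  obtain R where R: "\<And>t. \<bar>t\<bar> > R \<Longrightarrow> v t = 0" using assms unfolding test_fun_def by blast
  have "\<forall>t. \<bar>t\<bar> > R + \<bar>c\<bar> \<longrightarrow> v (t + c) = 0" using R by auto
  moreover have "smooth_real (\<lambda>t. v (t + c))"
    by (rule smooth_real_compose[OF test_fun_smooth[OF assms] smooth_real_add]) simp_all
  ultimately show ?thesis unfolding test_fun_def by (intro conjI exI)
qed

lemma test_fun_plateau:
  assumes "k > 0" shows "test_fun (\<lambda>t. plateau ((t - t0) * k))"
proof -
  have "\<forall>t. \<bar>t\<bar> > 2 / k + \<bar>t0\<bar> \<longrightarrow> plateau ((t - t0) * k) = 0"
  proof (intro allI impI plateau_eq_0)
    fix t :: real assume "\<bar>t\<bar> > 2 / k + \<bar>t0\<bar>"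
    then have "\<bar>t - t0\<bar> > 2 / k" by linarith
    then show "\<bar>(t - t0) * k\<bar> \<ge> 2" using assms by (simp add: abs_mult pos_divide_less_eq)
  qed
  moreover have "smooth_real (\<lambda>t. plateau ((t - t0) * k))"
    by (intro smooth_real_compose[OF smooth_real_plateau] smooth_real_mult smooth_real_diff) auto
  ultimately show ?thesis unfolding test_fun_def by blast
qed

lemma deriv_plateau_scale:
  "deriv (\<lambda>t. plateau (t * k)) = (\<lambda>t. k * deriv plateau (t * k))"
  "deriv (\<lambda>t. k * deriv plateau (t * k)) = (\<lambda>t. k\<^sup>2 * deriv (deriv plateau) (t * k))"
proof -
  note d = smooth_real_deriv[OF smooth_real_plateau]
  show "deriv (\<lambda>t. plateau (t * k)) = (\<lambda>t. k * deriv plateau (t * k))"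
    by (rule ext, rule DERIV_imp_deriv, subst mult.commute, rule DERIV_chain2[OF d(1)])
       (auto intro!: derivative_eq_intros)
  show "deriv (\<lambda>t. k * deriv plateau (t * k)) = (\<lambda>t. k\<^sup>2 * deriv (deriv plateau) (t * k))"
    by (rule ext, rule DERIV_imp_deriv)
       (auto intro!: derivative_eq_intros DERIV_chain2[OF smooth_real_deriv(1)[OF d(2)], where g="\<lambda>t. t * k"]
         simp: power2_eq_square)
qed

section \<open>Radial functions\<close>

text \<open>The Emden--Fowler substitution t = ln |x|. Since \<open>0 powr c = 0\<close>, a lift
  always vanishes at the origin, which for test profiles agrees with the extension by 0.\<close>

definition radial_lift :: "real \<Rightarrow> (real \<Rightarrow> real) \<Rightarrow> 'a::euclidean_space \<Rightarrow> real" where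
  "radial_lift c g x = norm x powr c * g (ln (norm x))"

lemma radial_lift_diff: "radial_lift c (\<lambda>t. v t - w t) x = radial_lift c v x - radial_lift c w x"
  and radial_lift_add: "radial_lift c (\<lambda>t. v t + w t) x = radial_lift c v x + radial_lift c w x"
  and radial_lift_cmult: "radial_lift c (\<lambda>t. k * w t) x = k * radial_lift c w x"
  by (auto simp: radial_lift_def algebra_simps)

lemma radial_lift_0: "radial_lift c g 0 = 0"
  by (simp add: radial_lift_def)

lemma radial_lift_eq_0:
  assumes "\<forall>t. \<bar>t\<bar> > R \<longrightarrow> g t = 0" and "norm x < exp (- R) \<or> norm x > exp R"
  shows "radial_lift c g x = 0"
proof (cases "x = 0")
  case False
  have "ln (norm x) < - R" if "norm x < exp (- R)"
    using that False by (metis ln_exp ln_less_cancel_iff exp_gt_zero zero_less_norm_iff)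
  moreover have "ln (norm x) > R" if "norm x > exp R"
    using that False by (metis ln_exp ln_less_cancel_iff exp_gt_zero zero_less_norm_iff)
  ultimately have "g (ln (norm x)) = 0" using assms by force
  then show ?thesis by (simp add: radial_lift_def)
qed (simp add: radial_lift_0)

text \<open>The gradient of a lift is the vector x times a lift of exponent \<open>c - 2\<close>;
  the missing powers of |x| are absorbed by writing x instead of the unit vector. Near the origin
  everything vanishes.\<close>

lemma radial_lift_has_derivative:
  fixes x :: "'a::euclidean_space"
  assumes g: "test_fun g"
  shows "(radial_lift c g has_derivative
    (\<lambda>h. (x \<bullet> h) * radial_lift (c - 2) (\<lambda>t. c * g t + deriv g t) x)) (at x)"
proof (cases "x = 0")
  case True
  obtain R where R: "\<forall>t. \<bar>t\<bar> > R \<longrightarrow> g t = 0" using g unfolding test_fun_def by blast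
  have "((\<lambda>x. 0) has_derivative (\<lambda>h. 0)) (at x)" by simp
  then have "(radial_lift c g has_derivative (\<lambda>h. 0)) (at x)"
    by (rule has_derivative_transform_within_open[of _ _ _ _ "ball 0 (exp (- R))"])
       (use True radial_lift_eq_0[OF R] in auto)
  then show ?thesis using True by simp
next
  case False
  define r where "r = norm x"
  have r: "r > 0" using False by (simp add: r_def)
  have "((\<lambda>r. r powr c * g (ln r)) has_real_derivative
      c * r powr (c - 1) * g (ln r) + (deriv g (ln r) * (1 / r)) * r powr c) (at r)"
    using r by (intro DERIV_mult has_real_derivative_powr DERIV_chain2[OF test_fun_deriv(1)[OF g]] DERIV_ln_divide)
  then have "((\<lambda>r. r powr c * g (ln r)) has_derivative
      (\<lambda>h. (c * r powr (c - 1) * g (ln r) + (deriv g (ln r) * (1 / r)) * r powr c) * h)) (at (norm x))"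
    by (simp add: has_field_derivative_def r_def)
  from has_derivative_compose[OF has_derivative_norm[OF False] this]
  have "((\<lambda>x. norm x powr c * g (ln (norm x))) has_derivative
     (\<lambda>h. (c * r powr (c - 1) * g (ln r) + (deriv g (ln r) * (1 / r)) * r powr c) * (h \<bullet> sgn x))) (at x)"
    by simp
  moreover have "(c * r powr (c - 1) * g (ln r) + (deriv g (ln r) * (1 / r)) * r powr c) * (h \<bullet> sgn x)
     = (x \<bullet> h) * radial_lift (c - 2) (\<lambda>t. c * g t + deriv g t) x" for h
  proof -
    have hs: "h \<bullet> sgn x = (x \<bullet> h) / r" by (simp add: sgn_div_norm r_def inner_commute divide_inverse)
    have rp: "r powr (c - 1) = r powr (c - 2) * r" "r powr c = r powr (c - 2) * r * r"
      using r powr_add[of r "c-2" 1] powr_add[of r "c-2" 2] by (auto simp: power2_eq_square)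
    show ?thesis using r unfolding radial_lift_def r_def[symmetric] hs rp by (simp add: field_simps)
  qed
  ultimately show ?thesis by (simp add: radial_lift_def[abs_def])
qed

lemma partial_deriv_eqI: "(f has_derivative f') (at x) \<Longrightarrow> partial_deriv b f x = f' b"
  unfolding partial_deriv_def using frechet_derivative_at by metis

lemma partial_deriv_radial_lift:
  assumes "test_fun g"
  shows "partial_deriv b (radial_lift c g) x = (x \<bullet> b) * radial_lift (c - 2) (\<lambda>t. c * g t + deriv g t) x"
  using partial_deriv_eqI[OF radial_lift_has_derivative[OF assms]] .

lemma test_fun_lift_deriv: "test_fun g \<Longrightarrow> test_fun (\<lambda>t. c * g t + deriv g t)"
  by (intro test_fun_add test_fun_cmult test_fun_deriv)

lemma norm_gradient_radial_lift:
  fixes x :: "'a::euclidean_space"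
  assumes "test_fun g"
  shows "norm (gradient (radial_lift c g) x)
    = norm x * \<bar>radial_lift (c - 2) (\<lambda>t. c * g t + deriv g t) x\<bar>"
proof -
  have "gradient (radial_lift c g) x
      = radial_lift (c - 2) (\<lambda>t. c * g t + deriv g t) x *\<^sub>R (\<Sum>b\<in>Basis. (x \<bullet> b) *\<^sub>R b)"
    unfolding gradient_def partial_deriv_radial_lift[OF assms] by (simp add: scaleR_sum_right mult.commute)
  then show ?thesis by (simp add: euclidean_representation)
qed

text \<open>In t = ln |x| the radial Laplacian is \<open>|x|\<^sup>-\<^sup>2 d (d + n - 2)\<close>
  with d = d/dt, and conjugation by the power of exponent c replaces d by d + c. The coefficients
  are those of (d + c) (d + c + n - 2).\<close>

lemma laplacian_radial_lift:
  fixes x :: "'a::euclidean_space"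
  assumes g: "test_fun g"
  shows "laplacian (radial_lift c g) x
    = radial_lift (c - 2) (\<lambda>t. c * (c - 2 + DIM('a)) * g t
        + (2 * c - 2 + DIM('a)) * deriv g t + deriv (deriv g) t) x"
proof -
  define w where "w = (\<lambda>t. c * g t + deriv g t)"
  have w: "test_fun w" unfolding w_def by (rule test_fun_lift_deriv[OF g])
  have dw: "deriv w t = c * deriv g t + deriv (deriv g) t" for t
    unfolding w_def by (rule DERIV_imp_deriv)
      (intro DERIV_add DERIV_cmult test_fun_deriv(1) g test_fun_deriv(2))
  have "partial_deriv b (partial_deriv b (radial_lift c g)) x
     = (x \<bullet> b)\<^sup>2 * radial_lift (c - 4) (\<lambda>t. (c - 2) * w t + deriv w t) x
       + radial_lift (c - 2) w x" if b: "b \<in> Basis" for b :: 'a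
  proof -
    have "((\<lambda>x::'a. (x \<bullet> b) * radial_lift (c - 2) w x) has_derivative
       (\<lambda>h. (x \<bullet> b) * ((x \<bullet> h) * radial_lift (c - 2 - 2) (\<lambda>t. (c - 2) * w t + deriv w t) x)
          + (h \<bullet> b) * radial_lift (c - 2) w x)) (at x)"
      by (intro has_derivative_mult radial_lift_has_derivative[OF w] has_derivative_inner_left has_derivative_ident)
    from partial_deriv_eqI[OF this, of b]
    have "partial_deriv b (\<lambda>x::'a. (x \<bullet> b) * radial_lift (c - 2) w x) x
      = (x \<bullet> b)\<^sup>2 * radial_lift (c - 4) (\<lambda>t. (c - 2) * w t + deriv w t) x
       + radial_lift (c - 2) w x"
      using b by (simp add: power2_eq_square)
    moreover have "partial_deriv b (radial_lift c g) = (\<lambda>x. (x \<bullet> b) * radial_lift (c - 2) w x)"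
      using partial_deriv_radial_lift[OF g] unfolding w_def by auto
    ultimately show ?thesis by simp
  qed
  then have "laplacian (radial_lift c g) x =
    (\<Sum>b\<in>Basis. (x \<bullet> b)\<^sup>2) * radial_lift (c - 4) (\<lambda>t. (c - 2) * w t + deriv w t) x
       + DIM('a) * radial_lift (c - 2) w x"
    unfolding laplacian_def by (simp add: sum.distrib sum_distrib_right)
  also have "(\<Sum>b\<in>Basis. (x \<bullet> b)\<^sup>2) = (norm x)\<^sup>2"
    by (simp add: norm_eq_sqrt_inner euclidean_inner[of x x] power2_eq_square sum_nonneg)
  also have "(norm x)\<^sup>2 * radial_lift (c - 4) (\<lambda>t. (c - 2) * w t + deriv w t) x
    = radial_lift (c - 2) (\<lambda>t. (c - 2) * w t + deriv w t) x"
  proof (cases "x = 0")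
    case False
    then have "norm x powr (c - 2) = norm x powr (c - 4) * (norm x)\<^sup>2"
      using powr_add[of "norm x" "c-4" 2] by auto
    then show ?thesis by (simp add: radial_lift_def)
  qed (simp add: radial_lift_0)
  finally show ?thesis
    unfolding radial_lift_def dw unfolding w_def by (simp add: algebra_simps)
qed

section \<open>Test functions on the punctured space are lifts of test functions on the line\<close>

lemma smooth_algebra:
  assumes S: "\<And>g x. g \<in> S \<Longrightarrow> g differentiable (at x)"
      "\<And>g b. g \<in> S \<Longrightarrow> b \<in> Basis \<Longrightarrow> partial_deriv b g \<in> fun_algebra S"
    and u: "u \<in> fun_algebra S"
  shows "smooth u"
proof -
  have *: "(\<forall>x. g differentiable (at x)) \<and> (\<forall>b\<in>Basis. partial_deriv b g \<in> fun_algebra S)"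
    if "g \<in> fun_algebra S" for g
    using that
  proof induction
    case (base f)
    then show ?case using S by blast
  next
    case (add f g)
    have "partial_deriv b (\<lambda>x. f x + g x) = (\<lambda>x. partial_deriv b f x + partial_deriv b g x)" for b
    proof
      fix x
      have "(f has_derivative frechet_derivative f (at x)) (at x)"
        "(g has_derivative frechet_derivative g (at x)) (at x)"
        using add frechet_derivative_works by blast+
      from partial_deriv_eqI[OF has_derivative_add[OF this]]
      show "partial_deriv b (\<lambda>x. f x + g x) x = partial_deriv b f x + partial_deriv b g x"
        by (simp add: partial_deriv_def)
    qed
    then show ?case using add by (auto intro: fun_algebra.intros differentiable_add)
  next
    case (mult f g)
    have "partial_deriv b (\<lambda>x. f x * g x) = (\<lambda>x. f x * partial_deriv b g x + partial_deriv b f x * g x)" for b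
    proof
      fix x
      have "(f has_derivative frechet_derivative f (at x)) (at x)"
        "(g has_derivative frechet_derivative g (at x)) (at x)"
        using mult frechet_derivative_works by blast+
      from partial_deriv_eqI[OF has_derivative_mult[OF this]]
      show "partial_deriv b (\<lambda>x. f x * g x) x = f x * partial_deriv b g x + partial_deriv b f x * g x"
        by (simp add: partial_deriv_def)
    qed
    moreover have "(\<lambda>x. f x * partial_deriv b g x + partial_deriv b f x * g x) \<in> fun_algebra S"
      if "b \<in> Basis" for b
      using mult that by (intro fun_algebra.add fun_algebra.mult) auto
    ultimately show ?case using mult by (auto intro: differentiable_mult)
  qed
  have "iter_partial_deriv bs u \<in> fun_algebra S" if "set bs \<subseteq> Basis" for bs
    using that by (induction bs) (use * u in auto)
  then show ?thesis
    unfolding smooth_def using * by (meson differentiable_at_imp_differentiable_on)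
qed

text \<open>Lifts, coordinate functions and constants generate an algebra closed under partial
  derivatives, because a partial derivative of a lift is a coordinate times a lift.\<close>

lemma smooth_radial_lift:
  assumes "test_fun g"
  shows "smooth (radial_lift c g :: 'a::euclidean_space \<Rightarrow> real)"
proof -
  let ?S = "{radial_lift c g |c g. test_fun g} \<union> {\<lambda>x. x \<bullet> b |b. True} \<union> {\<lambda>x. d |d. True} :: ('a \<Rightarrow> real) set"
  show ?thesis
  proof (rule smooth_algebra[of ?S])
    show "radial_lift c g \<in> fun_algebra ?S" using assms by (intro fun_algebra.base) blast
  next
    fix f :: "'a \<Rightarrow> real" and x assume "f \<in> ?S"
    then consider c g where "f = radial_lift c g" "test_fun g" | b where "f = (\<lambda>x. x \<bullet> b)" | d where "f = (\<lambda>x. d)"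
      by blast
    then show "f differentiable (at x)"
    proof cases
      case 1
      then show ?thesis using radial_lift_has_derivative unfolding differentiable_def by blast
    qed (auto intro: differentiable_inner)
  next
    fix f :: "'a \<Rightarrow> real" and b :: 'a assume "f \<in> ?S" "b \<in> Basis"
    then consider c g where "f = radial_lift c g" "test_fun g" | b' where "f = (\<lambda>x. x \<bullet> b')" | d where "f = (\<lambda>x. d)"
      by blast
    then show "partial_deriv b f \<in> fun_algebra ?S"
    proof cases
      case 1
      have "(\<lambda>x. (x \<bullet> b) * radial_lift (c - 2) (\<lambda>t. c * g t + deriv g t) x) \<in> fun_algebra ?S"
        using test_fun_lift_deriv[OF 1(2), of c] by (intro fun_algebra.mult fun_algebra.base) blast+
      moreover have "partial_deriv b f = (\<lambda>x. (x \<bullet> b) * radial_lift (c - 2) (\<lambda>t. c * g t + deriv g t) x)"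
        unfolding 1(1) by (intro ext partial_deriv_radial_lift 1(2))
      ultimately show ?thesis by simp
    next
      case 2
      have "partial_deriv b f = (\<lambda>x. b \<bullet> b')"
        unfolding 2 by (rule ext, rule partial_deriv_eqI) (auto intro!: derivative_eq_intros)
      then show ?thesis by (auto intro: fun_algebra.base)
    next
      case 3
      have "partial_deriv b f = (\<lambda>x. 0)"
        unfolding 3 by (rule ext, rule partial_deriv_eqI) (auto intro!: derivative_eq_intros)
      then show ?thesis by (auto intro: fun_algebra.base)
    qed
  qed
qed

lemma radial_lift_punctured_test_rad:
  assumes v: "test_fun v"
  shows "radial_lift c v \<in> punctured_test_rad"
proof -
  obtain R where R: "\<forall>t. \<bar>t\<bar> > R \<longrightarrow> v t = 0" using v unfolding test_fun_def by blast
  have "{x::'a. radial_lift c v x \<noteq> 0} \<subseteq> {x. exp (- R) \<le> norm x \<and> norm x \<le> exp R}"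
    using radial_lift_eq_0[OF R, of _ c] by (auto simp: not_less[symmetric])
  moreover have "closed {x::'a. exp (- R) \<le> norm x \<and> norm x \<le> exp R}"
    by (intro closed_Collect_conj closed_Collect_le continuous_intros)
  ultimately have s: "support (radial_lift c v) \<subseteq> {x::'a. exp (- R) \<le> norm x \<and> norm x \<le> exp R}"
    unfolding support_def by (rule closure_minimal)
  have "bounded (support (radial_lift c v :: 'a \<Rightarrow> real))"
    by (rule bounded_subset[OF bounded_cball[of 0 "exp R"]]) (use s in auto)
  then have "compact (support (radial_lift c v :: 'a \<Rightarrow> real))"
    by (auto simp: compact_eq_bounded_closed support_def)
  moreover have "0 \<notin> support (radial_lift c v :: 'a \<Rightarrow> real)"
    using s by (auto simp: not_le)
  moreover have "radial (radial_lift c v :: 'a \<Rightarrow> real)"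
    unfolding radial_def radial_lift_def by auto
  ultimately show ?thesis unfolding punctured_test_rad_def using smooth_radial_lift[OF v] by blast
qed

text \<open>By radiality \<open>u\<close> is determined on the ray through a basis vector
  \<open>e\<close>. The derivative along this ray of an iterated partial derivative is again one, so
  the class \<open>?S\<close> witnesses smoothness. The support of \<open>u\<close> stays away from
  0 and from infinity, hence the profile has compact support in t.\<close>

lemma punctured_test_rad_eq_radial_lift:
  fixes u :: "'a::euclidean_space \<Rightarrow> real"
  assumes u: "u \<in> punctured_test_rad"
  obtains v where "test_fun v" "u = radial_lift c v"
proof -
  have sm: "smooth u" and cs: "compact (support u)" and z: "0 \<notin> support u" and ra: "radial u"
    using u unfolding punctured_test_rad_def by auto
  obtain e :: 'a where e: "e \<in> Basis" using nonempty_Basis by blast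
  let ?S = "{\<lambda>r. iter_partial_deriv bs u (r *\<^sub>R e) |bs. set bs \<subseteq> Basis}"
  have "smooth_real (\<lambda>r. u (r *\<^sub>R e))"
  proof (rule smooth_realI[of _ ?S])
    show "(\<lambda>r. u (r *\<^sub>R e)) \<in> ?S" by (auto intro!: exI[of _ "[]"])
  next
    fix g assume "g \<in> ?S"
    then obtain bs where bs: "g = (\<lambda>r. iter_partial_deriv bs u (r *\<^sub>R e))" "set bs \<subseteq> Basis" by blast
    let ?f = "iter_partial_deriv bs u"
    have "(g has_real_derivative partial_deriv e ?f (t *\<^sub>R e)) (at t)" for t
    proof -
      have "?f differentiable (at (t *\<^sub>R e))"
        using sm bs(2) unfolding smooth_def by (simp add: differentiable_on_eq_differentiable_at)
      then have d: "(?f has_derivative frechet_derivative ?f (at (t *\<^sub>R e))) (at (t *\<^sub>R e))"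
        using frechet_derivative_works by blast
      have "((\<lambda>r. ?f (r *\<^sub>R e)) has_derivative (\<lambda>h. frechet_derivative ?f (at (t *\<^sub>R e)) (h *\<^sub>R e))) (at t)"
        by (rule has_derivative_compose[of "\<lambda>r. r *\<^sub>R e" "\<lambda>h. h *\<^sub>R e", OF _ d]) (auto intro!: derivative_eq_intros)
      moreover have "frechet_derivative ?f (at (t *\<^sub>R e)) (h *\<^sub>R e) = partial_deriv e ?f (t *\<^sub>R e) * h" for h
        unfolding partial_deriv_def using linear_scale[OF has_derivative_linear[OF d]] by simp
      ultimately show ?thesis unfolding has_field_derivative_def bs(1) by simp
    qed
    moreover have "(\<lambda>t. partial_deriv e ?f (t *\<^sub>R e)) \<in> ?S"
      using bs(2) e by (auto intro!: exI[of _ "e # bs"])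
    ultimately show "\<exists>g'\<in>?S. \<forall>t. (g has_real_derivative g' t) (at t)" by (intro bexI) auto
  qed
  then have sv: "smooth_real (\<lambda>t. exp (- c * t) * u (exp t *\<^sub>R e))"
    by (intro smooth_real_mult smooth_real_exp smooth_real_const smooth_real_id
        smooth_real_compose[of "\<lambda>r. u (r *\<^sub>R e)" exp] smooth_real_exp[of "\<lambda>t. t"])
  have zero: "u x = 0" if "x \<notin> support u" for x
    using that closure_subset[of "{x. u x \<noteq> 0}"] unfolding support_def by auto
  obtain M where M: "\<And>x. x \<in> support u \<Longrightarrow> norm x \<le> M"
    using compact_imp_bounded[OF cs] unfolding bounded_iff by blast
  have "open (- support u)" by (simp add: support_def open_Compl)
  then obtain d where d: "d > 0" "ball 0 d \<subseteq> - support u"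
    using z open_contains_ball[of "- support u"] by auto
  have out: "u x = 0" if "norm x < d \<or> norm x > M" for x
    using that d M[of x] by (intro zero) (auto simp: subset_eq)
  have "u (exp t *\<^sub>R e) = 0" if t: "\<bar>t\<bar> > \<bar>ln d\<bar> + \<bar>M\<bar>" for t
  proof (rule out)
    have n: "norm (exp t *\<^sub>R e) = exp t" using e by simp
    show "norm (exp t *\<^sub>R e) < d \<or> norm (exp t *\<^sub>R e) > M"
    proof (cases "t \<ge> 0")
      case True
      then have "M < t" using t by linarith
      then show ?thesis using exp_ge_add_one_self[of t] unfolding n by linarith
    next
      case False
      then have "t < ln d" using t by linarith
      then have "exp t < d" using d(1) by (metis exp_ln exp_less_cancel_iff)
      then show ?thesis unfolding n by simp
    qed
  qed
  then have "test_fun (\<lambda>t. exp (- c * t) * u (exp t *\<^sub>R e))"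
    unfolding test_fun_def using sv by (intro conjI exI[of _ "\<bar>ln d\<bar> + \<bar>M\<bar>"]) auto
  moreover have "u x = radial_lift c (\<lambda>t. exp (- c * t) * u (exp t *\<^sub>R e)) x" for x
  proof (cases "x = 0")
    case True
    then show ?thesis using zero[OF z] by (simp add: radial_lift_0)
  next
    case False
    have "norm (norm x *\<^sub>R e) = norm x" using e by simp
    then have "u (norm x *\<^sub>R e) = u x" using ra unfolding radial_def by blast
    moreover have "norm x powr c * exp (- c * ln (norm x)) = 1"
      using False by (simp add: powr_def flip: exp_add)
    ultimately show ?thesis using False by (simp add: radial_lift_def)
  qed
  ultimately show ?thesis using that by blast
qed

section \<open>Logarithmic polar coordinates\<close>

lemma integrable_compact_support:
  fixes f :: "real \<Rightarrow> real"
  assumes "continuous_on UNIV f" "\<And>t. \<bar>t\<bar> > R \<Longrightarrow> f t = 0"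
  shows "integrable lborel f"
proof -
  have "set_integrable lborel {-R..R} f"
    by (rule borel_integrable_atLeastAtMost') (auto intro: continuous_on_subset[OF assms(1)])
  moreover have "(\<lambda>t. indicator {-R..R} t *\<^sub>R f t) = f"
    using assms(2) by (force simp: indicator_def abs_le_iff)
  ultimately show ?thesis by (simp add: set_integrable_def)
qed

lemma integral_deriv_compact_support:
  fixes f F :: "real \<Rightarrow> real"
  assumes F: "\<And>t. (F has_real_derivative f t) (at t)" and f: "continuous_on UNIV f"
    and z: "\<And>t. \<bar>t\<bar> > R \<Longrightarrow> F t = 0"
  shows "integrable lborel f" "(LINT t|lborel. f t) = 0"
proof -
  have f0: "f t = 0" if t: "\<bar>t\<bar> > R" for t
  proof -
    have o: "open {t::real. \<bar>t\<bar> > R}" by (intro open_Collect_less continuous_intros)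
    have "(F has_real_derivative 0) (at t)"
      by (rule has_field_derivative_transform_within_open[OF DERIV_const o]) (use t z in auto)
    then show ?thesis using DERIV_unique F by blast
  qed
  show "integrable lborel f" by (rule integrable_compact_support[OF f f0])
  define M where "M = \<bar>R\<bar> + 1"
  have "(LINT t|lborel. indicator {-M..M} t *\<^sub>R f t) = F M - F (-M)"
    by (rule integral_FTC_atLeastAtMost)
       (auto simp: M_def intro!: has_vector_derivative_at_within F[unfolded has_real_derivative_iff_has_vector_derivative]
          continuous_on_subset[OF f])
  also have "\<dots> = 0" using z by (simp add: M_def)
  also have "(\<lambda>t. indicator {-M..M} t *\<^sub>R f t) = f"
    using f0 by (force simp: indicator_def abs_le_iff M_def)
  finally show "(LINT t|lborel. f t) = 0" .
qed

definition energy :: "real \<Rightarrow> real \<Rightarrow> (real \<Rightarrow> real) \<Rightarrow> real" where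
  "energy A B v = (LINT t|lborel. (deriv (deriv v) t)\<^sup>2 + A * (deriv v t)\<^sup>2 + B * (v t)\<^sup>2)"

lemma test_funE:
  assumes "test_fun v"
  obtains R v1 v2 where "\<And>t. (v has_real_derivative v1 t) (at t)"
    "\<And>t. (v1 has_real_derivative v2 t) (at t)" "deriv v = v1" "deriv v1 = v2" "test_fun v1" "test_fun v2"
    "continuous_on UNIV v" "continuous_on UNIV v1" "continuous_on UNIV v2"
    "\<And>t. \<bar>t\<bar> > R \<Longrightarrow> v t = 0" "\<And>t. \<bar>t\<bar> > R \<Longrightarrow> v1 t = 0" "\<And>t. \<bar>t\<bar> > R \<Longrightarrow> v2 t = 0"
proof -
  obtain R where R: "\<forall>t. \<bar>t\<bar> > R \<longrightarrow> v t = 0" using assms unfolding test_fun_def by blast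
  note d1 = test_fun_deriv(1,2)[OF assms]
  note d2 = test_fun_deriv(1,2)[OF d1(2)]
  have R1: "\<forall>t. \<bar>t\<bar> > R \<longrightarrow> deriv v t = 0" using test_fun_deriv(3)[OF assms R] by blast
  have R2: "\<forall>t. \<bar>t\<bar> > R \<longrightarrow> deriv (deriv v) t = 0" using test_fun_deriv(3)[OF d1(2) R1] by blast
  show thesis
    by (rule that[of "deriv v" "deriv (deriv v)" R])
       (use d1 d2 R R1 R2 assms in \<open>auto intro: smooth_real_continuous test_fun_smooth\<close>)
qed

lemma integrable_test_fun: "test_fun v \<Longrightarrow> integrable lborel v"
  by (metis integrable_compact_support test_fun_def smooth_real_continuous)

text \<open>The cross terms of the expanded squares are exact derivatives of compactly supported functions.\<close>

lemma energy_eq_radial_integrand: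
  assumes v: "test_fun v"
  shows "(LINT t|lborel. (deriv (deriv v) t + s * deriv v t - k * v t)\<^sup>2
      - l * (deriv v t - g * v t)\<^sup>2 + m * (v t)\<^sup>2)
    = energy (s\<^sup>2 + 2 * k - l) (k\<^sup>2 - l * g\<^sup>2 + m) v"
proof -
  obtain v1 v2 R where v: "\<And>t. (v has_real_derivative v1 t) (at t)"
    "\<And>t. (v1 has_real_derivative v2 t) (at t)" and d: "deriv v = v1" "deriv v1 = v2"
    and c: "continuous_on UNIV v" "continuous_on UNIV v1" "continuous_on UNIV v2"
    and z: "\<And>t. \<bar>t\<bar> > R \<Longrightarrow> v t = 0" "\<And>t. \<bar>t\<bar> > R \<Longrightarrow> v1 t = 0" "\<And>t. \<bar>t\<bar> > R \<Longrightarrow> v2 t = 0"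
    using test_funE[OF v] by metis
  let ?F = "\<lambda>t. s * (v1 t)\<^sup>2 - 2 * k * (v t * v1 t) - (s * k - l * g) * (v t)\<^sup>2"
  let ?f = "\<lambda>t. 2 * s * (v1 t * v2 t) - 2 * k * (v1 t * v1 t + v t * v2 t) - 2 * (s * k - l * g) * (v t * v1 t)"
  have F: "(?F has_real_derivative ?f t) (at t)" for t
    by (auto intro!: derivative_eq_intros v simp: algebra_simps)
  have f: "continuous_on UNIV ?f" by (intro continuous_intros c)
  have "integrable lborel (\<lambda>t. (v2 t)\<^sup>2 + (s\<^sup>2 + 2 * k - l) * (v1 t)\<^sup>2 + (k\<^sup>2 - l * g\<^sup>2 + m) * (v t)\<^sup>2)"
    by (rule integrable_compact_support[of _ R]) (auto intro!: continuous_intros c simp: z)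
  moreover note integral_deriv_compact_support[OF F f, of R]
  ultimately have "(LINT t|lborel. ((v2 t)\<^sup>2 + (s\<^sup>2 + 2 * k - l) * (v1 t)\<^sup>2 + (k\<^sup>2 - l * g\<^sup>2 + m) * (v t)\<^sup>2) + ?f t)
     = energy (s\<^sup>2 + 2 * k - l) (k\<^sup>2 - l * g\<^sup>2 + m) v"
    unfolding energy_def d by (subst Bochner_Integration.integral_add) (auto simp: z)
  also have "(\<lambda>t. ((v2 t)\<^sup>2 + (s\<^sup>2 + 2 * k - l) * (v1 t)\<^sup>2 + (k\<^sup>2 - l * g\<^sup>2 + m) * (v t)\<^sup>2) + ?f t)
    = (\<lambda>t. (v2 t + s * v1 t - k * v t)\<^sup>2 - l * (v1 t - g * v t)\<^sup>2 + m * (v t)\<^sup>2)"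
    by (auto simp: power2_eq_square algebra_simps)
  finally show ?thesis unfolding d .
qed

abbreviation sphere_area :: "'a::euclidean_space itself \<Rightarrow> real" where
  "sphere_area _ \<equiv> real DIM('a) * unit_ball_vol (real DIM('a))"

lemma nn_integral_exp_atMost:
  assumes "n > 0" "w \<ge> 0"
  shows "(\<integral>\<^sup>+t. ennreal (w * exp (n * t)) * indicator {..a} t \<partial>lborel) = ennreal (w / n * exp (n * a))"
proof -
  have "(\<integral>\<^sup>+t. ennreal (w * exp (n * t)) * indicator {..a} t \<partial>lborel)
    = (\<integral>\<^sup>+t. ennreal (w * exp (n * (- t))) * indicator {..a} (- t) \<partial>lborel)"
    by (subst nn_integral_real_affine[where c="-1" and t=0]) auto
  also have "\<dots> = (\<integral>\<^sup>+t. ennreal (w * exp (- n * t)) * indicator {-a..} t \<partial>lborel)"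
    by (intro nn_integral_cong) (auto simp: indicator_def)
  also have "\<dots> = ennreal (0 - (- (w / n) * exp (- n * (- a))))"
  proof (rule nn_integral_FTC_atLeast)
    have "((\<lambda>t. exp (- n * t)) \<longlongrightarrow> 0) at_top" using assms by real_asymp
    then show "((\<lambda>t. - (w / n) * exp (- n * t)) \<longlongrightarrow> 0) at_top"
      by (rule tendsto_mult_right_zero)
  qed (use assms in \<open>auto intro!: derivative_eq_intros\<close>)
  finally show ?thesis by simp
qed

text \<open>Polar coordinates for radial functions. Both measures give a half-line
  \<open>{..a}\<close> the volume of the ball of radius \<open>exp a\<close>, and half-lines form an
  intersection-stable generator of the Borel sets.\<close>

lemma distr_ln_norm:
  "distr lborel borel (\<lambda>x::'a::euclidean_space. ln (norm x))
    = density lborel (\<lambda>t. ennreal (sphere_area TYPE('a) * exp (DIM('a) * t)))" (is "?M = ?N")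
proof -
  let ?n = "real DIM('a)" and ?b = "unit_ball_vol (real DIM('a))"
  have n0: "?n > 0" by simp
  have N: "emeasure ?N {..a} = ennreal (?b * exp (?n * a))" for a
  proof -
    have "emeasure ?N {..a} = ennreal (sphere_area TYPE('a) / ?n * exp (?n * a))"
      by (subst emeasure_density, simp, simp, rule nn_integral_exp_atMost) simp_all
    then show ?thesis by simp
  qed
  have M: "emeasure ?M {..a} = ennreal (?b * exp (?n * a))" for a
  proof -
    have "emeasure ?M {..a} = emeasure lborel {x::'a. ln (norm x) \<le> a}"
      by (subst emeasure_distr) (auto intro!: arg_cong[of _ _ "emeasure lborel"])
    also have "\<dots> = emeasure lborel (cball (0::'a) (exp a))"
    proof (rule emeasure_eq_AE)
      \<comment> \<open>The origin is left out because \<open>ln 0\<close> is only a default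
        value.\<close>
      have "AE x::'a in lborel. x \<noteq> 0" by (rule AE_lborel_singleton)
      then show "AE x::'a in lborel. x \<in> {x. ln (norm x) \<le> a} \<longleftrightarrow> x \<in> cball 0 (exp a)"
      proof eventually_elim
        case (elim x)
        then have "ln (norm x) \<le> a \<longleftrightarrow> norm x \<le> exp a" by (metis exp_le_cancel_iff exp_ln zero_less_norm_iff)
        then show ?case by simp
      qed
    qed auto
    also have "\<dots> = ennreal (?b * exp a ^ DIM('a))" by (rule emeasure_cball) simp
    finally show ?thesis by (simp add: exp_of_nat_mult)
  qed
  show ?thesis
  proof (rule measure_eqI_generator_eq[where E="range (\<lambda>a::real. {..a})" and \<Omega>=UNIV and A="\<lambda>k. {..real k}"])
    show "Int_stable (range (\<lambda>a::real. {..a}))" by (auto simp: Int_stable_def min_def intro!: image_eqI)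
    show "sets ?M = sigma_sets UNIV (range (\<lambda>a::real. {..a}))"
      "sets ?N = sigma_sets UNIV (range (\<lambda>a::real. {..a}))"
      by (auto simp: borel_eq_atMost)
    show "(\<Union>k. {..real k}) = UNIV" using real_arch_simple by auto
  qed (auto simp: M N)
qed

text \<open>The density of the image measure is strictly positive, so it has the same null sets as
  Lebesgue measure.\<close>

lemma AE_ln_norm:
  assumes "{t. P t} \<in> sets borel"
  shows "(AE x::'a::euclidean_space in lborel. P (ln (norm x))) \<longleftrightarrow> (AE t in lborel. P t)"
proof -
  have "(AE x::'a in lborel. P (ln (norm x))) \<longleftrightarrow> (AE t in distr lborel borel (\<lambda>x::'a. ln (norm x)). P t)"
    by (subst AE_distr_iff) (use assms in auto)
  also have "\<dots> \<longleftrightarrow> (AE t in lborel. P t)"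
    unfolding distr_ln_norm by (subst AE_density) (auto simp: ennreal_zero_less_mult_iff)
  finally show ?thesis .
qed

text \<open>The weight of exponent \<open>- n\<close> cancels the density \<open>exp (n * t)\<close>
  and leaves plain Lebesgue measure in t.\<close>

lemma integral_polar:
  fixes h :: "real \<Rightarrow> real"
  assumes h: "h \<in> borel_measurable borel" and n: "n = real DIM('a::euclidean_space)"
  shows "(LINT x|(lebesgue :: 'a measure). norm x powr (- n) * h (ln (norm x)))
    = sphere_area TYPE('a) * (LINT t|lborel. h t)"
proof -
  note h [measurable]
  have "(LINT x|(lebesgue :: 'a measure). norm x powr (- n) * h (ln (norm x)))
    = (LINT x|(lborel :: 'a measure). norm x powr (- n) * h (ln (norm x)))"
    by (intro integral_completion) measurable
  also have "\<dots> = (LINT x|(lborel :: 'a measure). exp (- n * ln (norm x)) * h (ln (norm x)))"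
  proof (rule integral_cong_AE)
    have "AE x::'a in lborel. x \<noteq> 0" by (rule AE_lborel_singleton)
    then show "AE x::'a in lborel. norm x powr (- n) * h (ln (norm x)) = exp (- n * ln (norm x)) * h (ln (norm x))"
      by eventually_elim (simp add: powr_def)
  qed measurable
  also have "\<dots> = (LINT t|distr lborel borel (\<lambda>x::'a. ln (norm x)). exp (- n * t) * h t)"
    using h by (intro integral_distr[symmetric]) measurable
  also have "\<dots> = (LINT t|lborel. (sphere_area TYPE('a) * exp (DIM('a) * t)) * (exp (- n * t) * h t))"
    unfolding distr_ln_norm using h by (subst integral_density) (auto intro!: borel_measurable_times)
  also have "(\<lambda>t::real. (sphere_area TYPE('a) * exp (DIM('a) * t)) * (exp (- n * t) * h t)) = (\<lambda>t. sphere_area TYPE('a) * h t)"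
    by (auto simp: n exp_minus)
  finally show ?thesis by simp
qed

text \<open>The exponent \<open>g\<close> is the one for which all three terms of the integrand
  carry the weight of exponent \<open>- n\<close>; for instance - \<alpha> + 2 (- g - 2) = - n. What
  remains is a form in the profile with constant coefficients.\<close>

lemma alpha_norm_radial_lift:
  fixes \<alpha> lam \<mu> :: real
  assumes n: "n = real DIM('a::euclidean_space)" and v: "test_fun v"
    and g: "g = (n - 4 - \<alpha>) / 2"
  shows "alpha_norm \<alpha> lam \<mu> (radial_lift (- g) v :: 'a \<Rightarrow> real)
    = sqrt (sphere_area TYPE('a) *
        energy (((n - 2)\<^sup>2 + (2 + \<alpha>)\<^sup>2) / 2 - lam) ((g * (g + 2 + \<alpha>))\<^sup>2 - lam * g\<^sup>2 + \<mu>) v)"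
proof -
  define h where "h = (\<lambda>t. (deriv (deriv v) t + (2 + \<alpha>) * deriv v t - g * (g + 2 + \<alpha>) * v t)\<^sup>2
      - lam * (deriv v t - g * v t)\<^sup>2 + \<mu> * (v t)\<^sup>2)"
  obtain v1 v2 where c: "deriv v = v1" "deriv v1 = v2"
    "continuous_on UNIV v" "continuous_on UNIV v1" "continuous_on UNIV v2"
    using test_funE[OF v] by metis
  have h: "h \<in> borel_measurable borel"
    unfolding h_def c by (intro borel_measurable_continuous_onI continuous_intros c)
  have "norm x powr (-\<alpha>) * \<bar>laplacian (radial_lift (- g) v) x\<bar>\<^sup>2
       - lam * norm x powr (-\<alpha> - 2) * (norm (gradient (radial_lift (- g) v) x))\<^sup>2
       + \<mu> * norm x powr (-\<alpha> - 4) * (radial_lift (- g) v x)\<^sup>2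
      = norm x powr (- n) * h (ln (norm x))" for x :: 'a
  proof (cases "x = 0")
    case False
    define r where "r = norm x"
    have r: "r > 0" using False by (simp add: r_def)
    have p: "r powr a * (r powr b)\<^sup>2 = r powr (- n)" if "a + 2 * b = - n" for a b
      using r that by (simp add: power2_eq_square flip: powr_add)
    have q: "r * r powr b = r powr (b + 1)" for b
      using r by (simp add: powr_add)
    have p1: "r powr (-\<alpha>) * (r powr (- g - 2))\<^sup>2 = r powr (-n)"
      and p2: "r powr (-\<alpha> - 2) * (r powr (- g - 1))\<^sup>2 = r powr (-n)"
      and p3: "r powr (-\<alpha> - 4) * (r powr (- g))\<^sup>2 = r powr (-n)"
      by (rule p, use g in argo)+
    have 1: "r powr (-\<alpha>) * (r powr (- g - 2) * y)\<^sup>2 = r powr (-n) * y\<^sup>2" for y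
      unfolding p1[symmetric] by (simp add: power_mult_distrib)
    have 2: "r powr (-\<alpha> - 2) * (r * \<bar>r powr (- g - 2) * y\<bar>)\<^sup>2 = r powr (-n) * y\<^sup>2" for y
    proof -
      have "(r * \<bar>r powr (- g - 2) * y\<bar>)\<^sup>2 = (r powr (- g - 1))\<^sup>2 * y\<^sup>2"
      proof -
        have "r * r powr (- g - 2) = r powr (- g - 1)" using q[of "-g-2"] by (simp only: diff_conv_add_uminus add.assoc) simp
        then show ?thesis by (simp add: power_mult_distrib abs_mult flip: \<open>r * r powr (- g - 2) = r powr (- g - 1)\<close>)
      qed
      then show ?thesis unfolding p2[symmetric] by simp
    qed
    have 3: "r powr (-\<alpha> - 4) * (r powr (- g) * y)\<^sup>2 = r powr (-n) * y\<^sup>2" for y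
      unfolding p3[symmetric] by (simp add: power_mult_distrib)
    let ?t = "ln r"
    have co: "- g * (- g - 2 + n) = - (g * (g + 2 + \<alpha>))" "2 * (- g) - 2 + n = 2 + \<alpha>"
      using g by (auto simp: field_simps)
    have lap: "laplacian (radial_lift (- g) v) x
      = r powr (- g - 2) * (deriv (deriv v) ?t + (2 + \<alpha>) * deriv v ?t - g * (g + 2 + \<alpha>) * v ?t)"
      unfolding laplacian_radial_lift[OF v] n[symmetric] co unfolding radial_lift_def r_def
      by (simp add: algebra_simps)
    have gr: "norm (gradient (radial_lift (- g) v) x) = r * \<bar>r powr (- g - 2) * (deriv v ?t - g * v ?t)\<bar>"
      unfolding norm_gradient_radial_lift[OF v] unfolding radial_lift_def r_def by simp
    show ?thesis
      unfolding lap gr power2_abs unfolding radial_lift_def r_def[symmetric] mult.assoc 1 2 3 h_def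
      by (simp add: algebra_simps)
  qed (use n in simp)
  then have "(LINT x|(lebesgue :: 'a measure).
       norm x powr (-\<alpha>) * \<bar>laplacian (radial_lift (- g) v) x\<bar>\<^sup>2
       - lam * norm x powr (-\<alpha> - 2) * (norm (gradient (radial_lift (- g) v) x))\<^sup>2
       + \<mu> * norm x powr (-\<alpha> - 4) * (radial_lift (- g) v x)\<^sup>2)
     = sphere_area TYPE('a) * (LINT t|lborel. h t)"
    using integral_polar[OF h n] by simp
  also have "(LINT t|lborel. h t) = energy ((2 + \<alpha>)\<^sup>2 + 2 * (g * (g + 2 + \<alpha>)) - lam) ((g * (g + 2 + \<alpha>))\<^sup>2 - lam * g\<^sup>2 + \<mu>) v"
    unfolding h_def by (rule energy_eq_radial_integrand[OF v])
  also have "(2 + \<alpha>)\<^sup>2 + 2 * (g * (g + 2 + \<alpha>)) = ((n - 2)\<^sup>2 + (2 + \<alpha>)\<^sup>2) / 2"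
    unfolding g by (simp add: power2_eq_square field_simps)
  finally show ?thesis unfolding alpha_norm_def by simp
qed

text \<open>The cone over the whole sphere is the closed unit ball without its centre.\<close>

lemma surface_measure_sphere:
  "surface_measure (sphere (0 :: 'a::euclidean_space) 1) = sphere_area TYPE('a)"
proof -
  have "{r *\<^sub>R x | r x. 0 < r \<and> r \<le> 1 \<and> x \<in> sphere (0::'a) 1} = cball 0 1 - {0}"
  proof (intro set_eqI iffI)
    fix y :: 'a assume "y \<in> cball 0 1 - {0}"
    then have "y = norm y *\<^sub>R sgn y" "0 < norm y" "norm y \<le> 1" "sgn y \<in> sphere 0 1"
      by (auto simp: sgn_div_norm)
    then show "y \<in> {r *\<^sub>R x | r x. 0 < r \<and> r \<le> 1 \<and> x \<in> sphere (0::'a) 1}" by blast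
  qed auto
  moreover have "measure lebesgue (cball (0::'a) 1 - {0}) = measure lebesgue (cball (0::'a) 1)"
    by (rule measure_negligible_symdiff) (auto intro: negligible_subset[of "{0}"])
  moreover have "measure lebesgue (cball (0::'a) 1) = unit_ball_vol (real DIM('a))"
    using content_cball[of 1 "0::'a"] by (simp add: measure_completion)
  ultimately show ?thesis unfolding surface_measure_def by simp
qed

section \<open>The space of profiles\<close>

text \<open>The set where the functions differ is open and null, hence empty. This makes the
  continuous representative of a class unique.\<close>

lemma continuous_eq_AE:
  fixes v w :: "real \<Rightarrow> real"
  assumes "continuous_on UNIV v" "continuous_on UNIV w" "AE t in lborel. v t = w t"
  shows "v t = w t"
proof (rule ccontr)
  assume "v t \<noteq> w t"
  have "open {t. v t \<noteq> w t}" by (intro open_Collect_neq assms)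
  moreover have "negligible {t. v t \<noteq> w t}"
  proof -
    obtain N where "N \<in> null_sets lebesgue" "{t. v t \<noteq> w t} \<subseteq> N"
      using AE_completion[OF assms(3)] by (auto simp: eventually_ae_filter)
    then show ?thesis using negligible_iff_null_sets negligible_subset by blast
  qed
  ultimately show False using open_not_negligible \<open>v t \<noteq> w t\<close> by blast
qed

definition test_ip :: "real \<Rightarrow> real \<Rightarrow> (real \<Rightarrow> real) \<Rightarrow> (real \<Rightarrow> real) \<Rightarrow> real" where
  "test_ip A B v w = (LINT t|lborel. deriv (deriv v) t * deriv (deriv w) t + A * (deriv v t * deriv w t) + B * (v t * w t))"

lemma energy_lincomb:
  assumes v: "test_fun v" and w: "test_fun w"
  shows "energy A B (\<lambda>t. x * v t + y * w t)
    = x\<^sup>2 * energy A B v + 2 * x * y * test_ip A B v w + y\<^sup>2 * energy A B w"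
proof -
  obtain v1 v2 R where v: "\<And>t. (v has_real_derivative v1 t) (at t)"
    "\<And>t. (v1 has_real_derivative v2 t) (at t)" and d: "deriv v = v1" "deriv v1 = v2"
    and c: "continuous_on UNIV v" "continuous_on UNIV v1" "continuous_on UNIV v2"
    and z: "\<And>t. \<bar>t\<bar> > R \<Longrightarrow> v t = 0" "\<And>t. \<bar>t\<bar> > R \<Longrightarrow> v1 t = 0" "\<And>t. \<bar>t\<bar> > R \<Longrightarrow> v2 t = 0"
    using test_funE[OF v] by metis
  obtain w1 w2 R' where w: "\<And>t. (w has_real_derivative w1 t) (at t)"
    "\<And>t. (w1 has_real_derivative w2 t) (at t)" and d': "deriv w = w1" "deriv w1 = w2"
    and c': "continuous_on UNIV w" "continuous_on UNIV w1" "continuous_on UNIV w2"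
    and z': "\<And>t. \<bar>t\<bar> > R' \<Longrightarrow> w t = 0" "\<And>t. \<bar>t\<bar> > R' \<Longrightarrow> w1 t = 0" "\<And>t. \<bar>t\<bar> > R' \<Longrightarrow> w2 t = 0"
    using test_funE[OF w] by metis
  have e1: "deriv (\<lambda>t. x * v t + y * w t) = (\<lambda>t. x * v1 t + y * w1 t)"
    by (rule ext, rule DERIV_imp_deriv) (auto intro!: derivative_eq_intros v w)
  have e2: "deriv (\<lambda>t. x * v1 t + y * w1 t) = (\<lambda>t. x * v2 t + y * w2 t)"
    by (rule ext, rule DERIV_imp_deriv) (auto intro!: derivative_eq_intros v w)
  have i: "integrable lborel (\<lambda>t. (v2 t)\<^sup>2 + A * (v1 t)\<^sup>2 + B * (v t)\<^sup>2)"
    "integrable lborel (\<lambda>t. v2 t * w2 t + A * (v1 t * w1 t) + B * (v t * w t))"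
    by (rule integrable_compact_support[of _ R]; auto intro!: continuous_intros c c' simp: z)+
  have i': "integrable lborel (\<lambda>t. (w2 t)\<^sup>2 + A * (w1 t)\<^sup>2 + B * (w t)\<^sup>2)"
    by (rule integrable_compact_support[of _ R']; auto intro!: continuous_intros c c' simp: z')+
  have "energy A B (\<lambda>t. x * v t + y * w t)
    = (LINT t|lborel. x\<^sup>2 * ((v2 t)\<^sup>2 + A * (v1 t)\<^sup>2 + B * (v t)\<^sup>2)
        + 2 * x * y * (v2 t * w2 t + A * (v1 t * w1 t) + B * (v t * w t))
        + y\<^sup>2 * ((w2 t)\<^sup>2 + A * (w1 t)\<^sup>2 + B * (w t)\<^sup>2))"
    unfolding energy_def e1 e2 by (rule Bochner_Integration.integral_cong) (auto simp: power2_eq_square algebra_simps)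
  also have "\<dots> = x\<^sup>2 * energy A B v + 2 * x * y * test_ip A B v w + y\<^sup>2 * energy A B w"
    unfolding energy_def test_ip_def d d' using i i' by simp
  finally show ?thesis .
qed

lemma test_ip_add:
  assumes v: "test_fun v" and w: "test_fun w" and u: "test_fun u"
  shows "test_ip A B v (\<lambda>t. w t + u t) = test_ip A B v w + test_ip A B v u"
proof -
  have i: "integrable lborel (\<lambda>t. deriv (deriv v) t * deriv (deriv w) t + A * (deriv v t * deriv w t) + B * (v t * w t))"
    if w: "test_fun w" for w
    by (intro integrable_test_fun test_fun_add test_fun_mult test_fun_cmult test_fun_smooth test_fun_deriv w v)
  have e1: "deriv (\<lambda>t. w t + u t) = (\<lambda>t. deriv w t + deriv u t)"
    by (rule ext, rule DERIV_imp_deriv) (intro DERIV_add test_fun_deriv w u)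
  have e2: "deriv (\<lambda>t. deriv w t + deriv u t) = (\<lambda>t. deriv (deriv w) t + deriv (deriv u) t)"
    by (rule ext, rule DERIV_imp_deriv) (intro DERIV_add test_fun_deriv w u)
  show ?thesis
    unfolding test_ip_def e1 e2 Bochner_Integration.integral_add[OF i[OF w] i[OF u], symmetric]
    by (rule Bochner_Integration.integral_cong) (auto simp: algebra_simps)
qed

text \<open>One-dimensional Sobolev estimates: the sup bound integrates the derivative of the
  square, and the modulus of continuity integrates v' with a weighted Young inequality. The weight
  \<open>h\<close> stays free so that it can later be chosen from the bound on the energy
  alone.\<close>

lemma test_fun_energy_bounds:
  assumes v: "test_fun v" and A: "A > 0" and B: "B > 0"
  shows "B * (LINT t|lborel. (v t)\<^sup>2) \<le> energy A B v" "energy A B v \<ge> 0"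
    "(v t)\<^sup>2 \<le> energy A B v / min A B"
    "h > 0 \<Longrightarrow> \<bar>v t - v s\<bar> \<le> (h * (energy A B v / A) + \<bar>t - s\<bar> / h) / 2"
proof -
  obtain v1 v2 R where d: "\<And>t. (v has_real_derivative v1 t) (at t)"
    "\<And>t. (v1 has_real_derivative v2 t) (at t)" and e: "deriv v = v1" "deriv v1 = v2"
    and c: "continuous_on UNIV v" "continuous_on UNIV v1" "continuous_on UNIV v2"
    and z: "\<And>t. \<bar>t\<bar> > R \<Longrightarrow> v t = 0" "\<And>t. \<bar>t\<bar> > R \<Longrightarrow> v1 t = 0" "\<And>t. \<bar>t\<bar> > R \<Longrightarrow> v2 t = 0"
    using test_funE[OF v] by metis
  have i0: "integrable lborel (\<lambda>t. (v t)\<^sup>2)"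
    and i1: "integrable lborel (\<lambda>t. (v1 t)\<^sup>2)"
    and i2: "integrable lborel (\<lambda>t. (v2 t)\<^sup>2)"
    by (rule integrable_compact_support[of _ R]; auto intro!: continuous_intros c simp: z)+
  have E: "energy A B v = (LINT t|lborel. (v2 t)\<^sup>2) + A * (LINT t|lborel. (v1 t)\<^sup>2) + B * (LINT t|lborel. (v t)\<^sup>2)"
    unfolding energy_def e using i0 i1 i2 by simp
  have nn: "(LINT t|lborel. (v2 t)\<^sup>2) \<ge> 0" "(LINT t|lborel. (v1 t)\<^sup>2) \<ge> 0" "(LINT t|lborel. (v t)\<^sup>2) \<ge> 0"
    by simp_all
  then show "B * (LINT t|lborel. (v t)\<^sup>2) \<le> energy A B v" "energy A B v \<ge> 0"
    unfolding E using A B by simp_all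
  have e1: "(LINT t|lborel. (v1 t)\<^sup>2) \<le> energy A B v / A"
    unfolding E using A B nn by (simp add: field_simps)
  show "(v t)\<^sup>2 \<le> energy A B v / min A B"
  proof -
    \<comment> \<open>The point \<open>- M - 1\<close> is to the left of \<open>t\<close> and
      outside the support, so no boundary term remains there.\<close>
    define M where "M = max (\<bar>R\<bar> + 1) \<bar>t\<bar>"
    have D: "((\<lambda>t. (v t)\<^sup>2) has_real_derivative 2 * v t * v1 t) (at t)" for t
      by (auto intro!: derivative_eq_intros d)
    have f: "continuous_on UNIV (\<lambda>t. 2 * v t * v1 t)" by (intro continuous_intros c)
    have "(v t)\<^sup>2 = (v t)\<^sup>2 - (v (- M - 1))\<^sup>2" using z(1)[of "-M-1"] by (simp add: M_def)
    also have "\<dots> = (LINT s|lborel. indicator {-M-1..t} s *\<^sub>R (2 * v s * v1 s))"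
      by (rule integral_FTC_atLeastAtMost[symmetric])
         (auto simp: M_def intro!: has_vector_derivative_at_within D[unfolded has_real_derivative_iff_has_vector_derivative]
            continuous_on_subset[OF f])
    also have "\<dots> \<le> (LINT s|lborel. (v s)\<^sup>2 + (v1 s)\<^sup>2)"
    proof (rule integral_mono)
      have "set_integrable lborel {-M-1..t} (\<lambda>s. 2 * v s * v1 s)"
        by (rule borel_integrable_atLeastAtMost') (rule continuous_on_subset[OF f], simp)
      then show "integrable lborel (\<lambda>s. indicator {-M-1..t} s *\<^sub>R (2 * v s * v1 s))"
        by (simp add: set_integrable_def)
      show "indicator {-M-1..t} s *\<^sub>R (2 * v s * v1 s) \<le> (v s)\<^sup>2 + (v1 s)\<^sup>2" for s
        using sum_squares_bound[of "v s" "v1 s"] by (auto simp: indicator_def)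
    qed (use i0 i1 in simp)
    also have "\<dots> = (LINT t|lborel. (v t)\<^sup>2) + (LINT t|lborel. (v1 t)\<^sup>2)" using i0 i1 by simp
    also have "\<dots> \<le> energy A B v / min A B"
    proof -
      have "min A B * (LINT t|lborel. (v t)\<^sup>2) \<le> B * (LINT t|lborel. (v t)\<^sup>2)"
        "min A B * (LINT t|lborel. (v1 t)\<^sup>2) \<le> A * (LINT t|lborel. (v1 t)\<^sup>2)"
        using nn by (auto intro: mult_right_mono)
      then have "min A B * ((LINT t|lborel. (v t)\<^sup>2) + (LINT t|lborel. (v1 t)\<^sup>2)) \<le> energy A B v"
        unfolding E distrib_left using nn(1) by linarith
      then show ?thesis using A B by (simp add: field_simps)
    qed
    finally show ?thesis .
  qed
  show "\<bar>v t - v s\<bar> \<le> (h * (energy A B v / A) + \<bar>t - s\<bar> / h) / 2" if h: "h > 0"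
  proof -
    have *: "\<bar>v t - v s\<bar> \<le> (h * (energy A B v / A) + \<bar>t - s\<bar> / h) / 2" if st: "s \<le> t" for s t
    proof -
      have "v t - v s = (LINT x|lborel. indicator {s..t} x *\<^sub>R v1 x)"
        by (rule integral_FTC_atLeastAtMost[symmetric])
           (auto simp: st intro!: has_vector_derivative_at_within d(1)[unfolded has_real_derivative_iff_has_vector_derivative]
              continuous_on_subset[OF c(2)])
      then have "\<bar>v t - v s\<bar> \<le> (LINT x|lborel. \<bar>indicator {s..t} x *\<^sub>R v1 x\<bar>)"
        using integral_abs_bound by metis
      also have "\<dots> \<le> (LINT x|lborel. h / 2 * (v1 x)\<^sup>2 + 1 / (2 * h) * indicator {s..t} x)"
      proof (rule integral_mono)
        have "set_integrable lborel {s..t} v1"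
          by (rule borel_integrable_atLeastAtMost') (rule continuous_on_subset[OF c(2)], simp)
        then show "integrable lborel (\<lambda>x. \<bar>indicator {s..t} x *\<^sub>R v1 x\<bar>)"
          unfolding set_integrable_def by (rule integrable_abs)
        show "integrable lborel (\<lambda>x. h / 2 * (v1 x)\<^sup>2 + 1 / (2 * h) * indicator {s..t} x)"
          using i1 st by (intro Bochner_Integration.integrable_add integrable_mult_right integrable_real_indicator) auto
        fix x
        \<comment> \<open>Young's inequality; the constant term integrates over [s, t] to (t - s) /
          (2 h).\<close>
        have "2 * (h * \<bar>v1 x\<bar>) \<le> h\<^sup>2 * (v1 x)\<^sup>2 + 1"
          using sum_squares_bound[of "h * \<bar>v1 x\<bar>" 1] by (simp add: power_mult_distrib)
        then have "\<bar>v1 x\<bar> \<le> h / 2 * (v1 x)\<^sup>2 + 1 / (2 * h)"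
          using h by (simp add: field_simps power2_eq_square)
        then show "\<bar>indicator {s..t} x *\<^sub>R v1 x\<bar> \<le> h / 2 * (v1 x)\<^sup>2 + 1 / (2 * h) * indicator {s..t} x"
          using h by (auto simp: indicator_def)
      qed
      also have "\<dots> = h / 2 * (LINT x|lborel. (v1 x)\<^sup>2) + 1 / (2 * h) * (t - s)"
        using i1 st by (subst Bochner_Integration.integral_add) auto
      also have "\<dots> \<le> h / 2 * (energy A B v / A) + 1 / (2 * h) * (t - s)"
        using e1 h by (intro add_right_mono mult_left_mono) auto
      finally show ?thesis using st h by (simp add: field_simps)
    qed
    show ?thesis
      using *[of s t] *[of t s] by (cases "s \<le> t") (auto simp: abs_minus_commute)
  qed
qed

lemma energy_shift:
  assumes v: "test_fun v" shows "energy A B (\<lambda>t. v (t + c)) = energy A B v"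
proof -
  have d: "deriv (\<lambda>t. w (t + c)) = (\<lambda>t. deriv w (t + c))" if "test_fun w" for w
    by (rule ext, rule DERIV_imp_deriv, subst DERIV_shift[symmetric], rule test_fun_deriv(1)[OF that])
  have "energy A B (\<lambda>t. v (t + c)) = (LINT t|lborel. (deriv (deriv v) (c + 1 * t))\<^sup>2 + A * (deriv v (c + 1 * t))\<^sup>2 + B * (v (c + 1 * t))\<^sup>2)"
    unfolding energy_def d[OF v] d[OF test_fun_deriv(2)[OF v]] by (simp add: add.commute)
  also have "\<dots> = energy A B v"
    unfolding energy_def
    using lborel_integral_real_affine[of 1 "\<lambda>t. (deriv (deriv v) t)\<^sup>2 + A * (deriv v t)\<^sup>2 + B * (v t)\<^sup>2" c]
    by simp
  finally show ?thesis .
qed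

text \<open>A completion of the test functions on the line under the energy norm, whose elements are
  genuine continuous functions. They come with no derivatives: every property is proved for test
  functions and passed to the limit. \<open>evaluation\<close> turns norm limits into pointwise
  limits and thereby identifies them; it also makes \<open>q\<close> nonnegative and
  definite.\<close>

locale profile_space =
  fixes H :: "(real \<Rightarrow> real) set" and q :: "(real \<Rightarrow> real) \<Rightarrow> real" and A B c0 :: real
  assumes A: "A > 0" and B: "B > 0" and c0: "c0 > 0"
    and cont: "\<And>v. v \<in> H \<Longrightarrow> continuous_on UNIV v"
    and add: "\<And>v w. v \<in> H \<Longrightarrow> w \<in> H \<Longrightarrow> (\<lambda>t. v t + w t) \<in> H"
    and scale: "\<And>c v. v \<in> H \<Longrightarrow> (\<lambda>t. c * v t) \<in> H"
    and q_scale: "\<And>c v. v \<in> H \<Longrightarrow> q (\<lambda>t. c * v t) = \<bar>c\<bar> * q v"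
    and q_triangle: "\<And>v w. v \<in> H \<Longrightarrow> w \<in> H \<Longrightarrow> q (\<lambda>t. v t + w t) \<le> q v + q w"
    and test: "\<And>v. test_fun v \<Longrightarrow> v \<in> H"
    and q_test: "\<And>v. test_fun v \<Longrightarrow> q v = sqrt (energy A B v)"
    and dense: "\<And>v. v \<in> H \<Longrightarrow>
      \<exists>s. (\<forall>k::nat. test_fun (s k)) \<and> (\<lambda>k. q (\<lambda>t. s k t - v t)) \<longlonglongrightarrow> 0"
    and complete: "\<And>s :: nat \<Rightarrow> real \<Rightarrow> real. (\<And>k. s k \<in> H) \<Longrightarrow>
      (\<forall>e>0. \<exists>K. \<forall>j\<ge>K. \<forall>k\<ge>K. q (\<lambda>t. s j t - s k t) < e) \<Longrightarrow>
      \<exists>v\<in>H. (\<lambda>k. q (\<lambda>t. s k t - v t)) \<longlonglongrightarrow> 0"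
    and evaluation: "\<And>v t. v \<in> H \<Longrightarrow> \<bar>v t\<bar> \<le> c0 * q v"
begin

abbreviation Q :: "(real \<Rightarrow> real) \<Rightarrow> real" where "Q v \<equiv> (q v)\<^sup>2"

text \<open>Polarization of the norm. Bilinearity is not part of the axioms; it is inherited by
  density from \<open>test_ip\<close>.\<close>

definition ip :: "(real \<Rightarrow> real) \<Rightarrow> (real \<Rightarrow> real) \<Rightarrow> real" where
  "ip v w = (Q (\<lambda>t. v t + w t) - Q (\<lambda>t. v t - w t)) / 4"

lemma lincomb: "v \<in> H \<Longrightarrow> w \<in> H \<Longrightarrow> (\<lambda>t. x * v t + y * w t) \<in> H"
  by (intro add scale)

lemma diff: "v \<in> H \<Longrightarrow> w \<in> H \<Longrightarrow> (\<lambda>t. v t - w t) \<in> H"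
  using lincomb[of v w 1 "-1"] by simp

lemma q_nonneg: "v \<in> H \<Longrightarrow> q v \<ge> 0"
  using evaluation[of v 0] c0 by (metis abs_ge_zero order_trans zero_le_mult_iff not_le)

lemma q_minus: "v \<in> H \<Longrightarrow> w \<in> H \<Longrightarrow> q (\<lambda>t. v t - w t) = q (\<lambda>t. w t - v t)"
  using q_scale[OF diff, of w v "-1"] by simp

lemma q_diff_abs: "v \<in> H \<Longrightarrow> w \<in> H \<Longrightarrow> \<bar>q v - q w\<bar> \<le> q (\<lambda>t. v t - w t)"
  using q_triangle[of w "\<lambda>t. v t - w t"] q_triangle[of v "\<lambda>t. w t - v t"] diff[of v w] diff[of w v] q_minus[of v w]
  by auto

definition conv :: "(nat \<Rightarrow> real \<Rightarrow> real) \<Rightarrow> (real \<Rightarrow> real) \<Rightarrow> bool" where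
  "conv s v \<longleftrightarrow> (\<forall>k. s k \<in> H) \<and> v \<in> H \<and> (\<lambda>k. q (\<lambda>t. s k t - v t)) \<longlonglongrightarrow> 0"

lemma conv_q: assumes "conv s v" shows "(\<lambda>k. q (s k)) \<longlonglongrightarrow> q v"
proof -
  have "(\<lambda>k. q (s k) - q v) \<longlonglongrightarrow> 0"
    by (rule Lim_null_comparison[of _ "\<lambda>k. q (\<lambda>t. s k t - v t)"])
       (use assms q_diff_abs in \<open>auto simp: conv_def\<close>)
  then show ?thesis by (simp add: LIM_zero_iff)
qed

lemma conv_lincomb:
  assumes s: "conv s v" and r: "conv r w"
  shows "conv (\<lambda>k t. x * s k t + y * r k t) (\<lambda>t. x * v t + y * w t)"
  unfolding conv_def
proof (intro conjI allI)
  have "(\<lambda>k. \<bar>x\<bar> * q (\<lambda>t. s k t - v t) + \<bar>y\<bar> * q (\<lambda>t. r k t - w t)) \<longlonglongrightarrow> \<bar>x\<bar> * 0 + \<bar>y\<bar> * 0"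
    using s r unfolding conv_def by (intro tendsto_intros) auto
  then have *: "(\<lambda>k. \<bar>x\<bar> * q (\<lambda>t. s k t - v t) + \<bar>y\<bar> * q (\<lambda>t. r k t - w t)) \<longlonglongrightarrow> 0" by simp
  show "(\<lambda>k. q (\<lambda>t. (x * s k t + y * r k t) - (x * v t + y * w t))) \<longlonglongrightarrow> 0"
  proof (rule Lim_null_comparison[OF _ *], rule eventuallyI)
    fix k
    have m: "s k \<in> H" "v \<in> H" "r k \<in> H" "w \<in> H" using s r unfolding conv_def by auto
    have "(\<lambda>t. (x * s k t + y * r k t) - (x * v t + y * w t)) = (\<lambda>t. x * (s k t - v t) + y * (r k t - w t))"
      by (auto simp: algebra_simps)
    moreover have "q (\<lambda>t. x * (s k t - v t) + y * (r k t - w t)) \<le> \<bar>x\<bar> * q (\<lambda>t. s k t - v t) + \<bar>y\<bar> * q (\<lambda>t. r k t - w t)"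
      using q_triangle[OF scale[OF diff[OF m(1,2)], of x] scale[OF diff[OF m(3,4)], of y]]
      by (simp add: q_scale diff m)
    ultimately show "norm (q (\<lambda>t. (x * s k t + y * r k t) - (x * v t + y * w t)))
        \<le> \<bar>x\<bar> * q (\<lambda>t. s k t - v t) + \<bar>y\<bar> * q (\<lambda>t. r k t - w t)"
      using q_nonneg[OF lincomb[OF diff[OF m(1,2)] diff[OF m(3,4)], of x y]] by simp
  qed
qed (use s r lincomb in \<open>auto simp: conv_def\<close>)

lemma conv_add: "conv s v \<Longrightarrow> conv r w \<Longrightarrow> conv (\<lambda>k t. s k t + r k t) (\<lambda>t. v t + w t)"
  and conv_diff: "conv s v \<Longrightarrow> conv r w \<Longrightarrow> conv (\<lambda>k t. s k t - r k t) (\<lambda>t. v t - w t)"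
  using conv_lincomb[of s v r w 1 1] conv_lincomb[of s v r w 1 "-1"] by simp_all

lemma conv_ip: "conv s v \<Longrightarrow> conv r w \<Longrightarrow> (\<lambda>k. ip (s k) (r k)) \<longlonglongrightarrow> ip v w"
  unfolding ip_def
  by (intro tendsto_intros conv_q conv_add conv_diff) simp_all

lemma conv_const: "v \<in> H \<Longrightarrow> conv (\<lambda>k. v) v"
  unfolding conv_def using q_scale[of v 0] by simp

lemma dense': assumes "v \<in> H" obtains s where "\<And>k. test_fun (s k)" "conv s v"
  using dense[OF assms] assms test unfolding conv_def by metis

lemma conv_pointwise:
  assumes "conv s v" shows "(\<lambda>k. s k t) \<longlonglongrightarrow> v t"
proof -
  have "(\<lambda>k. s k t - v t) \<longlonglongrightarrow> 0"
  proof (rule Lim_null_comparison)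
    show "\<forall>\<^sub>F k in sequentially. norm (s k t - v t) \<le> c0 * q (\<lambda>t. s k t - v t)"
      using assms evaluation[OF diff] unfolding conv_def by auto
    show "(\<lambda>k. c0 * q (\<lambda>t. s k t - v t)) \<longlonglongrightarrow> 0"
      using assms unfolding conv_def by (auto intro: tendsto_mult_right_zero)
  qed
  then show ?thesis by (simp add: LIM_zero_iff)
qed

lemma Q_test: "test_fun v \<Longrightarrow> Q v = energy A B v"
  using test_fun_energy_bounds(2)[OF _ A B] by (simp add: q_test)

lemma ip_test: "test_fun v \<Longrightarrow> test_fun w \<Longrightarrow> ip v w = test_ip A B v w"
  using energy_lincomb[of v w A B 1 1] energy_lincomb[of v w A B 1 "-1"]
  by (simp add: ip_def Q_test test_fun_add test_fun_diff)

text \<open>The quadratic expansion holds for test functions, and both sides are continuous along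
  norm limits. It contains the parallelogram law.\<close>

lemma Q_lincomb:
  assumes "v \<in> H" "w \<in> H"
  shows "Q (\<lambda>t. x * v t + y * w t) = x\<^sup>2 * Q v + 2 * x * y * ip v w + y\<^sup>2 * Q w"
proof -
  obtain s r where s: "\<And>k. test_fun (s k)" "conv s v" and r: "\<And>k. test_fun (r k)" "conv r w"
    using dense' assms by metis
  have "(\<lambda>k. Q (\<lambda>t. x * s k t + y * r k t)) \<longlonglongrightarrow> Q (\<lambda>t. x * v t + y * w t)"
    by (intro tendsto_intros conv_q conv_lincomb s r)
  moreover have "Q (\<lambda>t. x * s k t + y * r k t) = x\<^sup>2 * Q (s k) + 2 * x * y * ip (s k) (r k) + y\<^sup>2 * Q (r k)" for k
    using energy_lincomb[OF s(1)[of k] r(1)[of k], of A B x y] s(1)[of k] r(1)[of k]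
    by (simp add: Q_test ip_test test_fun_add test_fun_cmult)
  moreover have "(\<lambda>k. x\<^sup>2 * Q (s k) + 2 * x * y * ip (s k) (r k) + y\<^sup>2 * Q (r k))
      \<longlonglongrightarrow> x\<^sup>2 * Q v + 2 * x * y * ip v w + y\<^sup>2 * Q w"
    by (intro tendsto_intros conv_q conv_ip s r)
  ultimately show ?thesis using LIMSEQ_unique by (metis (no_types, lifting) ext)
qed

lemma ip_add:
  assumes "v \<in> H" "w \<in> H" "u \<in> H"
  shows "ip v (\<lambda>t. w t + u t) = ip v w + ip v u"
proof -
  obtain s r p where s: "\<And>k. test_fun (s k)" "conv s v" and r: "\<And>k. test_fun (r k)" "conv r w"
    and p: "\<And>k. test_fun (p k)" "conv p u"
    using dense' assms by metis
  have "(\<lambda>k. ip (s k) (\<lambda>t. r k t + p k t)) \<longlonglongrightarrow> ip v (\<lambda>t. w t + u t)"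
    by (intro conv_ip conv_add s r p)
  moreover have "ip (s k) (\<lambda>t. r k t + p k t) = ip (s k) (r k) + ip (s k) (p k)" for k
    using test_ip_add[OF s(1)[of k] r(1)[of k] p(1)[of k], of A B] s(1)[of k] r(1)[of k] p(1)[of k]
    by (simp add: ip_test test_fun_add)
  moreover have "(\<lambda>k. ip (s k) (r k) + ip (s k) (p k)) \<longlonglongrightarrow> ip v w + ip v u"
    by (intro tendsto_intros conv_ip s r p)
  ultimately show ?thesis using LIMSEQ_unique by (metis (no_types, lifting) ext)
qed

lemma ip_commute:
  assumes "v \<in> H" "w \<in> H" shows "ip v w = ip w v"
  unfolding ip_def using q_minus[OF assms] by (simp add: add.commute)

lemma ip_scale: assumes "v \<in> H" "w \<in> H" shows "ip v (\<lambda>t. c * w t) = c * ip v w"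
  using Q_lincomb[OF assms, of 1 c] Q_lincomb[OF assms, of 1 "-c"] unfolding ip_def[of v "\<lambda>t. c * w t"]
  by simp

lemma ip_diff: assumes "v \<in> H" "w \<in> H" "u \<in> H" shows "ip v (\<lambda>t. w t - u t) = ip v w - ip v u"
  using ip_add[OF assms(1,2) scale[OF assms(3), of "-1"]] ip_scale[OF assms(1,3), of "-1"] by simp

lemma ip_self: assumes "v \<in> H" shows "ip v v = Q v"
  using Q_lincomb[OF assms assms, of 1 1] q_scale[OF assms, of 2] by (simp add: power_mult_distrib)

lemma ip_abs_le: assumes "v \<in> H" "w \<in> H" shows "\<bar>ip v w\<bar> \<le> q v * q w"
proof -
  have *: "ip v w \<le> q v * q w" if "v \<in> H" "w \<in> H" for v w
  proof -
    have "Q (\<lambda>t. v t + w t) \<le> (q v + q w)\<^sup>2"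
      using that by (intro power_mono q_triangle q_nonneg add)
    then show ?thesis using Q_lincomb[OF that, of 1 1] by (simp add: power2_sum)
  qed
  from *[OF assms] *[OF assms(1) scale[OF assms(2), of "-1"]] ip_scale[OF assms, of "-1"] q_scale[OF assms(2), of "-1"]
  show ?thesis by simp
qed

text \<open>Choosing first \<open>h\<close> small and then \<open>\<bar>t - s\<bar>\<close> small
  relative to \<open>h\<close> shows that norm-bounded sets are equicontinuous.\<close>

lemma equicontinuous:
  assumes v: "v \<in> H" and h: "h > 0"
  shows "\<bar>v t - v s\<bar> \<le> (h * (Q v / A) + \<bar>t - s\<bar> / h) / 2"
proof -
  obtain w where w: "\<And>k. test_fun (w k)" "conv w v" using dense'[OF v] by metis
  have "(\<lambda>k. \<bar>w k t - w k s\<bar>) \<longlonglongrightarrow> \<bar>v t - v s\<bar>"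
    by (intro tendsto_intros conv_pointwise w)
  moreover have "(\<lambda>k. (h * (Q (w k) / A) + \<bar>t - s\<bar> / h) / 2) \<longlonglongrightarrow> (h * (Q v / A) + \<bar>t - s\<bar> / h) / 2"
    using A by (intro tendsto_intros conv_q w) auto
  moreover have "\<bar>w k t - w k s\<bar> \<le> (h * (Q (w k) / A) + \<bar>t - s\<bar> / h) / 2" for k
    using test_fun_energy_bounds(4)[OF w(1) A B h] by (simp add: Q_test w)
  ultimately show ?thesis by (intro LIMSEQ_le) auto
qed

text \<open>Norm approximation is uniform approximation by \<open>evaluation\<close>, and the
  approximants have compact support.\<close>

lemma vanishes_at_infinity:
  assumes v: "v \<in> H" and e: "e > 0"
  obtains R where "\<And>t. \<bar>t\<bar> > R \<Longrightarrow> \<bar>v t\<bar> < e"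
proof -
  obtain w where w: "\<And>k. test_fun (w k)" "conv w v" using dense'[OF v] by metis
  have "eventually (\<lambda>k. q (\<lambda>t. w k t - v t) < e / c0) sequentially"
    using w(2) e c0 unfolding conv_def by (intro order_tendstoD) auto
  then obtain k where k: "q (\<lambda>t. w k t - v t) < e / c0" by (auto simp: eventually_sequentially)
  have b: "\<bar>w k t - v t\<bar> < e" for t
    using evaluation[OF diff[OF test[OF w(1)] v], of k t] k c0 by (simp add: field_simps)
  obtain R where "\<forall>t. \<bar>t\<bar> > R \<longrightarrow> w k t = 0" using w(1)[of k] unfolding test_fun_def by blast
  then show ?thesis using b that[of R] by (metis abs_minus_cancel diff_0)
qed

text \<open>Fatou's lemma along approximating test functions, which converge pointwise.\<close>

lemma square_integrable:
  assumes v: "v \<in> H"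
  shows "integrable lborel (\<lambda>t. (v t)\<^sup>2)" "B * (LINT t|lborel. (v t)\<^sup>2) \<le> Q v"
proof -
  obtain w where w: "\<And>k. test_fun (w k)" "conv w v" using dense'[OF v] by metis
  have mv: "v \<in> borel_measurable borel" using cont[OF v] by (rule borel_measurable_continuous_onI)
  have mw: "w k \<in> borel_measurable borel" for k using cont[OF test[OF w(1)]] by (rule borel_measurable_continuous_onI)
  have b: "(\<integral>\<^sup>+t. ennreal ((w k t)\<^sup>2) \<partial>lborel) \<le> ennreal (Q (w k) / B)" for k
  proof -
    have "integrable lborel (\<lambda>t. (w k t)\<^sup>2)"
      using integrable_test_fun[OF test_fun_mult[OF test_fun_smooth[OF w(1)] w(1)], of k k] by (simp add: power2_eq_square)
    then have "(\<integral>\<^sup>+t. ennreal ((w k t)\<^sup>2) \<partial>lborel) = ennreal (LINT t|lborel. (w k t)\<^sup>2)"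
      by (intro nn_integral_eq_integral) auto
    also have "\<dots> \<le> ennreal (Q (w k) / B)"
      using test_fun_energy_bounds(1)[OF w(1) A B, of k] B by (intro ennreal_leI) (simp add: Q_test w field_simps)
    finally show ?thesis .
  qed
  have "(\<integral>\<^sup>+t. ennreal ((v t)\<^sup>2) \<partial>lborel) = (\<integral>\<^sup>+t. liminf (\<lambda>k. ennreal ((w k t)\<^sup>2)) \<partial>lborel)"
  proof (rule nn_integral_cong)
    fix t
    have "(\<lambda>k. ennreal ((w k t)\<^sup>2)) \<longlonglongrightarrow> ennreal ((v t)\<^sup>2)"
      by (intro tendsto_ennrealI tendsto_intros conv_pointwise w)
    then show "ennreal ((v t)\<^sup>2) = liminf (\<lambda>k. ennreal ((w k t)\<^sup>2))"
      by (intro lim_imp_Liminf[symmetric]) simp_all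
  qed
  also have "\<dots> \<le> liminf (\<lambda>k. \<integral>\<^sup>+t. ennreal ((w k t)\<^sup>2) \<partial>lborel)"
    using mw by (intro nn_integral_liminf) measurable
  also have "\<dots> \<le> liminf (\<lambda>k. ennreal (Q (w k) / B))"
    by (intro Liminf_mono always_eventually allI b)
  also have "\<dots> = ennreal (Q v / B)"
  proof (rule lim_imp_Liminf)
    show "(\<lambda>k. ennreal (Q (w k) / B)) \<longlonglongrightarrow> ennreal (Q v / B)"
      using B by (intro tendsto_ennrealI tendsto_intros conv_q w) auto
  qed simp
  finally have *: "(\<integral>\<^sup>+t. ennreal ((v t)\<^sup>2) \<partial>lborel) \<le> ennreal (Q v / B)" .
  show i: "integrable lborel (\<lambda>t. (v t)\<^sup>2)"
    using mv * by (intro integrableI_bounded) (auto simp: le_less_trans[OF _ ennreal_less_top])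
  have "ennreal (LINT t|lborel. (v t)\<^sup>2) \<le> ennreal (Q v / B)"
    using * nn_integral_eq_integral[OF i] by simp
  then have "(LINT t|lborel. (v t)\<^sup>2) \<le> Q v / B" using B by (subst (asm) ennreal_le_iff) auto
  then show "B * (LINT t|lborel. (v t)\<^sup>2) \<le> Q v" using B by (simp add: field_simps)
qed

text \<open>The energy is translation invariant, so the shifted approximants are again Cauchy, and
  pointwise convergence identifies their limit as the shifted function.\<close>

lemma shift:
  assumes v: "v \<in> H"
  shows "(\<lambda>t. v (t + c)) \<in> H" "q (\<lambda>t. v (t + c)) = q v"
proof -
  obtain w where w: "\<And>k. test_fun (w k)" "conv w v" using dense'[OF v] by metis
  have qs: "q (\<lambda>t. f (t + c)) = q f" if "test_fun f" for f
    using energy_shift[OF that] by (simp add: q_test test_fun_shift that)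
  have "\<exists>y\<in>H. (\<lambda>k. q (\<lambda>t. w k (t + c) - y t)) \<longlonglongrightarrow> 0"
  proof (rule complete[OF test[OF test_fun_shift[OF w(1)]]], intro allI impI)
    fix e :: real assume e: "e > 0"
    have "eventually (\<lambda>k. q (\<lambda>t. w k t - v t) < e / 2) sequentially"
      using w(2) e unfolding conv_def by (intro order_tendstoD) auto
    then obtain K where K: "\<And>k. k \<ge> K \<Longrightarrow> q (\<lambda>t. w k t - v t) < e / 2" by (auto simp: eventually_sequentially)
    have "q (\<lambda>t. w j (t + c) - w k (t + c)) < e" if "j \<ge> K" "k \<ge> K" for j k
    proof -
      have "q (\<lambda>t. w j (t + c) - w k (t + c)) = q (\<lambda>t. w j t - w k t)"
        using qs[OF test_fun_diff[OF w(1)[of j] w(1)[of k]]] by simp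
      also have "\<dots> \<le> q (\<lambda>t. w j t - v t) + q (\<lambda>t. v t - w k t)"
        using q_triangle[OF diff[OF test[OF w(1)] v] diff[OF v test[OF w(1)]], of j k] by simp
      finally show ?thesis using K[OF that(1)] K[OF that(2)] q_minus[OF v test[OF w(1)], of k] by simp
    qed
    then show "\<exists>K. \<forall>j\<ge>K. \<forall>k\<ge>K. q (\<lambda>t. w j (t + c) - w k (t + c)) < e" by blast
  qed
  then obtain y where "y \<in> H" "(\<lambda>k. q (\<lambda>t. w k (t + c) - y t)) \<longlonglongrightarrow> 0" by blast
  then have y: "conv (\<lambda>k t. w k (t + c)) y" using test[OF test_fun_shift[OF w(1)]] unfolding conv_def by simp
  have "y t = v (t + c)" for t
    by (rule LIMSEQ_unique[OF conv_pointwise[OF y] conv_pointwise[OF w(2)]])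
  then have "y = (\<lambda>t. v (t + c))" by (rule ext)
  then have y: "conv (\<lambda>k t. w k (t + c)) (\<lambda>t. v (t + c))" using y by simp
  then show "(\<lambda>t. v (t + c)) \<in> H" by (simp add: conv_def)
  show "q (\<lambda>t. v (t + c)) = q v"
    using conv_q[OF y] conv_q[OF w(2)] LIMSEQ_unique by (simp add: qs w)
qed

end

section \<open>Weak compactness of norm-bounded sequences\<close>

inductive_set mid_hull :: "('a \<Rightarrow> real) set \<Rightarrow> ('a \<Rightarrow> real) set" for S where
  base: "v \<in> S \<Longrightarrow> v \<in> mid_hull S"
| mid: "v \<in> mid_hull S \<Longrightarrow> w \<in> mid_hull S \<Longrightarrow> (\<lambda>t. 1 / 2 * v t + 1 / 2 * w t) \<in> mid_hull S"

lemma mid_hull_mono: "v \<in> mid_hull S \<Longrightarrow> S \<subseteq> T \<Longrightarrow> v \<in> mid_hull T"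
proof (induction rule: mid_hull.induct)
  case (mid v w)
  then show ?case by (intro mid_hull.mid) auto
qed (auto intro: mid_hull.base)

context profile_space begin

lemma mid_hull_subset: "v \<in> mid_hull S \<Longrightarrow> S \<subseteq> H \<Longrightarrow> v \<in> H"
proof (induction rule: mid_hull.induct)
  case (mid v w)
  then show ?case by (intro lincomb) auto
qed auto

text \<open>Closure under midpoints replaces general convex combinations: it is what the
  parallelogram law asks for, and bounds on functionals that respect midpoints pass to the hull by a
  plain induction.\<close>

lemma mid_hull_functional:
  fixes F :: "(real \<Rightarrow> real) \<Rightarrow> real"
  assumes "v \<in> mid_hull S" and "S \<subseteq> H" and "\<And>v. v \<in> S \<Longrightarrow> \<bar>F v - l\<bar> \<le> e"
    and "\<And>v w. v \<in> H \<Longrightarrow> w \<in> H \<Longrightarrow> F (\<lambda>t. 1 / 2 * v t + 1 / 2 * w t) = (F v + F w) / 2"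
  shows "\<bar>F v - l\<bar> \<le> e"
  using assms(1)
proof induction
  case (mid v w)
  have "F (\<lambda>t. 1 / 2 * v t + 1 / 2 * w t) - l = (F v - l) / 2 + (F w - l) / 2"
    using assms(4)[OF mid_hull_subset[OF mid.hyps(1) assms(2)] mid_hull_subset[OF mid.hyps(2) assms(2)]]
    by (simp add: field_simps)
  moreover have "\<bar>a / 2 + b / 2\<bar> \<le> e" if "\<bar>a\<bar> \<le> e" "\<bar>b\<bar> \<le> e" for a b :: real
    using that by linarith
  ultimately show ?case using mid.IH by (simp only:)
qed (rule assms(3))

lemma ip_mid:
  assumes "u \<in> H" "v \<in> H" "w \<in> H"
  shows "ip u (\<lambda>t. 1 / 2 * v t + 1 / 2 * w t) = (ip u v + ip u w) / 2"
  using ip_add[OF assms(1) scale[OF assms(2), of "1/2"] scale[OF assms(3), of "1/2"]]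
    ip_scale[OF assms(1,2), of "1/2"] ip_scale[OF assms(1,3), of "1/2"] by (simp add: field_simps)

text \<open>Elements of almost minimal norm in the hulls of the tails form a Cauchy sequence by the
  parallelogram law; every functional that converges along \<open>w\<close> has the same limit along them.\<close>

lemma tail_hull_limit:
  assumes w: "\<And>k::nat. w k \<in> H" and K: "\<And>k. q (w k) \<le> K"
  obtains y z where "conv z y" "\<And>m. z m \<in> mid_hull (w ` {m..})"
proof -
  define C where "C m = mid_hull (w ` {m..})" for m
  define d where "d m = Inf (q ` C m)" for m
  have CH: "C m \<subseteq> H" for m using mid_hull_subset w unfolding C_def by blast
  have Cm: "C l \<subseteq> C m" if "m \<le> l" for m l
    using that mid_hull_mono[of _ "w ` {l..}" "w ` {m..}"] unfolding C_def by (auto simp: image_mono)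
  have wC: "w m \<in> C m" for m unfolding C_def by (rule mid_hull.base) auto
  have bb: "bdd_below (q ` C m)" for m using q_nonneg CH by (intro bdd_belowI[of _ 0]) auto
  have dle: "d m \<le> q v" if "v \<in> C m" for m v
    unfolding d_def using that bb by (intro cInf_lower) auto
  have d0: "d m \<ge> 0" for m
    unfolding d_def using wC[of m] q_nonneg CH by (intro cInf_greatest) auto
  have dmono: "incseq d"
  proof (rule incseq_SucI)
    fix m show "d m \<le> d (Suc m)"
      unfolding d_def using Cm[of m "Suc m"] wC[of "Suc m"] bb[of m] by (intro cInf_superset_mono) auto
  qed
  have dK: "d m \<le> K" for m using dle[OF wC] K order_trans by blast
  obtain D where D: "d \<longlonglongrightarrow> D" using incseq_convergent[OF dmono] dK by blast
  have "\<exists>v\<in>C m. q v < d m + 1 / Suc m" for m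
  proof -
    have "\<exists>x\<in>q ` C m. x < d m + 1 / Suc m"
      using wC[of m] by (intro cInf_lessD) (auto simp: d_def)
    then show ?thesis by blast
  qed
  then obtain z where z: "\<And>m. z m \<in> C m" "\<And>m. q (z m) < d m + 1 / Suc m" by metis
  have zH: "z m \<in> H" for m using z CH by blast
  have "(\<lambda>m. (d m + 1 / Suc m)\<^sup>2) \<longlonglongrightarrow> (D + 0)\<^sup>2"
    by (intro tendsto_intros D LIMSEQ_Suc[OF lim_1_over_n])
  then have L1: "(\<lambda>m. (d m + 1 / Suc m)\<^sup>2) \<longlonglongrightarrow> D\<^sup>2" by simp
  have L2: "(\<lambda>m. (d m)\<^sup>2) \<longlonglongrightarrow> D\<^sup>2" by (intro tendsto_intros D)
  \<comment> \<open>The hulls decrease, so the midpoint of \<open>z m\<close> and \<open>z l\<close>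
    still lies in \<open>C m\<close> and has norm at least \<open>d m\<close>. As \<open>d\<close>
    converges, the right-hand side tends to 0.\<close>
  have key: "Q (\<lambda>t. z m t - z l t) \<le> 2 * (d m + 1 / Suc m)\<^sup>2 + 2 * (d l + 1 / Suc l)\<^sup>2 - 4 * (d m)\<^sup>2"
    if "m \<le> l" for m l
  proof -
    have "(\<lambda>t. 1 / 2 * z m t + 1 / 2 * z l t) \<in> C m"
      using z(1)[of m] z(1)[of l] Cm[OF that] unfolding C_def by (intro mid_hull.mid) auto
    then have "(d m)\<^sup>2 \<le> Q (\<lambda>t. 1 / 2 * z m t + 1 / 2 * z l t)"
      using d0 dle by (intro power_mono) auto
    moreover have "Q (z m) \<le> (d m + 1 / Suc m)\<^sup>2" "Q (z l) \<le> (d l + 1 / Suc l)\<^sup>2"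
      by (rule power_mono[OF less_imp_le[OF z(2)] q_nonneg[OF zH]])+
    moreover have "Q (\<lambda>t. z m t - z l t) = 2 * Q (z m) + 2 * Q (z l) - 4 * Q (\<lambda>t. 1 / 2 * z m t + 1 / 2 * z l t)"
      using Q_lincomb[OF zH[of m] zH[of l], of "1/2" "1/2"] Q_lincomb[OF zH[of m] zH[of l], of 1 "-1"]
      by (simp add: power2_eq_square field_simps)
    ultimately show ?thesis by linarith
  qed
  have "\<exists>y\<in>H. (\<lambda>k. q (\<lambda>t. z k t - y t)) \<longlonglongrightarrow> 0"
  proof (rule complete[OF zH], intro allI impI)
    fix e :: real assume e: "e > 0"
    have "eventually (\<lambda>m. (d m + 1 / Suc m)\<^sup>2 < D\<^sup>2 + e\<^sup>2 / 16 \<and> (d m)\<^sup>2 > D\<^sup>2 - e\<^sup>2 / 16) sequentially"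
      using e by (intro eventually_conj order_tendstoD[OF L1] order_tendstoD[OF L2]) auto
    then obtain M where M: "\<And>m. m \<ge> M \<Longrightarrow> (d m + 1 / Suc m)\<^sup>2 < D\<^sup>2 + e\<^sup>2 / 16"
      "\<And>m. m \<ge> M \<Longrightarrow> (d m)\<^sup>2 > D\<^sup>2 - e\<^sup>2 / 16" by (auto simp: eventually_sequentially)
    have *: "q (\<lambda>t. z m t - z l t) < e" if "M \<le> m" "m \<le> l" for m l
    proof -
      have "Q (\<lambda>t. z m t - z l t) < e\<^sup>2"
        using key[OF that(2)] M(1)[OF that(1)] M(2)[OF that(1)] M(1)[OF order_trans[OF that]] zero_less_power[OF e, of 2] by linarith
      then show ?thesis using e by (rule power2_less_imp_less[OF _ less_imp_le])
    qed
    have "q (\<lambda>t. z m t - z l t) < e" if "M \<le> m" "M \<le> l" for m l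
      using *[OF that(1), of l] *[OF that(2), of m] q_minus[OF zH[of m] zH[of l]] by (cases "m \<le> l") auto
    then show "\<exists>M. \<forall>m\<ge>M. \<forall>l\<ge>M. q (\<lambda>t. z m t - z l t) < e" by blast
  qed
  then obtain y where "y \<in> H" "(\<lambda>k. q (\<lambda>t. z k t - y t)) \<longlonglongrightarrow> 0" by blast
  then have "conv z y" using zH unfolding conv_def by simp
  then show thesis using that[of z y] z(1) unfolding C_def by simp
qed

lemma functional_limit:
  fixes F :: "(real \<Rightarrow> real) \<Rightarrow> real"
  assumes w: "\<And>k::nat. w k \<in> H" and z: "\<And>m. z m \<in> mid_hull (w ` {m..})"
    and F: "\<And>v w. v \<in> H \<Longrightarrow> w \<in> H \<Longrightarrow> F (\<lambda>t. 1 / 2 * v t + 1 / 2 * w t) = (F v + F w) / 2"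
    and lim: "(\<lambda>k. F (w k)) \<longlonglongrightarrow> l"
  shows "(\<lambda>m. F (z m)) \<longlonglongrightarrow> l"
proof (rule LIMSEQ_I)
  fix e :: real assume e: "e > 0"
  then obtain M where M: "\<And>k. k \<ge> M \<Longrightarrow> \<bar>F (w k) - l\<bar> < e / 2"
    using LIMSEQ_D[OF lim, of "e/2"] by auto
  have "\<bar>F (z m) - l\<bar> \<le> e / 2" if "m \<ge> M" for m
    by (rule mid_hull_functional[OF z[of m] _ _ F]) (use w M that in \<open>force intro: less_imp_le\<close>)+
  then show "\<exists>no. \<forall>m\<ge>no. norm (F (z m) - l) < e" using e by (intro exI[of _ M]) fastforce
qed

text \<open>A diagonal subsequence makes all values at rational points and all inner products with
  the members of the sequence converge. The limit \<open>y\<close> is a norm limit of midpoint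
  combinations. Equicontinuity extends convergence from rational to all points, and approximation of
  \<open>y\<close> by hull elements gives convergence of the inner products with \<open>y\<close>;
  this is what splits \<open>Q (w - y)\<close> into \<open>Q w - Q y\<close> up to a null
  sequence.\<close>

lemma weak_compactness:
  assumes v: "\<And>k::nat. v k \<in> H" and K: "\<And>k. q (v k) \<le> K"
  obtains r y where "strict_mono r" "y \<in> H" "\<And>t. (\<lambda>k. v (r k) t) \<longlonglongrightarrow> y t"
    "(\<lambda>k. ip (v (r k)) y) \<longlonglongrightarrow> Q y"
proof -
  have K0: "K \<ge> 0" using K[of 0] q_nonneg[OF v[of 0]] by linarith
  \<comment> \<open>A sum type indexes points (\<open>Inl\<close>) and functionals
    (\<open>Inr\<close>) together, so a single extraction of a subsequence serves both.\<close>
  define f where "f k i = (case i of Inl t \<Rightarrow> v k t | Inr j \<Rightarrow> ip (v k) (v j))" for k and i :: "real + nat"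
  have "countable (Inl ` \<rat> \<union> Inr ` UNIV :: (real + nat) set)"
    by (intro countable_Un countable_image countable_rat) auto
  moreover have "norm (f k i) \<le> max (c0 * K) (K * K)" for k i
  proof (cases i)
    case (Inl t)
    have "c0 * q (v k) \<le> c0 * K" using K c0 by simp
    then show ?thesis using evaluation[OF v[of k], of t] Inl unfolding f_def by simp
  next
    case (Inr j)
    have "q (v k) * q (v j) \<le> K * K" using K v q_nonneg K0 by (intro mult_mono) auto
    then show ?thesis using ip_abs_le[OF v[of k] v[of j]] Inr unfolding f_def by simp
  qed
  ultimately obtain r where r: "strict_mono r" and
    lim: "\<And>i. i \<in> Inl ` \<rat> \<union> Inr ` UNIV \<Longrightarrow> \<exists>l. (\<lambda>k. f (r k) i) \<longlonglongrightarrow> l"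
    using function_convergent_subsequence[of "Inl ` \<rat> \<union> Inr ` UNIV" f] by metis
  define w where "w k = v (r k)" for k
  have w: "w k \<in> H" "q (w k) \<le> K" for k using v K by (auto simp: w_def)
  obtain y z where y: "conv z y" and z: "\<And>m. z m \<in> mid_hull (w ` {m..})"
    using tail_hull_limit[of w K, OF w] by blast
  have yH: "y \<in> H" and zH: "\<And>m. z m \<in> H" using y by (auto simp: conv_def)
  have rat: "(\<lambda>k. w k t) \<longlonglongrightarrow> y t" if tQ: "t \<in> \<rat>" for t
  proof -
    obtain l where l: "(\<lambda>k. w k t) \<longlonglongrightarrow> l" using lim[OF UnI1[OF imageI[OF tQ]]] by (auto simp: f_def w_def)
    have "(\<lambda>m. z m t) \<longlonglongrightarrow> l"
      by (rule functional_limit[OF w(1) z, where F="\<lambda>v. v t"]) (use l in \<open>auto simp: field_simps\<close>)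
    then have "l = y t" using conv_pointwise[OF y, of t] LIMSEQ_unique by blast
    then show ?thesis using l by simp
  qed
  have pointwise: "(\<lambda>k. w k t) \<longlonglongrightarrow> y t" for t
  proof (rule LIMSEQ_I)
    fix e :: real assume e: "e > 0"
    define K' where "K' = K\<^sup>2 + Q y"
    have K': "K' \<ge> 0" "Q (w k) \<le> K'" "Q y \<le> K'" for k
      using power_mono[OF w(2) q_nonneg[OF w(1)], of k 2] by (simp_all add: K'_def add_increasing2)
    \<comment> \<open>Chosen so that \<open>h * (K' / A + 1) / 2 = e / 4\<close>: with
      \<open>\<bar>t - s\<bar> < h * h\<close>, moving from \<open>t\<close> to \<open>s\<close>
      costs at most e/4 for each of the two functions.\<close>
    define h where "h = e / (2 * (K' / A + 1))"
    have h: "h > 0" using e A K' by (auto simp: h_def intro!: divide_pos_pos add_nonneg_pos)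
    obtain s where s: "s \<in> \<rat>" "\<bar>t - s\<bar> < h * h"
      using Rats_dense_in_real[of "t - h * h" "t + h * h"] h by (auto simp: abs_less_iff algebra_simps)
    have small: "\<bar>u t - u s\<bar> \<le> e / 4" if "u \<in> H" "Q u \<le> K'" for u
    proof -
      have "\<bar>u t - u s\<bar> \<le> (h * (Q u / A) + \<bar>t - s\<bar> / h) / 2" by (rule equicontinuous[OF that(1) h])
      also have "\<dots> \<le> (h * (K' / A) + h) / 2"
        using that(2) A h s(2) by (intro divide_right_mono add_mono mult_left_mono) (auto simp: field_simps)
      also have "\<dots> = h * (K' / A + 1) / 2" by (simp add: field_simps)
      also have "\<dots> = e / 4"
      proof -
        have "e / (2 * X) * X / 2 = e / 4" if "X > 0" for X :: real using that by simp
        moreover have "K' / A + 1 > 0" using K'(1) A by (simp add: add_nonneg_pos)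
        ultimately show ?thesis unfolding h_def by metis
      qed
      finally show ?thesis .
    qed
    obtain M where M: "\<And>k. k \<ge> M \<Longrightarrow> \<bar>w k s - y s\<bar> < e / 4"
      using LIMSEQ_D[OF rat[OF s(1)], of "e/4"] e by auto
    have "\<bar>w k t - y t\<bar> < e" if "k \<ge> M" for k
      using small[OF w(1) K'(2), of k] small[OF yH K'(3)] M[OF that] e by linarith
    then show "\<exists>no. \<forall>k\<ge>no. norm (w k t - y t) < e" by auto
  qed
  \<comment> \<open>Inner products with the \<open>v j\<close> converge by the choice of the
    subsequence; midpoints preserve this. The hull elements \<open>z m\<close> then serve as
    approximants of \<open>y\<close>.\<close>
  have hull_conv: "convergent (\<lambda>k. ip (w k) x)" if "x \<in> mid_hull (w ` {m..})" for x m
    using that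
  proof induction
    case (base x)
    then obtain j where "x = v j" unfolding w_def by blast
    then show ?case using lim[of "Inr j"] unfolding convergent_def by (auto simp: f_def w_def)
  next
    case (mid x x')
    have "x \<in> H" "x' \<in> H" using mid.hyps mid_hull_subset w(1) by blast+
    then have "(\<lambda>k. ip (w k) (\<lambda>t. 1 / 2 * x t + 1 / 2 * x' t)) = (\<lambda>k. (ip (w k) x + ip (w k) x') / 2)"
      using ip_mid[OF w(1)] by blast
    moreover obtain a b where "(\<lambda>k. ip (w k) x) \<longlonglongrightarrow> a" "(\<lambda>k. ip (w k) x') \<longlonglongrightarrow> b"
      using mid.IH unfolding convergent_def by blast
    moreover from this have "(\<lambda>k. (ip (w k) x + ip (w k) x') / 2) \<longlonglongrightarrow> (a + b) / 2"
      by (intro tendsto_intros) auto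
    ultimately show ?case unfolding convergent_def by metis
  qed
  have "Cauchy (\<lambda>k. ip (w k) y)"
  proof (rule CauchyI)
    fix e :: real assume e: "e > 0"
    have "eventually (\<lambda>m. q (\<lambda>t. z m t - y t) < e / (3 * (K + 1))) sequentially"
      using y e K0 unfolding conv_def by (intro order_tendstoD) auto
    then obtain m where "q (\<lambda>t. z m t - y t) < e / (3 * (K + 1))" by (auto simp: eventually_sequentially)
    then have m: "(K + 1) * q (\<lambda>t. y t - z m t) < e / 3"
      using K0 by (simp add: q_minus[OF zH yH] field_simps)
    have c: "\<bar>ip (w k) y - ip (w k) (z m)\<bar> < e / 3" for k
    proof -
      have "\<bar>ip (w k) y - ip (w k) (z m)\<bar> = \<bar>ip (w k) (\<lambda>t. y t - z m t)\<bar>"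
        by (simp add: ip_diff w yH zH)
      also have "\<dots> \<le> q (w k) * q (\<lambda>t. y t - z m t)" by (intro ip_abs_le w diff yH zH)
      also have "\<dots> \<le> (K + 1) * q (\<lambda>t. y t - z m t)"
        using w(2)[of k] by (intro mult_right_mono q_nonneg diff yH zH) simp
      finally show ?thesis using m by simp
    qed
    obtain N where N: "\<And>k l. k \<ge> N \<Longrightarrow> l \<ge> N \<Longrightarrow> \<bar>ip (w k) (z m) - ip (w l) (z m)\<bar> < e / 3"
      using CauchyD[OF convergent_Cauchy[OF hull_conv[OF z[of m]]], of "e/3"] e by auto
    have "\<bar>ip (w k) y - ip (w l) y\<bar> < e" if "k \<ge> N" "l \<ge> N" for k l
      using c[of k] c[of l] N[OF that] by linarith
    then show "\<exists>M. \<forall>m\<ge>M. \<forall>n\<ge>M. norm (ip (w m) y - ip (w n) y) < e" by auto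
  qed
  then obtain l where l: "(\<lambda>k. ip (w k) y) \<longlonglongrightarrow> l"
    using convergentD[OF iffD1[OF Cauchy_convergent_iff]] by blast
  have "(\<lambda>m. ip (z m) y) \<longlonglongrightarrow> l"
  proof (rule functional_limit[OF w(1) z, where F="\<lambda>v. ip v y"])
    fix v u assume vu: "v \<in> H" "u \<in> H"
    then show "ip (\<lambda>t. 1 / 2 * v t + 1 / 2 * u t) y = (ip v y + ip u y) / 2"
      unfolding ip_commute[OF lincomb[OF vu] yH] ip_commute[OF vu(1) yH] ip_commute[OF vu(2) yH]
      by (rule ip_mid[OF yH])
  qed (rule l)
  moreover have "(\<lambda>m. ip (z m) y) \<longlonglongrightarrow> ip y y" by (intro conv_ip y conv_const yH)
  ultimately have "l = Q y" using LIMSEQ_unique ip_self[OF yH] by metis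
  then have "(\<lambda>k. ip (v (r k)) y) \<longlonglongrightarrow> Q y" using l by (simp add: w_def)
  then show thesis by (rule that[OF r yH pointwise[unfolded w_def]])
qed

end

section \<open>Signed powers: derivatives, tangent inequality and splitting estimate\<close>

definition spow :: "real \<Rightarrow> real \<Rightarrow> real" where
  "spow p x = \<bar>x\<bar> powr (p - 1) * x"

lemma powr_over_tendsto_0:
  fixes s :: real assumes "s > 1" shows "((\<lambda>h::real. \<bar>h\<bar> powr s / h) \<longlongrightarrow> 0) (at 0)"
proof (rule Lim_null_comparison)
  show "\<forall>\<^sub>F h in at 0. norm (\<bar>h\<bar> powr s / h) \<le> \<bar>h::real\<bar> powr (s - 1)"
  proof (rule eventually_at_filter[THEN iffD2], rule always_eventually, intro allI impI)
    fix h :: real assume "h \<noteq> 0"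
    then show "norm (\<bar>h\<bar> powr s / h) \<le> \<bar>h\<bar> powr (s - 1)" by (simp add: abs_mult powr_diff)
  qed
  have "((\<lambda>h::real. \<bar>h\<bar> powr (s - 1)) \<longlongrightarrow> \<bar>0\<bar> powr (s - 1)) (at 0)"
    using assms by (intro tendsto_powr' tendsto_intros) auto
  then show "((\<lambda>h::real. \<bar>h\<bar> powr (s - 1)) \<longlongrightarrow> 0) (at 0)" by simp
qed

lemma abs_powr_has_derivative:
  assumes p: "p > 0"
  shows "((\<lambda>x. \<bar>x\<bar> powr (p + 1)) has_real_derivative (p + 1) * spow p x) (at x)"
proof -
  consider "x > 0" | "x < 0" | "x = 0" by linarith
  then show ?thesis
  proof cases
    case 1
    have "((\<lambda>x. x powr (p + 1)) has_real_derivative (p + 1) * x powr (p + 1 - 1)) (at x)"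
      using has_real_derivative_powr[OF 1] .
    moreover have "x powr (p + 1 - 1) = spow p x"
      using 1 powr_add[of x "p-1" 1] by (simp add: spow_def)
    ultimately have "((\<lambda>x. x powr (p + 1)) has_real_derivative (p + 1) * spow p x) (at x)" by metis
    then show ?thesis
      by (rule has_field_derivative_transform_within_open[of _ _ _ "{0<..}"]) (use 1 in auto)
  next
    case 2
    have "((\<lambda>x. (- x) powr (p + 1)) has_real_derivative (p + 1) * (- x) powr (p + 1 - 1) * (- 1)) (at x)"
      by (rule DERIV_chain2[OF has_real_derivative_powr]) (use 2 in \<open>auto intro!: derivative_eq_intros\<close>)
    moreover have "(p + 1) * (- x) powr (p + 1 - 1) * (- 1) = (p + 1) * spow p x"
      using 2 powr_add[of "-x" "p-1" 1] by (simp add: spow_def)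
    ultimately have "((\<lambda>x. (- x) powr (p + 1)) has_real_derivative (p + 1) * spow p x) (at x)" by metis
    then show ?thesis
      by (rule has_field_derivative_transform_within_open[of _ _ _ "{..<0}"]) (use 2 in auto)
  next
    case 3
    then show ?thesis unfolding has_field_derivative_iff using p powr_over_tendsto_0[of "p + 1"]
      by (simp add: spow_def)
  qed
qed

lemma spow_has_derivative:
  assumes p: "p > 1"
  shows "(spow p has_real_derivative p * \<bar>x\<bar> powr (p - 1)) (at x)"
proof -
  consider "x > 0" | "x < 0" | "x = 0" by linarith
  then show ?thesis
  proof cases
    case 1
    have "((\<lambda>x. x powr p) has_real_derivative p * \<bar>x\<bar> powr (p - 1)) (at x)"
      using has_real_derivative_powr[OF 1, of p] 1 by simp
    then show ?thesis
    proof (rule has_field_derivative_transform_within_open[of _ _ _ "{0<..}"])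
      show "y powr p = spow p y" if "y \<in> {0<..}" for y
        using powr_add[of y "p-1" 1] that by (simp add: spow_def)
    qed (use 1 in auto)
  next
    case 2
    have "((\<lambda>x. - ((- x) powr p)) has_real_derivative - (p * (- x) powr (p - 1) * (- 1))) (at x)"
      by (intro DERIV_minus DERIV_chain2[OF has_real_derivative_powr]) (use 2 in \<open>auto intro!: derivative_eq_intros\<close>)
    then have "((\<lambda>x. - ((- x) powr p)) has_real_derivative p * \<bar>x\<bar> powr (p - 1)) (at x)" using 2 by simp
    then show ?thesis
    proof (rule has_field_derivative_transform_within_open[of _ _ _ "{..<0}"])
      show "- ((- y) powr p) = spow p y" if "y \<in> {..<0}" for y
        using powr_add[of "-y" "p-1" 1] that by (simp add: spow_def)
    qed (use 2 in auto)
  next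
    case 3
    have "((\<lambda>h::real. \<bar>h\<bar> powr (p - 1)) \<longlongrightarrow> \<bar>0\<bar> powr (p - 1)) (at 0)"
      using p by (intro tendsto_powr' tendsto_intros) auto
    then have l: "((\<lambda>h::real. \<bar>h\<bar> powr (p - 1)) \<longlongrightarrow> 0) (at 0)" by simp
    have "((\<lambda>h. spow p h / h) \<longlongrightarrow> 0) (at 0)"
      by (rule tendsto_cong[THEN iffD1, OF _ l]) (auto simp: spow_def eventually_at_filter)
    then show ?thesis unfolding has_field_derivative_iff using 3 by (simp add: spow_def)
  qed
qed

lemma spow_minus: "spow p (- x) = - spow p x" and spow_0 [simp]: "spow p 0 = 0"
  by (simp_all add: spow_def)

lemma spow_mult: "c \<ge> 0 \<Longrightarrow> spow p (c * x) = c powr p * spow p x"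
  using powr_add[of c "p-1" 1] by (cases "c = 0") (auto simp: spow_def abs_mult powr_mult)

lemma spow_pos_eq: "x \<ge> 0 \<Longrightarrow> spow p x = x powr p"
  using powr_add[of x "p-1" 1] by (cases "x = 0") (auto simp: spow_def)

lemma spow_mono:
  assumes p: "p > 1" and "x \<le> y" shows "spow p x \<le> spow p y"
proof (rule DERIV_nonneg_imp_nondecreasing[OF assms(2)])
  fix z show "\<exists>y. (spow p has_real_derivative y) (at z) \<and> 0 \<le> y"
    using spow_has_derivative[OF p, of z] p by (intro exI[of _ "p * \<bar>z\<bar> powr (p - 1)"]) auto
qed

lemma spow_continuous: "p > 1 \<Longrightarrow> continuous_on A (spow p)"
  by (meson DERIV_isCont continuous_at_imp_continuous_on spow_has_derivative)

lemma spow_lipschitz: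
  assumes p: "p > 1" and x: "\<bar>x\<bar> \<le> M" and y: "\<bar>y\<bar> \<le> M"
  shows "\<bar>spow p x - spow p y\<bar> \<le> p * M powr (p - 1) * \<bar>x - y\<bar>"
proof -
  have *: "\<bar>spow p x - spow p y\<bar> \<le> p * M powr (p - 1) * \<bar>x - y\<bar>"
    if xy: "x < y" "\<bar>x\<bar> \<le> M" "\<bar>y\<bar> \<le> M" for x y
  proof -
    obtain z where z: "x < z" "z < y" "spow p y - spow p x = (y - x) * (p * \<bar>z\<bar> powr (p - 1))"
      using MVT2[OF xy(1), of "spow p" "\<lambda>z. p * \<bar>z\<bar> powr (p - 1)"] spow_has_derivative[OF p] by blast
    have "\<bar>z\<bar> powr (p - 1) \<le> M powr (p - 1)" using z xy p by (intro powr_mono2) auto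
    then have "(y - x) * (p * \<bar>z\<bar> powr (p - 1)) \<le> (y - x) * (p * M powr (p - 1))"
      using xy p by (intro mult_left_mono) auto
    moreover have "spow p x \<le> spow p y" using spow_mono[OF p] xy by simp
    ultimately show ?thesis using z(3) xy by (simp add: field_simps)
  qed
  show ?thesis
    using *[of x y] *[of y x] x y by (cases x y rule: linorder_cases) (auto simp: abs_minus_commute)
qed

text \<open>Convexity of the power, by the mean value theorem and monotonicity of
  \<open>spow\<close>. As a one-sided bound it later replaces differentiation under the integral
  sign.\<close>

lemma abs_powr_tangent:
  assumes p: "p > 1"
  shows "\<bar>x\<bar> powr (p + 1) + (p + 1) * spow p x * h \<le> \<bar>x + h\<bar> powr (p + 1)"
proof -
  consider "h = 0" | "h > 0" | "h < 0" by linarith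
  then show ?thesis
  proof cases
    case 2
    obtain z where z: "x < z" "z < x + h" "\<bar>x + h\<bar> powr (p + 1) - \<bar>x\<bar> powr (p + 1) = (x + h - x) * ((p + 1) * spow p z)"
      using MVT2[of x "x + h" "\<lambda>x. \<bar>x\<bar> powr (p + 1)" "\<lambda>x. (p + 1) * spow p x"] abs_powr_has_derivative p 2 by auto
    have "(p + 1) * h * spow p x \<le> (p + 1) * h * spow p z"
      using spow_mono[OF p, of x z] z 2 p by (intro mult_left_mono) auto
    then show ?thesis using z(3) by (simp add: algebra_simps)
  next
    case 3
    obtain z where z: "x + h < z" "z < x" "\<bar>x\<bar> powr (p + 1) - \<bar>x + h\<bar> powr (p + 1) = (x - (x + h)) * ((p + 1) * spow p z)"
      using MVT2[of "x + h" x "\<lambda>x. \<bar>x\<bar> powr (p + 1)" "\<lambda>x. (p + 1) * spow p x"] abs_powr_has_derivative p 3 by auto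
    have "(p + 1) * (- h) * spow p z \<le> (p + 1) * (- h) * spow p x"
      using spow_mono[OF p, of z x] z 3 p by (intro mult_left_mono mult_nonneg_nonneg) auto
    then show ?thesis using z(3) by (simp add: algebra_simps)
  qed simp
qed

text \<open>The mean value theorem applied to \<open>?g\<close> on [0, 1]: its derivative compares
  \<open>spow\<close> at two points that differ by \<open>w\<close>, so the Lipschitz bound yields
  the product \<open>\<bar>w\<bar> * \<bar>v\<bar>\<close>. Both points are bounded by
  \<open>2 * M\<close>.\<close>

lemma abs_powr_splitting:
  fixes p w v M :: real
  assumes p: "p > 1" and w: "\<bar>w\<bar> \<le> M" and v: "\<bar>v\<bar> \<le> M"
  shows "\<bar>\<bar>w + v\<bar> powr (p + 1) - \<bar>w\<bar> powr (p + 1) - \<bar>v\<bar> powr (p + 1)\<bar>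
    \<le> (p + 1) * (p * (2 * M) powr (p - 1)) * (\<bar>w\<bar> * \<bar>v\<bar>)"
proof -
  let ?g = "\<lambda>s. \<bar>w + s * v\<bar> powr (p + 1) - \<bar>s * v\<bar> powr (p + 1)"
  have d: "(?g has_real_derivative (p + 1) * spow p (w + s * v) * v - (p + 1) * spow p (s * v) * v) (at s)" for s
    using p by (intro DERIV_diff DERIV_chain2[OF abs_powr_has_derivative]) (auto intro!: derivative_eq_intros)
  obtain z where z: "0 < z" "z < 1" and
    e: "?g 1 - ?g 0 = (1 - 0) * ((p + 1) * spow p (w + z * v) * v - (p + 1) * spow p (z * v) * v)"
    using MVT2[of 0 1 ?g, OF _ d] by auto
  have zv: "\<bar>z * v\<bar> \<le> M" using z v mult_mono[of z 1 "\<bar>v\<bar>" M] by (simp add: abs_mult)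
  have "\<bar>spow p (w + z * v) - spow p (z * v)\<bar> \<le> p * (2 * M) powr (p - 1) * \<bar>w + z * v - z * v\<bar>"
    by (rule spow_lipschitz[OF p]) (use zv w v in linarith)+
  then have "(p + 1) * \<bar>v\<bar> * \<bar>spow p (w + z * v) - spow p (z * v)\<bar> \<le> (p + 1) * \<bar>v\<bar> * (p * (2 * M) powr (p - 1) * \<bar>w\<bar>)"
    using p by (intro mult_left_mono) auto
  moreover have "\<bar>?g 1 - ?g 0\<bar> = (p + 1) * \<bar>v\<bar> * \<bar>spow p (w + z * v) - spow p (z * v)\<bar>"
  proof -
    have "?g 1 - ?g 0 = (p + 1) * v * (spow p (w + z * v) - spow p (z * v))"
      unfolding e by (simp add: algebra_simps)
    then show ?thesis using p by (simp add: abs_mult)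
  qed
  moreover have "?g 1 - ?g 0 = \<bar>w + v\<bar> powr (p + 1) - \<bar>w\<bar> powr (p + 1) - \<bar>v\<bar> powr (p + 1)" by simp
  ultimately show ?thesis by (simp only: mult.assoc mult.left_commute[of "\<bar>v\<bar>"] mult.commute[of "\<bar>w\<bar>"])
qed

section \<open>Existence of minimizers\<close>

definition pow_integral :: "real \<Rightarrow> (real \<Rightarrow> real) \<Rightarrow> real" where
  "pow_integral p v = (LINT t|lborel. \<bar>v t\<bar> powr (p + 1))"

context profile_space begin

lemma abs_powr_le_square:
  assumes v: "v \<in> H" and p: "p \<ge> 1" and M: "\<And>t. \<bar>v t\<bar> \<le> M"
  shows "\<bar>v t\<bar> powr (p + 1) \<le> M powr (p - 1) * (v t)\<^sup>2"
proof -
  have "\<bar>v t\<bar> powr (p + 1) = \<bar>v t\<bar> powr (p - 1) * (v t)\<^sup>2"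
    using powr_add[of "\<bar>v t\<bar>" "p - 1" 2] by (cases "v t = 0") (auto simp: add.commute)
  also have "\<dots> \<le> M powr (p - 1) * (v t)\<^sup>2"
    using M p by (intro mult_right_mono powr_mono2) auto
  finally show ?thesis .
qed

lemma borel: "v \<in> H \<Longrightarrow> v \<in> borel_measurable borel"
  using cont by (rule borel_measurable_continuous_onI)

text \<open>Interpolation between the sup norm and the square integral. The second part also says
  that a uniformly small function of bounded norm has a small power integral, which prevents
  normalized minimizing sequences from vanishing.\<close>

lemma pow_integralegrable:
  assumes v: "v \<in> H" and p: "p \<ge> 1"
  shows "integrable lborel (\<lambda>t. \<bar>v t\<bar> powr (p + 1))"
    "(\<And>t. \<bar>v t\<bar> \<le> M) \<Longrightarrow> pow_integral p v \<le> M powr (p - 1) * (Q v / B)"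
proof -
  note [measurable] = borel[OF v]
  have i: "integrable lborel (\<lambda>t. M powr (p - 1) * (v t)\<^sup>2)" for M
    using square_integrable(1)[OF v] by simp
  show i': "integrable lborel (\<lambda>t. \<bar>v t\<bar> powr (p + 1))"
    by (rule Bochner_Integration.integrable_bound[OF i[of "c0 * q v"]])
       (use abs_powr_le_square[OF v p evaluation[OF v]] in \<open>auto intro!: AE_I2\<close>)
  assume M: "\<And>t. \<bar>v t\<bar> \<le> M"
  have "pow_integral p v \<le> (LINT t|lborel. M powr (p - 1) * (v t)\<^sup>2)"
    unfolding pow_integral_def by (intro integral_mono i i' abs_powr_le_square[OF v p M])
  also have "\<dots> = M powr (p - 1) * (LINT t|lborel. (v t)\<^sup>2)" by simp
  also have "\<dots> \<le> M powr (p - 1) * (Q v / B)"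
    using square_integrable(2)[OF v] B by (intro mult_left_mono) (auto simp: field_simps)
  finally show "pow_integral p v \<le> M powr (p - 1) * (Q v / B)" .
qed

lemma pow_integral_nonneg: "pow_integral p v \<ge> 0"
  unfolding pow_integral_def by simp

lemma pow_integral_scale: "pow_integral p (\<lambda>t. c * v t) = \<bar>c\<bar> powr (p + 1) * pow_integral p v"
  unfolding pow_integral_def by (simp add: abs_mult powr_mult)

lemma pow_integral_shift: "pow_integral p (\<lambda>t. v (t + c)) = pow_integral p v"
  unfolding pow_integral_def
  using lborel_integral_real_affine[of 1 "\<lambda>t. \<bar>v t\<bar> powr (p + 1)" c] by (simp add: add.commute)

lemma pow_integral_pos:
  assumes v: "v \<in> H" and p: "p \<ge> 1" and "v t \<noteq> 0"
  shows "pow_integral p v > 0"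
proof (rule ccontr)
  assume "\<not> pow_integral p v > 0"
  then have "pow_integral p v = 0" using pow_integral_nonneg[of p v] by simp
  then have "AE t in lborel. \<bar>v t\<bar> powr (p + 1) = 0"
    unfolding pow_integral_def by (subst (asm) integral_nonneg_eq_0_iff_AE) (auto intro: pow_integralegrable[OF v p])
  then have "AE t in lborel. v t = 0" by eventually_elim simp
  then show False using continuous_eq_AE[OF cont[OF v] continuous_on_const] assms(3) by blast
qed

text \<open>The defect \<open>g k\<close> is bounded by a multiple of
  \<open>\<bar>w k\<bar> * \<bar>v\<bar>\<close>. After subtracting
  \<open>d * (w k)\<^sup>2\<close>, whose integral is uniformly small, the positive part of the rest
  is dominated by a fixed multiple of \<open>v\<^sup>2\<close>, and dominated convergence
  applies.\<close>

lemma brezis_lieb: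
  assumes v: "v \<in> H" and w: "\<And>k::nat. w k \<in> H" and K: "\<And>k. q (w k) \<le> K"
    and lim: "\<And>t. (\<lambda>k. w k t) \<longlonglongrightarrow> 0" and p: "p > 1"
  shows "(\<lambda>k. pow_integral p (\<lambda>t. w k t + v t) - pow_integral p (w k)) \<longlonglongrightarrow> pow_integral p v"
proof -
  have K0: "K \<ge> 0" using q_nonneg[OF w[of 0]] K[of 0] by linarith
  define M where "M = c0 * (K + q v)"
  have wM: "\<bar>w k t\<bar> \<le> M" for k t
  proof -
    have "c0 * q (w k) \<le> M" unfolding M_def using c0 K[of k] q_nonneg[OF v] by (intro mult_left_mono) auto
    then show ?thesis using evaluation[OF w[of k], of t] by linarith
  qed
  have vM: "\<bar>v t\<bar> \<le> M" for t
  proof -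
    have "c0 * q v \<le> M" unfolding M_def using c0 K0 by (intro mult_left_mono) auto
    then show ?thesis using evaluation[OF v, of t] by linarith
  qed
  define L where "L = (p + 1) * (p * (2 * M) powr (p - 1))"
  have L0: "L \<ge> 0" unfolding L_def using p by simp
  define g where "g k t = \<bar>w k t + v t\<bar> powr (p + 1) - \<bar>w k t\<bar> powr (p + 1) - \<bar>v t\<bar> powr (p + 1)" for k t
  have gb: "\<bar>g k t\<bar> \<le> L * (\<bar>w k t\<bar> * \<bar>v t\<bar>)" for k t
    unfolding g_def L_def by (rule abs_powr_splitting[OF p wM vM])
  have gi: "integrable lborel (g k)" for k
    unfolding g_def using p by (intro Bochner_Integration.integrable_diff pow_integralegrable add v w) auto
  have gI: "(LINT t|lborel. g k t) = pow_integral p (\<lambda>t. w k t + v t) - pow_integral p (w k) - pow_integral p v" for k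
    unfolding g_def pow_integral_def using p
    by (subst Bochner_Integration.integral_diff; (subst Bochner_Integration.integral_diff)?)
       (auto intro!: Bochner_Integration.integrable_diff pow_integralegrable add v w)
  have [measurable]: "v \<in> borel_measurable borel" "w k \<in> borel_measurable borel" for k by (intro borel v w)+
  have "(\<lambda>k. LINT t|lborel. g k t) \<longlonglongrightarrow> 0"
  proof (rule LIMSEQ_I)
    fix e :: real assume e: "e > 0"
    \<comment> \<open>Since the integral of the square of \<open>w k\<close> is at most
      \<open>K\<^sup>2 / B\<close>, the subtracted term contributes at most e/2.\<close>
    define d where "d = e / (2 * (K\<^sup>2 / B + 1))"
    have d: "d > 0" unfolding d_def using e B by (intro divide_pos_pos mult_pos_pos add_nonneg_pos) auto
    define h where "h k t = max 0 (\<bar>g k t\<bar> - d * (w k t)\<^sup>2)" for k t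
    have hb: "\<bar>h k t\<bar> \<le> L\<^sup>2 / (4 * d) * (v t)\<^sup>2" for k t
    proof -
      \<comment> \<open>The completed square behind the Young inequality with weight
        \<open>d\<close>.\<close>
      have "0 \<le> (d * \<bar>w k t\<bar> - L / 2 * \<bar>v t\<bar>)\<^sup>2 / d" using d by simp
      then have "L * (\<bar>w k t\<bar> * \<bar>v t\<bar>) \<le> d * (w k t)\<^sup>2 + L\<^sup>2 / (4 * d) * (v t)\<^sup>2"
        using d by (simp add: field_simps power2_eq_square)
      then show ?thesis unfolding h_def using gb[of k t] d by (auto simp: max_def)
    qed
    have hi: "integrable lborel (h k)" for k
    proof (rule Bochner_Integration.integrable_bound[of _ "\<lambda>t. L\<^sup>2 / (4 * d) * (v t)\<^sup>2"])
      show "h k \<in> borel_measurable lborel" unfolding h_def g_def by measurable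
      show "AE t in lborel. norm (h k t) \<le> norm (L\<^sup>2 / (4 * d) * (v t)\<^sup>2)"
        using hb[of k] by (intro AE_I2) (metis abs_ge_self order_trans real_norm_def)
    qed (use square_integrable(1)[OF v] in auto)
    have "(\<lambda>k. LINT t|lborel. h k t) \<longlonglongrightarrow> integral\<^sup>L lborel (\<lambda>t::real. 0::real)"
    proof (rule integral_dominated_convergence[where w="\<lambda>t. L\<^sup>2 / (4 * d) * (v t)\<^sup>2"])
      show "AE t in lborel. (\<lambda>k. h k t) \<longlonglongrightarrow> 0"
      proof (rule AE_I2, rule Lim_null_comparison)
        fix t
        show "\<forall>\<^sub>F k in sequentially. norm (h k t) \<le> L * (\<bar>w k t\<bar> * \<bar>v t\<bar>)"
          using gb[of _ t] d L0 by (intro always_eventually allI) (auto simp: h_def max_def intro: order_trans[OF _ gb])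
        have "(\<lambda>k. L * (\<bar>w k t\<bar> * \<bar>v t\<bar>)) \<longlonglongrightarrow> L * (\<bar>0\<bar> * \<bar>v t\<bar>)" by (intro tendsto_intros lim)
        then show "(\<lambda>k. L * (\<bar>w k t\<bar> * \<bar>v t\<bar>)) \<longlonglongrightarrow> 0" by simp
      qed
    qed (use hb square_integrable(1)[OF v] in \<open>auto simp: h_def g_def\<close>)
    then have "(\<lambda>k. LINT t|lborel. h k t) \<longlonglongrightarrow> 0" by simp
    then obtain N where N: "\<And>k. k \<ge> N \<Longrightarrow> \<bar>LINT t|lborel. h k t\<bar> < e / 2"
      using LIMSEQ_D[of "\<lambda>k. LINT t|lborel. h k t" 0 "e/2"] e by auto
    have "\<bar>LINT t|lborel. g k t\<bar> < e" if "k \<ge> N" for k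
    proof -
      have "\<bar>LINT t|lborel. g k t\<bar> \<le> (LINT t|lborel. \<bar>g k t\<bar>)" by (rule integral_abs_bound)
      also have "\<dots> \<le> (LINT t|lborel. h k t + d * (w k t)\<^sup>2)"
        using gi hi square_integrable(1)[OF w] by (intro integral_mono) (auto simp: h_def)
      also have "\<dots> = (LINT t|lborel. h k t) + d * (LINT t|lborel. (w k t)\<^sup>2)"
        using hi square_integrable(1)[OF w] by simp
      also have "d * (LINT t|lborel. (w k t)\<^sup>2) \<le> d * (K\<^sup>2 / B)"
      proof -
        have "Q (w k) \<le> K\<^sup>2" using K q_nonneg w by (intro power_mono) auto
        then have "B * (LINT t|lborel. (w k t)\<^sup>2) \<le> K\<^sup>2" using square_integrable(2)[OF w[of k]] by linarith
        then show ?thesis using d B by (intro mult_left_mono) (auto simp: field_simps)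
      qed
      also have "d * (K\<^sup>2 / B) \<le> e / 2"
      proof -
        have "e / (2 * (X + 1)) * X \<le> e / 2" if "X \<ge> 0" for X :: real using that e by (simp add: field_simps)
        moreover have "K\<^sup>2 / B \<ge> 0" using B by simp
        ultimately show ?thesis unfolding d_def by blast
      qed
      finally show ?thesis using N[OF that] by linarith
    qed
    then show "\<exists>no. \<forall>k\<ge>no. norm ((LINT t|lborel. g k t) - 0) < e" by auto
  qed
  then have "(\<lambda>k. (LINT t|lborel. g k t) + pow_integral p v) \<longlonglongrightarrow> 0 + pow_integral p v"
    by (intro tendsto_intros)
  then show ?thesis unfolding gI by simp
qed

definition best :: "real \<Rightarrow> real" where
  "best p = Inf ((\<lambda>v. Q v / pow_integral p v powr (2 / (p + 1))) ` {v \<in> H. \<exists>t. v t \<noteq> 0})"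

lemma nonzero_exists: "\<exists>v\<in>H. v 0 \<noteq> 0"
proof -
  have "test_fun plateau" using test_fun_plateau[of 1 0] by simp
  then show ?thesis using plateau_eq_1[of 0] by (intro bexI[OF _ test]) auto
qed

lemma best_le:
  assumes v: "v \<in> H" and p: "p > 1"
  shows "best p * pow_integral p v powr (2 / (p + 1)) \<le> Q v"
proof (cases "\<exists>t. v t \<noteq> 0")
  case True
  then have pos: "pow_integral p v > 0" using pow_integral_pos[OF v] p by auto
  have "best p \<le> Q v / pow_integral p v powr (2 / (p + 1))"
    unfolding best_def using v True by (intro cInf_lower bdd_belowI[of _ 0]) auto
  then show ?thesis using pos by (simp add: field_simps)
next
  case False
  then show ?thesis by (simp add: pow_integral_def)
qed

lemma best_approx:
  assumes p: "p > 1" and e: "e > 0"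
  obtains v where "v \<in> H" "pow_integral p v = 1" "Q v < best p + e"
proof -
  have "\<exists>x\<in>(\<lambda>v. Q v / pow_integral p v powr (2 / (p + 1))) ` {v \<in> H. \<exists>t. v t \<noteq> 0}. x < best p + e"
    using nonzero_exists e by (intro cInf_lessD) (auto simp: best_def)
  then obtain u t where u: "u \<in> H" "u t \<noteq> 0" "Q u / pow_integral p u powr (2 / (p + 1)) < best p + e" by blast
  have pos: "pow_integral p u > 0" using pow_integral_pos[OF u(1) _ u(2), of p] p by simp
  define c where "c = pow_integral p u powr (- 1 / (p + 1))"
  have c: "c > 0" using pos by (simp add: c_def)
  show thesis
  proof (rule that[of "\<lambda>t. c * u t"])
    show "(\<lambda>t. c * u t) \<in> H" by (rule scale[OF u(1)])
    show "pow_integral p (\<lambda>t. c * u t) = 1"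
    proof -
      have "c powr (p + 1) = pow_integral p u powr (- 1 / (p + 1) * (p + 1))" unfolding c_def by (rule powr_powr)
      also have "\<dots> = inverse (pow_integral p u)" using p pos by (simp add: powr_minus)
      finally show ?thesis unfolding pow_integral_scale using c pos by simp
    qed
    have "c\<^sup>2 = pow_integral p u powr (- (2 / (p + 1)))"
      using pos by (simp add: c_def power2_eq_square flip: powr_add)
    then show "Q (\<lambda>t. c * u t) < best p + e"
      using u(3) by (simp add: q_scale[OF u(1)] power_mult_distrib powr_minus field_simps)
  qed
qed

lemma best_nonneg: "best p \<ge> 0"
  unfolding best_def using nonzero_exists by (intro cInf_greatest) auto

theorem minimizer_exists:
  assumes p: "p > 1"
  obtains y where "y \<in> H" "pow_integral p y = 1" "Q y = best p" "best p > 0"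
proof -
  define S where "S = best p"
  have S0: "S \<ge> 0" unfolding S_def by (rule best_nonneg)
  \<comment> \<open>If \<open>\<bar>u\<bar> \<le> d\<close> everywhere and
    \<open>Q u \<le> S + 1\<close>, the power integral is at most
    \<open>d powr (p - 1) * ((S + 1) / B) = 1 / 2\<close>. A normalized almost-minimizer therefore
    exceeds \<open>d\<close> somewhere and can be translated so that this happens at 0.\<close>
  define d where "d = (B / (2 * (S + 1))) powr (1 / (p - 1))"
  have d: "d > 0" unfolding d_def using B S0 by auto
  have dp: "d powr (p - 1) * ((S + 1) / B) = 1 / 2"
  proof -
    have "d powr (p - 1) = B / (2 * (S + 1))" unfolding d_def using p B S0 by (simp add: powr_powr)
    then show ?thesis using B S0 by (simp add: field_simps)
  qed
  have "\<exists>v. v \<in> H \<and> pow_integral p v = 1 \<and> Q v < S + 1 / Suc k \<and> \<bar>v 0\<bar> \<ge> d" for k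
  proof -
    obtain u where u: "u \<in> H" "pow_integral p u = 1" "Q u < S + 1 / Suc k"
      using best_approx[OF p, of "1 / Suc k"] unfolding S_def by auto
    have "\<exists>t. \<bar>u t\<bar> \<ge> d"
    proof (rule ccontr)
      assume "\<not> (\<exists>t. \<bar>u t\<bar> \<ge> d)"
      then have "\<And>t. \<bar>u t\<bar> \<le> d" by (auto simp: not_le intro: less_imp_le)
      then have "1 \<le> d powr (p - 1) * (Q u / B)" using pow_integralegrable(2)[OF u(1), of p d] p u(2) by simp
      also have "Q u \<le> S + 1" using u(3) by (rule order_trans[OF less_imp_le]) auto
      finally have "1 \<le> d powr (p - 1) * ((S + 1) / B)" using B d by (simp add: divide_right_mono mult_left_mono)
      then show False unfolding dp by simp
    qed
    then obtain t where "\<bar>u t\<bar> \<ge> d" by blast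
    then show ?thesis using shift[OF u(1), of t] pow_integral_shift[of p u t] u by (intro exI[of _ "\<lambda>s. u (s + t)"]) simp
  qed
  then obtain v where v: "\<And>k. v k \<in> H" "\<And>k. pow_integral p (v k) = 1" "\<And>k. Q (v k) < S + 1 / Suc k" "\<And>k. \<bar>v k 0\<bar> \<ge> d"
    by metis
  have vK: "q (v k) \<le> sqrt (S + 1)" for k
  proof (rule real_le_rsqrt)
    have "1 / Suc k \<le> (1::real)" by simp
    then show "Q (v k) \<le> S + 1" using v(3)[of k] by linarith
  qed
  obtain r y where r: "strict_mono r" and y: "y \<in> H" and pw: "\<And>t. (\<lambda>k. v (r k) t) \<longlonglongrightarrow> y t"
    and wk: "(\<lambda>k. ip (v (r k)) y) \<longlonglongrightarrow> Q y"
    using weak_compactness[of v "sqrt (S + 1)", OF v(1) vK] by blast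
  define w where "w k = v (r k)" for k
  have w: "w k \<in> H" "pow_integral p (w k) = 1" "\<bar>w k 0\<bar> \<ge> d" for k using v by (auto simp: w_def)
  have "(\<lambda>k. S + 1 / Suc k) \<longlonglongrightarrow> S + 0" by (intro tendsto_intros LIMSEQ_Suc[OF lim_1_over_n])
  then have "(\<lambda>k. S + 1 / Suc (r k)) \<longlonglongrightarrow> S" using LIMSEQ_subseq_LIMSEQ[OF _ r] by (simp add: o_def)
  moreover have "S \<le> Q (w k)" for k using best_le[OF w(1) p, of k] w(2) by (simp add: S_def)
  ultimately have QS: "(\<lambda>k. Q (w k)) \<longlonglongrightarrow> S"
    using less_imp_le[OF v(3)[of "r _"]]
    by (intro tendsto_sandwich[of "\<lambda>_. S" "\<lambda>k. Q (w k)" _ "\<lambda>k. S + 1 / Suc (r k)"] always_eventually allI tendsto_const)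
      (simp_all add: w_def)
  have y0: "\<bar>y 0\<bar> \<ge> d"
    by (rule LIMSEQ_le_const[OF tendsto_rabs[OF pw]]) (use v(4) in auto)
  then have ynz: "y 0 \<noteq> 0" using d by auto
  \<comment> \<open>The lower bound at 0 keeps the norms away from 0, and thus gives
    \<open>S > 0\<close>.\<close>
  have "q (w k) \<ge> d / c0" for k
    using evaluation[OF w(1)[of k], of 0] w(3)[of k] c0 by (simp add: field_simps)
  then have "Q (w k) \<ge> (d / c0)\<^sup>2" for k using d c0 by (intro power_mono) auto
  then have "S \<ge> (d / c0)\<^sup>2" by (intro LIMSEQ_le_const[OF QS]) auto
  then have S: "S > 0" using d c0 by (meson divide_pos_pos less_le_trans zero_less_power)
  have Qd: "Q (\<lambda>t. w k t - y t) = Q (w k) - 2 * ip (w k) y + Q y" for k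
    using Q_lincomb[OF w(1)[of k] y, of 1 "-1"] by simp
  have Qlim: "(\<lambda>k. Q (\<lambda>t. w k t - y t)) \<longlonglongrightarrow> S - 2 * Q y + Q y"
    unfolding Qd using wk by (intro tendsto_intros QS) (simp add: w_def)
  have "(\<lambda>k. pow_integral p (\<lambda>t. (w k t - y t) + y t) - pow_integral p (\<lambda>t. w k t - y t)) \<longlonglongrightarrow> pow_integral p y"
  proof (rule brezis_lieb[OF y, where K="sqrt (S + 1) + q y"])
    show "(\<lambda>t. w k t - y t) \<in> H" for k by (intro diff w y)
    show "q (\<lambda>t. w k t - y t) \<le> sqrt (S + 1) + q y" for k
      using q_triangle[OF w(1)[of k] scale[OF y, of "-1"]] vK[of "r k"] q_scale[OF y, of "-1"] by (simp add: w_def)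
    show "(\<lambda>k. w k t - y t) \<longlonglongrightarrow> 0" for t using pw[of t] by (simp add: w_def LIM_zero)
  qed (rule p)
  then have "(\<lambda>k. 1 - pow_integral p (\<lambda>t. w k t - y t)) \<longlonglongrightarrow> pow_integral p y" by (simp add: w)
  then have "(\<lambda>k. 1 - (1 - pow_integral p (\<lambda>t. w k t - y t))) \<longlonglongrightarrow> 1 - pow_integral p y" by (intro tendsto_intros)
  then have Ilim: "(\<lambda>k. pow_integral p (\<lambda>t. w k t - y t)) \<longlonglongrightarrow> 1 - pow_integral p y" by simp
  define I where "I = pow_integral p y"
  have I0: "I > 0" using pow_integral_pos[OF y _ ynz, of p] p by (simp add: I_def)
  have I1: "I \<le> 1"
    using LIMSEQ_le_const[OF Ilim, of 0] pow_integral_nonneg by (auto simp: I_def)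
  define s where "s = 2 / (p + 1)"
  have s: "0 < s" "s < 1" unfolding s_def using p by auto
  have a: "S * I powr s \<le> Q y" using best_le[OF y p] by (simp add: S_def I_def s_def)
  have "(\<lambda>k. S * pow_integral p (\<lambda>t. w k t - y t) powr s) \<longlonglongrightarrow> S * (1 - I) powr s"
    unfolding I_def using s pow_integral_nonneg
    by (intro tendsto_intros tendsto_powr'[OF Ilim]) auto
  from LIMSEQ_le[OF this Qlim] have b: "S * (1 - I) powr s \<le> S - Q y"
    using best_le[OF diff[OF w(1) y] p] by (auto simp: S_def s_def)
  \<comment> \<open>The weak limit carries the mass \<open>I\<close>, and \<open>1 - I\<close>
    escapes. Each part costs at least \<open>S\<close> times its mass to the power s < 1, and by the
    splitting of \<open>Q\<close> the costs sum to at most \<open>S\<close>; for 0 < I < 1 strict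
    subadditivity forbids this.\<close>
  from a b have "S * (I powr s + (1 - I) powr s) \<le> S * 1" by (simp add: algebra_simps)
  then have c: "I powr s + (1 - I) powr s \<le> 1" using S by simp
  have "I = 1"
  proof (rule ccontr)
    assume "I \<noteq> 1"
    then have "I < 1" using I1 by simp
    then have "I powr s > I powr 1" "(1 - I) powr s > (1 - I) powr 1"
      using s I0 by (intro powr_less_mono'; simp)+
    then show False using c I0 \<open>I < 1\<close> by simp
  qed
  then show thesis using that[OF y] a b S s by (simp add: I_def S_def)
qed

text \<open>The tangent inequality bounds the power integral of \<open>y + e w\<close> below by an
  affine function of \<open>e\<close>. Hence the explicit function \<open>G\<close> has a local
  minimum at 0, and its derivative there is the weak equation.\<close>

theorem euler_lagrange:
  assumes y: "y \<in> H" "pow_integral p y = 1" "Q y = best p" and w: "w \<in> H" and p: "p > 1"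
  shows "integrable lborel (\<lambda>t. spow p (y t) * w t)"
    "ip y w = best p * (LINT t|lborel. spow p (y t) * w t)"
proof -
  define S where "S = best p"
  have S0: "S \<ge> 0" unfolding S_def by (rule best_nonneg)
  define M where "M = c0 * q y"
  have [measurable]: "y \<in> borel_measurable borel" "w \<in> borel_measurable borel" by (intro borel y w)+
  have [measurable]: "spow p \<in> borel_measurable borel"
    using spow_continuous[OF p] by (rule borel_measurable_continuous_onI)
  show i: "integrable lborel (\<lambda>t. spow p (y t) * w t)"
  proof (rule Bochner_Integration.integrable_bound[of _ "\<lambda>t. M powr (p - 1) * ((y t)\<^sup>2 + (w t)\<^sup>2)"])
    show "integrable lborel (\<lambda>t. M powr (p - 1) * ((y t)\<^sup>2 + (w t)\<^sup>2))"
      using square_integrable(1)[OF y(1)] square_integrable(1)[OF w] by simp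
    show "AE t in lborel. norm (spow p (y t) * w t) \<le> norm (M powr (p - 1) * ((y t)\<^sup>2 + (w t)\<^sup>2))"
    proof (rule AE_I2)
      fix t
      have "\<bar>y t\<bar> * \<bar>w t\<bar> \<le> (y t)\<^sup>2 + (w t)\<^sup>2"
        using sum_squares_bound[of "\<bar>y t\<bar>" "\<bar>w t\<bar>"] mult_nonneg_nonneg[of "\<bar>y t\<bar>" "\<bar>w t\<bar>"]
        unfolding power2_abs mult.assoc by linarith
      moreover have "\<bar>y t\<bar> powr (p - 1) \<le> M powr (p - 1)"
        using evaluation[OF y(1)] p unfolding M_def by (intro powr_mono2) auto
      ultimately have "\<bar>y t\<bar> powr (p - 1) * (\<bar>y t\<bar> * \<bar>w t\<bar>) \<le> M powr (p - 1) * ((y t)\<^sup>2 + (w t)\<^sup>2)"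
        by (intro mult_mono) auto
      then show "norm (spow p (y t) * w t) \<le> norm (M powr (p - 1) * ((y t)\<^sup>2 + (w t)\<^sup>2))"
        by (simp add: spow_def abs_mult mult.assoc)
    qed
  qed measurable
  define J where "J = (LINT t|lborel. spow p (y t) * w t)"
  have low: "pow_integral p (\<lambda>t. y t + e * w t) \<ge> 1 + e * ((p + 1) * J)" for e
  proof -
    have "(LINT t|lborel. \<bar>y t\<bar> powr (p + 1) + (p + 1) * e * (spow p (y t) * w t)) \<le> pow_integral p (\<lambda>t. y t + e * w t)"
      unfolding pow_integral_def
    proof (rule integral_mono)
      show "integrable lborel (\<lambda>t. \<bar>y t\<bar> powr (p + 1) + (p + 1) * e * (spow p (y t) * w t))"
        using i pow_integralegrable(1)[OF y(1), of p] p by simp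
      show "integrable lborel (\<lambda>t. \<bar>y t + e * w t\<bar> powr (p + 1))"
        using p by (intro pow_integralegrable add scale y w) auto
      show "\<bar>y t\<bar> powr (p + 1) + (p + 1) * e * (spow p (y t) * w t) \<le> \<bar>y t + e * w t\<bar> powr (p + 1)" for t
        using abs_powr_tangent[OF p, of "y t" "e * w t"] by (simp add: ac_simps)
    qed
    also have "(LINT t|lborel. \<bar>y t\<bar> powr (p + 1) + (p + 1) * e * (spow p (y t) * w t)) = 1 + (p + 1) * e * J"
      using i pow_integralegrable(1)[OF y(1), of p] p y(2) unfolding J_def pow_integral_def by simp
    finally show ?thesis by (simp add: ac_simps)
  qed
  define G where "G e = S + 2 * e * ip y w + e\<^sup>2 * Q w - S * (1 + e * ((p + 1) * J)) powr (2 / (p + 1))" for e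
  have dG: "(G has_real_derivative 2 * ip y w - S * (2 / (p + 1) * 1 powr (2 / (p + 1) - 1) * ((p + 1) * J))) (at 0)"
    unfolding G_def by (auto intro!: derivative_eq_intros)
  \<comment> \<open>For \<open>\<bar>e\<bar> < \<delta>\<close> the affine lower bound stays
    positive, so that raising it to a positive power preserves the inequality.\<close>
  define \<delta> where "\<delta> = 1 / (\<bar>(p + 1) * J\<bar> + 1)"
  have \<delta>: "\<delta> > 0" unfolding \<delta>_def by (intro divide_pos_pos) auto
  have G0: "G 0 \<le> G e" if "\<bar>0 - e\<bar> < \<delta>" for e
  proof -
    have "\<bar>e\<bar> * (\<bar>(p + 1) * J\<bar> + 1) < 1" using that unfolding \<delta>_def by (simp add: pos_less_divide_eq add_nonneg_pos)
    moreover have "\<bar>e * ((p + 1) * J)\<bar> \<le> \<bar>e\<bar> * (\<bar>(p + 1) * J\<bar> + 1)"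
      unfolding abs_mult[of e] by (intro mult_left_mono) auto
    ultimately have "\<bar>e * ((p + 1) * J)\<bar> < 1" by linarith
    then have pos: "1 + e * ((p + 1) * J) > 0" by linarith
    have "S * (1 + e * ((p + 1) * J)) powr (2 / (p + 1)) \<le> S * pow_integral p (\<lambda>t. y t + e * w t) powr (2 / (p + 1))"
      using low[of e] pos p S0 by (intro mult_left_mono powr_mono2) auto
    also have "\<dots> \<le> Q (\<lambda>t. y t + e * w t)"
      unfolding S_def by (intro best_le add scale y w p)
    also have "\<dots> = S + 2 * e * ip y w + e\<^sup>2 * Q w"
      using Q_lincomb[OF y(1) w, of 1 e] y(3) by (simp add: S_def)
    finally show ?thesis unfolding G_def by simp
  qed
  have "2 * ip y w - S * (2 / (p + 1) * 1 powr (2 / (p + 1) - 1) * ((p + 1) * J)) = 0"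
    by (rule DERIV_local_min[OF dG \<delta>]) (use G0 in auto)
  then show "ip y w = best p * (LINT t|lborel. spow p (y t) * w t)"
    using p by (simp add: S_def J_def)
qed

end

section \<open>Resolvents of second order operators\<close>

lemma continuous_antiderivative:
  fixes g :: "real \<Rightarrow> real"
  assumes g: "continuous_on UNIV g"
  obtains G where "\<And>t. (G has_real_derivative g t) (at t)"
proof
  fix t :: real
  let ?a = "- \<bar>t\<bar> - 1" and ?b = "\<bar>t\<bar> + 1"
  have "((\<lambda>u. LBINT y=0..u. g y) has_vector_derivative g t) (at t within {?a..?b})"
    using interval_integral_FTC2[of ?a 0 ?b g t] continuous_on_subset[OF g] by (simp add: zero_ereal_def)
  moreover have "at t within {?a..?b} = at t" by (rule at_within_Icc_at) auto
  ultimately show "((\<lambda>u. LBINT y=0..u. g y) has_real_derivative g t) (at t)"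
    by (simp add: has_real_derivative_iff_has_vector_derivative)
qed

text \<open>The bounded solution is \<open>exp (- a t)\<close> times the integral of
  \<open>exp (a s) * f s\<close> from minus infinity. No improper integral is formed: the limit
  \<open>L\<close> of the antiderivative \<open>G\<close> at minus infinity is obtained from an
  increasing upper barrier \<open>?h\<close> and a decreasing lower barrier \<open>?k\<close>, and
  the barriers also give the bound M / a.\<close>

lemma bounded_first_order_solution:
  fixes f :: "real \<Rightarrow> real"
  assumes f: "continuous_on UNIV f" and M: "\<And>t. \<bar>f t\<bar> \<le> M" and a: "a > 0"
  obtains P where "\<And>t. (P has_real_derivative f t - a * P t) (at t)" "\<And>t. \<bar>P t\<bar> \<le> M / a"
proof -
  obtain G where G: "\<And>t. (G has_real_derivative exp (a * t) * f t) (at t)"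
  proof -
    have "continuous_on UNIV (\<lambda>t. exp (a * t) * f t)" by (intro continuous_intros f)
    from continuous_antiderivative[OF this] show ?thesis using that by blast
  qed
  let ?h = "\<lambda>t. G t + M / a * exp (a * t)" and ?k = "\<lambda>t. G t - M / a * exp (a * t)"
  have "M \<ge> 0" using M[of 0] by linarith
  have dh: "(?h has_real_derivative exp (a * t) * (f t + M)) (at t)" for t
    using a by (auto intro!: derivative_eq_intros G simp: algebra_simps)
  have dk: "(?k has_real_derivative exp (a * t) * (f t - M)) (at t)" for t
    using a by (auto intro!: derivative_eq_intros G simp: algebra_simps)
  have hm: "?h s \<le> ?h t" if "s \<le> t" for s t
  proof (rule DERIV_nonneg_imp_nondecreasing[OF that])
    fix x show "\<exists>y. (?h has_real_derivative y) (at x) \<and> 0 \<le> y"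
      using dh[of x] M[of x] by (intro exI[of _ "exp (a * x) * (f x + M)"]) (auto simp: abs_le_iff)
  qed
  have km: "?k t \<le> ?k s" if "s \<le> t" for s t
  proof (rule DERIV_nonpos_imp_nonincreasing[OF that])
    fix x show "\<exists>y. (?k has_real_derivative y) (at x) \<and> y \<le> 0"
      using dk[of x] M[of x] by (intro exI[of _ "exp (a * x) * (f x - M)"]) (auto simp: abs_le_iff mult_le_0_iff)
  qed
  have kh: "?k t \<le> ?h t" for t using a \<open>M \<ge> 0\<close> by simp
  have kh': "?k t \<le> ?h s" for s t
  proof (cases "s \<le> t")
    case True
    then show ?thesis using km[OF True] kh[of s] by linarith
  next
    case False
    then show ?thesis using hm[of t s] kh[of t] by linarith
  qed
  \<comment> \<open>Every \<open>?k t\<close> is below every \<open>?h s\<close>, so the infimum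
    lies between the two barriers at each time.\<close>
  define L where "L = (INF t. ?h t)"
  have Lh: "L \<le> ?h t" for t
    unfolding L_def by (rule cINF_lower) (use kh'[of 0] in \<open>auto intro!: bdd_belowI[of _ "?k 0"]\<close>)
  have Lk: "?k t \<le> L" for t unfolding L_def by (rule cINF_greatest) (use kh' in auto)
  show thesis
  proof
    show "((\<lambda>t. exp (- a * t) * (G t - L)) has_real_derivative f t - a * (exp (- a * t) * (G t - L))) (at t)" for t
    proof -
      have e: "exp (a * t) * exp (- (a * t)) = 1" by (simp flip: exp_add)
      show ?thesis
        by (auto intro!: derivative_eq_intros G simp: algebra_simps e)
    qed
    fix t
    have "\<bar>G t - L\<bar> \<le> M / a * exp (a * t)" using Lh[of t] Lk[of t] by (simp add: abs_le_iff algebra_simps)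
    then have "\<bar>exp (- a * t) * (G t - L)\<bar> \<le> exp (- a * t) * (M / a * exp (a * t))"
      unfolding abs_mult abs_exp_cancel by (intro mult_left_mono) auto
    also have "\<dots> = M / a * (exp (- a * t) * exp (a * t))" by simp
    also have "exp (- a * t) * exp (a * t) = 1" by (simp flip: exp_add)
    finally show "\<bar>exp (- a * t) * (G t - L)\<bar> \<le> M / a" by simp
  qed
qed

text \<open>Integrating factor \<open>exp (a x)\<close> applied to
  \<open>\<sigma> P - e / a\<close>, with the sign \<sigma> treating the two one-sided bounds
  together.\<close>

lemma first_order_comparison:
  fixes P f :: "real \<Rightarrow> real"
  assumes P: "\<And>t. (P has_real_derivative f t - a * P t) (at t)" and K: "\<bar>P s\<bar> \<le> K" and a: "a > 0"
    and st: "s \<le> t" and e: "\<And>x. s \<le> x \<Longrightarrow> x \<le> t \<Longrightarrow> \<bar>f x\<bar> \<le> e"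
  shows "\<bar>P t\<bar> \<le> e / a + exp (- a * (t - s)) * K"
proof -
  have e0: "e \<ge> 0" using e[of s] st by simp
  have *: "\<sigma> * P t \<le> e / a + exp (- a * (t - s)) * K" if \<sigma>: "\<sigma> = 1 \<or> \<sigma> = -1" for \<sigma> :: real
  proof -
    let ?F = "\<lambda>x. exp (a * x) * (\<sigma> * P x - e / a)"
    have "?F t \<le> ?F s"
    proof (rule DERIV_nonpos_imp_nonincreasing[OF st])
      fix x assume x: "s \<le> x" "x \<le> t"
      have "(?F has_real_derivative exp (a * x) * (\<sigma> * f x - e)) (at x)"
        using a by (auto intro!: derivative_eq_intros P simp: algebra_simps)
      moreover have "\<sigma> * f x \<le> e" using e[OF x] \<sigma> by auto
      ultimately show "\<exists>y. (?F has_real_derivative y) (at x) \<and> y \<le> 0"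
        by (intro exI[of _ "exp (a * x) * (\<sigma> * f x - e)"]) (auto simp: mult_le_0_iff)
    qed
    also have "?F s \<le> exp (a * s) * K"
    proof -
      have "\<sigma> * P s \<le> K" using K \<sigma> by auto
      moreover have "e / a \<ge> 0" using e0 a by simp
      ultimately show ?thesis by (intro mult_left_mono) auto
    qed
    finally have "exp (- a * t) * ?F t \<le> exp (- a * t) * (exp (a * s) * K)" by (intro mult_left_mono) auto
    moreover have "exp (- a * t) * ?F t = \<sigma> * P t - e / a"
    proof -
      have "exp (- a * t) * exp (a * t) = 1" by (simp flip: exp_add)
      then show ?thesis by (metis mult.assoc mult_1)
    qed
    moreover have "exp (- a * t) * (exp (a * s) * K) = exp (- a * (t - s)) * K"
      by (simp add: algebra_simps flip: exp_add mult.assoc)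
    ultimately show ?thesis by linarith
  qed
  show ?thesis using *[of 1] *[of "-1"] by (simp add: abs_le_iff)
qed

lemma first_order_vanishing:
  fixes P f :: "real \<Rightarrow> real"
  assumes P: "\<And>t. (P has_real_derivative f t - a * P t) (at t)" and K: "\<And>s. \<bar>P s\<bar> \<le> K" and a: "a > 0"
    and f: "(f \<longlongrightarrow> 0) at_infinity"
  shows "(P \<longlongrightarrow> 0) at_infinity"
proof (rule tendstoI)
  fix \<epsilon> :: real assume \<epsilon>: "\<epsilon> > 0"
  have K0: "K \<ge> 0" using K[of 0] by linarith
  define e where "e = a * \<epsilon> / 3"
  have e: "e > 0" "e / a = \<epsilon> / 3" using a \<epsilon> by (auto simp: e_def)
  have "eventually (\<lambda>x. dist (f x) 0 < e) at_infinity" using f e(1) tendstoD by blast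
  then obtain R where R: "\<And>x. \<bar>x\<bar> \<ge> R \<Longrightarrow> \<bar>f x\<bar> < e" by (auto simp: eventually_at_infinity)
  have "((\<lambda>x. exp (- a * x) * K) \<longlongrightarrow> 0) at_top"
    using a by (intro tendsto_mult_left_zero) real_asymp
  then have "eventually (\<lambda>x. exp (- a * x) * K < \<epsilon> / 3) at_top" using \<epsilon> by (intro order_tendstoD) auto
  then obtain T where T: "\<And>x. x \<ge> T \<Longrightarrow> exp (- a * x) * K < \<epsilon> / 3" by (auto simp: eventually_at_top_linorder)
  have "\<bar>P t\<bar> < \<epsilon>" if t: "\<bar>t\<bar> \<ge> \<bar>R\<bar> + \<bar>T\<bar>" for t
  proof (cases "t \<ge> 0")
    case True
    have "\<bar>P t\<bar> \<le> e / a + exp (- a * (t - \<bar>R\<bar>)) * K"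
      by (rule first_order_comparison[OF P K a]) (use t True less_imp_le[OF R] in auto)
    moreover have "exp (- a * (t - \<bar>R\<bar>)) * K < \<epsilon> / 3" by (rule T) (use t True in linarith)
    ultimately show ?thesis using e(2) \<epsilon> by linarith
  next
    case False
    \<comment> \<open>Towards minus infinity the comparison starts a fixed time
      \<open>\<bar>T\<bar>\<close> earlier, where the forcing is small as well; the uniform bound
      \<open>K\<close> is damped over this time.\<close>
    have "\<bar>P t\<bar> \<le> e / a + exp (- a * (t - (t - \<bar>T\<bar>))) * K"
      by (rule first_order_comparison[OF P K a]) (use t False less_imp_le[OF R] in auto)
    moreover have "exp (- a * (t - (t - \<bar>T\<bar>))) * K < \<epsilon> / 3" by (rule T) linarith
    ultimately show ?thesis using e(2) \<epsilon> by linarith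
  qed
  then show "eventually (\<lambda>t. dist (P t) 0 < \<epsilon>) at_infinity" by (auto simp: eventually_at_infinity)
qed

lemma first_order_exp_decay:
  fixes P f :: "real \<Rightarrow> real"
  assumes P: "\<And>t. (P has_real_derivative f t - a * P t) (at t)" and K: "\<And>s. \<bar>P s\<bar> \<le> K" and a: "a > 0"
    and R: "\<And>t. \<bar>t\<bar> > R \<Longrightarrow> f t = 0"
  shows "\<bar>P t\<bar> \<le> exp (a * (\<bar>R\<bar> + 1)) * K * exp (- a * \<bar>t\<bar>)"
proof -
  define r where "r = \<bar>R\<bar> + 1"
  have K0: "K \<ge> 0" using K[of 0] by linarith
  have e: "exp (a * r) * K * exp (- a * \<bar>t\<bar>) = exp (- a * (\<bar>t\<bar> - r)) * K" 
    by (simp add: algebra_simps flip: exp_add mult.assoc)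
  have "\<bar>P t\<bar> \<le> exp (- a * (\<bar>t\<bar> - r)) * K"
  proof -
    consider "t \<ge> r" | "t \<le> - r" | "\<bar>t\<bar> \<le> r" by linarith
    then show ?thesis
    proof cases
      case 1
      have "\<bar>P t\<bar> \<le> 0 / a + exp (- a * (t - r)) * K"
        by (rule first_order_comparison[OF P K a 1]) (use R in \<open>auto simp: r_def\<close>)
      then show ?thesis using 1 by (simp add: r_def)
    next
      case 2
      have "\<bar>P t\<bar> \<le> 0 / a + exp (- a * (t - (t - x))) * K" if "x \<ge> 0" for x
        by (rule first_order_comparison[OF P K a]) (use that R 2 in \<open>auto simp: r_def\<close>)
      then have "\<bar>P t\<bar> \<le> exp (- a * x) * K" if "x \<ge> 0" for x using that by auto
      from this[of "\<bar>t\<bar> - r"] show ?thesis using 2 by simp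
    next
      case 3
      have "1 \<le> exp (- a * (\<bar>t\<bar> - r))" using 3 a by (simp add: mult_nonneg_nonpos)
      then have "1 * K \<le> exp (- a * (\<bar>t\<bar> - r)) * K" using K0 by (rule mult_right_mono)
      then show ?thesis using K[of t] by linarith
    qed
  qed
  then show ?thesis unfolding e[symmetric] unfolding r_def .
qed

text \<open>Factorization \<open>- d\<^sup>2 + a\<^sup>2 = (d + a) (- d + a)\<close>:
  \<open>P\<close> is the bounded solution of the forward equation, \<open>Q\<close> that of the
  backward one obtained by reflection, and \<open>Y = (P + Q) / (2 a)\<close> is the convolution of
  \<open>f\<close> with the Green function \<open>exp (- a |t|) / (2 a)\<close>.\<close>

lemma bounded_resolvent:
  fixes f :: "real \<Rightarrow> real"
  assumes f: "continuous_on UNIV f" and M: "\<And>t. \<bar>f t\<bar> \<le> M" and a: "a > 0"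
  obtains Y Y' where "\<And>t. (Y has_real_derivative Y' t) (at t)"
    "\<And>t. (Y' has_real_derivative a\<^sup>2 * Y t - f t) (at t)" "\<And>t. \<bar>Y t\<bar> \<le> M / a\<^sup>2" "\<And>t. \<bar>Y' t\<bar> \<le> M / a"
    "(f \<longlongrightarrow> 0) at_infinity \<Longrightarrow> (Y \<longlongrightarrow> 0) at_infinity"
    "(f \<longlongrightarrow> 0) at_infinity \<Longrightarrow> (Y' \<longlongrightarrow> 0) at_infinity"
    "(\<forall>t. \<bar>t\<bar> > R \<longrightarrow> f t = 0) \<Longrightarrow> \<exists>C. \<forall>t. \<bar>Y t\<bar> \<le> C * exp (- a * \<bar>t\<bar>) \<and> \<bar>Y' t\<bar> \<le> C * exp (- a * \<bar>t\<bar>)"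
proof -
  obtain P where P: "\<And>t. (P has_real_derivative f t - a * P t) (at t)" "\<And>t. \<bar>P t\<bar> \<le> M / a"
    using bounded_first_order_solution[OF f M a] by blast
  have fm: "continuous_on UNIV (\<lambda>t. f (- t))"
    by (rule continuous_on_compose2[OF f]) (auto intro: continuous_intros)
  obtain N where N: "\<And>t. (N has_real_derivative f (- t) - a * N t) (at t)" "\<And>t. \<bar>N t\<bar> \<le> M / a"
    using bounded_first_order_solution[OF fm M a] by blast
  define Q where "Q t = N (- t)" for t
  have Q: "(Q has_real_derivative a * Q t - f t) (at t)" for t
  proof -
    have "((\<lambda>t. N (- t)) has_real_derivative (f (- (- t)) - a * N (- t)) * (- 1)) (at t)"
      by (rule DERIV_chain2[OF N(1)]) (auto intro!: derivative_eq_intros)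
    then show ?thesis by (simp add: Q_def[abs_def])
  qed
  have Qb: "\<bar>Q t\<bar> \<le> M / a" for t unfolding Q_def by (rule N)
  define Y where "Y t = (P t + Q t) / (2 * a)" for t
  define Y' where "Y' t = (Q t - P t) / 2" for t
  show thesis
  proof (rule that[of Y Y'])
    show "(Y has_real_derivative Y' t) (at t)" for t
      unfolding Y_def[abs_def] Y'_def using a
      by (auto intro!: derivative_eq_intros P Q simp: field_simps)
    show "(Y' has_real_derivative a\<^sup>2 * Y t - f t) (at t)" for t
      unfolding Y_def Y'_def[abs_def] using a
      by (auto intro!: derivative_eq_intros P Q simp: field_simps power2_eq_square)
    have "\<bar>(x - y) / 2\<bar> \<le> m" if "\<bar>x\<bar> \<le> m" "\<bar>y\<bar> \<le> m" for x y m :: real using that by (auto simp: abs_le_iff)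
    then show "\<bar>Y' t\<bar> \<le> M / a" for t using P(2)[of t] Qb[of t] unfolding Y'_def by blast
    show "\<bar>Y t\<bar> \<le> M / a\<^sup>2" for t
    proof -
      have "\<bar>P t + Q t\<bar> \<le> 2 * (M / a)" using P(2)[of t] Qb[of t] by linarith
      then have "\<bar>P t + Q t\<bar> / (2 * a) \<le> 2 * (M / a) / (2 * a)" using a by (intro divide_right_mono) auto
      then show ?thesis unfolding Y_def using a by (simp add: power2_eq_square)
    qed
  next
    assume f0: "(f \<longlongrightarrow> 0) at_infinity"
    have mi: "filterlim uminus at_infinity (at_infinity :: real filter)"
      unfolding filterlim_iff eventually_at_infinity real_norm_def by (metis abs_minus_cancel)
    have P0: "(P \<longlongrightarrow> 0) at_infinity" by (rule first_order_vanishing[OF P a f0])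
    have "(N \<longlongrightarrow> 0) at_infinity"
      by (rule first_order_vanishing[OF N a]) (use filterlim_compose[OF f0 mi] in simp)
    then have Q0: "(Q \<longlongrightarrow> 0) at_infinity"
      using filterlim_compose[OF _ mi] unfolding Q_def[abs_def] by blast
    show "(Y \<longlongrightarrow> 0) at_infinity" "(Y' \<longlongrightarrow> 0) at_infinity"
      unfolding Y_def[abs_def] Y'_def[abs_def] using tendsto_divide_zero[OF tendsto_add_zero[OF P0 Q0]]
        tendsto_divide_zero[OF tendsto_diff[OF Q0 P0, simplified]] by auto
  next
    assume R: "\<forall>t. \<bar>t\<bar> > R \<longrightarrow> f t = 0"
    define D where "D = exp (a * (\<bar>R\<bar> + 1)) * (M / a)"
    have Pb: "\<bar>P t\<bar> \<le> D * exp (- a * \<bar>t\<bar>)" for t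
      unfolding D_def by (rule first_order_exp_decay[OF P a]) (use R in auto)
    have "\<bar>N t\<bar> \<le> D * exp (- a * \<bar>t\<bar>)" for t
      unfolding D_def by (rule first_order_exp_decay[OF N a]) (use R in auto)
    then have Qb': "\<bar>Q t\<bar> \<le> D * exp (- a * \<bar>t\<bar>)" for t unfolding Q_def by (metis abs_minus_cancel)
    define C where "C = D * (1 + 1 / a)"
    have D0: "D \<ge> 0" unfolding D_def using M[of 0] a by (auto intro!: mult_nonneg_nonneg divide_nonneg_pos)
    have "\<bar>Y t\<bar> \<le> C * exp (- a * \<bar>t\<bar>) \<and> \<bar>Y' t\<bar> \<le> C * exp (- a * \<bar>t\<bar>)" for t
    proof
      define E where "E = D * exp (- a * \<bar>t\<bar>)"
      have E: "E \<ge> 0" "C * exp (- a * \<bar>t\<bar>) = E + E / a" using D0 by (auto simp: E_def C_def algebra_simps)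
      have b: "\<bar>P t\<bar> \<le> E" "\<bar>Q t\<bar> \<le> E" using Pb Qb' by (auto simp: E_def)
      have "\<bar>Y' t\<bar> \<le> E" using b unfolding Y'_def by (auto simp: abs_le_iff)
      moreover have "E / a \<ge> 0" using E(1) a by simp
      ultimately show "\<bar>Y' t\<bar> \<le> C * exp (- a * \<bar>t\<bar>)" unfolding E(2) by linarith
      have "\<bar>P t + Q t\<bar> / (2 * a) \<le> 2 * E / (2 * a)" using b a by (intro divide_right_mono) auto
      then show "\<bar>Y t\<bar> \<le> C * exp (- a * \<bar>t\<bar>)" unfolding E(2) using E(1) a unfolding Y_def by simp
    qed
    then show "\<exists>C. \<forall>t. \<bar>Y t\<bar> \<le> C * exp (- a * \<bar>t\<bar>) \<and> \<bar>Y' t\<bar> \<le> C * exp (- a * \<bar>t\<bar>)" by blast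
  qed
qed

text \<open>The equation itself expresses the derivative of \<open>Y'\<close> through
  \<open>Y\<close> and \<eta>, so \<open>Y\<close>, \<open>Y'\<close> and the smooth functions
  generate an algebra closed under differentiation.\<close>

lemma smooth_resolvent:
  assumes e: "smooth_real \<eta>" and Y: "\<And>t. (Y has_real_derivative Y' t) (at t)"
    "\<And>t. (Y' has_real_derivative c * Y t - \<eta> t) (at t)"
  shows "smooth_real Y"
proof -
  let ?S = "insert Y (insert Y' {g. smooth_real g})"
  show ?thesis
  proof (rule smooth_real_algebra[of ?S])
    fix g assume "g \<in> ?S"
    then consider "g = Y" | "g = Y'" | "smooth_real g" by blast
    then show "\<exists>g'\<in>fun_algebra ?S. \<forall>t. (g has_real_derivative g' t) (at t)"
    proof cases
      case 1
      then show ?thesis using Y(1) by (intro bexI[of _ Y'] fun_algebra.base) auto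
    next
      case 2
      have "smooth_real (\<lambda>t. -1 * \<eta> t)" "smooth_real (\<lambda>t. c)"
        using smooth_real_mult[OF smooth_real_const[of "-1"] e] by auto
      then have "(\<lambda>t. c * Y t + -1 * \<eta> t) \<in> fun_algebra ?S"
        by (intro fun_algebra.add[OF fun_algebra.mult]) (auto intro!: fun_algebra.base)
      then show ?thesis using Y(2) 2 by (intro bexI[of _ "\<lambda>t. c * Y t + -1 * \<eta> t"]) auto
    next
      case 3
      then show ?thesis using smooth_real_deriv[OF 3] by (intro bexI[of _ "deriv g"] fun_algebra.base) auto
    qed
  qed (auto intro: fun_algebra.base)
qed

lemma integrable_exp_abs:
  fixes c :: real assumes c: "c > 0" shows "integrable lborel (\<lambda>t. exp (- c * \<bar>t\<bar>))"
proof (rule integrableI_bounded)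
  have "(\<integral>\<^sup>+t. ennreal (norm (exp (- c * \<bar>t\<bar>))) \<partial>lborel)
    \<le> (\<integral>\<^sup>+t. ennreal (1 * exp (c * t)) * indicator {..0} t + ennreal (1 * exp (c * (-t))) * indicator {..0} (- t) \<partial>lborel)"
    by (intro nn_integral_mono) (auto simp: indicator_def)
  also have "\<dots> = (\<integral>\<^sup>+t. ennreal (1 * exp (c * t)) * indicator {..0} t \<partial>lborel)
      + (\<integral>\<^sup>+t. ennreal (1 * exp (c * (-t))) * indicator {..0} (- t) \<partial>lborel)"
    by (intro nn_integral_add) auto
  also have "(\<integral>\<^sup>+t. ennreal (1 * exp (c * (-t))) * indicator {..0} (- t) \<partial>lborel)
      = (\<integral>\<^sup>+t. ennreal (1 * exp (c * t)) * indicator {..0} t \<partial>lborel)"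
    by (subst (2) nn_integral_real_affine[where c="-1" and t=0]) auto
  finally show "(\<integral>\<^sup>+t. ennreal (norm (exp (- c * \<bar>t\<bar>))) \<partial>lborel) < \<infinity>"
    unfolding nn_integral_exp_atMost[OF c zero_le_one] by (rule order_le_less_trans) (simp flip: ennreal_plus)
qed simp

lemma integral_deriv_vanishing:
  fixes F h :: "real \<Rightarrow> real"
  assumes F: "\<And>t. (F has_real_derivative h t) (at t)" and h: "continuous_on UNIV h" "integrable lborel h"
    and z: "(F \<longlongrightarrow> 0) at_infinity"
  shows "(LINT t|lborel. h t) = 0"
proof -
  have z': "(F \<longlongrightarrow> 0) at_top" "(F \<longlongrightarrow> 0) at_bot"
    using z by (auto intro: filterlim_mono[OF _ order_refl] simp: at_top_le_at_infinity at_bot_le_at_infinity)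
  have "(LBINT t=-\<infinity>..\<infinity>. h t) = 0 - 0"
  proof (rule interval_integral_FTC_integrable)
    show "(F has_vector_derivative h t) (at t)" for t
      using F by (simp add: has_real_derivative_iff_has_vector_derivative)
    show "isCont h t" for t using h(1) by (simp add: continuous_on_eq_continuous_at)
    show "((F \<circ> real_of_ereal) \<longlongrightarrow> 0) (at_right (-\<infinity>))" "((F \<circ> real_of_ereal) \<longlongrightarrow> 0) (at_left \<infinity>)"
      using z' by (auto simp: ereal_tendsto_simps1)
    show "set_integrable lborel (einterval (-\<infinity>) \<infinity>) h" using h(2) by (simp add: set_integrable_def)
  qed simp
  then show ?thesis by (simp add: interval_lebesgue_integral_def set_lebesgue_integral_def)
qed

text \<open>Tested with a bump on which \<open>D\<close> keeps its sign, the integrand has constant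
  sign and integral 0; it therefore vanishes almost everywhere and, being continuous, also at
  \<open>t0\<close>, where the bump is 1.\<close>

lemma fundamental_lemma:
  assumes D: "continuous_on UNIV D" and z: "\<And>\<eta>. test_fun \<eta> \<Longrightarrow> (LINT t|lborel. D t * \<eta> t) = 0"
  shows "D t0 = 0"
proof (rule ccontr)
  assume "D t0 \<noteq> 0"
  have "isCont D t0" using D by (simp add: continuous_on_eq_continuous_at)
  then obtain d where d: "d > 0" "\<And>t. \<bar>t - t0\<bar> < d \<Longrightarrow> \<bar>D t - D t0\<bar> < \<bar>D t0\<bar>"
    using \<open>D t0 \<noteq> 0\<close> unfolding continuous_at_eps_delta dist_real_def by (metis zero_less_abs_iff)
  \<comment> \<open>\<open>plateau\<close> vanishes from 2 on, so the factor 3/d confines the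
    support to distance 2d/3 < d from \<open>t0\<close>.\<close>
  define \<eta> where "\<eta> t = plateau ((t - t0) * (3 / d))" for t
  have e: "test_fun \<eta>" unfolding \<eta>_def[abs_def] using d by (intro test_fun_plateau) auto
  have "\<eta> t = 0" if "\<bar>t - t0\<bar> \<ge> d" for t
  proof -
    have "\<bar>(t - t0) * (3 / d)\<bar> = \<bar>t - t0\<bar> * 3 / d" unfolding abs_mult using d by simp
    also have "\<dots> \<ge> 2" using that d by (simp add: field_simps)
    finally show ?thesis unfolding \<eta>_def by (rule plateau_eq_0)
  qed
  then have far: "\<bar>t - t0\<bar> < d \<or> \<eta> t = 0" for t by (meson not_le)
  have near: "sgn (D t0) * D t \<ge> 0" if "\<bar>t - t0\<bar> < d" for t
    using d(2)[OF that] \<open>D t0 \<noteq> 0\<close> by (cases "D t0 > 0") (auto simp: sgn_if)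
  have nn: "sgn (D t0) * (D t * \<eta> t) \<ge> 0" for t
  proof (cases "\<eta> t = 0")
    case False
    then have "sgn (D t0) * D t * \<eta> t \<ge> 0"
      using far[of t] near[of t] plateau_nonneg unfolding \<eta>_def by (intro mult_nonneg_nonneg[of "sgn (D t0) * D t"]) auto
    then show ?thesis by (simp only: mult.assoc)
  qed simp
  have c: "continuous_on UNIV (\<lambda>t. D t * \<eta> t)"
    by (intro continuous_intros D smooth_real_continuous test_fun_smooth e)
  obtain R where "\<And>t. \<bar>t\<bar> > R \<Longrightarrow> \<eta> t = 0" using e unfolding test_fun_def by blast
  then have i: "integrable lborel (\<lambda>t. D t * \<eta> t)" by (intro integrable_compact_support[OF c, of R]) auto
  have "(LINT t|lborel. sgn (D t0) * (D t * \<eta> t)) = 0" using z[OF e] by simp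
  then have "AE t in lborel. sgn (D t0) * (D t * \<eta> t) = 0"
    using nn i by (subst (asm) integral_nonneg_eq_0_iff_AE) auto
  then have "AE t in lborel. D t * \<eta> t = 0"
    by eventually_elim (use \<open>D t0 \<noteq> 0\<close> in \<open>simp add: sgn_zero_iff\<close>)
  from continuous_eq_AE[OF c _ this, of t0] have "D t0 * \<eta> t0 = 0" by simp
  then show False using \<open>D t0 \<noteq> 0\<close> by (simp add: \<eta>_def plateau_eq_1)
qed

lemma test_fun_bounded:
  assumes "test_fun v" obtains X where "X \<ge> 0" "\<And>t. \<bar>v t\<bar> \<le> X"
proof -
  obtain R where R: "\<And>t. \<bar>t\<bar> > R \<Longrightarrow> v t = 0" using assms unfolding test_fun_def by blast
  have "compact (v ` {-R..R})"
    by (intro compact_continuous_image smooth_real_continuous test_fun_smooth assms) simp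
  then have "bounded (v ` {-R..R})" by (rule compact_imp_bounded)
  then obtain X where "\<forall>x\<in>v ` {-R..R}. norm x \<le> X" unfolding bounded_iff by blast
  then have X: "\<And>t. t \<in> {-R..R} \<Longrightarrow> \<bar>v t\<bar> \<le> X" by auto
  have "\<bar>v t\<bar> \<le> \<bar>X\<bar>" for t
  proof (cases "\<bar>t\<bar> > R")
    case False
    then have "t \<in> {-R..R}" by auto
    then show ?thesis using X abs_ge_self[of X] order_trans by blast
  qed (simp add: R)
  then show ?thesis using that[of "\<bar>X\<bar>"] by simp
qed

lemma deriv_plateau_eq_0:
  assumes "\<bar>s\<bar> < 1" shows "deriv plateau s = 0" "deriv (deriv plateau) s = 0"
proof -
  have o: "open {t::real. \<bar>t\<bar> < 1}" by (intro open_Collect_less continuous_intros)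
  have z: "deriv plateau t = 0" if "\<bar>t\<bar> < 1" for t
  proof (rule DERIV_imp_deriv, rule has_field_derivative_transform_within_open[OF DERIV_const o])
    show "1 = plateau x" if "x \<in> {t. \<bar>t\<bar> < 1}" for x using that plateau_eq_1[of x] by simp
  qed (use that in simp)
  then show "deriv plateau s = 0" using assms by blast
  show "deriv (deriv plateau) s = 0"
  proof (rule DERIV_imp_deriv, rule has_field_derivative_transform_within_open[OF DERIV_const o])
    show "0 = deriv plateau x" if "x \<in> {t. \<bar>t\<bar> < 1}" for x using that z[of x] by simp
  qed (use assms in simp)
qed

section \<open>Green potentials of test functions belong to the space\<close>

context profile_space begin

text \<open>The cutoffs \<open>w0 k\<close> agree with \<open>w\<close> for
  \<open>\<bar>t\<bar> < k + 1\<close>. Hence differences of late cutoffs live far out, where the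
  exponential decay makes their energy small; they are Cauchy, and pointwise convergence identifies
  the limit as \<open>w\<close>. Against a fixed test function the inner product is eventually
  constant in \<open>k\<close>.\<close>

lemma decaying_in_space:
  assumes w: "smooth_real w" and c: "c > 0" and C: "\<And>t. \<bar>w t\<bar> \<le> C * exp (- c * \<bar>t\<bar>)"
    "\<And>t. \<bar>deriv w t\<bar> \<le> C * exp (- c * \<bar>t\<bar>)" "\<And>t. \<bar>deriv (deriv w) t\<bar> \<le> C * exp (- c * \<bar>t\<bar>)"
  shows "w \<in> H" "\<And>v. test_fun v \<Longrightarrow> ip v w = test_ip A B v w"
proof -
  define h where "h k = 1 / real (Suc k)" for k
  have h: "0 < h k" "h k \<le> 1" for k by (auto simp: h_def)
  define w0 where "w0 k t = w t * plateau (t * h k)" for k t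
  define w1 where "w1 k t = deriv w t * plateau (t * h k) + w t * (h k * deriv plateau (t * h k))" for k t
  define w2 where "w2 k t = deriv (deriv w) t * plateau (t * h k) + 2 * deriv w t * (h k * deriv plateau (t * h k))
      + w t * ((h k)\<^sup>2 * deriv (deriv plateau) (t * h k))" for k t
  have pl: "test_fun plateau" using test_fun_plateau[of 1 0] by simp
  have tk: "test_fun (\<lambda>t. plateau (t * h k))" for k using test_fun_plateau[OF h(1), of 0] by simp
  have t0: "test_fun (w0 k)" for k unfolding w0_def by (rule test_fun_mult[OF w tk])
  note dw = smooth_real_deriv[OF w]
  note dw' = smooth_real_deriv[OF dw(2)]
  note dp = smooth_real_deriv[OF smooth_real_plateau]
  note dp' = smooth_real_deriv[OF dp(2)]
  have dh: "((\<lambda>t. plateau (t * h k)) has_real_derivative h k * deriv plateau (t * h k)) (at t)" for k t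
    by (subst mult.commute, rule DERIV_chain2[OF dp(1)]) (auto intro!: derivative_eq_intros)
  have dh': "((\<lambda>t. h k * deriv plateau (t * h k)) has_real_derivative (h k)\<^sup>2 * deriv (deriv plateau) (t * h k)) (at t)" for k t
    by (auto intro!: derivative_eq_intros DERIV_chain2[OF dp'(1), where g="\<lambda>t. t * h k"] simp: power2_eq_square)
  have d1: "deriv (w0 k) = w1 k" for k
    unfolding w0_def w1_def by (rule ext, rule DERIV_imp_deriv) (auto intro!: derivative_eq_intros dw dh)
  have d2: "deriv (w1 k) = w2 k" for k
    unfolding w1_def w2_def
    by (rule ext, rule DERIV_imp_deriv,
        rule DERIV_cong[OF DERIV_add[OF DERIV_mult[OF dw'(1) dh] DERIV_mult[OF dw(1) dh']]])
       (simp add: algebra_simps)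
  have one: "w0 k t = w t" "w1 k t = deriv w t" "w2 k t = deriv (deriv w) t" if "\<bar>t\<bar> < real (Suc k)" for k t
  proof -
    have "\<bar>t * h k\<bar> < 1" using that by (simp add: h_def abs_mult)
    then show "w0 k t = w t" "w1 k t = deriv w t" "w2 k t = deriv (deriv w) t"
      using plateau_eq_1[of "t * h k"] deriv_plateau_eq_0[of "t * h k"] by (auto simp: w0_def w1_def w2_def)
  qed
  obtain X0 where X0: "X0 \<ge> 0" "\<And>t. \<bar>plateau t\<bar> \<le> X0" by (rule test_fun_bounded[OF pl]) blast
  obtain X1 where X1: "X1 \<ge> 0" "\<And>t. \<bar>deriv plateau t\<bar> \<le> X1" by (rule test_fun_bounded[OF test_fun_deriv(2)[OF pl]]) blast
  obtain X2 where X2: "X2 \<ge> 0" "\<And>t. \<bar>deriv (deriv plateau) t\<bar> \<le> X2"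
    by (rule test_fun_bounded[OF test_fun_deriv(2)[OF test_fun_deriv(2)[OF pl]]]) blast
  define X where "X = X0 + X1 + X2"
  have p0: "\<bar>plateau (t * h k)\<bar> \<le> X" for k t using X0(2)[of "t * h k"] X1(1) X2(1) by (simp add: X_def)
  have p1: "\<bar>h k * deriv plateau (t * h k)\<bar> \<le> X" for k t
  proof -
    have "\<bar>h k * deriv plateau (t * h k)\<bar> \<le> 1 * X1"
      unfolding abs_mult using h[of k] X1 by (intro mult_mono) auto
    then show ?thesis using X0(1) X2(1) by (simp add: X_def)
  qed
  have p2: "\<bar>(h k)\<^sup>2 * deriv (deriv plateau) (t * h k)\<bar> \<le> X" for k t
  proof -
    have "(h k)\<^sup>2 \<le> 1" using h[of k] by (simp add: power_le_one)
    then have "\<bar>(h k)\<^sup>2 * deriv (deriv plateau) (t * h k)\<bar> \<le> 1 * X2"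
      unfolding abs_mult using X2 by (intro mult_mono) auto
    then show ?thesis using X0(1) X1(1) by (simp add: X_def)
  qed
  define E where "E t = C * exp (- c * \<bar>t\<bar>) * X" for t
  have m: "\<bar>x * y\<bar> \<le> E t" if "\<bar>x\<bar> \<le> C * exp (- c * \<bar>t\<bar>)" "\<bar>y\<bar> \<le> X" for x y t
    unfolding E_def abs_mult using that by (intro mult_mono) (auto intro: order_trans[OF abs_ge_zero])
  have E0: "E t \<ge> 0" for t using m[OF C(1) p0, of t 0 0] by (rule order_trans[OF abs_ge_zero])
  \<comment> \<open>The factor 4 counts the terms of \<open>w2\<close> with multiplicity and is used
    for all three bounds alike.\<close>
  have b0: "\<bar>w0 k t\<bar> \<le> 4 * E t" for k t
    using m[OF C(1) p0, of t t k] E0[of t] unfolding w0_def by linarith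
  have b1: "\<bar>w1 k t\<bar> \<le> 4 * E t" for k t
    using m[OF C(2) p0, of t t k] m[OF C(1) p1, of t k t] E0[of t] unfolding w1_def by linarith
  have b2: "\<bar>w2 k t\<bar> \<le> 4 * E t" for k t
    using m[OF C(3) p0, of t t k] m[OF C(2) p1, of t k t] m[OF C(1) p2, of t k t] E0[of t]
    unfolding w2_def mult.assoc by linarith
  define I where "I = (LINT t|lborel. exp (- c * \<bar>t\<bar>))"
  \<comment> \<open>A difference of two cutoffs is at most \<open>8 * E t\<close>, whence
    \<open>64 = 8 * 8\<close>. Of the squared exponential one factor is spent on
    \<open>exp (- c * K)\<close> and the other keeps the integral finite.\<close>
  define D where "D = 64 * C\<^sup>2 * X\<^sup>2 * (1 + A + B)"
  have D0: "D \<ge> 0" using A B by (simp add: D_def)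
  have I0: "I \<ge> 0" unfolding I_def by simp
  have en: "energy A B (\<lambda>t. w0 j t - w0 l t) \<le> D * exp (- c * real K) * I" if jl: "K \<le> j" "K \<le> l" for j l K
  proof -
    have e1: "deriv (\<lambda>t. w0 j t - w0 l t) = (\<lambda>t. w1 j t - w1 l t)"
      by (rule ext, rule DERIV_imp_deriv) (use test_fun_deriv(1)[OF t0] d1 in \<open>auto intro!: DERIV_diff\<close>)
    have e2: "deriv (\<lambda>t. w1 j t - w1 l t) = (\<lambda>t. w2 j t - w2 l t)"
      by (rule ext, rule DERIV_imp_deriv)
         (use test_fun_deriv(1)[OF test_fun_deriv(2)[OF t0]] d1 d2 in \<open>auto intro!: DERIV_diff\<close>)
    have sq: "(x - y)\<^sup>2 \<le> (8 * E t)\<^sup>2" if "\<bar>x\<bar> \<le> 4 * E t" "\<bar>y\<bar> \<le> 4 * E t" for x y t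
      using that E0[of t] by (intro abs_le_square_iff[THEN iffD1]) auto
    have "energy A B (\<lambda>t. w0 j t - w0 l t) \<le> (LINT t|lborel. D * exp (- c * real K) * exp (- c * \<bar>t\<bar>))"
      unfolding energy_def e1 e2
    proof (rule integral_mono')
      show "integrable lborel (\<lambda>t. D * exp (- c * real K) * exp (- c * \<bar>t\<bar>))"
        using integrable_exp_abs[OF c] by simp
      show "0 \<le> D * exp (- c * real K) * exp (- c * \<bar>t\<bar>)" for t using D0 by simp
      show "(w2 j t - w2 l t)\<^sup>2 + A * (w1 j t - w1 l t)\<^sup>2 + B * (w0 j t - w0 l t)\<^sup>2
          \<le> D * exp (- c * real K) * exp (- c * \<bar>t\<bar>)" for t
      proof (cases "\<bar>t\<bar> < real (Suc K)")
        case True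
        then have "\<bar>t\<bar> < real (Suc j)" "\<bar>t\<bar> < real (Suc l)" using jl by auto
        then show ?thesis using D0 by (simp add: one)
      next
        case False
        then have K: "real K \<le> \<bar>t\<bar>" by simp
        have "(w2 j t - w2 l t)\<^sup>2 + A * (w1 j t - w1 l t)\<^sup>2 + B * (w0 j t - w0 l t)\<^sup>2
            \<le> (8 * E t)\<^sup>2 + A * (8 * E t)\<^sup>2 + B * (8 * E t)\<^sup>2"
          using A B by (intro add_mono mult_left_mono sq b0 b1 b2) auto
        also have "\<dots> = D * (exp (- c * \<bar>t\<bar>) * exp (- c * \<bar>t\<bar>))"
          unfolding D_def E_def by (simp add: power2_eq_square algebra_simps)
        also have "\<dots> \<le> D * (exp (- c * real K) * exp (- c * \<bar>t\<bar>))"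
          using K c D0 by (intro mult_left_mono mult_right_mono) auto
        finally show ?thesis by (simp only: mult.assoc)
      qed
    qed
    then show ?thesis using integrable_exp_abs[OF c] by (simp add: I_def)
  qed
  have lim: "(\<lambda>K. D * exp (- c * real K) * I) \<longlonglongrightarrow> 0"
  proof -
    have "(\<lambda>K. exp (- c * real K)) \<longlonglongrightarrow> 0" using c by real_asymp
    then show ?thesis by (intro tendsto_mult_left_zero tendsto_mult_right_zero)
  qed
  have "\<exists>y\<in>H. (\<lambda>k. q (\<lambda>t. w0 k t - y t)) \<longlonglongrightarrow> 0"
  proof (rule complete[OF test[OF t0]], intro allI impI)
    fix e :: real assume e: "e > 0"
    then have "eventually (\<lambda>K. D * exp (- c * real K) * I < e\<^sup>2) sequentially"
      by (intro order_tendstoD[OF lim]) auto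
    then obtain K where K: "D * exp (- c * real K) * I < e\<^sup>2" by (auto simp: eventually_sequentially)
    have "q (\<lambda>t. w0 j t - w0 l t) < e" if "K \<le> j" "K \<le> l" for j l
    proof -
      have "energy A B (\<lambda>t. w0 j t - w0 l t) < e\<^sup>2" using en[OF that] K by linarith
      then show ?thesis
        unfolding q_test[OF test_fun_diff[OF t0 t0]] using e by (intro real_less_lsqrt) auto
    qed
    then show "\<exists>K. \<forall>j\<ge>K. \<forall>k\<ge>K. q (\<lambda>t. w0 j t - w0 k t) < e" by blast
  qed
  then obtain y where "y \<in> H" "(\<lambda>k. q (\<lambda>t. w0 k t - y t)) \<longlonglongrightarrow> 0" by blast
  then have y: "conv w0 y" using test[OF t0] unfolding conv_def by simp
  have "y t = w t" for t
  proof (rule LIMSEQ_unique[OF conv_pointwise[OF y]])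
    obtain K where "\<bar>t\<bar> < real K" using reals_Archimedean2 by blast
    then have "w0 k t = w t" if "k \<ge> K" for k using one(1)[of t k] that by auto
    then show "(\<lambda>k. w0 k t) \<longlonglongrightarrow> w t" by (intro tendsto_eventually) (auto simp: eventually_sequentially)
  qed
  then have "y = w" by (rule ext)
  with y have yw: "conv w0 w" by simp
  then show "w \<in> H" by (simp add: conv_def)
  fix v assume v: "test_fun v"
  obtain R v1 v2 where vz: "deriv v = v1" "deriv v1 = v2" "\<And>t. \<bar>t\<bar> > R \<Longrightarrow> v t = 0"
    "\<And>t. \<bar>t\<bar> > R \<Longrightarrow> v1 t = 0" "\<And>t. \<bar>t\<bar> > R \<Longrightarrow> v2 t = 0"
    by (rule test_funE[OF v]) blast
  obtain K where K: "R < real K" using reals_Archimedean2 by blast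
  have "ip v (w0 k) = test_ip A B v w" if k: "k \<ge> K" for k
    unfolding ip_test[OF v t0] test_ip_def d1 d2 vz
  proof (rule Bochner_Integration.integral_cong[OF refl])
    fix t
    show "v2 t * w2 k t + A * (v1 t * w1 k t) + B * (v t * w0 k t)
        = v2 t * deriv (deriv w) t + A * (v1 t * deriv w t) + B * (v t * w t)"
    proof (cases "\<bar>t\<bar> > R")
      case False
      then have "\<bar>t\<bar> < real (Suc k)" using K k by simp
      then show ?thesis by (simp add: one)
    qed (simp add: vz)
  qed
  then have "(\<lambda>k. ip v (w0 k)) \<longlonglongrightarrow> test_ip A B v w"
    by (intro tendsto_eventually) (auto simp: eventually_sequentially)
  moreover have "(\<lambda>k. ip v (w0 k)) \<longlonglongrightarrow> ip v w" by (intro conv_ip conv_const test v yw)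
  ultimately show "ip v w = test_ip A B v w" using LIMSEQ_unique by blast
qed

lemma tendsto_0_at_infinity: assumes "v \<in> H" shows "(v \<longlongrightarrow> 0) at_infinity"
proof (rule tendstoI)
  fix e :: real assume "e > 0"
  then obtain R where "\<And>t. \<bar>t\<bar> > R \<Longrightarrow> \<bar>v t\<bar> < e" using vanishes_at_infinity[OF assms] by metis
  then show "\<forall>\<^sub>F t in at_infinity. dist (v t) 0 < e"
    unfolding eventually_at_infinity by (intro exI[of _ "R + 1"]) auto
qed

text \<open>Partial fractions: for a \<noteq> b the difference of the two resolvents divided by
  \<open>a\<^sup>2 - b\<^sup>2\<close> inverts the product
  \<open>(- d\<^sup>2 + a\<^sup>2) (- d\<^sup>2 + b\<^sup>2)\<close>. By exponential decay it lies
  in \<open>H\<close>, and there it is the Riesz representative of integration against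
  \<eta>.\<close>

lemma resolvent_in_space:
  assumes ab: "a > 0" "b > 0" "a \<noteq> b" and AB: "A = a\<^sup>2 + b\<^sup>2" "B = a\<^sup>2 * b\<^sup>2" and \<eta>: "test_fun \<eta>"
    and Ya: "\<And>t. (Ya has_real_derivative Ya' t) (at t)" "\<And>t. (Ya' has_real_derivative a\<^sup>2 * Ya t - \<eta> t) (at t)"
      "\<And>t. \<bar>Ya t\<bar> \<le> Ca * exp (- a * \<bar>t\<bar>)" "\<And>t. \<bar>Ya' t\<bar> \<le> Ca * exp (- a * \<bar>t\<bar>)"
    and Yb: "\<And>t. (Yb has_real_derivative Yb' t) (at t)" "\<And>t. (Yb' has_real_derivative b\<^sup>2 * Yb t - \<eta> t) (at t)"
      "\<And>t. \<bar>Yb t\<bar> \<le> Cb * exp (- b * \<bar>t\<bar>)" "\<And>t. \<bar>Yb' t\<bar> \<le> Cb * exp (- b * \<bar>t\<bar>)"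
  shows "(\<lambda>t. (Yb t - Ya t) / (a\<^sup>2 - b\<^sup>2)) \<in> H"
    "v \<in> H \<Longrightarrow> ip v (\<lambda>t. (Yb t - Ya t) / (a\<^sup>2 - b\<^sup>2)) = (LINT t|lborel. v t * \<eta> t)"
proof -
  define d where "d = a\<^sup>2 - b\<^sup>2"
  have d: "d \<noteq> 0" using ab by (simp add: d_def)
  define w where "w t = (Yb t - Ya t) / d" for t
  define w1 where "w1 t = (Yb' t - Ya' t) / d" for t
  define w2 where "w2 t = (b\<^sup>2 * Yb t - a\<^sup>2 * Ya t) / d" for t
  define w3 where "w3 t = (b\<^sup>2 * Yb' t - a\<^sup>2 * Ya' t) / d" for t
  have D: "(w has_real_derivative w1 t) (at t)" "(w1 has_real_derivative w2 t) (at t)" "(w2 has_real_derivative w3 t) (at t)" for t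
    unfolding w_def[abs_def] w1_def[abs_def] w2_def[abs_def] w3_def[abs_def]
    by (rule DERIV_cdivide[OF DERIV_diff[OF Yb(1) Ya(1)]])
       (rule DERIV_cong[OF DERIV_cdivide[OF DERIV_diff[OF Yb(2) Ya(2)]]], simp,
        rule DERIV_cdivide[OF DERIV_diff[OF DERIV_cmult[OF Yb(1)] DERIV_cmult[OF Ya(1)]]])
  have "(w3 has_real_derivative (b\<^sup>2 * (b\<^sup>2 * Yb t - \<eta> t) - a\<^sup>2 * (a\<^sup>2 * Ya t - \<eta> t)) / d) (at t)" for t
    unfolding w3_def[abs_def]
    by (rule DERIV_cdivide[OF DERIV_diff[OF DERIV_cmult[OF Yb(2)] DERIV_cmult[OF Ya(2)]]])
  moreover have "(b\<^sup>2 * (b\<^sup>2 * Yb t - \<eta> t) - a\<^sup>2 * (a\<^sup>2 * Ya t - \<eta> t)) / d = A * w2 t - B * w t + \<eta> t" for t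
    using d unfolding w_def w2_def AB d_def by (simp add: divide_simps) (simp add: algebra_simps power2_eq_square)
  ultimately have D3: "(w3 has_real_derivative A * w2 t - B * w t + \<eta> t) (at t)" for t by simp
  have dw: "deriv w = w1" "deriv w1 = w2" using D DERIV_imp_deriv by blast+
  have sY: "smooth_real Ya" "smooth_real Yb"
    by (rule smooth_resolvent[OF test_fun_smooth[OF \<eta>]], fact+)+
  have "smooth_real (\<lambda>t. (Yb t - Ya t) * (1 / d))" by (intro smooth_real_mult smooth_real_diff sY smooth_real_const)
  then have sw: "smooth_real w" unfolding w_def[abs_def] by simp
  define c where "c = min a b"
  have c: "c > 0" using ab by (simp add: c_def)
  have C0: "Ca \<ge> 0" "Cb \<ge> 0" using order_trans[OF abs_ge_zero Ya(3)[of 0]] order_trans[OF abs_ge_zero Yb(3)[of 0]] by auto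
  define E where "E t = (Ca + Cb) * exp (- c * \<bar>t\<bar>)" for t
  have "Ca * exp (- a * \<bar>t\<bar>) + Cb * exp (- b * \<bar>t\<bar>) \<le> Ca * exp (- c * \<bar>t\<bar>) + Cb * exp (- c * \<bar>t\<bar>)" for t
    using C0 by (intro add_mono mult_left_mono) (auto simp: c_def intro: mult_right_mono)
  then have E: "Ca * exp (- a * \<bar>t\<bar>) + Cb * exp (- b * \<bar>t\<bar>) \<le> E t" for t
    unfolding E_def by (simp add: distrib_right)
  define C where "C = (1 + a\<^sup>2 + b\<^sup>2) / \<bar>d\<bar> * (Ca + Cb)"
  have CE: "C * exp (- c * \<bar>t\<bar>) = (1 + a\<^sup>2 + b\<^sup>2) * E t / \<bar>d\<bar>" for t by (simp add: C_def E_def)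
  have E0: "E t \<ge> 0" for t using C0 by (simp add: E_def)
  have one: "x / \<bar>d\<bar> \<le> C * exp (- c * \<bar>t\<bar>)" if "x \<le> (1 + a\<^sup>2 + b\<^sup>2) * E t" for x t
    unfolding CE using that by (rule divide_right_mono) simp
  have E1: "E t \<le> (1 + a\<^sup>2 + b\<^sup>2) * E t" for t using E0[of t] by (simp add: mult_le_cancel_right1)
  have b0: "\<bar>w t\<bar> \<le> C * exp (- c * \<bar>t\<bar>)" for t
    unfolding w_def abs_divide by (rule one) (use Ya(3)[of t] Yb(3)[of t] E[of t] E1[of t] in linarith)
  have b1: "\<bar>w1 t\<bar> \<le> C * exp (- c * \<bar>t\<bar>)" for t
    unfolding w1_def abs_divide by (rule one) (use Ya(4)[of t] Yb(4)[of t] E[of t] E1[of t] in linarith)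
  have b2: "\<bar>w2 t\<bar> \<le> C * exp (- c * \<bar>t\<bar>)" for t
    unfolding w2_def abs_divide
  proof (rule one)
    have "Ca * exp (- a * \<bar>t\<bar>) \<ge> 0" "Cb * exp (- b * \<bar>t\<bar>) \<ge> 0" using C0 by auto
    then have y: "\<bar>Ya t\<bar> \<le> E t" "\<bar>Yb t\<bar> \<le> E t"
      using Ya(3)[of t] Yb(3)[of t] E[of t] by linarith+
    have "\<bar>b\<^sup>2 * Yb t\<bar> \<le> b\<^sup>2 * E t" "\<bar>a\<^sup>2 * Ya t\<bar> \<le> a\<^sup>2 * E t"
      unfolding abs_mult using y by (auto intro!: mult_left_mono)
    then show "\<bar>b\<^sup>2 * Yb t - a\<^sup>2 * Ya t\<bar> \<le> (1 + a\<^sup>2 + b\<^sup>2) * E t"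
      using E0[of t] by (simp add: distrib_right)
  qed
  note dec = decaying_in_space[OF sw c b0 b1[folded dw] b2[folded dw]]
  have weq: "(\<lambda>t. (Yb t - Ya t) / (a\<^sup>2 - b\<^sup>2)) = w" by (simp add: w_def[abs_def] d_def)
  show wH: "(\<lambda>t. (Yb t - Ya t) / (a\<^sup>2 - b\<^sup>2)) \<in> H" unfolding weq by (rule dec(1))
  have parts: "test_ip A B v w = (LINT t|lborel. v t * \<eta> t)" if v: "test_fun v" for v
  proof -
    obtain R v1 v2 where dv: "\<And>t. (v has_real_derivative v1 t) (at t)"
      "\<And>t. (v1 has_real_derivative v2 t) (at t)" "deriv v = v1" "deriv v1 = v2"
      and cv: "continuous_on UNIV v" "continuous_on UNIV v1" "continuous_on UNIV v2"
      and vz: "\<And>t. \<bar>t\<bar> > R \<Longrightarrow> v t = 0" "\<And>t. \<bar>t\<bar> > R \<Longrightarrow> v1 t = 0" "\<And>t. \<bar>t\<bar> > R \<Longrightarrow> v2 t = 0"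
      by (rule test_funE[OF v]) blast
    have cw: "continuous_on UNIV w" "continuous_on UNIV w1" "continuous_on UNIV w2"
      using D by (auto intro!: continuous_at_imp_continuous_on DERIV_isCont)
    have ce: "continuous_on UNIV \<eta>" by (intro smooth_real_continuous test_fun_smooth \<eta>)
    \<comment> \<open>The collected boundary terms of the integrations by parts that move all
      derivatives onto \<open>w\<close>.\<close>
    let ?F = "\<lambda>t. v1 t * w2 t - v t * w3 t + A * (v t * w1 t)"
    let ?f = "\<lambda>t. (v2 t * w2 t + A * (v1 t * w1 t) + B * (v t * w t)) - v t * \<eta> t"
    have F: "(?F has_real_derivative ?f t) (at t)" for t
      by (auto intro!: derivative_eq_intros dv D D3 simp: algebra_simps)
    have f: "continuous_on UNIV ?f" by (intro continuous_intros cv cw ce)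
    have "(LINT t|lborel. ?f t) = 0"
      by (rule integral_deriv_compact_support(2)[OF F f, of R]) (simp add: vz)
    moreover have "integrable lborel (\<lambda>t. v2 t * w2 t + A * (v1 t * w1 t) + B * (v t * w t))"
      by (rule integrable_compact_support[of _ R]) (auto intro!: continuous_intros cv cw simp: vz)
    moreover have "integrable lborel (\<lambda>t. v t * \<eta> t)"
      by (rule integrable_compact_support[of _ R]) (auto intro!: continuous_intros cv ce simp: vz)
    ultimately show ?thesis unfolding test_ip_def dv(3,4) dw by simp
  qed
  assume v: "v \<in> H"
  obtain s where s: "\<And>k. test_fun (s k)" "conv s v" using dense'[OF v] by metis
  have i\<eta>: "integrable lborel (\<lambda>t. \<bar>\<eta> t\<bar>)" using integrable_test_fun[OF \<eta>] by simp
  have l1: "(\<lambda>k. ip (s k) w) \<longlonglongrightarrow> ip v w" by (intro conv_ip s conv_const dec(1))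
  have l2: "(\<lambda>k. LINT t|lborel. s k t * \<eta> t) \<longlonglongrightarrow> (LINT t|lborel. v t * \<eta> t)"
  proof -
    have ii: "integrable lborel (\<lambda>t. u t * \<eta> t)" if "u \<in> H" for u
    proof -
      obtain R where "\<And>t. \<bar>t\<bar> > R \<Longrightarrow> \<eta> t = 0" using \<eta> unfolding test_fun_def by blast
      then show ?thesis
        by (intro integrable_compact_support[of _ R] continuous_intros cont that smooth_real_continuous test_fun_smooth \<eta>) auto
    qed
    have "(\<lambda>k. (LINT t|lborel. s k t * \<eta> t) - (LINT t|lborel. v t * \<eta> t)) \<longlonglongrightarrow> 0"
    proof (rule Lim_null_comparison)
      show "\<forall>\<^sub>F k in sequentially. norm ((LINT t|lborel. s k t * \<eta> t) - (LINT t|lborel. v t * \<eta> t))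
          \<le> c0 * q (\<lambda>t. s k t - v t) * (LINT t|lborel. \<bar>\<eta> t\<bar>)"
      proof (rule always_eventually, rule allI)
        fix k
        have H: "s k \<in> H" "(\<lambda>t. s k t - v t) \<in> H" using s test v diff by auto
        have "norm ((LINT t|lborel. s k t * \<eta> t) - (LINT t|lborel. v t * \<eta> t))
           = \<bar>LINT t|lborel. (s k t - v t) * \<eta> t\<bar>"
          using ii[OF H(1)] ii[OF v] by (simp add: left_diff_distrib)
        also have "\<dots> \<le> (LINT t|lborel. \<bar>(s k t - v t) * \<eta> t\<bar>)" by (rule integral_abs_bound)
        also have "\<dots> \<le> (LINT t|lborel. c0 * q (\<lambda>t. s k t - v t) * \<bar>\<eta> t\<bar>)"
          using integrable_abs[OF ii[OF H(2)]] i\<eta> evaluation[OF H(2)]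
          by (intro integral_mono) (auto simp: abs_mult intro!: mult_right_mono)
        finally show "norm ((LINT t|lborel. s k t * \<eta> t) - (LINT t|lborel. v t * \<eta> t))
          \<le> c0 * q (\<lambda>t. s k t - v t) * (LINT t|lborel. \<bar>\<eta> t\<bar>)" by simp
      qed
      show "(\<lambda>k. c0 * q (\<lambda>t. s k t - v t) * (LINT t|lborel. \<bar>\<eta> t\<bar>)) \<longlonglongrightarrow> 0"
        using s(2) unfolding conv_def by (intro tendsto_mult_left_zero tendsto_mult_right_zero) auto
    qed
    then show ?thesis by (simp add: LIM_zero_iff)
  qed
  have "ip (s k) w = (LINT t|lborel. s k t * \<eta> t)" for k using dec(2)[OF s(1)] parts[OF s(1)] by simp
  then show "ip v (\<lambda>t. (Yb t - Ya t) / (a\<^sup>2 - b\<^sup>2)) = (LINT t|lborel. v t * \<eta> t)"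
    unfolding weq using LIMSEQ_unique l1 l2 by simp
qed

end

text \<open>Green's identity: the Wronskian \<open>Y' Z - Y Z'\<close> has derivative
  \<open>f Y - Z \<eta>\<close>, and it vanishes at infinity because \<open>Y\<close> and
  \<open>Y'\<close> decay exponentially while \<open>Z\<close> and \<open>Z'\<close> are
  bounded.\<close>

lemma resolvent_symmetric:
  fixes f \<eta> :: "real \<Rightarrow> real"
  assumes a: "a > 0" and f: "continuous_on UNIV f" "\<And>t. \<bar>f t\<bar> \<le> M" and \<eta>: "test_fun \<eta>"
    and Y: "\<And>t. (Y has_real_derivative Y' t) (at t)" "\<And>t. (Y' has_real_derivative a\<^sup>2 * Y t - \<eta> t) (at t)"
      "\<And>t. \<bar>Y t\<bar> \<le> C * exp (- a * \<bar>t\<bar>)" "\<And>t. \<bar>Y' t\<bar> \<le> C * exp (- a * \<bar>t\<bar>)"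
    and Z: "\<And>t. (Z has_real_derivative Z' t) (at t)" "\<And>t. (Z' has_real_derivative a\<^sup>2 * Z t - f t) (at t)"
      "\<And>t. \<bar>Z t\<bar> \<le> K" "\<And>t. \<bar>Z' t\<bar> \<le> K"
  shows "integrable lborel (\<lambda>t. f t * Y t)" "integrable lborel (\<lambda>t. Z t * \<eta> t)"
    "(LINT t|lborel. f t * Y t) = (LINT t|lborel. Z t * \<eta> t)"
proof -
  have c: "continuous_on UNIV Y" "continuous_on UNIV Z"
    using Y(1) Z(1) by (auto intro!: continuous_at_imp_continuous_on DERIV_isCont)
  have ce: "continuous_on UNIV \<eta>" by (intro smooth_real_continuous test_fun_smooth \<eta>)
  obtain R where R: "\<And>t. \<bar>t\<bar> > R \<Longrightarrow> \<eta> t = 0" using \<eta> unfolding test_fun_def by blast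
  show i2: "integrable lborel (\<lambda>t. Z t * \<eta> t)"
    by (rule integrable_compact_support[of _ R]) (auto intro!: continuous_intros c ce simp: R)
  show i1: "integrable lborel (\<lambda>t. f t * Y t)"
  proof (rule Bochner_Integration.integrable_bound[of _ "\<lambda>t. M * C * exp (- a * \<bar>t\<bar>)"])
    show "integrable lborel (\<lambda>t. M * C * exp (- a * \<bar>t\<bar>))" using integrable_exp_abs[OF a] by simp
    have "continuous_on UNIV (\<lambda>t. f t * Y t)" by (intro continuous_intros f c)
    then show "(\<lambda>t. f t * Y t) \<in> borel_measurable lborel" by (simp add: borel_measurable_continuous_onI)
    show "AE t in lborel. norm (f t * Y t) \<le> norm (M * C * exp (- a * \<bar>t\<bar>))"
    proof (rule AE_I2)
      fix t
      have "\<bar>f t\<bar> * \<bar>Y t\<bar> \<le> M * (C * exp (- a * \<bar>t\<bar>))"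
        using f(2)[of t] Y(3)[of t] by (intro mult_mono) (auto intro: order_trans[OF abs_ge_zero])
      then have "norm (f t * Y t) \<le> M * C * exp (- a * \<bar>t\<bar>)"
        unfolding real_norm_def abs_mult mult.assoc .
      then show "norm (f t * Y t) \<le> norm (M * C * exp (- a * \<bar>t\<bar>))"
        unfolding real_norm_def by (rule order_trans[OF _ abs_ge_self])
    qed
  qed
  let ?F = "\<lambda>t. Y' t * Z t - Y t * Z' t"
  let ?h = "\<lambda>t. f t * Y t - Z t * \<eta> t"
  have F: "(?F has_real_derivative ?h t) (at t)" for t
    by (auto intro!: derivative_eq_intros Y Z simp: algebra_simps)
  have "(LINT t|lborel. ?h t) = 0"
  proof (rule integral_deriv_vanishing[OF F])
    show "continuous_on UNIV ?h" by (intro continuous_intros f c ce)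
    show "integrable lborel ?h" using i1 i2 by simp
    show "(?F \<longlongrightarrow> 0) at_infinity"
    proof (rule Lim_null_comparison)
      show "\<forall>\<^sub>F t in at_infinity. norm (?F t) \<le> 2 * C * K * exp (- a * \<bar>t\<bar>)"
      proof (rule always_eventually, rule allI)
        fix t
        have "\<bar>Y' t * Z t\<bar> \<le> C * exp (- a * \<bar>t\<bar>) * K" "\<bar>Y t * Z' t\<bar> \<le> C * exp (- a * \<bar>t\<bar>) * K"
          unfolding abs_mult using Y(3,4)[of t] Z(3,4)[of t]
          by (auto intro!: mult_mono intro: order_trans[OF abs_ge_zero])
        then have "norm (?F t) \<le> C * exp (- a * \<bar>t\<bar>) * K + C * exp (- a * \<bar>t\<bar>) * K"
          unfolding real_norm_def by linarith
        then show "norm (?F t) \<le> 2 * C * K * exp (- a * \<bar>t\<bar>)" by (simp add: algebra_simps)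
      qed
      have "((\<lambda>x. exp (- a * x)) \<longlongrightarrow> 0) at_top" using a by real_asymp
      moreover have "filterlim (\<lambda>t::real. \<bar>t\<bar>) at_top at_infinity" using filterlim_norm_at_top[where 'a=real] by (metis (no_types, lifting) ext real_norm_def)
      ultimately have "((\<lambda>t. exp (- a * \<bar>t\<bar>)) \<longlongrightarrow> 0) at_infinity" by (rule filterlim_compose)
      then show "((\<lambda>t. 2 * C * K * exp (- a * \<bar>t\<bar>)) \<longlongrightarrow> 0) at_infinity" by (rule tendsto_mult_right_zero)
    qed
  qed
  then show "(LINT t|lborel. f t * Y t) = (LINT t|lborel. Z t * \<eta> t)" using i1 i2 by simp
qed

context profile_space begin

text \<open>Testing the Euler--Lagrange equation against the Green potential of a test function shows that
  the minimizer itself is the Green potential of its nonlinearity, hence a classical solution.\<close>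

lemma minimizer_equation:
  assumes ab: "a > 0" "b > 0" "a \<noteq> b" and AB: "A = a\<^sup>2 + b\<^sup>2" "B = a\<^sup>2 * b\<^sup>2" and p: "p > 1"
    and y: "y \<in> H" "pow_integral p y = 1" "Q y = best p"
  obtains y' z z' where "\<And>t. (y has_real_derivative y' t) (at t)" "\<And>t. (y' has_real_derivative a\<^sup>2 * y t - z t) (at t)"
    "\<And>t. (z has_real_derivative z' t) (at t)" "\<And>t. (z' has_real_derivative b\<^sup>2 * z t - best p * spow p (y t)) (at t)"
    "(y' \<longlongrightarrow> 0) at_infinity" "(z \<longlongrightarrow> 0) at_infinity" "(z' \<longlongrightarrow> 0) at_infinity"
proof -
  define S where "S = best p"
  define f where "f t = spow p (y t)" for t
  have fc: "continuous_on UNIV f"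
    unfolding f_def[abs_def] by (rule continuous_on_compose2[OF spow_continuous[OF p] cont[OF y(1)]]) auto
  have f0: "(f \<longlongrightarrow> 0) at_infinity"
  proof -
    have "isCont (spow p) 0" using spow_has_derivative[OF p] by (rule DERIV_isCont)
    then have "((\<lambda>t. spow p (y t)) \<longlongrightarrow> spow p 0) at_infinity"
      using tendsto_0_at_infinity[OF y(1)] by (rule isCont_tendsto_compose)
    then show ?thesis by (simp add: f_def[abs_def])
  qed
  define M where "M = (c0 * q y) powr p"
  have fM: "\<bar>f t\<bar> \<le> M" for t
  proof -
    have "\<bar>f t\<bar> = \<bar>y t\<bar> powr p" using spow_pos_eq[of "\<bar>y t\<bar>" p] by (simp add: f_def spow_def abs_mult)
    also have "\<dots> \<le> M" unfolding M_def using evaluation[OF y(1)] p by (intro powr_mono2) auto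
    finally show ?thesis .
  qed
  obtain Za Za' where Za: "\<And>t. (Za has_real_derivative Za' t) (at t)"
    "\<And>t. (Za' has_real_derivative a\<^sup>2 * Za t - f t) (at t)" "\<And>t. \<bar>Za t\<bar> \<le> M / a\<^sup>2" "\<And>t. \<bar>Za' t\<bar> \<le> M / a"
    "(Za \<longlongrightarrow> 0) at_infinity" "(Za' \<longlongrightarrow> 0) at_infinity"
    by (rule bounded_resolvent[OF fc fM ab(1)]) (use f0 in blast)
  obtain Zb Zb' where Zb: "\<And>t. (Zb has_real_derivative Zb' t) (at t)"
    "\<And>t. (Zb' has_real_derivative b\<^sup>2 * Zb t - f t) (at t)" "\<And>t. \<bar>Zb t\<bar> \<le> M / b\<^sup>2" "\<And>t. \<bar>Zb' t\<bar> \<le> M / b"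
    "(Zb \<longlongrightarrow> 0) at_infinity" "(Zb' \<longlongrightarrow> 0) at_infinity"
    by (rule bounded_resolvent[OF fc fM ab(2)]) (use f0 in blast)
  define d where "d = a\<^sup>2 - b\<^sup>2"
  have d: "d \<noteq> 0" using ab by (simp add: d_def)
  have M0: "M \<ge> 0" by (simp add: M_def)
  define Ka where "Ka = M / a\<^sup>2 + M / a"
  define Kb where "Kb = M / b\<^sup>2 + M / b"
  have ZK: "\<bar>Za t\<bar> \<le> Ka" "\<bar>Za' t\<bar> \<le> Ka" "\<bar>Zb t\<bar> \<le> Kb" "\<bar>Zb' t\<bar> \<le> Kb" for t
  proof -
    have "M / a\<^sup>2 \<ge> 0" "M / a \<ge> 0" "M / b\<^sup>2 \<ge> 0" "M / b \<ge> 0" using M0 ab by auto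
    then show "\<bar>Za t\<bar> \<le> Ka" "\<bar>Za' t\<bar> \<le> Ka" "\<bar>Zb t\<bar> \<le> Kb" "\<bar>Zb' t\<bar> \<le> Kb"
      using Za(3,4)[of t] Zb(3,4)[of t] by (simp_all add: Ka_def Kb_def)
  qed
  have cZ: "continuous_on UNIV Za" "continuous_on UNIV Zb"
    using Za(1) Zb(1) by (auto intro!: continuous_at_imp_continuous_on DERIV_isCont)
  have eq: "y t = S * ((Zb t - Za t) / d)" for t
  proof -
    have "y t - S * ((Zb t - Za t) / d) = 0"
    proof (rule fundamental_lemma[of "\<lambda>t. y t - S * ((Zb t - Za t) / d)" t])
      show "continuous_on UNIV (\<lambda>t. y t - S * ((Zb t - Za t) / d))"
        using d by (intro continuous_intros cont y cZ) auto
      fix \<eta> assume \<eta>: "test_fun \<eta>"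
      have ec: "continuous_on UNIV \<eta>" by (intro smooth_real_continuous test_fun_smooth \<eta>)
      obtain R where R: "\<forall>t. \<bar>t\<bar> > R \<longrightarrow> \<eta> t = 0" using \<eta> unfolding test_fun_def by blast
      obtain X where X: "\<And>t. \<bar>\<eta> t\<bar> \<le> X" by (rule test_fun_bounded[OF \<eta>]) blast
      obtain Ya Ya' Ca where Ya: "\<And>t. (Ya has_real_derivative Ya' t) (at t)"
        "\<And>t. (Ya' has_real_derivative a\<^sup>2 * Ya t - \<eta> t) (at t)"
        "\<And>t. \<bar>Ya t\<bar> \<le> Ca * exp (- a * \<bar>t\<bar>)" "\<And>t. \<bar>Ya' t\<bar> \<le> Ca * exp (- a * \<bar>t\<bar>)"
        by (rule bounded_resolvent[OF ec X ab(1), of R]) (use R in blast)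
      obtain Yb Yb' Cb where Yb: "\<And>t. (Yb has_real_derivative Yb' t) (at t)"
        "\<And>t. (Yb' has_real_derivative b\<^sup>2 * Yb t - \<eta> t) (at t)"
        "\<And>t. \<bar>Yb t\<bar> \<le> Cb * exp (- b * \<bar>t\<bar>)" "\<And>t. \<bar>Yb' t\<bar> \<le> Cb * exp (- b * \<bar>t\<bar>)"
        by (rule bounded_resolvent[OF ec X ab(2), of R]) (use R in blast)
      note w = resolvent_in_space[OF ab AB \<eta> Ya Yb]
      note sa = resolvent_symmetric[OF ab(1) fc fM \<eta> Ya Za(1,2) ZK(1,2)]
      note sb = resolvent_symmetric[OF ab(2) fc fM \<eta> Yb Zb(1,2) ZK(3,4)]
      have iy: "integrable lborel (\<lambda>t. y t * \<eta> t)"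
        using R by (intro integrable_compact_support[of _ R] continuous_on_mult cont[OF y(1)] ec) auto
      have "(LINT t|lborel. y t * \<eta> t) = ip y (\<lambda>t. (Yb t - Ya t) / (a\<^sup>2 - b\<^sup>2))"
        using w(2)[OF y(1)] by simp
      also have "\<dots> = S * (LINT t|lborel. f t * ((Yb t - Ya t) / (a\<^sup>2 - b\<^sup>2)))"
        unfolding S_def f_def by (rule euler_lagrange(2)[OF y w(1) p])
      also have "(\<lambda>t. f t * ((Yb t - Ya t) / (a\<^sup>2 - b\<^sup>2))) = (\<lambda>t. (f t * Yb t - f t * Ya t) / d)"
        by (simp add: d_def right_diff_distrib)
      also have "(LINT t|lborel. (f t * Yb t - f t * Ya t) / d) = ((LINT t|lborel. Zb t * \<eta> t) - (LINT t|lborel. Za t * \<eta> t)) / d"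
        using sa sb by simp
      finally have e1: "(LINT t|lborel. y t * \<eta> t) = S * (((LINT t|lborel. Zb t * \<eta> t) - (LINT t|lborel. Za t * \<eta> t)) / d)" .
      have "(LINT t|lborel. (y t - S * ((Zb t - Za t) / d)) * \<eta> t)
         = (LINT t|lborel. y t * \<eta> t - S * ((Zb t * \<eta> t - Za t * \<eta> t) / d))"
        by (rule Bochner_Integration.integral_cong) (auto simp: algebra_simps diff_divide_distrib)
      also have "\<dots> = (LINT t|lborel. y t * \<eta> t) - S * (((LINT t|lborel. Zb t * \<eta> t) - (LINT t|lborel. Za t * \<eta> t)) / d)"
        using iy sa(2) sb(2) by simp
      finally show "(LINT t|lborel. (y t - S * ((Zb t - Za t) / d)) * \<eta> t) = 0" using e1 by simp
    qed
    then show ?thesis by simp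
  qed
  have yeq: "y = (\<lambda>t. S * ((Zb t - Za t) / d))" using eq by (rule ext)
  \<comment> \<open>The auxiliary function \<open>z = (- d\<^sup>2 + a\<^sup>2) y\<close> turns out
    to be \<open>S * Zb\<close>: the operator maps \<open>Za\<close> to \<open>f\<close> and
    \<open>Zb\<close> to \<open>f + (a\<^sup>2 - b\<^sup>2) Zb\<close>, so \<open>f\<close> cancels
    in the difference.\<close>
  define y' where "y' t = S * ((Zb' t - Za' t) / d)" for t
  show thesis
  proof (rule that[of y' "\<lambda>t. S * Zb t" "\<lambda>t. S * Zb' t"])
    show "(y has_real_derivative y' t) (at t)" for t
      unfolding yeq y'_def using d by (auto intro!: derivative_eq_intros Za Zb)
    have "(y' has_real_derivative S * (((b\<^sup>2 * Zb t - f t) - (a\<^sup>2 * Za t - f t)) / d)) (at t)" for t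
      unfolding y'_def[abs_def] using d by (auto intro!: derivative_eq_intros Za Zb)
    moreover have "S * (((b\<^sup>2 * Zb t - f t) - (a\<^sup>2 * Za t - f t)) / d) = a\<^sup>2 * y t - S * Zb t" for t
      unfolding eq[of t] using d by (simp add: field_simps) (simp add: d_def algebra_simps)
    ultimately show "(y' has_real_derivative a\<^sup>2 * y t - S * Zb t) (at t)" for t by simp
    show "((\<lambda>t. S * Zb t) has_real_derivative S * Zb' t) (at t)" for t
      by (auto intro!: derivative_eq_intros Zb)
    show "((\<lambda>t. S * Zb' t) has_real_derivative b\<^sup>2 * (S * Zb t) - best p * spow p (y t)) (at t)" for t
      by (auto intro!: derivative_eq_intros Zb simp: S_def f_def algebra_simps)
    show "((\<lambda>t. S * Zb t) \<longlongrightarrow> 0) at_infinity" "((\<lambda>t. S * Zb' t) \<longlongrightarrow> 0) at_infinity"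
      by (intro tendsto_mult_right_zero Zb)+
    have "((\<lambda>t. S * ((Zb' t - Za' t) / d)) \<longlongrightarrow> S * ((0 - 0) / d)) at_infinity"
      using d by (intro tendsto_intros Za Zb)
    then show "(y' \<longlongrightarrow> 0) at_infinity" by (simp add: y'_def[abs_def])
  qed
qed

end

section \<open>Uniqueness of positive solutions\<close>

lemma DERIV_nonneg_mono:
  fixes f :: "real \<Rightarrow> real"
  assumes "s \<le> t" "\<And>x. (f has_real_derivative f' x) (at x)" "\<And>x. s \<le> x \<Longrightarrow> x \<le> t \<Longrightarrow> f' x \<ge> 0"
  shows "f s \<le> f t"
  by (rule DERIV_nonneg_imp_nondecreasing[OF assms(1)]) (use assms in blast)

text \<open>\<phi> stands for a difference of two solutions, \<psi> for
  \<open>\<phi>'' - a\<^sup>2 \<phi>\<close> and \<open>g\<close> for the difference of the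
  nonlinear terms. The system preserves order while \<phi> is nonnegative; the bound
  \<open>K\<close> is what growth will contradict.\<close>

locale growth_system =
  fixes \<phi> \<phi>' \<psi> \<psi>' g :: "real \<Rightarrow> real" and a b K :: real
  assumes d: "\<And>t. (\<phi> has_real_derivative \<phi>' t) (at t)"
      "\<And>t. (\<phi>' has_real_derivative a\<^sup>2 * \<phi> t + \<psi> t) (at t)"
      "\<And>t. (\<psi> has_real_derivative \<psi>' t) (at t)"
      "\<And>t. (\<psi>' has_real_derivative b\<^sup>2 * \<psi> t + g t) (at t)"
    and g: "\<And>t. \<phi> t \<ge> 0 \<Longrightarrow> g t \<ge> 0" and K: "\<And>t. \<bar>\<phi> t\<bar> \<le> K" and a: "a > 0"
begin

text \<open>With \<open>d\<^sup>2 - a\<^sup>2 = (d - a) (d + a)\<close>, two first-order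
  integrations carry the sign of \<psi> first to \<open>\<phi>' + a \<phi>\<close> and then to
  \<phi>. With \<phi> and \<psi> nonnegative, \<psi>' cannot decrease.\<close>

lemma propagate:
  assumes st: "s \<le> t" and i: "\<phi> s \<ge> 0" "\<phi>' s \<ge> 0" "\<psi>' s \<ge> 0"
    and \<psi>: "\<And>x. s \<le> x \<Longrightarrow> x \<le> t \<Longrightarrow> \<psi> x \<ge> 0"
  shows "\<phi> t \<ge> 0" "\<phi>' t \<ge> 0" "\<psi>' t \<ge> \<psi>' s" "\<psi> t \<ge> \<psi> s"
proof -
  have 1: "\<phi>' x + a * \<phi> x \<ge> 0" if x: "s \<le> x" "x \<le> t" for x
  proof -
    let ?F = "\<lambda>x. exp (- a * x) * (\<phi>' x + a * \<phi> x)"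
    have "?F s \<le> ?F x"
    proof (rule DERIV_nonneg_mono[OF x(1)])
      show "(?F has_real_derivative exp (- a * y) * \<psi> y) (at y)" for y
        by (auto intro!: derivative_eq_intros d simp: algebra_simps power2_eq_square)
    qed (use \<psi> x in auto)
    moreover have "?F s \<ge> 0" using i a by simp
    ultimately have "?F x \<ge> 0" by linarith
    then show ?thesis by (simp add: zero_le_mult_iff)
  qed
  have 2: "\<phi> x \<ge> 0" if x: "s \<le> x" "x \<le> t" for x
  proof -
    let ?F = "\<lambda>x. exp (a * x) * \<phi> x"
    have "?F s \<le> ?F x"
    proof (rule DERIV_nonneg_mono[OF x(1)])
      show "(?F has_real_derivative exp (a * y) * (\<phi>' y + a * \<phi> y)) (at y)" for y
        by (auto intro!: derivative_eq_intros d simp: algebra_simps)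
    qed (use 1 x in auto)
    moreover have "?F s \<ge> 0" using i by simp
    ultimately have "?F x \<ge> 0" by linarith
    then show ?thesis by (simp add: zero_le_mult_iff)
  qed
  show "\<phi> t \<ge> 0" using 2 st by simp
  have "\<phi>' s \<le> \<phi>' t" by (rule DERIV_nonneg_mono[OF st d(2)]) (use 2 \<psi> in auto)
  then show "\<phi>' t \<ge> 0" using i by simp
  have 3: "\<psi>' s \<le> \<psi>' x" if x: "s \<le> x" "x \<le> t" for x
    by (rule DERIV_nonneg_mono[OF x(1) d(4)]) (use 2 \<psi> g x in auto)
  then show "\<psi>' t \<ge> \<psi>' s" using st by simp
  show "\<psi> t \<ge> \<psi> s"
  proof (rule DERIV_nonneg_mono[OF st d(3)])
    show "\<psi>' x \<ge> 0" if "s \<le> x" "x \<le> t" for x using 3[OF that] i by simp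
  qed
qed

text \<open>A continuation argument: if \<psi> became negative, there would be a first time at which
  it equals half of its initial value, but up to that time \<open>propagate\<close> keeps it above
  the initial value. Then \<open>\<phi>'' \<ge> \<psi> s\<close> forever, and quadratic growth of
  \<phi> contradicts its bound.\<close>

lemma no_growth_pos:
  assumes i: "\<phi> s \<ge> 0" "\<phi>' s \<ge> 0" "\<psi>' s \<ge> 0" and \<psi>: "\<psi> s > 0"
  shows False
proof -
  have c\<psi>: "continuous_on X \<psi>" for X using d(3) by (meson DERIV_isCont continuous_at_imp_continuous_on)
  have pos: "\<psi> t \<ge> 0" if t: "s \<le> t" for t
  proof (rule ccontr)
    assume n: "\<not> \<psi> t \<ge> 0"
    define c where "c = \<psi> s / 2"
    have c: "0 < c" "c < \<psi> s" using \<psi> by (auto simp: c_def)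
    define X where "X = {x \<in> {s..t}. \<psi> x = c}"
    have ivt: "\<exists>y. s \<le> y \<and> y \<le> x \<and> \<psi> y = c" if "s \<le> x" "\<psi> x \<le> c" for x
      using IVT2'[of \<psi> x c s] that c c\<psi> by auto
    have "X \<noteq> {}" using ivt[OF t] n c unfolding X_def by force
    have "compact X"
    proof -
      have "closed X" unfolding X_def
        by (rule continuous_closed_preimage_constant[OF c\<psi>]) simp
      then show ?thesis unfolding compact_eq_bounded_closed X_def
        by (auto intro: bounded_subset[OF bounded_closed_interval])
    qed
    then obtain T where T: "T \<in> X" "\<And>x. x \<in> X \<Longrightarrow> T \<le> x"
      using compact_attains_inf[OF _ \<open>X \<noteq> {}\<close>] by metis
    have Ts: "s \<le> T" "T \<le> t" "\<psi> T = c" using T(1) by (auto simp: X_def)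
    have "\<psi> x \<ge> 0" if x: "s \<le> x" "x \<le> T" for x
    proof (rule ccontr)
      assume "\<not> \<psi> x \<ge> 0"
      then obtain y where y: "s \<le> y" "y \<le> x" "\<psi> y = c" using ivt[OF x(1)] c by force
      then have "T \<le> y" using T(2)[of y] x Ts by (auto simp: X_def)
      then have "x = T" using x y by simp
      then show False using \<open>\<not> \<psi> x \<ge> 0\<close> Ts c by simp
    qed
    from propagate(4)[OF Ts(1) i this] show False using Ts(3) c by simp
  qed
  have p: "\<phi> t \<ge> 0" "\<psi> t \<ge> \<psi> s" if "s \<le> t" for t
    using propagate[OF that i] pos by auto
  have f1: "\<phi>' t \<ge> \<psi> s * (t - s)" if t: "s \<le> t" for t
  proof -
    have "\<phi>' s - \<psi> s * (s - s) \<le> \<phi>' t - \<psi> s * (t - s)"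
    proof (rule DERIV_nonneg_mono[OF t])
      show "((\<lambda>t. \<phi>' t - \<psi> s * (t - s)) has_real_derivative (a\<^sup>2 * \<phi> x + \<psi> x) - \<psi> s) (at x)" for x
        by (auto intro!: derivative_eq_intros d)
      show "a\<^sup>2 * \<phi> x + \<psi> x - \<psi> s \<ge> 0" if "s \<le> x" for x using p[OF that] by (simp add: add_increasing)
    qed
    then show ?thesis using i by simp
  qed
  \<comment> \<open>Late enough that \<open>\<psi> s / 2 * (t - s)\<close> exceeds \<open>K\<close>;
    since \<open>t - s \<ge> 1\<close>, the square exceeds it too.\<close>
  define t where "t = s + (1 + (\<bar>K\<bar> + 1) * 2 / \<psi> s)"
  have t: "s \<le> t" "t - s \<ge> 1" using \<psi> by (auto simp: t_def intro!: add_nonneg_nonneg divide_nonneg_pos)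
  have "\<phi> s - \<psi> s / 2 * (s - s)\<^sup>2 \<le> \<phi> t - \<psi> s / 2 * (t - s)\<^sup>2"
  proof (rule DERIV_nonneg_mono[OF t(1)])
    show "((\<lambda>t. \<phi> t - \<psi> s / 2 * (t - s)\<^sup>2) has_real_derivative \<phi>' x - \<psi> s * (x - s)) (at x)" for x
      by (auto intro!: derivative_eq_intros d)
  qed (use f1 in auto)
  then have "\<phi> t \<ge> \<psi> s / 2 * (t - s)\<^sup>2" using i by simp
  moreover have "\<psi> s / 2 * (t - s)\<^sup>2 \<ge> \<psi> s / 2 * (t - s)"
    using t \<psi> by (intro mult_left_mono self_le_power) auto
  moreover have "\<psi> s / 2 * (t - s) = \<psi> s / 2 + (\<bar>K\<bar> + 1)" unfolding t_def using \<psi> by (simp add: field_simps)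
  ultimately show False using K[of t] \<psi> by linarith
qed

text \<open>If \<psi> starts at 0 with positive slope, it is positive slightly later, and the growth
  argument is started there.\<close>

lemma no_growth_forward:
  assumes i: "\<phi> 0 = 0" "\<phi>' 0 = 0" "\<psi> 0 \<ge> 0" "\<psi>' 0 \<ge> 0"
  shows "\<psi> 0 = 0 \<and> \<psi>' 0 = 0"
proof (rule ccontr)
  assume n: "\<not> (\<psi> 0 = 0 \<and> \<psi>' 0 = 0)"
  have "\<not> \<psi> 0 > 0"
  proof
    assume "\<psi> 0 > 0"
    then show False using no_growth_pos[of 0] i by simp
  qed
  then have "\<psi> 0 = 0" using i(3) by linarith
  then have z: "\<psi> 0 = 0" "\<psi>' 0 > 0" using i(4) n by force+
  obtain e where e: "e > 0" "\<And>h. 0 < h \<Longrightarrow> h < e \<Longrightarrow> \<psi> 0 < \<psi> (0 + h)"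
    using DERIV_pos_inc_right[OF d(3) z(2)] by blast
  define s where "s = e / 2"
  have s: "0 < s" "s < e" using e(1) by (auto simp: s_def)
  have "\<psi> x \<ge> 0" if "0 \<le> x" "x \<le> s" for x
    using e(2)[of x] that s z by (cases "x = 0") auto
  note p = propagate[OF less_imp_le[OF s(1)] _ _ _ this]
  show False using no_growth_pos[of s] p i e(2)[of s] s z by auto
qed

end

text \<open>Time reflection changes the sign of \<psi>' and of nothing else that matters at 0, so
  one of the two directions always satisfies the sign condition on the slope.\<close>

lemma no_growth:
  assumes "growth_system \<phi> \<phi>' \<psi> \<psi>' g a b K" and i: "\<phi> 0 = 0" "\<phi>' 0 = 0"
  shows "\<psi> 0 \<le> 0" "\<psi> 0 = 0 \<Longrightarrow> \<psi>' 0 = 0"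
proof -
  interpret g1: growth_system \<phi> \<phi>' \<psi> \<psi>' g a b K by fact
  have refl: "((\<lambda>t. f (- t)) has_real_derivative - f' (- t)) (at t)"
    if "\<And>t. (f has_real_derivative f' t) (at t)" for f f' :: "real \<Rightarrow> real" and t
  proof -
    have "((\<lambda>t. f (- t)) has_real_derivative f' (- t) * (- 1)) (at t)"
      by (rule DERIV_chain2[where g=uminus, OF that]) (auto intro!: derivative_eq_intros)
    then show ?thesis by simp
  qed
  interpret g2: growth_system "\<lambda>t. \<phi> (- t)" "\<lambda>t. - \<phi>' (- t)" "\<lambda>t. \<psi> (- t)" "\<lambda>t. - \<psi>' (- t)" "\<lambda>t. g (- t)" a b K
  proof
    show "((\<lambda>t. \<phi> (- t)) has_real_derivative - \<phi>' (- t)) (at t)" for t by (rule refl[OF g1.d(1)])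
    show "((\<lambda>t. \<psi> (- t)) has_real_derivative - \<psi>' (- t)) (at t)" for t by (rule refl[OF g1.d(3)])
    show "((\<lambda>t. - \<phi>' (- t)) has_real_derivative a\<^sup>2 * \<phi> (- t) + \<psi> (- t)) (at t)" for t
      by (rule DERIV_cong[OF DERIV_minus[OF refl[OF g1.d(2)]]]) simp
    show "((\<lambda>t. - \<psi>' (- t)) has_real_derivative b\<^sup>2 * \<psi> (- t) + g (- t)) (at t)" for t
      by (rule DERIV_cong[OF DERIV_minus[OF refl[OF g1.d(4)]]]) simp
  qed (use g1.g g1.K g1.a in auto)
  show "\<psi> 0 \<le> 0" "\<psi> 0 = 0 \<Longrightarrow> \<psi>' 0 = 0"
    using g1.no_growth_forward g2.no_growth_forward i by (cases "\<psi>' 0 \<ge> 0"; force)+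
qed

lemma gronwall_zero:
  fixes W W' :: "real \<Rightarrow> real"
  assumes W: "\<And>t. (W has_real_derivative W' t) (at t)" and b: "\<And>t. \<bar>W' t\<bar> \<le> C * W t"
    and nn: "\<And>t. W t \<ge> 0" and z: "W 0 = 0"
  shows "W t = 0"
proof (cases "t \<ge> 0")
  case True
  have "- (exp (- C * 0) * W 0) \<le> - (exp (- C * t) * W t)"
  proof (rule DERIV_nonneg_mono[where f="\<lambda>t. - (exp (- C * t) * W t)", OF True])
    show "((\<lambda>t. - (exp (- C * t) * W t)) has_real_derivative exp (- C * x) * (C * W x - W' x)) (at x)" for x
      by (auto intro!: derivative_eq_intros W simp: algebra_simps)
    show "exp (- C * x) * (C * W x - W' x) \<ge> 0" for x using b[of x] by (simp add: abs_le_iff)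
  qed
  then have "W t \<le> 0" using z by (simp add: mult_le_0_iff)
  then show ?thesis using nn[of t] by simp
next
  case False
  have "exp (C * t) * W t \<le> exp (C * 0) * W 0"
  proof (rule DERIV_nonneg_mono[where f="\<lambda>t. exp (C * t) * W t"])
    show "((\<lambda>t. exp (C * t) * W t) has_real_derivative exp (C * x) * (C * W x + W' x)) (at x)" for x
      by (auto intro!: derivative_eq_intros W simp: algebra_simps)
    show "exp (C * x) * (C * W x + W' x) \<ge> 0" for x using b[of x] by (simp add: abs_le_iff)
  qed (use False in simp)
  then have "W t \<le> 0" using z by (simp add: mult_le_0_iff)
  then show ?thesis using nn[of t] by simp
qed

text \<open>The equation \<open>(- d\<^sup>2 + a\<^sup>2) (- d\<^sup>2 + b\<^sup>2) v = k |v|\<^sup>p\<^sup>-\<^sup>1 v\<close> as a system of two second order equations.\<close>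

locale soliton =
  fixes v v' z z' :: "real \<Rightarrow> real" and a b p k :: real
  assumes d: "\<And>t. (v has_real_derivative v' t) (at t)"
      "\<And>t. (v' has_real_derivative a\<^sup>2 * v t - z t) (at t)"
      "\<And>t. (z has_real_derivative z' t) (at t)"
      "\<And>t. (z' has_real_derivative b\<^sup>2 * z t - k * spow p (v t)) (at t)"
    and lim: "(v \<longlongrightarrow> 0) at_infinity" "(v' \<longlongrightarrow> 0) at_infinity" "(z \<longlongrightarrow> 0) at_infinity" "(z' \<longlongrightarrow> 0) at_infinity"
    and vmax: "\<And>t. \<bar>v t\<bar> \<le> v 0" and v0: "v 0 > 0" and p: "p > 1" and a: "a > 0"
begin

lemma v'0: "v' 0 = 0"
  by (rule DERIV_local_max[OF d(1) zero_less_one]) (use vmax in \<open>force simp: abs_le_iff\<close>)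

lemma v''0: "a\<^sup>2 * v 0 - z 0 \<le> 0"
proof (rule ccontr)
  assume "\<not> a\<^sup>2 * v 0 - z 0 \<le> 0"
  then have "a\<^sup>2 * v 0 - z 0 > 0" by simp
  from DERIV_pos_inc_right[OF d(2) this] obtain e where
    e: "e > 0" "\<And>h. 0 < h \<Longrightarrow> h < e \<Longrightarrow> v' 0 < v' (0 + h)" by blast
  have "v 0 < v (e / 2)"
  proof -
    obtain x where x: "0 < x" "x < e / 2" "v (e / 2) - v 0 = (e / 2 - 0) * v' x"
      using MVT2[of 0 "e/2" v v'] d(1) e(1) by auto
    then have "v' x > 0" using e(2)[of x] v'0 by simp
    then show ?thesis using x e(1) by (metis diff_gt_0_iff_gt half_gt_zero diff_zero mult_pos_pos)
  qed
  then show False using vmax[of "e/2"] by linarith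
qed

text \<open>The conserved quantity \<open>v' v''' - v''\<^sup>2 / 2 - (a\<^sup>2 + b\<^sup>2)
  v'\<^sup>2 / 2 + a\<^sup>2 b\<^sup>2 v\<^sup>2 / 2 - k |v|\<^sup>p\<^sup>+\<^sup>1 / (p +
  1)\<close> is 0 because it tends to 0 at infinity. At the maximum v' = 0, which expresses the
  squared curvature there through the height.\<close>

lemma hamiltonian: "(a\<^sup>2 * v 0 - z 0)\<^sup>2 = a\<^sup>2 * b\<^sup>2 * (v 0)\<^sup>2 - 2 * k * v 0 powr (p + 1) / (p + 1)"
proof -
  define r where "r t = \<bar>v t\<bar> powr (p + 1) / (p + 1)" for t
  define E where "E t = a\<^sup>2 * (v' t)\<^sup>2 - v' t * z' t - (a\<^sup>2 * v t - z t)\<^sup>2 / 2 - (a\<^sup>2 + b\<^sup>2) / 2 * (v' t)\<^sup>2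
      + a\<^sup>2 * b\<^sup>2 / 2 * (v t)\<^sup>2 - k * r t" for t
  have dp: "(r has_real_derivative spow p (v t) * v' t) (at t)" for t
    unfolding r_def[abs_def]
    by (rule DERIV_cong[OF DERIV_cdivide[OF DERIV_chain2[OF abs_powr_has_derivative d(1)]]]) (use p in simp_all)
  have "(E has_real_derivative 0) (at t)" for t
    unfolding E_def[abs_def] using p
    by (auto intro!: derivative_eq_intros d dp simp: field_simps power2_eq_square)
  then have c: "E t = E 0" for t using DERIV_isconst_all by blast
  have pw: "(r \<longlongrightarrow> 0) at_infinity"
  proof -
    have "((\<lambda>t. \<bar>v t\<bar> powr (p + 1)) \<longlongrightarrow> \<bar>0\<bar> powr (p + 1)) at_infinity"
      using p by (intro tendsto_powr' tendsto_intros lim) auto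
    then have "((\<lambda>t. \<bar>v t\<bar> powr (p + 1)) \<longlongrightarrow> 0) at_infinity" by simp
    then show ?thesis unfolding r_def[abs_def] by (rule tendsto_divide_zero)
  qed
  have "(E \<longlongrightarrow> a\<^sup>2 * 0\<^sup>2 - 0 * 0 - (a\<^sup>2 * 0 - 0)\<^sup>2 / 2 - (a\<^sup>2 + b\<^sup>2) / 2 * 0\<^sup>2
      + a\<^sup>2 * b\<^sup>2 / 2 * 0\<^sup>2 - k * 0) at_infinity"
    unfolding E_def[abs_def] by (intro tendsto_intros lim pw) auto
  moreover have "(E \<longlongrightarrow> E 0) at_infinity" using c by (intro tendsto_eventually) auto
  ultimately have "E 0 = 0" using tendsto_unique[OF trivial_limit_at_infinity] by fastforce
  then show ?thesis unfolding E_def v'0 r_def using v0 by simp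
qed

text \<open>For p > 1, lowering the height by a factor c < 1 strengthens the coefficient of the
  nonlinearity.\<close>

lemma scaled:
  assumes c: "c > 0"
  shows "soliton (\<lambda>t. c * v t) (\<lambda>t. c * v' t) (\<lambda>t. c * z t) (\<lambda>t. c * z' t) a b p (c powr (1 - p) * k)"
proof
  show "((\<lambda>t. c * v t) has_real_derivative c * v' t) (at t)" for t by (intro DERIV_cmult d)
  show "((\<lambda>t. c * z t) has_real_derivative c * z' t) (at t)" for t by (intro DERIV_cmult d)
  show "((\<lambda>t. c * v' t) has_real_derivative a\<^sup>2 * (c * v t) - c * z t) (at t)" for t
    using DERIV_cmult[OF d(2), of c t] by (simp add: algebra_simps)
  show "((\<lambda>t. c * z' t) has_real_derivative b\<^sup>2 * (c * z t) - c powr (1 - p) * k * spow p (c * v t)) (at t)" for t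
  proof -
    have "c powr (1 - p) * c powr p = c" using c by (simp flip: powr_add)
    then have "c powr (1 - p) * k * spow p (c * v t) = c * (k * spow p (v t))"
      using c by (simp add: spow_mult)
    then show ?thesis
      by (intro DERIV_cong[OF DERIV_cmult[OF d(4)]]) (auto simp: right_diff_distrib)
  qed
  show "\<bar>c * v t\<bar> \<le> c * v 0" for t using vmax[of t] c by (simp add: abs_mult)
qed (use v0 c p a in \<open>auto intro!: tendsto_mult_right_zero lim\<close>)

end

text \<open>Two opposing estimates at the common maximum: absence of growth gives
  \<open>w'' \<le> v'' \<le> 0\<close>, so \<open>w\<close> bends at least as much, while the
  conserved energy with the larger coefficient \<open>l\<close> says that it bends at most as much.
  Equality forces \<open>k = l\<close> and equal Cauchy data, and Gronwall finishes. Condition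
  \<open>nn\<close> allows \<open>k\<close> to be replaced by \<open>l\<close> in front of
  \<open>spow p (w t)\<close> where \<open>v t \<le> w t\<close>.\<close>

lemma soliton_comparison:
  assumes s1: "soliton v v' z z' a b p k" and s2: "soliton w w' y y' a b p l"
    and eq: "v 0 = w 0" and kl: "0 \<le> k" "k \<le> l" and nn: "\<And>t. v t \<le> w t \<Longrightarrow> w t \<ge> 0"
  shows "k = l" "v t = w t"
proof -
  interpret s1: soliton v v' z z' a b p k by (fact s1)
  interpret s2: soliton w w' y y' a b p l by (fact s2)
  let ?g = "\<lambda>t. l * spow p (w t) - k * spow p (v t)"
  have gs: "growth_system (\<lambda>t. w t - v t) (\<lambda>t. w' t - v' t) (\<lambda>t. z t - y t) (\<lambda>t. z' t - y' t) ?g a b (2 * v 0)"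
  proof
    show "((\<lambda>t. w t - v t) has_real_derivative w' t - v' t) (at t)" for t by (intro DERIV_diff s1.d s2.d)
    show "((\<lambda>t. z t - y t) has_real_derivative z' t - y' t) (at t)" for t by (intro DERIV_diff s1.d s2.d)
    show "((\<lambda>t. w' t - v' t) has_real_derivative a\<^sup>2 * (w t - v t) + (z t - y t)) (at t)" for t
      by (rule DERIV_cong[OF DERIV_diff[OF s2.d(2) s1.d(2)]]) (simp add: algebra_simps)
    show "((\<lambda>t. z' t - y' t) has_real_derivative b\<^sup>2 * (z t - y t) + ?g t) (at t)" for t
      by (rule DERIV_cong[OF DERIV_diff[OF s1.d(4) s2.d(4)]]) (simp add: algebra_simps)
    show "?g t \<ge> 0" if "w t - v t \<ge> 0" for t
    proof -
      have vw: "v t \<le> w t" using that by simp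
      have "k * spow p (v t) \<le> k * spow p (w t)" using spow_mono[OF s1.p vw] kl(1) by (rule mult_left_mono)
      also have "\<dots> \<le> l * spow p (w t)" using kl(2) nn[OF vw] by (intro mult_right_mono) (auto simp: spow_def)
      finally show ?thesis by simp
    qed
    show "\<bar>w t - v t\<bar> \<le> 2 * v 0" for t using s1.vmax[of t] s2.vmax[of t] eq by linarith
    show "a > 0" by (rule s1.a)
  qed
  note ng = no_growth[OF gs]
  have le: "z 0 \<le> y 0" using ng(1) eq s1.v'0 s2.v'0 by simp
  define M where "M = v 0"
  have c: "a\<^sup>2 * M - y 0 \<le> a\<^sup>2 * M - z 0" "a\<^sup>2 * M - z 0 \<le> 0" using le s1.v''0 by (auto simp: M_def)
  then have sq: "(a\<^sup>2 * M - z 0)\<^sup>2 \<le> (a\<^sup>2 * M - y 0)\<^sup>2"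
    using abs_le_square_iff[of "a\<^sup>2 * M - z 0" "a\<^sup>2 * M - y 0"] by simp
  define P where "P = 2 * M powr (p + 1) / (p + 1)"
  have P: "P > 0" using s1.v0 s1.p by (simp add: M_def P_def)
  have "(a\<^sup>2 * M - z 0)\<^sup>2 = a\<^sup>2 * b\<^sup>2 * M\<^sup>2 - k * P" "(a\<^sup>2 * M - y 0)\<^sup>2 = a\<^sup>2 * b\<^sup>2 * M\<^sup>2 - l * P"
    using s1.hamiltonian s2.hamiltonian eq unfolding M_def P_def by (simp_all add: ac_simps)
  then have "l * P \<le> k * P" using sq by linarith
  then have "l \<le> k" using P by (simp only: mult_le_cancel_right_pos)
  then show kl': "k = l" using kl by simp
  have "(a\<^sup>2 * M - z 0)\<^sup>2 = (a\<^sup>2 * M - y 0)\<^sup>2" using s1.hamiltonian s2.hamiltonian eq kl' unfolding M_def by simp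
  then have "a\<^sup>2 * M - z 0 = a\<^sup>2 * M - y 0 \<or> a\<^sup>2 * M - z 0 = - (a\<^sup>2 * M - y 0)"
    by (simp only: power2_eq_iff)
  then have zy: "z 0 = y 0" using c by linarith
  have zy': "z' 0 = y' 0" using ng(2) eq s1.v'0 s2.v'0 zy by simp
  define L where "L = k * (p * M powr (p - 1))"
  have L0: "L \<ge> 0" unfolding L_def using kl s1.p by simp
  let ?\<phi> = "\<lambda>t. w t - v t" and ?\<phi>' = "\<lambda>t. w' t - v' t" and ?\<psi> = "\<lambda>t. z t - y t" and ?\<psi>' = "\<lambda>t. z' t - y' t"
  have gL: "\<bar>?g t\<bar> \<le> L * \<bar>?\<phi> t\<bar>" for t
  proof -
    have "\<bar>spow p (w t) - spow p (v t)\<bar> \<le> p * M powr (p - 1) * \<bar>w t - v t\<bar>"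
      by (rule spow_lipschitz[OF s1.p]) (use s1.vmax s2.vmax eq in \<open>auto simp: M_def\<close>)
    then have "k * \<bar>spow p (w t) - spow p (v t)\<bar> \<le> k * (p * M powr (p - 1) * \<bar>w t - v t\<bar>)"
      using kl(1) by (rule mult_left_mono)
    moreover have "\<bar>?g t\<bar> = k * \<bar>spow p (w t) - spow p (v t)\<bar>"
      unfolding kl'[symmetric] right_diff_distrib[symmetric] abs_mult using kl(1) by simp
    ultimately show ?thesis by (simp add: L_def mult.assoc)
  qed
  interpret gs: growth_system ?\<phi> ?\<phi>' ?\<psi> ?\<psi>' ?g a b "2 * v 0" by (fact gs)
  let ?W = "\<lambda>t. (?\<phi> t)\<^sup>2 + (?\<phi>' t)\<^sup>2 + (?\<psi> t)\<^sup>2 + (?\<psi>' t)\<^sup>2"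
  let ?W' = "\<lambda>t. 2 * (?\<phi> t * ?\<phi>' t) + 2 * (?\<phi>' t * (a\<^sup>2 * ?\<phi> t + ?\<psi> t)) + 2 * (?\<psi> t * ?\<psi>' t)
      + 2 * (?\<psi>' t * (b\<^sup>2 * ?\<psi> t + ?g t))"
  have "?W t = 0"
  proof (rule gronwall_zero[where W="?W" and W'="?W'" and C="4 + a\<^sup>2 + b\<^sup>2 + L"])
    have sqd: "((\<lambda>t. (f t)\<^sup>2) has_real_derivative 2 * (f t * f')) (at t)"
      if "(f has_real_derivative f') (at t)" for f f' t
      by (rule DERIV_cong[OF DERIV_power[OF that, of 2]]) simp
    show "(?W has_real_derivative ?W' t) (at t)" for t
      by (intro DERIV_add sqd gs.d)
    show "\<bar>?W' t\<bar> \<le> (4 + a\<^sup>2 + b\<^sup>2 + L) * ?W t" for t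
    proof -
      have key: "\<bar>2 * (x * x1) + 2 * (x1 * (a\<^sup>2 * x + y)) + 2 * (y * y1) + 2 * (y1 * (b\<^sup>2 * y + h))\<bar>
         \<le> (4 + a\<^sup>2 + b\<^sup>2 + L) * (x\<^sup>2 + x1\<^sup>2 + y\<^sup>2 + y1\<^sup>2)" if h: "\<bar>h\<bar> \<le> L * \<bar>x\<bar>" for x x1 y y1 h :: real
      proof -
        have s: "2 * \<bar>r * s\<bar> \<le> r\<^sup>2 + s\<^sup>2" for r s :: real
          using sum_squares_bound[of "\<bar>r\<bar>" "\<bar>s\<bar>"] by (simp add: abs_mult)
        have 1: "\<bar>2 * (x * x1)\<bar> \<le> x\<^sup>2 + x1\<^sup>2" "\<bar>2 * (x1 * y)\<bar> \<le> x1\<^sup>2 + y\<^sup>2" "\<bar>2 * (y * y1)\<bar> \<le> y\<^sup>2 + y1\<^sup>2"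
          using s[of x x1] s[of x1 y] s[of y y1] by (simp_all add: abs_mult)
        have 2: "\<bar>2 * (a\<^sup>2 * (x * x1))\<bar> \<le> a\<^sup>2 * (x\<^sup>2 + x1\<^sup>2)" "\<bar>2 * (b\<^sup>2 * (y * y1))\<bar> \<le> b\<^sup>2 * (y\<^sup>2 + y1\<^sup>2)"
          using mult_left_mono[OF s[of x x1], of "a\<^sup>2"] mult_left_mono[OF s[of y y1], of "b\<^sup>2"] by (simp_all add: abs_mult ac_simps)
        have 3: "\<bar>2 * (y1 * h)\<bar> \<le> L * (x\<^sup>2 + y1\<^sup>2)"
        proof -
          have "2 * \<bar>y1\<bar> * \<bar>h\<bar> \<le> 2 * \<bar>y1\<bar> * (L * \<bar>x\<bar>)" using h by (intro mult_left_mono) auto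
          also have "\<dots> = L * (2 * \<bar>x * y1\<bar>)" by (simp add: abs_mult)
          also have "\<dots> \<le> L * (x\<^sup>2 + y1\<^sup>2)" using s[of x y1] L0 by (rule mult_left_mono)
          finally show ?thesis by (simp add: abs_mult)
        qed
        have eq: "2 * (x * x1) + 2 * (x1 * (a\<^sup>2 * x + y)) + 2 * (y * y1) + 2 * (y1 * (b\<^sup>2 * y + h))
          = 2 * (x * x1) + 2 * (a\<^sup>2 * (x * x1)) + 2 * (x1 * y) + 2 * (y * y1) + 2 * (b\<^sup>2 * (y * y1)) + 2 * (y1 * h)"
          by (simp add: algebra_simps)
        have "\<bar>2 * (x * x1) + 2 * (a\<^sup>2 * (x * x1)) + 2 * (x1 * y) + 2 * (y * y1) + 2 * (b\<^sup>2 * (y * y1)) + 2 * (y1 * h)\<bar>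
          \<le> (x\<^sup>2 + x1\<^sup>2) + a\<^sup>2 * (x\<^sup>2 + x1\<^sup>2) + (x1\<^sup>2 + y\<^sup>2) + (y\<^sup>2 + y1\<^sup>2) + b\<^sup>2 * (y\<^sup>2 + y1\<^sup>2) + L * (x\<^sup>2 + y1\<^sup>2)"
          by (intro order_trans[OF abs_triangle_ineq] add_mono 1 2 3)
        also have "\<dots> \<le> (4 + a\<^sup>2 + b\<^sup>2 + L) * (x\<^sup>2 + x1\<^sup>2 + y\<^sup>2 + y1\<^sup>2)"
        proof -
          have "a\<^sup>2 * (x\<^sup>2 + x1\<^sup>2) \<le> a\<^sup>2 * (x\<^sup>2 + x1\<^sup>2 + y\<^sup>2 + y1\<^sup>2)" "b\<^sup>2 * (y\<^sup>2 + y1\<^sup>2) \<le> b\<^sup>2 * (x\<^sup>2 + x1\<^sup>2 + y\<^sup>2 + y1\<^sup>2)"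
            "L * (x\<^sup>2 + y1\<^sup>2) \<le> L * (x\<^sup>2 + x1\<^sup>2 + y\<^sup>2 + y1\<^sup>2)"
            using L0 by (intro mult_left_mono; simp)+
          moreover have "(x\<^sup>2 + x1\<^sup>2) + (x1\<^sup>2 + y\<^sup>2) + (y\<^sup>2 + y1\<^sup>2) \<le> 4 * (x\<^sup>2 + x1\<^sup>2 + y\<^sup>2 + y1\<^sup>2)"
          proof -
            have "X + X1 + (X1 + Y) + (Y + Y1) \<le> 4 * (X + X1 + Y + Y1)"
              if "0 \<le> X" "0 \<le> X1" "0 \<le> Y" "0 \<le> Y1" for X X1 Y Y1 :: real
              using that by argo
            then show ?thesis by simp
          qed
          moreover define N where "N = x\<^sup>2 + x1\<^sup>2 + y\<^sup>2 + y1\<^sup>2"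
          ultimately have "(x\<^sup>2 + x1\<^sup>2) + a\<^sup>2 * (x\<^sup>2 + x1\<^sup>2) + (x1\<^sup>2 + y\<^sup>2) + (y\<^sup>2 + y1\<^sup>2) + b\<^sup>2 * (y\<^sup>2 + y1\<^sup>2) + L * (x\<^sup>2 + y1\<^sup>2)
              \<le> 4 * N + a\<^sup>2 * N + b\<^sup>2 * N + L * N" unfolding N_def by linarith
          also have "\<dots> = (4 + a\<^sup>2 + b\<^sup>2 + L) * N" by (simp add: algebra_simps)
          finally show ?thesis unfolding N_def .
        qed
        finally show ?thesis unfolding eq .
      qed
      show ?thesis by (rule key[OF gL])
    qed
    show "?W 0 = 0" using eq s1.v'0 s2.v'0 zy zy' by simp
  qed simp
  then have "(w t - v t)\<^sup>2 = 0"
    using zero_le_power2[of "?\<phi> t"] zero_le_power2[of "?\<phi>' t"] zero_le_power2[of "?\<psi> t"] zero_le_power2[of "?\<psi>' t"] by linarith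
  then show "v t = w t" by simp
qed

theorem soliton_unique:
  assumes U: "soliton U U' zU zU' a b p 1" and V: "soliton V V' zV zV' a b p 1"
    and pos: "\<And>t. U t > 0"
  shows "V t = U t"
proof -
  interpret U: soliton U U' zU zU' a b p 1 by (fact U)
  interpret V: soliton V V' zV zV' a b p 1 by (fact V)
  have p: "p > 1" by (rule U.p)
  show ?thesis
  proof (cases "V 0 \<ge> U 0")
    case True
    define c where "c = U 0 / V 0"
    have c: "0 < c" "c \<le> 1" using True U.v0 V.v0 by (auto simp: c_def)
    have k: "1 \<le> c powr (1 - p)"
    proof -
      have "1 powr (1 - p) \<le> c powr (1 - p)" using c p by (intro powr_mono2') auto
      then show ?thesis by simp
    qed
    note r = soliton_comparison[OF U V.scaled[OF c(1)]]
    have e: "U 0 = c * V 0" using V.v0 by (simp add: c_def)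
    \<comment> \<open>\<open>V\<close> may change sign, but wherever the scaled \<open>V\<close>
      dominates \<open>U\<close> it is positive since \<open>U\<close> is.\<close>
    have nn: "c * V t \<ge> 0" if "U t \<le> c * V t" for t using that pos[of t] by linarith
    have "1 = c powr (1 - p) * 1" "U t = c * V t" using r[OF e] k nn by auto
    then have "c = 1" using c p by (simp add: powr_def)
    then show ?thesis using \<open>U t = c * V t\<close> by simp
  next
    case False
    define c where "c = V 0 / U 0"
    have c: "0 < c" "c \<le> 1" using False U.v0 V.v0 by (auto simp: c_def)
    have k: "1 \<le> c powr (1 - p)"
    proof -
      have "1 powr (1 - p) \<le> c powr (1 - p)" using c p by (intro powr_mono2') auto
      then show ?thesis by simp
    qed
    note r = soliton_comparison[OF V U.scaled[OF c(1)]]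
    have e: "V 0 = c * U 0" using U.v0 by (simp add: c_def)
    have nn: "c * U t \<ge> 0" for t using pos[of t] c by simp
    have "1 = c powr (1 - p) * 1" "V t = c * U t" using r[OF e] k nn by auto
    then have "c = 1" using c p by (simp add: powr_def)
    then show ?thesis using \<open>V t = c * U t\<close> by simp
  qed
qed

section \<open>Explicit solutions\<close>

lemma attains_abs_max:
  fixes y :: "real \<Rightarrow> real"
  assumes c: "continuous_on UNIV y" and l: "(y \<longlongrightarrow> 0) at_infinity" and nz: "y s \<noteq> 0"
  obtains m where "\<And>t. \<bar>y t\<bar> \<le> \<bar>y m\<bar>"
proof -
  have "eventually (\<lambda>t. dist (y t) 0 < \<bar>y s\<bar>) at_infinity" using nz tendstoD[OF l] by simp
  then obtain R where R: "\<And>t. R \<le> \<bar>t\<bar> \<Longrightarrow> \<bar>y t\<bar> < \<bar>y s\<bar>" unfolding eventually_at_infinity by auto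
  define T where "T = max \<bar>R\<bar> \<bar>s\<bar>"
  have "continuous_on {-T..T} (\<lambda>t. \<bar>y t\<bar>)" by (intro continuous_intros continuous_on_subset[OF c]) auto
  moreover have "s \<in> {-T..T}" by (auto simp: T_def)
  ultimately obtain m where m: "m \<in> {-T..T}" "\<And>t. t \<in> {-T..T} \<Longrightarrow> \<bar>y t\<bar> \<le> \<bar>y m\<bar>"
    using continuous_attains_sup[of "{-T..T}" "\<lambda>t. \<bar>y t\<bar>"] by auto
  show thesis
  proof (rule that[of m])
    fix t
    show "\<bar>y t\<bar> \<le> \<bar>y m\<bar>"
    proof (cases "t \<in> {-T..T}")
      case False
      then have "R \<le> \<bar>t\<bar>" by (auto simp: T_def)
      then show ?thesis using R[of t] m(2)[OF \<open>s \<in> {-T..T}\<close>] by linarith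
    qed (rule m(2))
  qed
qed

lemma filterlim_add_const_at_infinity: "filterlim (\<lambda>t::real. t + m) at_infinity at_infinity"
  unfolding filterlim_iff eventually_at_infinity real_norm_def
proof (intro allI impI)
  fix P :: "real \<Rightarrow> bool" assume "\<exists>b. \<forall>x. b \<le> \<bar>x\<bar> \<longrightarrow> P x"
  then obtain b where b: "\<And>x. b \<le> \<bar>x\<bar> \<Longrightarrow> P x" by blast
  show "\<exists>c. \<forall>x. c \<le> \<bar>x\<bar> \<longrightarrow> P (x + m)"
  proof (intro exI allI impI b)
    fix x assume "\<bar>b\<bar> + \<bar>m\<bar> \<le> \<bar>x\<bar>"
    then show "b \<le> \<bar>x + m\<bar>" by linarith
  qed
qed

context profile_space begin

text \<open>A minimizer becomes a soliton with coefficient 1 after a change of sign, a translation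
  of its absolute maximum to 0 and a scaling, so uniqueness identifies it with \<open>U\<close>.
  Thus \<open>U\<close> inherits membership in \<open>H\<close> and minimality.\<close>

theorem soliton_minimizer:
  assumes ab: "a > 0" "b > 0" "a \<noteq> b" and AB: "A = a\<^sup>2 + b\<^sup>2" "B = a\<^sup>2 * b\<^sup>2" and p: "p > 1"
    and U: "soliton U U' zU zU' a b p 1" and pos: "\<And>t. U t > 0"
  shows "U \<in> H" "Q U = pow_integral p U" "pow_integral p U > 0"
    "best p = pow_integral p U powr ((p - 1) / (p + 1))"
proof -
  obtain y where y: "y \<in> H" "pow_integral p y = 1" "Q y = best p" and S: "best p > 0"
    using minimizer_exists[OF p] by blast
  obtain y' z z' where d: "\<And>t. (y has_real_derivative y' t) (at t)" "\<And>t. (y' has_real_derivative a\<^sup>2 * y t - z t) (at t)"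
    "\<And>t. (z has_real_derivative z' t) (at t)" "\<And>t. (z' has_real_derivative b\<^sup>2 * z t - best p * spow p (y t)) (at t)"
    and l: "(y' \<longlongrightarrow> 0) at_infinity" "(z \<longlongrightarrow> 0) at_infinity" "(z' \<longlongrightarrow> 0) at_infinity"
    by (rule minimizer_equation[OF ab AB p y]) blast
  have ly: "(y \<longlongrightarrow> 0) at_infinity" by (rule tendsto_0_at_infinity[OF y(1)])
  have "\<exists>s. y s \<noteq> 0"
  proof (rule ccontr)
    assume "\<not> (\<exists>s. y s \<noteq> 0)"
    then show False using y(2) by (simp add: pow_integral_def)
  qed
  then obtain s where s: "y s \<noteq> 0" by blast
  obtain m where m: "\<And>t. \<bar>y t\<bar> \<le> \<bar>y m\<bar>" by (rule attains_abs_max[OF cont[OF y(1)] ly s]) blast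
  have ym: "y m \<noteq> 0" using m[of s] s by auto
  define \<sigma> where "\<sigma> = sgn (y m)"
  have \<sigma>: "\<bar>\<sigma>\<bar> = 1" "\<sigma> * y m = \<bar>y m\<bar>" using ym by (auto simp: \<sigma>_def sgn_if)
  have \<sigma>': "\<sigma> = 1 \<or> \<sigma> = -1" using \<sigma>(1) by linarith
  have sp: "spow p (\<sigma> * x) = \<sigma> * spow p x" for x using \<sigma>' spow_minus[of p x] by auto
  have sh: "((\<lambda>t. \<sigma> * f (t + m)) has_real_derivative \<sigma> * f') (at t)"
    if "(f has_real_derivative f') (at (t + m))" for f f' t
    using that by (intro DERIV_cmult) (simp add: DERIV_shift)
  have ls: "((\<lambda>t. \<sigma> * f (t + m)) \<longlongrightarrow> 0) at_infinity" if "(f \<longlongrightarrow> 0) at_infinity" for f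
    by (rule tendsto_mult_right_zero[OF filterlim_compose[OF that filterlim_add_const_at_infinity]])
  have "soliton (\<lambda>t. \<sigma> * y (t + m)) (\<lambda>t. \<sigma> * y' (t + m)) (\<lambda>t. \<sigma> * z (t + m)) (\<lambda>t. \<sigma> * z' (t + m)) a b p (best p)"
  proof
    show "((\<lambda>t. \<sigma> * y' (t + m)) has_real_derivative a\<^sup>2 * (\<sigma> * y (t + m)) - \<sigma> * z (t + m)) (at t)" for t
      by (rule DERIV_cong[OF sh[OF d(2)]]) (simp add: algebra_simps)
    show "((\<lambda>t. \<sigma> * z' (t + m)) has_real_derivative b\<^sup>2 * (\<sigma> * z (t + m)) - best p * spow p (\<sigma> * y (t + m))) (at t)" for t
      unfolding sp by (rule DERIV_cong[OF sh[OF d(4)]]) (simp add: algebra_simps)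
    show "\<bar>\<sigma> * y (t + m)\<bar> \<le> \<sigma> * y (0 + m)" for t using m[of "t + m"] \<sigma> by (simp add: abs_mult)
    show "0 < \<sigma> * y (0 + m)" using \<sigma>(2) ym by simp
  qed (intro sh d ls l ly p ab)+
  then interpret Y: soliton "\<lambda>t. \<sigma> * y (t + m)" "\<lambda>t. \<sigma> * y' (t + m)" "\<lambda>t. \<sigma> * z (t + m)" "\<lambda>t. \<sigma> * z' (t + m)" a b p "best p" .
  \<comment> \<open>The scaling for which \<open>c powr (1 - p) * best p = 1\<close>. With it both
    \<open>Q U = c\<^sup>2 * best p\<close> and the power integral of \<open>U\<close> equal
    \<open>c powr (p + 1)\<close>.\<close>
  define c where "c = best p powr (1 / (p - 1))"
  have c: "c > 0" using S by (simp add: c_def)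
  have cS: "c powr (p - 1) = best p" using S p by (simp add: c_def powr_powr)
  have "c powr (1 - p) * best p = 1"
    unfolding cS[symmetric] using c by (simp flip: powr_add)
  then have "soliton (\<lambda>t. c * (\<sigma> * y (t + m))) (\<lambda>t. c * (\<sigma> * y' (t + m))) (\<lambda>t. c * (\<sigma> * z (t + m))) (\<lambda>t. c * (\<sigma> * z' (t + m))) a b p 1"
    using Y.scaled[OF c] by simp
  from soliton_unique[OF U this pos] have Ueq: "U = (\<lambda>t. (c * \<sigma>) * y (t + m))" by (auto simp: mult.assoc)
  show UH: "U \<in> H" unfolding Ueq by (intro scale shift y)
  have qU: "Q U = c\<^sup>2 * best p"
    unfolding Ueq q_scale[OF shift(1)[OF y(1)]] shift(2)[OF y(1)] using c y(3) \<sigma>(1) by (simp add: abs_mult power_mult_distrib)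
  have iU: "pow_integral p U = c powr (p + 1)"
    unfolding Ueq pow_integral_scale pow_integral_shift[of p y m] y(2) using c \<sigma>(1) by (simp add: abs_mult)
  have "c powr (p + 1) = c powr 2 * c powr (p - 1)" by (simp add: add.commute flip: powr_add)
  then show "Q U = pow_integral p U" unfolding qU iU cS using c by simp
  show "pow_integral p U > 0" unfolding iU using c by simp
  show "best p = pow_integral p U powr ((p - 1) / (p + 1))" unfolding iU powr_powr using p cS by simp
qed

end

section \<open>Powers of the hyperbolic cosine: the explicit solution and its integral\<close>

lemma cosh_powr_has_derivative:
  fixes \<nu> s :: real
  shows "((\<lambda>t. cosh (\<nu> * t) powr s) has_real_derivative s * \<nu> * (cosh (\<nu> * t) powr (s - 1) * sinh (\<nu> * t))) (at t)"
    "((\<lambda>t. s * \<nu> * (cosh (\<nu> * t) powr (s - 1) * sinh (\<nu> * t))) has_real_derivative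
      \<nu>\<^sup>2 * (s\<^sup>2 * cosh (\<nu> * t) powr s - s * (s - 1) * cosh (\<nu> * t) powr (s - 2))) (at t)"
proof -
  have ch: "((\<lambda>t. cosh (\<nu> * t)) has_real_derivative \<nu> * sinh (\<nu> * t)) (at t)"
    and shd: "((\<lambda>t. sinh (\<nu> * t)) has_real_derivative \<nu> * cosh (\<nu> * t)) (at t)" for t
    by (auto intro!: derivative_eq_intros)
  have 1: "((\<lambda>t. cosh (\<nu> * t) powr s) has_real_derivative s * \<nu> * (cosh (\<nu> * t) powr (s - 1) * sinh (\<nu> * t))) (at t)" for s t
    by (rule DERIV_cong[OF DERIV_chain2[OF has_real_derivative_powr ch]]) (auto simp: cosh_real_pos)
  show "((\<lambda>t. cosh (\<nu> * t) powr s) has_real_derivative s * \<nu> * (cosh (\<nu> * t) powr (s - 1) * sinh (\<nu> * t))) (at t)"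
    by (rule 1)
  define c where "c = cosh (\<nu> * t)"
  define h where "h = sinh (\<nu> * t)"
  have c: "c > 0" by (simp add: c_def cosh_real_pos)
  have hc: "h * h = c * c - 1" using cosh_square_eq[of "\<nu> * t"] by (simp add: c_def h_def power2_eq_square)
  have pw: "c powr (s - 1) = c powr (s - 2) * c" "c powr s = c powr (s - 2) * (c * c)"
    using c powr_add[of c "s-2" 1] powr_add[of c "s-2" 2] by (auto simp: power2_eq_square)
  have "((\<lambda>t. s * \<nu> * (cosh (\<nu> * t) powr (s - 1) * sinh (\<nu> * t))) has_real_derivative
      s * \<nu> * ((s - 1) * \<nu> * (c powr (s - 1 - 1) * h) * h + \<nu> * c * c powr (s - 1))) (at t)"
    unfolding c_def h_def by (intro DERIV_cmult DERIV_mult 1 shd)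
  moreover have "s * \<nu> * ((s - 1) * \<nu> * (c powr (s - 1 - 1) * h) * h + \<nu> * c * c powr (s - 1))
    = \<nu>\<^sup>2 * (s\<^sup>2 * c powr s - s * (s - 1) * c powr (s - 2))"
  proof -
    have "s * \<nu> * ((s - 1) * \<nu> * (c powr (s - 1 - 1) * h) * h + \<nu> * c * c powr (s - 1))
      = s * \<nu>\<^sup>2 * c powr (s - 2) * ((s - 1) * (h * h) + c * c)"
      unfolding pw(1) by (simp add: power2_eq_square algebra_simps)
    also have "\<dots> = \<nu>\<^sup>2 * (s\<^sup>2 * c powr s - s * (s - 1) * c powr (s - 2))"
      unfolding hc pw(2) by (simp add: power2_eq_square algebra_simps)
    finally show ?thesis .
  qed
  ultimately show "((\<lambda>t. s * \<nu> * (cosh (\<nu> * t) powr (s - 1) * sinh (\<nu> * t))) has_real_derivative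
      \<nu>\<^sup>2 * (s\<^sup>2 * cosh (\<nu> * t) powr s - s * (s - 1) * cosh (\<nu> * t) powr (s - 2))) (at t)"
    unfolding c_def by simp
qed

lemma cosh_powr_tendsto_0:
  fixes \<nu> s :: real assumes \<nu>: "\<nu> > 0" and s: "s < 0"
  shows "((\<lambda>t. cosh (\<nu> * t) powr s) \<longlongrightarrow> 0) at_infinity"
    "((\<lambda>t. s * \<nu> * (cosh (\<nu> * t) powr (s - 1) * sinh (\<nu> * t))) \<longlongrightarrow> 0) at_infinity"
proof -
  have "filterlim (\<lambda>t::real. \<bar>t\<bar>) at_top at_infinity"
    using filterlim_norm_at_top[where 'a=real] by (metis (no_types, lifting) ext real_norm_def)
  moreover have "filterlim (\<lambda>t. cosh (\<nu> * t)) at_top at_top" using \<nu>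
    by (intro filterlim_compose[OF cosh_real_at_top] filterlim_tendsto_pos_mult_at_top[OF tendsto_const] filterlim_ident)
  ultimately have "filterlim (\<lambda>t. cosh (\<nu> * \<bar>t\<bar>)) at_top at_infinity"
    by (rule filterlim_compose[rotated])
  moreover have "cosh (\<nu> * \<bar>t\<bar>) = cosh (\<nu> * t)" for t by (cases "t \<ge> 0") auto
  ultimately have ct: "filterlim (\<lambda>t. cosh (\<nu> * t)) at_top at_infinity" by simp
  show 1: "((\<lambda>t. cosh (\<nu> * t) powr s) \<longlongrightarrow> 0) at_infinity"
    by (rule tendsto_neg_powr[OF s ct])
  show "((\<lambda>t. s * \<nu> * (cosh (\<nu> * t) powr (s - 1) * sinh (\<nu> * t))) \<longlongrightarrow> 0) at_infinity"
  proof (rule Lim_null_comparison)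
    show "\<forall>\<^sub>F t in at_infinity. norm (s * \<nu> * (cosh (\<nu> * t) powr (s - 1) * sinh (\<nu> * t))) \<le> \<bar>s * \<nu>\<bar> * cosh (\<nu> * t) powr s"
    proof (rule always_eventually, rule allI)
      fix t
      have cp: "cosh (\<nu> * t) > 0" by (rule cosh_real_pos)
      have "\<bar>sinh (\<nu> * t)\<bar> \<le> cosh (\<nu> * t)"
        using sinh_less_cosh_real[of "\<nu> * t"] sinh_less_cosh_real[of "- (\<nu> * t)"] by (simp add: abs_le_iff)
      then have "cosh (\<nu> * t) powr (s - 1) * \<bar>sinh (\<nu> * t)\<bar> \<le> cosh (\<nu> * t) powr (s - 1) * cosh (\<nu> * t)"
        by (intro mult_left_mono) auto
      also have "\<dots> = cosh (\<nu> * t) powr s" using cp powr_add[of "cosh (\<nu> * t)" "s - 1" 1] by simp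
      finally show "norm (s * \<nu> * (cosh (\<nu> * t) powr (s - 1) * sinh (\<nu> * t))) \<le> \<bar>s * \<nu>\<bar> * cosh (\<nu> * t) powr s"
        by (simp add: abs_mult mult_left_mono)
    qed
    show "((\<lambda>t. \<bar>s * \<nu>\<bar> * cosh (\<nu> * t) powr s) \<longlongrightarrow> 0) at_infinity" by (rule tendsto_mult_right_zero[OF 1])
  qed
qed

text \<open>The operator \<open>- d\<^sup>2 + (m \<nu>)\<^sup>2\<close> maps \<open>cosh\<close> to
  the power m to \<open>m (m - 1) \<nu>\<^sup>2\<close> times its power m - 2, and
  \<open>- d\<^sup>2 + ((m - 2) \<nu>)\<^sup>2\<close> repeats this down to the power m - 4. Since m
  p = m - 4, the result is the nonlinearity once C is normalized by \<open>Cp\<close>.\<close>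

lemma cosh_soliton:
  fixes \<nu> m p C :: real
  assumes \<nu>: "\<nu> > 0" and m: "m < 0" and p: "p = 1 - 4 / m" and C: "C > 0"
    and Cp: "C powr (p - 1) = m * (m - 1) * (m - 2) * (m - 3) * \<nu> ^ 4"
  shows "soliton (\<lambda>t. C * cosh (\<nu> * t) powr m)
    (\<lambda>t. C * (m * \<nu> * (cosh (\<nu> * t) powr (m - 1) * sinh (\<nu> * t))))
    (\<lambda>t. C * m * (m - 1) * \<nu>\<^sup>2 * cosh (\<nu> * t) powr (m - 2))
    (\<lambda>t. C * m * (m - 1) * \<nu>\<^sup>2 * ((m - 2) * \<nu> * (cosh (\<nu> * t) powr (m - 2 - 1) * sinh (\<nu> * t))))
    (\<nu> * - m) (\<nu> * (2 - m)) p 1"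
proof
  note d = cosh_powr_has_derivative[where \<nu>=\<nu>]
  show "((\<lambda>t. C * cosh (\<nu> * t) powr m) has_real_derivative C * (m * \<nu> * (cosh (\<nu> * t) powr (m - 1) * sinh (\<nu> * t)))) (at t)" for t
    by (intro DERIV_cmult d)
  show "((\<lambda>t. C * m * (m - 1) * \<nu>\<^sup>2 * cosh (\<nu> * t) powr (m - 2)) has_real_derivative
      C * m * (m - 1) * \<nu>\<^sup>2 * ((m - 2) * \<nu> * (cosh (\<nu> * t) powr (m - 2 - 1) * sinh (\<nu> * t)))) (at t)" for t
    by (intro DERIV_cmult d)
  show "((\<lambda>t. C * (m * \<nu> * (cosh (\<nu> * t) powr (m - 1) * sinh (\<nu> * t)))) has_real_derivative
      (\<nu> * - m)\<^sup>2 * (C * cosh (\<nu> * t) powr m) - C * m * (m - 1) * \<nu>\<^sup>2 * cosh (\<nu> * t) powr (m - 2)) (at t)" for t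
    by (rule DERIV_cong[OF DERIV_cmult[OF d(2)]]) (simp add: power2_eq_square algebra_simps)
  show "((\<lambda>t. C * m * (m - 1) * \<nu>\<^sup>2 * ((m - 2) * \<nu> * (cosh (\<nu> * t) powr (m - 2 - 1) * sinh (\<nu> * t)))) has_real_derivative
      (\<nu> * (2 - m))\<^sup>2 * (C * m * (m - 1) * \<nu>\<^sup>2 * cosh (\<nu> * t) powr (m - 2)) - 1 * spow p (C * cosh (\<nu> * t) powr m)) (at t)" for t
  proof (rule DERIV_cong[OF DERIV_cmult[OF d(2)]])
    have c: "cosh (\<nu> * t) > 0" by (rule cosh_real_pos)
    have mp: "m * p = m - 4" using m by (simp add: p field_simps)
    have "spow p (C * cosh (\<nu> * t) powr m) = C powr p * cosh (\<nu> * t) powr (m - 4)"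
      using C c mp by (simp add: spow_pos_eq powr_mult powr_powr)
    also have "C powr p = C powr (p - 1) * C" using C powr_add[of C "p-1" 1] by simp
    finally have sp: "spow p (C * cosh (\<nu> * t) powr m)
       = m * (m - 1) * (m - 2) * (m - 3) * \<nu> ^ 4 * C * cosh (\<nu> * t) powr (m - 2 - 2)" by (simp add: Cp)
    show "C * m * (m - 1) * \<nu>\<^sup>2 * (\<nu>\<^sup>2 * ((m - 2)\<^sup>2 * cosh (\<nu> * t) powr (m - 2) - (m - 2) * (m - 2 - 1) * cosh (\<nu> * t) powr (m - 2 - 2)))
      = (\<nu> * (2 - m))\<^sup>2 * (C * m * (m - 1) * \<nu>\<^sup>2 * cosh (\<nu> * t) powr (m - 2)) - 1 * spow p (C * cosh (\<nu> * t) powr m)"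
      unfolding sp power4_eq_xxxx power2_eq_square by algebra
  qed
  show "((\<lambda>t. C * cosh (\<nu> * t) powr m) \<longlongrightarrow> 0) at_infinity"
    "((\<lambda>t. C * (m * \<nu> * (cosh (\<nu> * t) powr (m - 1) * sinh (\<nu> * t)))) \<longlongrightarrow> 0) at_infinity"
    "((\<lambda>t. C * m * (m - 1) * \<nu>\<^sup>2 * cosh (\<nu> * t) powr (m - 2)) \<longlongrightarrow> 0) at_infinity"
    "((\<lambda>t. C * m * (m - 1) * \<nu>\<^sup>2 * ((m - 2) * \<nu> * (cosh (\<nu> * t) powr (m - 2 - 1) * sinh (\<nu> * t)))) \<longlongrightarrow> 0) at_infinity"
    using m by (intro tendsto_mult_right_zero cosh_powr_tendsto_0 \<nu>; simp)+
  show "\<bar>C * cosh (\<nu> * t) powr m\<bar> \<le> C * cosh (\<nu> * 0) powr m" for t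
  proof -
    have "cosh (\<nu> * t) powr m \<le> 1 powr m"
      using m cosh_real_ge_1[of "\<nu> * t"] by (intro powr_mono2') auto
    then show ?thesis using C by (simp add: abs_mult)
  qed
  have "4 / m < 0" using m by (simp add: divide_pos_neg)
  then show "p > 1" unfolding p by linarith
qed (use C \<nu> m in \<open>auto simp: mult_pos_neg\<close>)

text \<open>Legendre's duplication formula, rewritten for the Beta function.\<close>

lemma Beta_diagonal:
  fixes c :: real assumes c: "c > 0" shows "4 powr c * Beta c c / 2 = Beta c (1 / 2)"
proof -
  have "complex_of_real c \<notin> \<int>\<^sub>\<le>\<^sub>0" "complex_of_real c + 1 / 2 \<notin> \<int>\<^sub>\<le>\<^sub>0"
    using c by (auto dest!: nonpos_Ints_nonpos simp: complex_nonpos_Reals_iff elim!: nonpos_Ints_cases simp: complex_eq_iff)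
  from Gamma_legendre_duplication[OF this]
  have "complex_of_real (Gamma c * Gamma (c + 1 / 2)) = complex_of_real (exp ((1 - 2 * c) * ln 2) * sqrt pi * Gamma (2 * c))"
    by (simp add: Gamma_complex_of_real[symmetric] exp_of_real[symmetric])
  then have D: "Gamma c * Gamma (c + 1 / 2) = exp ((1 - 2 * c) * ln 2) * sqrt pi * Gamma (2 * c)"
    by (simp only: of_real_eq_iff)
  have G: "Gamma c > 0" "Gamma (c + 1 / 2) > 0" "Gamma (2 * c) > 0" using c by (auto intro: Gamma_real_pos)
  have e: "4 powr c * exp ((1 - 2 * c) * ln 2) = 2"
  proof -
    have "(4::real) powr c = 2 powr (2 * c)" by (simp add: powr_powr[symmetric])
    moreover have "exp ((1 - 2 * c) * ln 2) = (2::real) powr (1 - 2 * c)" by (simp add: powr_def)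
    ultimately show ?thesis by (simp flip: powr_add)
  qed
  have "4 powr c * Gamma c * Gamma (c + 1 / 2) = (4 powr c * exp ((1 - 2 * c) * ln 2)) * sqrt pi * Gamma (2 * c)"
    using D by (simp add: mult.assoc)
  then have "4 powr c * Gamma c * Gamma (c + 1 / 2) = 2 * sqrt pi * Gamma (2 * c)" unfolding e .
  then show ?thesis
    using G unfolding Beta_def by (simp add: Gamma_one_half_real field_simps)
qed

text \<open>The logistic substitution \<open>g\<close> maps the line onto (0, 1), with
  \<open>g (1 - g) = 1 / (4 cosh\<^sup>2)\<close> and \<open>dg = 2 \<nu> g (1 - g) dt\<close>. It
  turns the integral into the symmetric Beta integral.\<close>

lemma integral_cosh_powr:
  fixes c \<nu> :: real assumes c: "c > 0" and \<nu>: "\<nu> > 0"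
  shows "(LINT t|lborel. cosh (\<nu> * t) powr (- 2 * c)) = Beta c (1 / 2) / \<nu>"
proof -
  define g where "g t = 1 / (1 + exp (- (2 * \<nu>) * t))" for t
  define g' where "g' t = 2 * \<nu> * (g t * (1 - g t))" for t
  define f where "f x = x powr (c - 1) * (1 - x) powr (c - 1)" for x :: real
  have ep: "1 + exp (- (2 * \<nu>) * t) > 0" for t by (simp add: add_pos_pos)
  have g01: "0 < g t" "g t < 1" for t using ep[of t] by (auto simp: g_def)
  have dg: "(g has_real_derivative g' t) (at t)" for t
  proof -
    have "(g has_real_derivative (2 * \<nu>) * exp (- (2 * \<nu>) * t) / (1 + exp (- (2 * \<nu>) * t))\<^sup>2) (at t)"
      unfolding g_def[abs_def] using ep[of t] by (auto intro!: derivative_eq_intros simp: power2_eq_square)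
    moreover have "(2 * \<nu>) * exp (- (2 * \<nu>) * t) / (1 + exp (- (2 * \<nu>) * t))\<^sup>2 = g' t"
      unfolding g'_def g_def using ep[of t] by (simp add: field_simps power2_eq_square)
    ultimately show ?thesis by simp
  qed
  have gg: "g t * (1 - g t) = 1 / 4 * cosh (\<nu> * t) powr (- 2)" for t
  proof -
    define E where "E = exp (- \<nu> * t)"
    have E: "E > 0" by (simp add: E_def)
    have e2: "exp (- (2 * \<nu>) * t) = E * E" unfolding E_def by (simp flip: exp_add)
    have ei: "exp (\<nu> * t) = 1 / E" unfolding E_def by (simp add: exp_minus inverse_eq_divide[symmetric])
    have ch: "cosh (\<nu> * t) = (1 / E + E) / 2" unfolding cosh_field_def using ei by (simp add: E_def)
    have s: "1 + E * E \<noteq> 0" using E by (simp add: add_pos_pos less_imp_neq[symmetric])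
    have "cosh (\<nu> * t) powr (- 2) = 1 / (cosh (\<nu> * t))\<^sup>2"
      using cosh_real_pos[of "\<nu> * t"] by (simp add: powr_minus divide_inverse)
    then show ?thesis unfolding ch g_def e2 using E s by (simp add: field_simps power2_eq_square)
  qed
  have fg: "f (g t) * g' t = (2 * \<nu> / 4 powr c) * cosh (\<nu> * t) powr (- 2 * c)" for t
  proof -
    define x where "x = g t * (1 - g t)"
    have x: "x > 0" using g01[of t] by (simp add: x_def)
    have "f (g t) * g' t = 2 * \<nu> * (x powr (c - 1) * x)"
      unfolding f_def g'_def x_def using g01[of t] by (simp add: powr_mult)
    also have "x powr (c - 1) * x = x powr c" using x powr_add[of x "c-1" 1] by simp
    also have "\<dots> = (1 / 4) powr c * (cosh (\<nu> * t) powr (- 2)) powr c" unfolding x_def gg by (rule powr_mult)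
    finally show ?thesis by (simp add: powr_powr powr_divide)
  qed
  have lim: "(g \<longlongrightarrow> 0) at_bot" "(g \<longlongrightarrow> 1) at_top"
    unfolding g_def[abs_def] using \<nu> by (real_asymp, real_asymp)
  have h: "(f has_integral Beta c c) {0..1}" unfolding f_def by (rule has_integral_Beta_real[OF c c])
  have f0: "f x \<ge> 0" for x unfolding f_def by simp
  have ifg: "integrable lborel (\<lambda>t. f (g t) * g' t)"
  proof (rule Bochner_Integration.integrable_bound)
    show "integrable lborel (\<lambda>t. 2 * \<nu> * exp (- (2 * c * \<nu>) * \<bar>t\<bar>))"
      using integrable_exp_abs[of "2 * c * \<nu>"] c \<nu> by simp
    have "continuous_on UNIV (\<lambda>t. (2 * \<nu> / 4 powr c) * cosh (\<nu> * t) powr (- 2 * c))"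
      by (intro continuous_intros ballI) (use cosh_real_pos in force)
    then show "(\<lambda>t. f (g t) * g' t) \<in> borel_measurable lborel"
      unfolding fg by (simp add: borel_measurable_continuous_onI)
    show "AE t in lborel. norm (f (g t) * g' t) \<le> norm (2 * \<nu> * exp (- (2 * c * \<nu>) * \<bar>t\<bar>))"
    proof (rule AE_I2)
      fix t
      have "exp (\<nu> * \<bar>t\<bar>) / 2 \<le> cosh (\<nu> * t)"
        unfolding cosh_field_def by (cases "t \<ge> 0") auto
      then have "cosh (\<nu> * t) powr (- 2 * c) \<le> (exp (\<nu> * \<bar>t\<bar>) / 2) powr (- 2 * c)"
        using c by (intro powr_mono2') auto
      also have "\<dots> = 2 powr (2 * c) * exp (- (2 * c * \<nu>) * \<bar>t\<bar>)"
        by (simp add: powr_def ln_div algebra_simps flip: exp_add)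
      also have "(2::real) powr (2 * c) = 4 powr c" by (simp add: powr_powr[symmetric])
      finally have "(2 * \<nu> / 4 powr c) * cosh (\<nu> * t) powr (- 2 * c)
          \<le> (2 * \<nu> / 4 powr c) * (4 powr c * exp (- (2 * c * \<nu>) * \<bar>t\<bar>))"
        using \<nu> by (intro mult_left_mono) auto
      then show "norm (f (g t) * g' t) \<le> norm (2 * \<nu> * exp (- (2 * c * \<nu>) * \<bar>t\<bar>))"
        unfolding fg using \<nu> by simp
    qed
  qed
  have "((ereal \<circ> g) \<longlongrightarrow> 0) at_bot" "((ereal \<circ> g) \<longlongrightarrow> 1) at_top"
    unfolding comp_def zero_ereal_def one_ereal_def by (intro tendsto_ereal lim)+
  then have l1: "((ereal \<circ> g \<circ> real_of_ereal) \<longlongrightarrow> 0) (at_right (- \<infinity>))"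
    and l2: "((ereal \<circ> g \<circ> real_of_ereal) \<longlongrightarrow> 1) (at_left \<infinity>)"
    by (simp_all add: ereal_tendsto_simps1)
  have cf: "isCont f (g t)" for t unfolding f_def using g01[of t] by (intro continuous_intros) auto
  have cg': "isCont g' t" for t
    unfolding g'_def[abs_def] using DERIV_isCont[OF dg] by (intro continuous_intros)
  have g'0: "g' t \<ge> 0" for t unfolding g'_def using \<nu> g01[of t] by simp
  have sfg: "set_integrable lborel (einterval (- \<infinity>) \<infinity>) (\<lambda>t. f (g t) * g' t)"
    using ifg by (simp add: set_integrable_def)
  note sub = interval_integral_substitution_nonneg[of "- \<infinity>" \<infinity> g g' f, OF _ dg cf cg' f0 g'0 l1 l2 sfg]
  have ein: "einterval 0 1 = {0<..<1}" by (auto simp: einterval_def)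
  have "(LBINT x=0..1. f x) = (LINT x:{0<..<1}|lborel. f x)"
    by (simp add: interval_lebesgue_integral_def ein)
  also have "\<dots> = integral {0<..<1} f"
    using sub(1) unfolding ein by (intro set_borel_integral_eq_integral) simp
  also have "\<dots> = Beta c c" using h by (simp add: integral_open_interval_real[symmetric] integral_unique)
  finally have "Beta c c = (LINT t|lborel. f (g t) * g' t)"
    using sub(2) by (simp add: interval_lebesgue_integral_def set_lebesgue_integral_def)
  also have "\<dots> = (2 * \<nu> / 4 powr c) * (LINT t|lborel. cosh (\<nu> * t) powr (- 2 * c))"
    unfolding fg by simp
  finally have "4 powr c * Beta c c / 2 = \<nu> * (LINT t|lborel. cosh (\<nu> * t) powr (- 2 * c))" by simp
  then show ?thesis unfolding Beta_diagonal[OF c] using \<nu> by (simp add: field_simps)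
qed

section \<open>From profiles to radial functions\<close>

text \<open>Two steps of the recurrence in the first argument; the right-hand side is the bracket in
  \<open>phi\<close>.\<close>

lemma Beta_shift:
  fixes m :: real assumes m: "m < 0"
  shows "Beta (2 - m) (1 / 2) = 4 * m * (m - 1) / ((2 * m - 1) * (2 * m - 3)) * Beta (- m) (1 / 2)"
proof -
  have "(- m + 1 / 2) * Beta (- m + 1) (1 / 2) = - m * Beta (- m) (1 / 2)"
    by (rule Beta_plus1_left) (use m in \<open>auto elim!: nonpos_Ints_cases\<close>)
  moreover have "(1 - m + 1 / 2) * Beta (1 - m + 1) (1 / 2) = (1 - m) * Beta (1 - m) (1 / 2)"
    by (rule Beta_plus1_left) (use m in \<open>auto elim!: nonpos_Ints_cases\<close>)
  ultimately have *: "(1 / 2 - m) * Beta (1 - m) (1 / 2) = - m * Beta (- m) (1 / 2)"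
    "(3 / 2 - m) * Beta (2 - m) (1 / 2) = (1 - m) * Beta (1 - m) (1 / 2)"
    by (simp_all add: add.commute[of "- m"])
  have "(1 / 2 - m) * ((3 / 2 - m) * Beta (2 - m) (1 / 2)) = (1 - m) * (- m * Beta (- m) (1 / 2))"
    unfolding *(2) *(1)[symmetric] by simp
  then have "((2 * m - 1) * (2 * m - 3)) * Beta (2 - m) (1 / 2) = 4 * m * (m - 1) * Beta (- m) (1 / 2)"
    by (simp add: field_simps)
  moreover have "(2 * m - 1) * (2 * m - 3) \<noteq> 0" using m by auto
  ultimately show ?thesis by (simp add: nonzero_eq_divide_eq mult.commute)
qed

context profile_space begin

text \<open>Since m (p + 1) = - 2 (2 - m), the power integral of \<open>U\<close> is
  \<open>C powr (p + 1) * Beta (2 - m) (1 / 2) / \<nu>\<close>. Raising it to the power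
  \<open>e\<close> leaves \<open>C powr (p - 1)\<close>, which \<open>Cp\<close> evaluates; its
  factor \<open>\<nu> ^ 4\<close> and the remaining \<open>\<nu> powr (- e)\<close> explain the
  exponent \<open>4 - e\<close>.\<close>

lemma explicit_minimizer:
  fixes \<nu> m p :: real
  assumes \<nu>: "\<nu> > 0" and m: "m < 0" and p: "p = 1 - 4 / m"
    and AB: "A = \<nu>\<^sup>2 * (m\<^sup>2 + (m - 2)\<^sup>2)" "B = \<nu> ^ 4 * (m\<^sup>2 * (m - 2)\<^sup>2)"
    and C: "C > 0" and Cp: "C powr (p - 1) = m * (m - 1) * (m - 2) * (m - 3) * \<nu> ^ 4"
  defines "U \<equiv> \<lambda>t. C * cosh (\<nu> * t) powr m" and "e \<equiv> (p - 1) / (p + 1)"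
  shows "U \<in> H" "Q U = best p * pow_integral p U powr (2 / (p + 1))" "pow_integral p U > 0"
    "best p = phi m \<nu> (4 - e) e"
proof -
  have "4 / m < 0" using m by (simp add: divide_pos_neg)
  then have p1: "p > 1" unfolding p by linarith
  have "\<nu> * (2 - m) = \<nu> * - m + 2 * \<nu>" by (simp add: algebra_simps)
  moreover have "\<nu> * - m > 0" "\<nu> * (2 - m) > 0" using \<nu> m by (simp_all add: mult_pos_neg)
  ultimately have ab: "\<nu> * - m > 0" "\<nu> * (2 - m) > 0" "\<nu> * - m \<noteq> \<nu> * (2 - m)" using \<nu> by linarith+
  have AB': "A = (\<nu> * - m)\<^sup>2 + (\<nu> * (2 - m))\<^sup>2" "B = (\<nu> * - m)\<^sup>2 * (\<nu> * (2 - m))\<^sup>2"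
    unfolding AB by (simp_all add: power2_eq_square power4_eq_xxxx algebra_simps)
  have pos: "C * cosh (\<nu> * t) powr m > 0" for t using C cosh_real_pos[of "\<nu> * t"] by simp
  note min = soliton_minimizer[OF ab AB' p1 cosh_soliton[OF \<nu> m p C Cp] pos, folded U_def]
  show "U \<in> H" "pow_integral p U > 0" by (rule min)+
  have "(p - 1) / (p + 1) + 2 / (p + 1) = 1" using p1 by (simp flip: add_divide_distrib)
  then have "pow_integral p U = pow_integral p U powr ((p - 1) / (p + 1)) * pow_integral p U powr (2 / (p + 1))"
    using min(3) by (simp flip: powr_add)
  then show "Q U = best p * pow_integral p U powr (2 / (p + 1))"
    unfolding min(2) min(4)[symmetric] .
  have mp: "m * (p + 1) = - 2 * (2 - m)" unfolding p using m by (simp add: field_simps)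
  have "\<bar>U t\<bar> powr (p + 1) = C powr (p + 1) * cosh (\<nu> * t) powr (- 2 * (2 - m))" for t
    unfolding U_def mp[symmetric] using C by (simp add: abs_mult powr_mult powr_powr)
  then have "pow_integral p U = C powr (p + 1) * (LINT t|lborel. cosh (\<nu> * t) powr (- 2 * (2 - m)))"
    unfolding pow_integral_def by simp
  also have "\<dots> = C powr (p + 1) * (Beta (2 - m) (1 / 2) / \<nu>)"
    using integral_cosh_powr[of "2 - m" \<nu>] m \<nu> by simp
  finally have I: "pow_integral p U = C powr (p + 1) * (Beta (2 - m) (1 / 2) / \<nu>)" .
  have "best p = (C powr (p + 1) * (Beta (2 - m) (1 / 2) / \<nu>)) powr e"
    unfolding min(4) I e_def ..
  also have "\<dots> = C powr (p - 1) * (Beta (2 - m) (1 / 2) powr e * \<nu> powr (- e))"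
  proof -
    have "(p + 1) * e = p - 1" using p1 by (simp add: e_def)
    moreover have "(X * (Y / \<nu>)) powr e = X powr e * (Y powr e * \<nu> powr (- e))" for X Y
      by (simp only: powr_mult powr_divide powr_minus_divide) simp
    ultimately show ?thesis by (simp only: powr_powr)
  qed
  also have "\<dots> = phi m \<nu> (4 - e) e"
  proof -
    have "\<nu> powr (4 - e) = \<nu> ^ 4 * \<nu> powr (- e)"
      using \<nu> powr_add[of \<nu> 4 "- e"] by simp
    then show ?thesis unfolding phi_def Cp Beta_shift[OF m, symmetric] by simp
  qed
  finally show "best p = phi m \<nu> (4 - e) e" .
qed

end

text \<open>With t = ln |x|, \<open>1 + |x|\<^sup>2\<^sup>\<nu>\<close> is
  \<open>2 exp (\<nu> t) cosh (\<nu> t)\<close>; the powers of 2 and of |x| in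
  \<open>extremal\<close> are those this identity produces.\<close>

lemma extremal_eq_radial_lift:
  fixes x :: "'a::euclidean_space"
  assumes g: "g = (real DIM('a) - 4 - \<alpha>) / 2"
  shows "extremal \<alpha> C m \<nu> x = radial_lift (- g) (\<lambda>t. C * cosh (\<nu> * t) powr m) x"
proof (cases "x = 0")
  case False
  define t where "t = ln (norm x)"
  have n: "norm x = exp t" using False by (simp add: t_def)
  have "cosh (\<nu> * t) = exp (- \<nu> * t) * (1 + exp (2 * \<nu> * t)) / 2"
    by (simp add: cosh_field_def algebra_simps flip: exp_add)
  then have "cosh (\<nu> * t) powr m = (exp (- \<nu> * t) * (1 + exp (2 * \<nu> * t))) powr m / 2 powr m"
    by (simp only: powr_divide)
  then have "cosh (\<nu> * t) powr m = exp (- \<nu> * t) powr m * (1 + exp (2 * \<nu> * t)) powr m / 2 powr m"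
    by (simp only: powr_mult)
  moreover have "norm x powr (- (g + \<nu> * m)) = norm x powr (- g) * exp (- \<nu> * t) powr m"
    unfolding n by (simp add: powr_def algebra_simps flip: exp_add)
  moreover have "norm x powr (2 * \<nu>) = exp (2 * \<nu> * t)" unfolding n by (simp add: powr_def)
  ultimately show ?thesis unfolding extremal_def radial_lift_def t_def[symmetric] g[symmetric] by simp
qed (simp add: extremal_def radial_lift_def)

lemma AE_eq_radial_lift:
  fixes v w :: "real \<Rightarrow> real"
  assumes v: "continuous_on UNIV v" and w: "continuous_on UNIV w"
    and eq: "AE x in (lebesgue :: 'a::euclidean_space measure). radial_lift c v x = radial_lift c w x"
  shows "v = w"
proof -
  have [measurable]: "v \<in> borel_measurable borel" "w \<in> borel_measurable borel"
    using v w by (auto intro: borel_measurable_continuous_onI)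
  have "AE x in (lborel :: 'a measure). radial_lift c v x = radial_lift c w x"
    using eq by (subst (asm) AE_completion_iff) (auto simp: radial_lift_def)
  moreover have "AE x::'a in lborel. x \<noteq> 0" by (rule AE_lborel_singleton)
  ultimately have "AE x::'a in lborel. v (ln (norm x)) = w (ln (norm x))"
    by eventually_elim (simp add: radial_lift_def)
  then have "AE t in lborel. v t = w t"
    by (subst (asm) AE_ln_norm) auto
  then show ?thesis using continuous_eq_AE[OF v w] by (intro ext) blast
qed

lemma uniform_Cauchy_limit:
  fixes s :: "nat \<Rightarrow> real \<Rightarrow> real" and c :: real
  assumes s: "\<And>k. continuous_on UNIV (s k)"
    and b: "\<And>e. e > 0 \<Longrightarrow> \<exists>K. \<forall>j\<ge>K. \<forall>k\<ge>K. \<forall>t. \<bar>s j t - s k t\<bar> < e"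
  obtains v where "continuous_on UNIV v" "\<And>t. (\<lambda>k. s k t) \<longlonglongrightarrow> v t"
proof -
  have "uniformly_Cauchy_on UNIV s"
    unfolding uniformly_Cauchy_on_def dist_real_def using b by (metis UNIV_I)
  then have "uniformly_convergent_on UNIV s" by (rule Cauchy_uniformly_convergent)
  then obtain v where v: "uniform_limit UNIV s v sequentially" unfolding uniformly_convergent_on_def by blast
  have "continuous_on UNIV v" by (rule uniform_limit_theorem[OF _ v]) (use s in auto)
  moreover have "(\<lambda>k. s k t) \<longlonglongrightarrow> v t" for t using tendsto_uniform_limitI[OF v] by blast
  ultimately show thesis using that by blast
qed

section \<open>Elements of the completion as lifts of continuous profiles\<close>

locale radial_completion = function_completion "punctured_test_rad :: ('a::euclidean_space \<Rightarrow> real) set" "alpha_norm \<alpha> lam \<mu>" N nrm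
  for \<alpha> lam \<mu> :: real and N nrm +
  fixes g A B :: real
  assumes g: "g = (real DIM('a) - 4 - \<alpha>) / 2"
    and A_eq: "A = ((real DIM('a) - 2)\<^sup>2 + (2 + \<alpha>)\<^sup>2) / 2 - lam"
    and B_eq: "B = (g * (g + 2 + \<alpha>))\<^sup>2 - lam * g\<^sup>2 + \<mu>"
begin

abbreviation lift :: "(real \<Rightarrow> real) \<Rightarrow> 'a \<Rightarrow> real" where "lift \<equiv> radial_lift (- g)"
definition \<omega> :: real where "\<omega> = real DIM('a) * unit_ball_vol (real DIM('a))"

lemma \<omega>_pos [simp]: "\<omega> > 0" and \<omega>_nonneg [simp]: "\<omega> \<ge> 0" and \<omega>_nonzero [simp]: "\<omega> \<noteq> 0"
proof -
  show "\<omega> > 0" by (simp add: \<omega>_def)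
  then show "\<omega> \<ge> 0" "\<omega> \<noteq> 0" by auto
qed

lemma lift_test: "test_fun v \<Longrightarrow> lift v \<in> N"
  using radial_lift_punctured_test_rad subset by blast

lemma nrm_test: "test_fun v \<Longrightarrow> nrm (lift v) = sqrt (\<omega> * energy A B v)"
  using extends[OF radial_lift_punctured_test_rad] alpha_norm_radial_lift[OF refl _ g] A_eq B_eq
  by (simp add: \<omega>_def)

lemma nrm_AE_eq: "u \<in> N \<Longrightarrow> w \<in> N \<Longrightarrow> AE x in lebesgue. u x = w x \<Longrightarrow> nrm u = nrm w"
  using norm_diff[of u w] norm_diff[of w u] norm_minus[of u w] norm_eq_0[OF diff_closed, of u w] by simp

text \<open>If \<open>B = 0\<close>, the slowly varying test functions \<open>plateau (t / k)\<close> have norms tending to 0.\<close>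

lemma B_nonzero: assumes A: "A \<ge> 0" shows "B \<noteq> 0"
proof
  assume B0: "B = 0"
  define v where "v k t = plateau (t * (1 / real (Suc k)))" for k t
  have tv: "test_fun (v k)" for k
    unfolding v_def using test_fun_plateau[of "1 / real (Suc k)" 0] by simp
  define P where "P = (LINT t|lborel. (deriv plateau t)\<^sup>2)"
  define P2 where "P2 = (LINT t|lborel. (deriv (deriv plateau) t)\<^sup>2)"
  have pl: "test_fun plateau" using test_fun_plateau[of 1 0] by simp
  have i: "integrable lborel (\<lambda>t. (u t)\<^sup>2)" if "test_fun u" for u
    using integrable_test_fun[OF test_fun_mult[OF test_fun_smooth[OF that] that]] by (simp add: power2_eq_square)
  note t1 = test_fun_deriv(2)[OF pl] and t2 = test_fun_deriv(2)[OF test_fun_deriv(2)[OF pl]]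
  have en: "energy A B (v k) = P2 * (1 / real (Suc k)) ^ 3 + A * P * (1 / real (Suc k))" for k
  proof -
    define h where "h = 1 / real (Suc k)"
    have h: "h > 0" by (simp add: h_def)
    have d: "deriv (v k) = (\<lambda>t. h * deriv plateau (t * h))" "deriv (\<lambda>t. h * deriv plateau (t * h)) = (\<lambda>t. h\<^sup>2 * deriv (deriv plateau) (t * h))"
      unfolding v_def h_def[symmetric] by (rule deriv_plateau_scale)+
    have a: "integrable lborel (\<lambda>t. (f (t * h))\<^sup>2)" "(LINT t|lborel. (f (t * h))\<^sup>2) = (LINT t|lborel. (f t)\<^sup>2) / h" if "test_fun f" for f
    proof -
      have "integrable lborel (\<lambda>t. (f (0 + h * t))\<^sup>2)"
        using lborel_integrable_real_affine[OF i[OF that], of h 0] h by simp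
      then show "integrable lborel (\<lambda>t. (f (t * h))\<^sup>2)" by (simp add: mult.commute)
      show "(LINT t|lborel. (f (t * h))\<^sup>2) = (LINT t|lborel. (f t)\<^sup>2) / h"
        using lborel_integral_real_affine[of h "\<lambda>t. (f t)\<^sup>2" 0] h by (simp add: mult.commute)
    qed
    \<comment> \<open>Each derivative brings a factor \<open>h\<close> and the change of variables
      divides by \<open>h\<close>. With B = 0 the one term that would grow like 1/h is
      absent.\<close>
    have "energy A B (v k) = (LINT t|lborel. h ^ 4 * (deriv (deriv plateau) (t * h))\<^sup>2 + A * h\<^sup>2 * (deriv plateau (t * h))\<^sup>2)"
      unfolding energy_def d B0 by (simp add: power_mult_distrib mult.assoc flip: power_mult)
    also have "\<dots> = h ^ 4 * (P2 / h) + A * h\<^sup>2 * (P / h)"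
      using a[OF t1] a[OF t2] by (simp add: P_def P2_def)
    also have "\<dots> = P2 * h ^ 3 + A * P * h"
      using h by (simp add: power4_eq_xxxx power3_eq_cube power2_eq_square)
    finally show ?thesis unfolding h_def .
  qed
  have lim: "(\<lambda>k. 1 / real (Suc k)) \<longlonglongrightarrow> 0" using LIMSEQ_Suc[OF lim_1_over_n] by simp
  have "(\<lambda>k. sqrt (\<omega> * (P2 * (1 / real (Suc k)) ^ 3 + A * P * (1 / real (Suc k))))) \<longlonglongrightarrow> sqrt (\<omega> * (P2 * 0 ^ 3 + A * P * 0))"
    by (intro tendsto_intros lim)
  then have n0: "(\<lambda>k. nrm (lift (v k))) \<longlonglongrightarrow> 0" by (simp add: nrm_test[OF tv] en)
  have zero: "(\<lambda>x. 0) \<in> N" using scale_closed[OF lift_test[OF pl], of 0] by simp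
  obtain r where r: "strict_mono r" "AE x in lebesgue. (\<lambda>k. lift (v (r k)) x) \<longlonglongrightarrow> 0"
    using AE_limit[of "\<lambda>k. lift (v k)", OF lift_test[OF tv] zero] n0 by auto
  have "AE x::'a in lebesgue. x \<noteq> 0" by (rule AE_completion) (rule AE_lborel_singleton)
  with r(2) have "AE x::'a in lebesgue. False"
  proof eventually_elim
    case (elim x)
    obtain K where K: "\<bar>ln (norm x)\<bar> < real K" using reals_Archimedean2 by blast
    \<comment> \<open>At every fixed point the cutoff is eventually 1, so the sequence converges to
      a nonzero power of |x| although its norm limit is 0.\<close>
    have "lift (v (r k)) x = norm x powr (- g)" if "k \<ge> K" for k
    proof -
      have "K \<le> r k" using seq_suble[OF r(1), of k] that by linarith
      then have "\<bar>ln (norm x)\<bar> \<le> real (Suc (r k))" using K by simp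
      then have "\<bar>ln (norm x) * (1 / real (Suc (r k)))\<bar> \<le> 1" by (simp add: abs_mult)
      then show ?thesis unfolding radial_lift_def v_def by (simp add: plateau_eq_1)
    qed
    then have "(\<lambda>k. lift (v (r k)) x) \<longlonglongrightarrow> norm x powr (- g)"
      by (intro tendsto_eventually) (auto simp: eventually_sequentially)
    then have "norm x powr (- g) = 0" using elim(1) LIMSEQ_unique by blast
    then show False using elim(2) by simp
  qed
  then obtain X where "X \<in> null_sets (lebesgue :: 'a measure)" "UNIV \<subseteq> X" by (auto simp: eventually_ae_filter)
  then have "negligible (UNIV :: 'a set)" using negligible_iff_null_sets negligible_subset by blast
  then show False using open_not_negligible[OF open_UNIV] by simp
qed

definition profiles :: "(real \<Rightarrow> real) set" where
  "profiles = {v. continuous_on UNIV v \<and> lift v \<in> N}"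

text \<open>Division by \<open>sqrt \<omega>\<close> makes the norm of a test profile exactly the
  square root of its energy.\<close>

definition profile_norm :: "(real \<Rightarrow> real) \<Rightarrow> real" where
  "profile_norm v = nrm (lift v) / sqrt \<omega>"

context assumes A: "A > 0" and B: "B > 0"
begin

text \<open>The evaluation bound makes the approximating test profiles uniformly Cauchy, so they
  have a continuous limit; \<open>AE_limit\<close> identifies its lift with the given element almost
  everywhere, and the bound survives in the limit.\<close>

lemma profile_exists:
  assumes u: "u \<in> N"
  obtains v where "v \<in> profiles" "AE x in lebesgue. u x = lift v x"
    "\<And>t. \<bar>v t\<bar> \<le> 1 / sqrt (min A B) * profile_norm v"
proof -
  obtain s where s: "\<And>k::nat. s k \<in> punctured_test_rad" and lim: "(\<lambda>k. nrm (\<lambda>x. s k x - u x)) \<longlonglongrightarrow> 0"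
    using dense[OF u] by blast
  have "\<exists>v. test_fun v \<and> s k = lift v" for k using punctured_test_rad_eq_radial_lift[OF s] by metis
  then obtain v where v: "\<And>k. test_fun (v k)" "\<And>k. s k = lift (v k)" by metis
  have sN: "s k \<in> N" for k using s subset by blast
  have mAB: "min A B > 0" using A B by simp
  define c where "c = 1 / sqrt (min A B)"
  have c: "c > 0" using mAB by (simp add: c_def)
  have ev: "\<bar>w t\<bar> \<le> c * profile_norm w" if w: "test_fun w" for w t
  proof -
    have "\<bar>w t\<bar> = sqrt ((w t)\<^sup>2)" by simp
    also have "\<dots> \<le> sqrt (energy A B w / min A B)"
      using test_fun_energy_bounds(3)[OF w A B] by (rule real_sqrt_le_mono)
    also have "\<dots> = c * profile_norm w"
      unfolding profile_norm_def nrm_test[OF w] using \<omega>_pos by (simp add: c_def real_sqrt_divide real_sqrt_mult)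
    finally show ?thesis .
  qed
  have cauchy: "\<exists>K. \<forall>j\<ge>K. \<forall>k\<ge>K. \<forall>t. \<bar>v j t - v k t\<bar> < e" if e: "e > 0" for e
  proof -
    define d where "d = e * sqrt \<omega> / (2 * c)"
    have d: "d > 0" using e c \<omega>_pos by (simp add: d_def)
    have "eventually (\<lambda>k. nrm (\<lambda>x. s k x - u x) < d) sequentially" using lim d by (rule order_tendstoD)
    then obtain K where K: "\<And>k. k \<ge> K \<Longrightarrow> nrm (\<lambda>x. s k x - u x) < d" by (auto simp: eventually_sequentially)
    have "\<bar>v j t - v k t\<bar> < e" if jk: "j \<ge> K" "k \<ge> K" for j k t
    proof -
      have "lift (\<lambda>t. v j t - v k t) = (\<lambda>x. (s j x - u x) + (u x - s k x))" by (auto simp: v radial_lift_diff)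
      then have "nrm (lift (\<lambda>t. v j t - v k t)) \<le> nrm (\<lambda>x. s j x - u x) + nrm (\<lambda>x. u x - s k x)"
        using norm_triangle[OF diff_closed[OF sN[of j] u] diff_closed[OF u sN[of k]]] by simp
      also have "\<dots> < d + d" using K[OF jk(1)] K[OF jk(2)] norm_minus[OF u sN[of k]] by simp
      finally have "nrm (lift (\<lambda>t. v j t - v k t)) < d + d" .
      then have "c * profile_norm (\<lambda>t. v j t - v k t) < c * ((d + d) / sqrt \<omega>)"
        unfolding profile_norm_def using c \<omega>_pos by (intro mult_strict_left_mono divide_strict_right_mono) auto
      also have "\<dots> = e" unfolding d_def using c \<omega>_pos by (simp add: field_simps)
      finally show ?thesis using ev[OF test_fun_diff[OF v(1)[of j] v(1)[of k]], of t] by linarith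
    qed
    then show ?thesis by blast
  qed
  obtain w where w: "continuous_on UNIV w" "\<And>t. (\<lambda>k. v k t) \<longlonglongrightarrow> w t"
    by (rule uniform_Cauchy_limit[of v, OF smooth_real_continuous[OF test_fun_smooth[OF v(1)]] cauchy]) blast+
  obtain r where r: "strict_mono r" "AE x in lebesgue. (\<lambda>k. s (r k) x) \<longlonglongrightarrow> u x"
    using AE_limit[OF sN u lim] by blast
  have eq: "AE x in lebesgue. u x = lift w x"
    using r(2)
  proof eventually_elim
    case (elim x)
    have "(\<lambda>k. lift (v k) x) \<longlonglongrightarrow> lift w x" unfolding radial_lift_def by (intro tendsto_intros w)
    then have "(\<lambda>k. s (r k) x) \<longlonglongrightarrow> lift w x" using LIMSEQ_subseq_LIMSEQ[OF _ r(1)] by (simp add: v o_def)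
    then show ?case using elim LIMSEQ_unique by blast
  qed
  have wN: "lift w \<in> N" by (rule AE_closed[OF u]) (use eq in \<open>auto elim: eventually_mono\<close>)
  have "(\<lambda>k. c * profile_norm (v k)) \<longlonglongrightarrow> c * profile_norm w"
    unfolding profile_norm_def
    using norm_limit[OF sN u lim] nrm_AE_eq[OF u wN eq] \<omega>_pos v by (intro tendsto_intros) auto
  then have "\<bar>w t\<bar> \<le> c * profile_norm w" for t
    using LIMSEQ_le[OF tendsto_rabs[OF w(2)[of t]]] ev[OF v(1)] by blast
  then show thesis using that[of w] w(1) wN eq unfolding profiles_def c_def by blast
qed

lemma profile_space: "profile_space profiles profile_norm A B (1 / sqrt (min A B))"
proof
  have s\<omega>: "sqrt \<omega> > 0" by simp
  show "1 / sqrt (min A B) > 0" using A B by simp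
  show "continuous_on UNIV v" if "v \<in> profiles" for v using that by (simp add: profiles_def)
  show "(\<lambda>t. v t + w t) \<in> profiles" if "v \<in> profiles" "w \<in> profiles" for v w
    using that add_closed[of "lift v" "lift w"]
    by (auto simp: profiles_def radial_lift_add[abs_def] intro!: continuous_on_add)
  show "(\<lambda>t. c * v t) \<in> profiles" if "v \<in> profiles" for c v
    using that scale_closed[of "lift v" c]
    by (auto simp: profiles_def radial_lift_cmult[abs_def] intro!: continuous_on_mult_left)
  show "profile_norm (\<lambda>t. c * v t) = \<bar>c\<bar> * profile_norm v" if "v \<in> profiles" for c v
    using that norm_scale[of "lift v" c] by (simp add: profile_norm_def profiles_def radial_lift_cmult[abs_def])
  show "profile_norm (\<lambda>t. v t + w t) \<le> profile_norm v + profile_norm w" if "v \<in> profiles" "w \<in> profiles" for v w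
    using that norm_triangle[of "lift v" "lift w"] s\<omega>
    by (simp add: profile_norm_def profiles_def radial_lift_add[abs_def] flip: add_divide_distrib)
       (simp add: divide_right_mono)
  show tv: "v \<in> profiles" if "test_fun v" for v
    using lift_test[OF that] smooth_real_continuous[OF test_fun_smooth[OF that]] by (simp add: profiles_def)
  show "profile_norm v = sqrt (energy A B v)" if "test_fun v" for v
    using nrm_test[OF that] \<omega>_pos by (simp add: profile_norm_def real_sqrt_mult)
  show "\<exists>s. (\<forall>k::nat. test_fun (s k)) \<and> (\<lambda>k. profile_norm (\<lambda>t. s k t - v t)) \<longlonglongrightarrow> 0" if v: "v \<in> profiles" for v
  proof -
    obtain s where s: "\<And>k::nat. s k \<in> punctured_test_rad" and lim: "(\<lambda>k. nrm (\<lambda>x. s k x - lift v x)) \<longlonglongrightarrow> 0"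
      using dense[of "lift v"] v unfolding profiles_def by blast
    have "\<exists>w. test_fun w \<and> s k = lift w" for k using punctured_test_rad_eq_radial_lift[OF s] by metis
    then obtain w where w: "\<And>k. test_fun (w k)" "\<And>k. s k = lift (w k)" by metis
    have "profile_norm (\<lambda>t. w k t - v t) = nrm (\<lambda>x. s k x - lift v x) / sqrt \<omega>" for k
      unfolding profile_norm_def w(2) radial_lift_diff[abs_def] ..
    then have "(\<lambda>k. profile_norm (\<lambda>t. w k t - v t)) \<longlonglongrightarrow> 0" using tendsto_divide_zero[OF lim] by simp
    then show ?thesis using w(1) by blast
  qed
  show "\<exists>v\<in>profiles. (\<lambda>k. profile_norm (\<lambda>t. s k t - v t)) \<longlonglongrightarrow> 0"
    if s: "\<And>k. s k \<in> profiles" and C: "\<forall>e>0. \<exists>K. \<forall>j\<ge>K. \<forall>k\<ge>K. profile_norm (\<lambda>t. s j t - s k t) < e"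
    for s :: "nat \<Rightarrow> real \<Rightarrow> real"
  proof -
    have sN: "lift (s k) \<in> N" for k using s by (simp add: profiles_def)
    have "\<exists>u\<in>N. (\<lambda>k. nrm (\<lambda>x. lift (s k) x - u x)) \<longlonglongrightarrow> 0"
    proof (rule complete[OF sN], intro allI impI)
      fix e :: real assume e: "e > 0"
      then obtain K where K: "\<And>j k. j \<ge> K \<Longrightarrow> k \<ge> K \<Longrightarrow> profile_norm (\<lambda>t. s j t - s k t) < e / sqrt \<omega>"
        using C[rule_format, of "e / sqrt \<omega>"] s\<omega> by (auto simp del: real_sqrt_gt_0_iff)
      have "nrm (\<lambda>x. lift (s j) x - lift (s k) x) < e" if "j \<ge> K" "k \<ge> K" for j k
        using K[OF that] s\<omega> unfolding profile_norm_def radial_lift_diff[abs_def] by (simp add: divide_less_cancel)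
      then show "\<exists>K. \<forall>j\<ge>K. \<forall>k\<ge>K. nrm (\<lambda>x. lift (s j) x - lift (s k) x) < e" by blast
    qed
    then obtain u where u: "u \<in> N" "(\<lambda>k. nrm (\<lambda>x. lift (s k) x - u x)) \<longlonglongrightarrow> 0" by blast
    obtain v where v: "v \<in> profiles" "AE x in lebesgue. u x = lift v x" using profile_exists[OF u(1)] by blast
    have vN: "lift v \<in> N" using v(1) by (simp add: profiles_def)
    have "profile_norm (\<lambda>t. s k t - v t) = nrm (\<lambda>x. lift (s k) x - u x) / sqrt \<omega>" for k
    proof -
      have "nrm (\<lambda>x. lift (s k) x - lift v x) = nrm (\<lambda>x. lift (s k) x - u x)"
        by (rule nrm_AE_eq[OF diff_closed[OF sN vN] diff_closed[OF sN u(1)]])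
           (use v(2) in \<open>auto elim: eventually_mono\<close>)
      then show ?thesis unfolding profile_norm_def radial_lift_diff[abs_def] by simp
    qed
    then have "(\<lambda>k. profile_norm (\<lambda>t. s k t - v t)) \<longlonglongrightarrow> 0" using tendsto_divide_zero[OF u(2)] by simp
    then show ?thesis using v(1) by blast
  qed
  show "\<bar>v t\<bar> \<le> 1 / sqrt (min A B) * profile_norm v" if v: "v \<in> profiles" for v t
  proof -
    have vN: "lift v \<in> N" using v by (simp add: profiles_def)
    obtain w where w: "w \<in> profiles" "AE x in lebesgue. lift v x = lift w x"
      "\<And>t. \<bar>w t\<bar> \<le> 1 / sqrt (min A B) * profile_norm w" using profile_exists[OF vN] by blast
    have "v = w" by (rule AE_eq_radial_lift[OF _ _ w(2)]) (use v w(1) in \<open>auto simp: profiles_def\<close>)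
    then show ?thesis using w(3) by simp
  qed
qed (rule A B)+

interpretation P: profile_space profiles profile_norm A B "1 / sqrt (min A B)"
  by (rule profile_space)

section \<open>The quotient and its infimum in terms of profiles\<close>

context
  fixes \<beta> p :: real
  assumes p: "p > 1" and balance: "real DIM('a) + \<beta> = g * (p + 1)"
begin

text \<open>\<open>balance\<close> says that the exponent \<beta> - g (p + 1) is minus the
  dimension, so this integral loses its weight in logarithmic polar coordinates too.\<close>

lemma weighted_integral_lift:
  assumes v: "v \<in> profiles"
  shows "(LINT x|lebesgue. norm x powr \<beta> * \<bar>lift v x\<bar> powr (p + 1)) = \<omega> * pow_integral p v"
proof -
  have [measurable]: "v \<in> borel_measurable borel" by (rule P.borel[OF v])
  have "norm x powr \<beta> * \<bar>lift v x\<bar> powr (p + 1) = norm x powr (- real DIM('a)) * \<bar>v (ln (norm x))\<bar> powr (p + 1)" for x :: 'a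
  proof -
    have "norm x powr \<beta> * (norm x powr (- g)) powr (p + 1) = norm x powr (- real DIM('a))"
    proof -
      have "\<beta> + (- g) * (p + 1) = - real DIM('a)" using balance by simp
      then show ?thesis by (simp only: powr_powr powr_add[symmetric])
    qed
    then show ?thesis by (simp add: radial_lift_def abs_mult powr_mult flip: mult.assoc)
  qed
  then have "(LINT x|(lebesgue :: 'a measure). norm x powr \<beta> * \<bar>lift v x\<bar> powr (p + 1))
     = (LINT x|(lebesgue :: 'a measure). norm x powr (- real DIM('a)) * \<bar>v (ln (norm x))\<bar> powr (p + 1))" by simp
  also have "\<dots> = \<omega> * pow_integral p v"
    unfolding pow_integral_def \<omega>_def by (rule integral_polar) auto
  finally show ?thesis .
qed

lemma quotient_lift:
  assumes v: "v \<in> profiles"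
  shows "quotient \<beta> p nrm (lift v)
    = \<omega> powr ((p - 1) / (p + 1)) * ((profile_norm v)\<^sup>2 / pow_integral p v powr (2 / (p + 1)))"
proof -
  have "(nrm (lift v))\<^sup>2 = \<omega> * (profile_norm v)\<^sup>2"
    unfolding profile_norm_def power_divide real_sqrt_pow2[OF \<omega>_nonneg] by simp
  moreover have "(\<omega> * pow_integral p v) powr (2 / (p + 1)) = \<omega> powr (2 / (p + 1)) * pow_integral p v powr (2 / (p + 1))"
    using P.pow_integral_nonneg \<omega>_pos by (simp add: powr_mult)
  moreover have "\<omega> / \<omega> powr (2 / (p + 1)) = \<omega> powr ((p - 1) / (p + 1))"
  proof -
    have "\<omega> / \<omega> powr (2 / (p + 1)) = \<omega> powr (1 - 2 / (p + 1))" using \<omega>_pos by (simp add: powr_diff)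
    also have "1 - 2 / (p + 1) = (p - 1) / (p + 1)" using p by (simp add: field_simps)
    finally show ?thesis .
  qed
  ultimately show ?thesis
    unfolding quotient_def weighted_integral_lift[OF v] by (simp flip: times_divide_times_eq)
qed

text \<open>Every competitor agrees almost everywhere with the lift of a profile, and the quotient
  depends only on the class. What remains of \<omega> after division is its power
  \<open>1 - 2 / (p + 1)\<close>.\<close>

lemma achieved_lift:
  assumes v: "v \<in> profiles" and pos: "pow_integral p v > 0"
    and min: "(profile_norm v)\<^sup>2 = P.best p * pow_integral p v powr (2 / (p + 1))"
  shows "best_const \<beta> p N nrm = \<omega> powr ((p - 1) / (p + 1)) * P.best p"
    "best_const_achieved_by \<beta> p N nrm (lift v)"
proof -
  let ?S = "\<omega> powr ((p - 1) / (p + 1)) * P.best p"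
  have vN: "lift v \<in> N" using v by (simp add: profiles_def)
  have nz: "nonzero (lift v)"
  proof (rule ccontr)
    assume "\<not> nonzero (lift v)"
    then have "AE x in lebesgue. lift v x = lift (\<lambda>t. 0) x" by (simp add: nonzero_def radial_lift_def)
    then have "v = (\<lambda>t. 0)" by (intro AE_eq_radial_lift[of v "\<lambda>t. 0" "- g"]) (use v in \<open>auto simp: profiles_def\<close>)
    then show False using pos by (simp add: pow_integral_def)
  qed
  have qv: "quotient \<beta> p nrm (lift v) = ?S"
    unfolding quotient_lift[OF v] min using pos by simp
  have ge: "?S \<le> quotient \<beta> p nrm u" if u: "u \<in> N" "nonzero u" for u
  proof -
    obtain w where w: "w \<in> profiles" "AE x in lebesgue. u x = lift w x" using profile_exists[OF u(1)] by blast
    have wN: "lift w \<in> N" using w(1) by (simp add: profiles_def)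
    have "\<exists>t. w t \<noteq> 0"
    proof (rule ccontr)
      assume "\<not> (\<exists>t. w t \<noteq> 0)"
      then have "AE x in lebesgue. u x = 0" using w(2) by (simp add: radial_lift_def)
      then show False using u(2) by (simp add: nonzero_def)
    qed
    then have I: "pow_integral p w > 0" using P.pow_integral_pos[OF w(1)] p by auto
    have "(LINT x|lebesgue. norm x powr \<beta> * \<bar>u x\<bar> powr (p + 1)) = (LINT x|lebesgue. norm x powr \<beta> * \<bar>lift w x\<bar> powr (p + 1))"
    proof (rule integral_cong_AE)
      have [measurable]: "u \<in> borel_measurable lebesgue" "lift w \<in> borel_measurable lebesgue"
        using u(1) wN by (auto intro: measurable)
      have [measurable]: "(\<lambda>x::'a. norm x powr \<beta>) \<in> borel_measurable lebesgue"
        by (rule measurable_completion) measurable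
      show "(\<lambda>x. norm x powr \<beta> * \<bar>u x\<bar> powr (p + 1)) \<in> borel_measurable lebesgue"
        "(\<lambda>x. norm x powr \<beta> * \<bar>lift w x\<bar> powr (p + 1)) \<in> borel_measurable lebesgue" by measurable
      show "AE x in lebesgue. norm x powr \<beta> * \<bar>u x\<bar> powr (p + 1) = norm x powr \<beta> * \<bar>lift w x\<bar> powr (p + 1)"
        using w(2) by eventually_elim simp
    qed
    then have "quotient \<beta> p nrm u = quotient \<beta> p nrm (lift w)"
      unfolding quotient_def using nrm_AE_eq[OF u(1) wN w(2)] by simp
    also have "\<dots> \<ge> ?S"
    proof -
      have "P.best p \<le> (profile_norm w)\<^sup>2 / pow_integral p w powr (2 / (p + 1))"
        using P.best_le[OF w(1) p] I by (simp add: pos_le_divide_eq)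
      then show ?thesis unfolding quotient_lift[OF w(1)] by (intro mult_left_mono) auto
    qed
    finally show ?thesis .
  qed
  show bc: "best_const \<beta> p N nrm = ?S"
    unfolding best_const_def using vN nz qv ge by (intro cInf_eq_minimum) (auto intro!: rev_image_eqI)
  show "best_const_achieved_by \<beta> p N nrm (lift v)"
    unfolding best_const_achieved_by_def bc using vN nz qv by simp
qed

theorem best_const_attained: "best_const \<beta> p N nrm > 0 \<and> (\<exists>u. best_const_achieved_by \<beta> p N nrm u)"
proof -
  obtain y where y: "y \<in> profiles" "pow_integral p y = 1" "(profile_norm y)\<^sup>2 = P.best p" "P.best p > 0"
    using P.minimizer_exists[OF p] by blast
  have "pow_integral p y > 0" "(profile_norm y)\<^sup>2 = P.best p * pow_integral p y powr (2 / (p + 1))" using y by simp_all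
  note ach = achieved_lift[OF y(1) this]
  have "\<omega> powr ((p - 1) / (p + 1)) > 0" by simp
  then have "best_const \<beta> p N nrm > 0" unfolding ach(1) using y(4) by (rule mult_pos_pos)
  then show ?thesis using ach(2) by blast
qed

theorem best_const_explicit:
  fixes \<nu> m :: real
  assumes \<nu>: "\<nu> > 0" and m: "m < 0" and pm: "p = 1 - 4 / m"
    and AB: "A = \<nu>\<^sup>2 * (m\<^sup>2 + (m - 2)\<^sup>2)" "B = \<nu> ^ 4 * (m\<^sup>2 * (m - 2)\<^sup>2)"
    and e: "e = (p - 1) / (p + 1)"
  shows "best_const \<beta> p N nrm = surface_measure (sphere (0 :: 'a) 1) powr e * phi m \<nu> (4 - e) e"
    "\<exists>C>0. C powr (p - 1) = m * (m - 1) * (m - 2) * (m - 3) * \<nu> ^ 4 \<and>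
      best_const_achieved_by \<beta> p N nrm (extremal \<alpha> C m \<nu>)"
proof -
  define X where "X = m * (m - 1) * (m - 2) * (m - 3) * \<nu> ^ 4"
  have X: "X > 0" unfolding X_def using m \<nu> by (simp add: mult_neg_neg mult_neg_pos mult_pos_neg zero_less_mult_iff)
  define C where "C = X powr (1 / (p - 1))"
  have C: "C > 0" using X by (simp add: C_def)
  have Cp: "C powr (p - 1) = m * (m - 1) * (m - 2) * (m - 3) * \<nu> ^ 4"
    unfolding X_def[symmetric] C_def powr_powr using X p by simp
  note min = P.explicit_minimizer[OF \<nu> m pm AB C Cp]
  note ach = achieved_lift[OF min(1) min(3) min(2)]
  show "best_const \<beta> p N nrm = surface_measure (sphere (0 :: 'a) 1) powr e * phi m \<nu> (4 - e) e"
    using ach(1) min(4) unfolding surface_measure_sphere e \<omega>_def by simp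
  have "extremal \<alpha> C m \<nu> = lift (\<lambda>t. C * cosh (\<nu> * t) powr m)"
    by (rule ext) (rule extremal_eq_radial_lift[OF g])
  then show "\<exists>C>0. C powr (p - 1) = m * (m - 1) * (m - 2) * (m - 3) * \<nu> ^ 4 \<and>
      best_const_achieved_by \<beta> p N nrm (extremal \<alpha> C m \<nu>)"
    using C Cp ach(2) by auto
qed

end

end

end

section \<open>The parameter curves\<close>

text \<open>Here s = 2 + \<alpha>, and the dimension minus 2 is 2 g + s. The first alternative is
  the first condition on the parameters and gives \<open>A \<ge> 2 g\<^sup>2 + 2 sqrt \<mu>\<close>
  and \<open>B \<ge> (g\<^sup>2 + sqrt \<mu>)\<^sup>2\<close>. The second and third conditions both
  imply the other alternative, where \<open>B\<close> is \<open>g\<^sup>2\<close> times the slack in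
  the bound on lam and \<open>A\<close> is the same slack plus
  \<open>g\<^sup>2 - \<mu> / g\<^sup>2\<close>; zero slack is the endpoint.\<close>

lemma coefficients_nonneg:
  fixes g s lam \<mu> A B :: real
  assumes g: "g > 0" and A: "A = ((2 * g + s)\<^sup>2 + s\<^sup>2) / 2 - lam" and B: "B = (g * (g + s))\<^sup>2 - lam * g\<^sup>2 + \<mu>"
    and C: "(\<mu> \<ge> 0 \<and> lam \<le> (2 * g + s) * s - 2 * sqrt \<mu>) \<or> (\<mu> \<le> g ^ 4 \<and> lam \<le> \<mu> / g\<^sup>2 + (g + s)\<^sup>2)"
  shows "(A > 0 \<and> B > 0) \<or> (A \<ge> 0 \<and> B = 0)"
  using C
proof
  assume c: "\<mu> \<ge> 0 \<and> lam \<le> (2 * g + s) * s - 2 * sqrt \<mu>"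
  define r where "r = sqrt \<mu>"
  have r: "r \<ge> 0" "\<mu> = r\<^sup>2" using c by (auto simp: r_def)
  have l: "lam \<le> (2 * g + s) * s - 2 * r" using c by (simp add: r_def)
  have "A \<ge> 2 * g\<^sup>2 + 2 * r" unfolding A using l by (simp add: power2_eq_square algebra_simps)
  moreover have "2 * g\<^sup>2 + 2 * r > 0" using g r by (simp add: add_pos_nonneg)
  moreover have "B \<ge> (g\<^sup>2 + r)\<^sup>2"
  proof -
    have "lam * g\<^sup>2 \<le> ((2 * g + s) * s - 2 * r) * g\<^sup>2" using l by (rule mult_right_mono) simp
    then show ?thesis unfolding B r(2) by (simp add: power2_eq_square algebra_simps)
  qed
  moreover have "g\<^sup>2 + r > 0" using g r by (simp add: add_pos_nonneg)
  then have "(g\<^sup>2 + r)\<^sup>2 > 0" by (rule zero_less_power)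
  ultimately show ?thesis by linarith
next
  assume c: "\<mu> \<le> g ^ 4 \<and> lam \<le> \<mu> / g\<^sup>2 + (g + s)\<^sup>2"
  have BB: "B = g\<^sup>2 * (\<mu> / g\<^sup>2 + (g + s)\<^sup>2 - lam)" 
  proof -
    have "g\<^sup>2 * (\<mu> / g\<^sup>2) = \<mu>" using g by simp
    moreover have "g\<^sup>2 * (\<mu> / g\<^sup>2 + (g + s)\<^sup>2 - lam) = g\<^sup>2 * (\<mu> / g\<^sup>2) + g\<^sup>2 * (g + s)\<^sup>2 - g\<^sup>2 * lam"
      by (simp only: right_diff_distrib distrib_left[of "g\<^sup>2"])
    ultimately show ?thesis unfolding B power_mult_distrib by simp
  qed
  have AA: "A = (g\<^sup>2 - \<mu> / g\<^sup>2) + (\<mu> / g\<^sup>2 + (g + s)\<^sup>2 - lam)" unfolding A by (simp add: power2_eq_square field_simps)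
  have "\<mu> / g\<^sup>2 \<le> g\<^sup>2" using c g by (simp add: divide_le_eq power4_eq_xxxx power2_eq_square mult.assoc)
  moreover have "B > 0 \<longleftrightarrow> \<mu> / g\<^sup>2 + (g + s)\<^sup>2 - lam > 0" "B = 0 \<longleftrightarrow> \<mu> / g\<^sup>2 + (g + s)\<^sup>2 - lam = 0"
    unfolding BB using g by (auto simp: zero_less_mult_iff)
  ultimately show ?thesis using c unfolding AA by linarith
qed

text \<open>Squaring removes the root and the choice of sign at once, leaving one polynomial
  identity for both branches.\<close>

lemma quadratic_root_square:
  fixes D L R x :: real
  assumes "L > 0" "D \<ge> 0" "\<exists>\<sigma>\<in>{1, -1}. x = (R + \<sigma> * sqrt D) / L"
  shows "(L * x - R)\<^sup>2 = D"
proof -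
  obtain \<sigma> where "\<sigma> \<in> {1, -1}" "x = (R + \<sigma> * sqrt D) / L" using assms(3) by blast
  then have \<sigma>: "\<sigma> = 1 \<or> \<sigma> = -1" "x = (R + \<sigma> * sqrt D) / L" by simp_all
  have "L * x - R = \<sigma> * sqrt D" using \<sigma>(2) assms(1) by simp
  then show ?thesis using \<sigma>(1) assms(2) by (auto simp: power_mult_distrib)
qed

text \<open>With \<open>T = g\<^sup>2 + h\<^sup>2\<close> the conclusion says
  \<open>T\<^sup>2 B = g\<^sup>2 h\<^sup>2 A\<^sup>2\<close>: the numbers with sum \<open>A\<close>
  and product \<open>B\<close> are in the ratio of \<open>g\<^sup>2\<close> to
  \<open>h\<^sup>2\<close>. This is the form in which the parameter curves enter.\<close>

lemma parameter_relation:
  fixes g h lam \<mu> P :: real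
  assumes g: "g > 0" and h: "h > 0" and P: "P = 2 * h / g" and X: "X = lam / (g + h)\<^sup>2" and M: "M = \<mu> / (g + h) ^ 4"
    and R: "4 * P\<^sup>2 * (P + 2) * X\<^sup>2 - 4 * (P - 2) * (P\<^sup>2 + 4) * X = (P + 2) * (P\<^sup>2 + 4)\<^sup>2 * M"
  shows "(g\<^sup>2 + h\<^sup>2)\<^sup>2 * \<mu> = g\<^sup>2 * h\<^sup>2 * lam\<^sup>2 - g\<^sup>2 * (h\<^sup>2 - g\<^sup>2) * (g\<^sup>2 + h\<^sup>2) * lam"
proof -
  define k where "k = g + h"
  have k: "k > 0" using g h by (simp add: k_def)
  have l: "lam = X * k\<^sup>2" "\<mu> = M * k ^ 4" using k by (simp_all add: X M k_def)
  have i: "P * g = 2 * h" "(P + 2) * g = 2 * k" "(P - 2) * g = 2 * (h - g)" "(P\<^sup>2 + 4) * g\<^sup>2 = 4 * (g\<^sup>2 + h\<^sup>2)"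
    unfolding P k_def using g by (simp_all add: field_simps power2_eq_square)
  \<comment> \<open>The factor \<open>g ^ 5\<close> clears all denominators: \<open>P\<close>,
    \<open>P + 2\<close> and \<open>P - 2\<close> each absorb one \<open>g\<close>, and
    \<open>P\<^sup>2 + 4\<close> absorbs \<open>g\<^sup>2\<close>.\<close>
  have "g ^ 5 * (4 * P\<^sup>2 * (P + 2) * X\<^sup>2 - 4 * (P - 2) * (P\<^sup>2 + 4) * X) = g ^ 5 * ((P + 2) * (P\<^sup>2 + 4)\<^sup>2 * M)"
    unfolding R ..
  moreover have "g ^ 5 * (4 * P\<^sup>2 * (P + 2) * X\<^sup>2 - 4 * (P - 2) * (P\<^sup>2 + 4) * X)
    = 4 * (P * g)\<^sup>2 * ((P + 2) * g) * g\<^sup>2 * X\<^sup>2 - 4 * ((P - 2) * g) * ((P\<^sup>2 + 4) * g\<^sup>2) * g\<^sup>2 * X"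
    by (simp add: algebra_simps power2_eq_square eval_nat_numeral)
  moreover have "g ^ 5 * ((P + 2) * (P\<^sup>2 + 4)\<^sup>2 * M) = ((P + 2) * g) * ((P\<^sup>2 + 4) * g\<^sup>2)\<^sup>2 * M"
    by (simp add: algebra_simps power2_eq_square eval_nat_numeral)
  ultimately have "4 * (2 * h)\<^sup>2 * (2 * k) * g\<^sup>2 * X\<^sup>2 - 4 * (2 * (h - g)) * (4 * (g\<^sup>2 + h\<^sup>2)) * g\<^sup>2 * X
      = (2 * k) * (4 * (g\<^sup>2 + h\<^sup>2))\<^sup>2 * M"
    unfolding i by simp
  then have e: "g\<^sup>2 * h\<^sup>2 * k * X\<^sup>2 - g\<^sup>2 * (h - g) * (g\<^sup>2 + h\<^sup>2) * X = k * (g\<^sup>2 + h\<^sup>2)\<^sup>2 * M"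
    by algebra
  have "(g\<^sup>2 + h\<^sup>2)\<^sup>2 * \<mu> = k ^ 3 * (k * (g\<^sup>2 + h\<^sup>2)\<^sup>2 * M)" unfolding l by (simp add: eval_nat_numeral)
  also have "\<dots> = g\<^sup>2 * h\<^sup>2 * lam\<^sup>2 - g\<^sup>2 * ((h - g) * k) * (g\<^sup>2 + h\<^sup>2) * lam"
    unfolding e[symmetric] l by (simp add: algebra_simps eval_nat_numeral)
  also have "(h - g) * k = h\<^sup>2 - g\<^sup>2" by (simp add: k_def power2_eq_square algebra_simps)
  finally show ?thesis .
qed

lemma parameter_relation_first:
  fixes g h lam \<mu> P :: real
  assumes g: "g > 0" and h: "h > 0" and P: "P = 2 * h / g"
    and D: "D = (P ^ 4 - 16)\<^sup>2 + P\<^sup>2 * (P + 2) ^ 4 * (P\<^sup>2 + 4)\<^sup>2 * (\<mu> / (g + h) ^ 4)" "D \<ge> 0"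
    and eq: "\<exists>\<sigma>\<in>{1, -1}. lam / (g + h)\<^sup>2 = (P ^ 4 - 16 + \<sigma> * sqrt D) / (2 * P\<^sup>2 * (P + 2)\<^sup>2)"
  shows "(g\<^sup>2 + h\<^sup>2)\<^sup>2 * \<mu> = g\<^sup>2 * h\<^sup>2 * lam\<^sup>2 - g\<^sup>2 * (h\<^sup>2 - g\<^sup>2) * (g\<^sup>2 + h\<^sup>2) * lam"
proof (rule parameter_relation[OF g h P refl refl])
  define X where "X = lam / (g + h)\<^sup>2"
  define M where "M = \<mu> / (g + h) ^ 4"
  have P0: "P > 0" unfolding P using g h by simp
  have "(2 * P\<^sup>2 * (P + 2)\<^sup>2 * X - (P ^ 4 - 16))\<^sup>2 = (P ^ 4 - 16)\<^sup>2 + P\<^sup>2 * (P + 2) ^ 4 * (P\<^sup>2 + 4)\<^sup>2 * M"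
    using quadratic_root_square[OF _ D(2) eq] P0 unfolding D(1) X_def M_def by simp
  \<comment> \<open>\<open>(P ^ 4 - 16)\<^sup>2\<close> cancels after expansion, and
    \<open>P ^ 4 - 16 = (P - 2) (P + 2) (P\<^sup>2 + 4)\<close> lets the remaining terms share the
    factor \<open>P\<^sup>2 (P + 2) ^ 3\<close>.\<close>
  then have "P\<^sup>2 * (P + 2) ^ 3 * (4 * P\<^sup>2 * (P + 2) * X\<^sup>2 - 4 * (P - 2) * (P\<^sup>2 + 4) * X - (P + 2) * (P\<^sup>2 + 4)\<^sup>2 * M) = 0"
    by algebra
  moreover have "P \<noteq> 0" "P + 2 \<noteq> 0" using P0 by auto
  ultimately show "4 * P\<^sup>2 * (P + 2) * (lam / (g + h)\<^sup>2)\<^sup>2 - 4 * (P - 2) * (P\<^sup>2 + 4) * (lam / (g + h)\<^sup>2)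
      = (P + 2) * (P\<^sup>2 + 4)\<^sup>2 * (\<mu> / (g + h) ^ 4)"
    unfolding X_def M_def by simp
qed

text \<open>The second parameter curve is the first one with \<open>P\<close> replaced by \<open>4 / P\<close>.\<close>

lemma parameter_relation_second:
  fixes g h lam \<mu> P :: real
  assumes g: "g > 0" and h: "h > 0" and P: "P = 2 * g / h"
    and D: "D = P ^ 4 * (P ^ 4 - 16)\<^sup>2 + 16 * P\<^sup>2 * (P + 2) ^ 4 * (P\<^sup>2 + 4)\<^sup>2 * (\<mu> / (g + h) ^ 4)" "D \<ge> 0"
    and eq: "\<exists>\<sigma>\<in>{1, -1}. lam / (g + h)\<^sup>2 = (P\<^sup>2 * (16 - P ^ 4) + \<sigma> * sqrt D) / (8 * P\<^sup>2 * (P + 2)\<^sup>2)"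
  shows "(g\<^sup>2 + h\<^sup>2)\<^sup>2 * \<mu> = g\<^sup>2 * h\<^sup>2 * lam\<^sup>2 - g\<^sup>2 * (h\<^sup>2 - g\<^sup>2) * (g\<^sup>2 + h\<^sup>2) * lam"
proof (rule parameter_relation[OF g h refl refl refl])
  define X where "X = lam / (g + h)\<^sup>2"
  define M where "M = \<mu> / (g + h) ^ 4"
  \<comment> \<open>This is 4 / P, the variable of the first curve.\<close>
  define q where "q = 2 * h / g"
  have P0: "P > 0" and q0: "q > 0" unfolding P q_def using g h by simp_all
  have Pq: "P * q = 4" unfolding P q_def using g h by simp
  have "(8 * P\<^sup>2 * (P + 2)\<^sup>2 * X - P\<^sup>2 * (16 - P ^ 4))\<^sup>2 = P ^ 4 * (P ^ 4 - 16)\<^sup>2 + 16 * P\<^sup>2 * (P + 2) ^ 4 * (P\<^sup>2 + 4)\<^sup>2 * M"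
    using quadratic_root_square[OF _ D(2) eq] P0 unfolding D(1) X_def M_def by simp
  then have "16 * P\<^sup>2 * (P + 2) ^ 3 * (4 * P\<^sup>2 * (P + 2) * X\<^sup>2 - P\<^sup>2 * (2 - P) * (P\<^sup>2 + 4) * X - (P + 2) * (P\<^sup>2 + 4)\<^sup>2 * M) = 0"
    by algebra
  moreover have "P \<noteq> 0" "P + 2 \<noteq> 0" using P0 by auto
  ultimately have R: "4 * P\<^sup>2 * (P + 2) * X\<^sup>2 - P\<^sup>2 * (2 - P) * (P\<^sup>2 + 4) * X - (P + 2) * (P\<^sup>2 + 4)\<^sup>2 * M = 0" by simp
  have i: "P * (q + 2) = 2 * (P + 2)" "P * (q - 2) = 2 * (2 - P)" "P\<^sup>2 * (q\<^sup>2 + 4) = 4 * (P\<^sup>2 + 4)"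
  proof -
    have "P\<^sup>2 * q\<^sup>2 = 16" using Pq by (simp flip: power_mult_distrib)
    then show "P\<^sup>2 * (q\<^sup>2 + 4) = 4 * (P\<^sup>2 + 4)" by (simp add: distrib_left)
    show "P * (q + 2) = 2 * (P + 2)" "P * (q - 2) = 2 * (2 - P)"
      using Pq by (simp_all add: distrib_left right_diff_distrib)
  qed
  have "P ^ 5 * (4 * q\<^sup>2 * (q + 2) * X\<^sup>2 - 4 * (q - 2) * (q\<^sup>2 + 4) * X - (q + 2) * (q\<^sup>2 + 4)\<^sup>2 * M)
     = 4 * (P * q)\<^sup>2 * (P * (q + 2)) * P\<^sup>2 * X\<^sup>2 - 4 * (P * (q - 2)) * (P\<^sup>2 * (q\<^sup>2 + 4)) * P\<^sup>2 * X
       - (P * (q + 2)) * (P\<^sup>2 * (q\<^sup>2 + 4))\<^sup>2 * M"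
    by (simp add: algebra_simps eval_nat_numeral)
  also have "\<dots> = 32 * (4 * P\<^sup>2 * (P + 2) * X\<^sup>2 - P\<^sup>2 * (2 - P) * (P\<^sup>2 + 4) * X - (P + 2) * (P\<^sup>2 + 4)\<^sup>2 * M)"
    unfolding i Pq by algebra
  finally have "P ^ 5 * (4 * q\<^sup>2 * (q + 2) * X\<^sup>2 - 4 * (q - 2) * (q\<^sup>2 + 4) * X - (q + 2) * (q\<^sup>2 + 4)\<^sup>2 * M) = 0"
    unfolding R by simp
  then have "4 * q\<^sup>2 * (q + 2) * X\<^sup>2 - 4 * (q - 2) * (q\<^sup>2 + 4) * X - (q + 2) * (q\<^sup>2 + 4)\<^sup>2 * M = 0"
    using P0 by simp
  then show "4 * (2 * h / g)\<^sup>2 * (2 * h / g + 2) * (lam / (g + h)\<^sup>2)\<^sup>2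
      - 4 * (2 * h / g - 2) * ((2 * h / g)\<^sup>2 + 4) * (lam / (g + h)\<^sup>2)
      = (2 * h / g + 2) * ((2 * h / g)\<^sup>2 + 4)\<^sup>2 * (\<mu> / (g + h) ^ 4)"
    unfolding q_def[symmetric] X_def[symmetric] M_def[symmetric] by simp
qed

text \<open>The square root in \<nu> is \<open>sqrt (A / T)\<close> with
  \<open>T = g\<^sup>2 + h\<^sup>2\<close>, so that \<open>2 g \<nu> / |s|\<close> and
  \<open>2 h \<nu> / |s|\<close> have squares with sum \<open>A\<close>; by the relation on the
  parameters these squares have product \<open>B\<close>.\<close>

lemma soliton_coefficients:
  fixes g s lam \<mu> \<nu> A B :: real
  assumes g: "g > 0" and h: "g + s > 0" and s: "s \<noteq> 0"
    and A: "A = ((2 * g + s)\<^sup>2 + s\<^sup>2) / 2 - lam" "A > 0" and B: "B = (g * (g + s))\<^sup>2 - lam * g\<^sup>2 + \<mu>"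
    and rel: "(g\<^sup>2 + (g + s)\<^sup>2)\<^sup>2 * \<mu> = g\<^sup>2 * (g + s)\<^sup>2 * lam\<^sup>2 - g\<^sup>2 * ((g + s)\<^sup>2 - g\<^sup>2) * (g\<^sup>2 + (g + s)\<^sup>2) * lam"
    and \<nu>: "\<nu> = \<bar>s\<bar> / 2 * sqrt (1 - 2 * lam / ((2 * g + s)\<^sup>2 + s\<^sup>2))"
  shows "\<nu> > 0" "A = \<nu>\<^sup>2 * ((2 * g / s)\<^sup>2 + (2 * (g + s) / s)\<^sup>2)"
    "B = \<nu> ^ 4 * ((2 * g / s)\<^sup>2 * (2 * (g + s) / s)\<^sup>2)"
proof -
  define h where "h = g + s"
  define T where "T = g\<^sup>2 + h\<^sup>2"
  have T: "T > 0" unfolding T_def using g by (simp add: add_pos_nonneg)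
  have T2: "(2 * g + s)\<^sup>2 + s\<^sup>2 = 2 * T" unfolding T_def h_def by (simp add: power2_eq_square algebra_simps)
  have AT: "A = T - lam" unfolding A(1) T2 by simp
  have r: "1 - 2 * lam / (2 * T) = A / T" unfolding AT using T by (simp add: field_simps)
  have AT0: "A / T > 0" using A(2) T by simp
  show "\<nu> > 0" unfolding \<nu> T2 r using s AT0 by simp
  have \<nu>2: "\<nu>\<^sup>2 = s\<^sup>2 / 4 * (A / T)" unfolding \<nu> T2 r using AT0 by (simp add: power_mult_distrib power_divide)
  show "A = \<nu>\<^sup>2 * ((2 * g / s)\<^sup>2 + (2 * (g + s) / s)\<^sup>2)"
  proof -
    have "\<nu>\<^sup>2 * ((2 * g / s)\<^sup>2 + (2 * (g + s) / s)\<^sup>2) = A / T * T"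
    proof -
      have "(2 * g / s)\<^sup>2 + (2 * h / s)\<^sup>2 = 4 * T / s\<^sup>2"
        by (simp add: T_def power_divide power_mult_distrib add_divide_distrib)
      then show ?thesis unfolding \<nu>2 h_def[symmetric] using s by simp
    qed
    then show ?thesis using T by simp
  qed
  have "T\<^sup>2 * B = g\<^sup>2 * h\<^sup>2 * A\<^sup>2"
  proof -
    have "T\<^sup>2 * B = T\<^sup>2 * (g * h)\<^sup>2 - lam * g\<^sup>2 * T\<^sup>2 + T\<^sup>2 * \<mu>" unfolding B h_def by (simp add: algebra_simps)
    also have "T\<^sup>2 * \<mu> = g\<^sup>2 * h\<^sup>2 * lam\<^sup>2 - g\<^sup>2 * (h\<^sup>2 - g\<^sup>2) * T * lam" using rel by (simp add: T_def h_def)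
    finally show ?thesis unfolding AT by (simp add: T_def power2_eq_square algebra_simps)
  qed
  then have BT: "B = g\<^sup>2 * h\<^sup>2 * A\<^sup>2 / T\<^sup>2" using T by (simp add: field_simps)
  have "\<nu> ^ 4 = (\<nu>\<^sup>2)\<^sup>2" by (simp flip: power_mult)
  then have "\<nu> ^ 4 = s\<^sup>2 * s\<^sup>2 / 16 * (A\<^sup>2 / T\<^sup>2)" unfolding \<nu>2 by (simp add: power_mult_distrib power_divide power2_eq_square)
  then show "B = \<nu> ^ 4 * ((2 * g / s)\<^sup>2 * (2 * (g + s) / s)\<^sup>2)"
    unfolding BT h_def[symmetric] using s by (simp add: power_divide power_mult_distrib)
qed

text \<open>\<open>D \<ge> 0\<close> asks that the root in the parameter equation be real; at
  negative arguments the total function \<open>sqrt\<close> would return a default real value. The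
  constant \<open>C\<close> is determined by its power because p > 1.\<close>

theorem theorem1p2:
  fixes \<alpha> \<beta> p lam \<mu> n :: real
    and N :: "(real ^ 'n \<Rightarrow> real) set"
    and nrm :: "(real ^ 'n \<Rightarrow> real) \<Rightarrow> real"
  assumes n: "n = real CARD('n)" "CARD('n) \<ge> 5"
    and \<alpha>: "- n < \<alpha>" "\<alpha> < n - 4"
    and p: "p > 1"
    and balance: "(n + \<alpha>) / 2 + (n + \<beta>) / (p + 1) = n - 2"
    and C123:
      "(\<mu> \<ge> 0 \<and> lam \<le> (n - 2) * (2 + \<alpha>) - 2 * sqrt \<mu>) \<or>
       (0 \<le> \<mu> \<and> \<mu> \<le> ((n - 4 - \<alpha>) / 2) ^ 4 \<and>
        (n - 2) * (2 + \<alpha>) + 2 * sqrt \<mu> \<le> lam \<and>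
        lam \<le> 4 * \<mu> / (n - 4 - \<alpha>)\<^sup>2 + (n + \<alpha>)\<^sup>2 / 4) \<or>
       (\<mu> \<le> 0 \<and> lam \<le> 4 * \<mu> / (n - 4 - \<alpha>)\<^sup>2 + (n + \<alpha>)\<^sup>2 / 4)"
    and N: "function_completion punctured_test_rad (alpha_norm \<alpha> lam \<mu>) N nrm"
  shows
    "(best_const \<beta> p N nrm > 0 \<and> (\<exists>u. best_const_achieved_by \<beta> p N nrm u))
     \<and>
     (let D = ((p + 1) ^ 4 - 16)\<^sup>2
              + (p + 1)\<^sup>2 * (p + 3) ^ 4 * ((p + 1)\<^sup>2 + 4)\<^sup>2 * (\<mu> / (n - 2) ^ 4);
          m = - (n - 4 - \<alpha>) / (2 + \<alpha>);
          \<nu> = (2 + \<alpha>) / 2 * sqrt (1 - 2 * lam / ((n - 2)\<^sup>2 + (2 + \<alpha>)\<^sup>2))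
      in \<alpha> = \<beta> \<and> \<alpha> > - 2 \<and> D \<ge> 0 \<and>
         (\<exists>\<sigma>\<in>{1, -1}. lam / (n - 2)\<^sup>2 =
            ((p + 1) ^ 4 - 16 + \<sigma> * sqrt D) / (2 * (p + 1)\<^sup>2 * (p + 3)\<^sup>2))
         \<longrightarrow>
         best_const \<beta> p N nrm =
           surface_measure (sphere (0 :: real ^ 'n) 1) powr (2 * (2 + \<alpha>) / (n + \<alpha>)) *
           phi m \<nu> (2 * (2 * n + \<alpha> - 2) / (n + \<alpha>)) (2 * (2 + \<alpha>) / (n + \<alpha>)) \<and>
         (\<exists>C>0. C powr (p - 1) = m * (m - 1) * (m - 2) * (m - 3) * \<nu> ^ 4 \<and>
            best_const_achieved_by \<beta> p N nrm (extremal \<alpha> C m \<nu>)))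
     \<and>
     (let D = (p + 1) ^ 4 * ((p + 1) ^ 4 - 16)\<^sup>2
              + 16 * (p + 1)\<^sup>2 * (p + 3) ^ 4 * ((p + 1)\<^sup>2 + 4)\<^sup>2 * (\<mu> / (n - 2) ^ 4);
          m = (n + \<alpha>) / (2 + \<alpha>);
          \<nu> = - (2 + \<alpha>) / 2 * sqrt (1 - 2 * lam / ((n - 2)\<^sup>2 + (2 + \<alpha>)\<^sup>2))
      in (n + \<alpha>) * (n + \<beta>) = (n - 4 - \<alpha>)\<^sup>2 \<and> \<alpha> < - 2 \<and> D \<ge> 0 \<and>
         (\<exists>\<sigma>\<in>{1, -1}. lam / (n - 2)\<^sup>2 =
            ((p + 1)\<^sup>2 * (16 - (p + 1) ^ 4) + \<sigma> * sqrt D) / (8 * (p + 1)\<^sup>2 * (p + 3)\<^sup>2))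
         \<longrightarrow>
         best_const \<beta> p N nrm =
           surface_measure (sphere (0 :: real ^ 'n) 1) powr (- 2 * (2 + \<alpha>) / (n - 4 - \<alpha>)) *
           phi m \<nu> (2 * (2 * n - \<alpha> - 6) / (n - 4 - \<alpha>)) (- 2 * (2 + \<alpha>) / (n - 4 - \<alpha>)) \<and>
         (\<exists>C>0. C powr (p - 1) = m * (m - 1) * (m - 2) * (m - 3) * \<nu> ^ 4 \<and>
            best_const_achieved_by \<beta> p N nrm (extremal \<alpha> C m \<nu>)))"
proof -
  \<comment> \<open>In the variables g, h = g + s all exponents are simple: n - 2 = g + h, n +
    \<alpha> = 2 h, n - 4 - \<alpha> = 2 g, and n + \<beta> = g (p + 1).\<close>
  define s where "s = 2 + \<alpha>"
  define g where "g = (n - 4 - \<alpha>) / 2"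
  define h where "h = g + s"
  define A where "A = ((n - 2)\<^sup>2 + (2 + \<alpha>)\<^sup>2) / 2 - lam"
  define B where "B = (g * (g + 2 + \<alpha>))\<^sup>2 - lam * g\<^sup>2 + \<mu>"
  have dim: "real DIM(real ^ 'n) = n" using n by simp
  interpret radial_completion \<alpha> lam \<mu> N nrm g A B
  proof (intro radial_completion.intro radial_completion_axioms.intro N)
    show "g = (real DIM(real ^ 'n) - 4 - \<alpha>) / 2" unfolding dim by (rule g_def)
    show "A = ((real DIM(real ^ 'n) - 2)\<^sup>2 + (2 + \<alpha>)\<^sup>2) / 2 - lam" unfolding dim by (rule A_def)
  qed (rule B_def)
  have g0: "g > 0" using \<alpha> by (simp add: g_def)
  have h0: "h > 0" using \<alpha> by (simp add: h_def g_def s_def field_simps)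
  have e: "\<alpha> = s - 2" "n = 2 * g + s + 2" by (simp_all add: s_def g_def field_simps)
  have e': "n - 2 = g + h" "n - 2 = 2 * g + s" "n + \<alpha> = 2 * h" "n - 4 - \<alpha> = 2 * g" "2 + \<alpha> = s" "g + 2 + \<alpha> = g + s"
    by (simp_all add: e h_def)
  have A': "A = ((2 * g + s)\<^sup>2 + s\<^sup>2) / 2 - lam" and B': "B = (g * (g + s))\<^sup>2 - lam * g\<^sup>2 + \<mu>"
    unfolding A_def B_def e'(2,5,6) by simp_all
  have "4 * \<mu> / (n - 4 - \<alpha>)\<^sup>2 + (n + \<alpha>)\<^sup>2 / 4 = \<mu> / g\<^sup>2 + (g + s)\<^sup>2"
    unfolding e' h_def power_mult_distrib by simp
  moreover have "((n - 4 - \<alpha>) / 2) ^ 4 = g ^ 4" by (simp add: g_def)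
  moreover have "\<mu> \<le> 0 \<Longrightarrow> \<mu> \<le> g ^ 4" using g0 by (meson order_trans zero_le_power less_imp_le)
  ultimately have "(\<mu> \<ge> 0 \<and> lam \<le> (2 * g + s) * s - 2 * sqrt \<mu>) \<or> (\<mu> \<le> g ^ 4 \<and> lam \<le> \<mu> / g\<^sup>2 + (g + s)\<^sup>2)"
    using C123 unfolding e'(2,5) by auto
  from coefficients_nonneg[OF g0 A' B' this] have AB: "A > 0" "B > 0"
    using B_nonzero by auto
  have P: "n + \<beta> = g * (p + 1)"
  proof -
    have "(n + \<beta>) / (p + 1) = n - 2 - (n + \<alpha>) / 2" using balance by simp
    also have "\<dots> = g" using e'(1,3) by simp
    finally show ?thesis using p by (simp add: field_simps)
  qed
  then have bal: "real DIM(real ^ 'n) + \<beta> = g * (p + 1)" unfolding dim .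
  have p3: "p + 3 = (p + 1) + 2" by simp
  have first: "best_const \<beta> p N nrm > 0 \<and> (\<exists>u. best_const_achieved_by \<beta> p N nrm u)"
    by (rule best_const_attained[OF AB p bal])
  have second: "best_const \<beta> p N nrm =
           surface_measure (sphere (0 :: real ^ 'n) 1) powr (2 * (2 + \<alpha>) / (n + \<alpha>)) *
           phi m \<nu> (2 * (2 * n + \<alpha> - 2) / (n + \<alpha>)) (2 * (2 + \<alpha>) / (n + \<alpha>)) \<and>
         (\<exists>C>0. C powr (p - 1) = m * (m - 1) * (m - 2) * (m - 3) * \<nu> ^ 4 \<and>
            best_const_achieved_by \<beta> p N nrm (extremal \<alpha> C m \<nu>))"
    if hyp: "\<alpha> = \<beta>" "\<alpha> > - 2" "D \<ge> 0"
         "\<exists>\<sigma>\<in>{1, -1}. lam / (n - 2)\<^sup>2 = ((p + 1) ^ 4 - 16 + \<sigma> * sqrt D) / (2 * (p + 1)\<^sup>2 * (p + 3)\<^sup>2)"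
      and D: "D = ((p + 1) ^ 4 - 16)\<^sup>2 + (p + 1)\<^sup>2 * (p + 3) ^ 4 * ((p + 1)\<^sup>2 + 4)\<^sup>2 * (\<mu> / (n - 2) ^ 4)"
      and m: "m = - (n - 4 - \<alpha>) / (2 + \<alpha>)"
      and \<nu>: "\<nu> = (2 + \<alpha>) / 2 * sqrt (1 - 2 * lam / ((n - 2)\<^sup>2 + (2 + \<alpha>)\<^sup>2))"
    for D m \<nu>
  proof -
    have s0: "s > 0" using hyp(2) by (simp add: s_def)
    have m': "m = - (2 * g / s)" unfolding m e' by simp
    have m2: "m - 2 = - (2 * (g + s) / s)" unfolding m' using s0 by (simp add: field_simps)
    have P': "p + 1 = 2 * h / g"
    proof -
      \<comment> \<open>For \<alpha> = \<beta> the left-hand side n + \<beta> of the balance is n +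
        \<alpha> = 2 h.\<close>
      have "g * (p + 1) = 2 * h" using P hyp(1) e'(3) by simp
      then show ?thesis using g0 by (simp add: field_simps)
    qed
    have rel: "(g\<^sup>2 + h\<^sup>2)\<^sup>2 * \<mu> = g\<^sup>2 * h\<^sup>2 * lam\<^sup>2 - g\<^sup>2 * (h\<^sup>2 - g\<^sup>2) * (g\<^sup>2 + h\<^sup>2) * lam"
      by (rule parameter_relation_first[OF g0 h0 P' D[unfolded e'(1) p3] hyp(3) hyp(4)[unfolded e'(1) p3]])
    have \<nu>': "\<nu> = \<bar>s\<bar> / 2 * sqrt (1 - 2 * lam / ((2 * g + s)\<^sup>2 + s\<^sup>2))"
      unfolding \<nu> e'(2,5) using s0 by simp
    have sn: "s \<noteq> 0" using s0 by simp
    note co = soliton_coefficients[OF g0 h0[unfolded h_def] sn A' AB(1) B' rel[unfolded h_def] \<nu>']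
    have m0: "m < 0" unfolding m' using g0 s0 by simp
    have pm: "p = 1 - 4 / m"
    proof -
      have "- (4 / m) = 2 * s / g" unfolding m' using g0 s0 by (simp add: field_simps)
      moreover have "p = 2 * h / g - 1" using P' by simp
      moreover have "2 * h / g - 1 = 1 + 2 * s / g" unfolding h_def using g0 by (simp add: field_simps)
      ultimately show ?thesis by linarith
    qed
    have ee: "s / h = (p - 1) / (p + 1)"
    proof -
      have "p - 1 = 2 * s / g" using P' g0 unfolding h_def by (simp add: field_simps)
      then show ?thesis unfolding P' using g0 by simp
    qed
    have Aq: "A = \<nu>\<^sup>2 * (m\<^sup>2 + (m - 2)\<^sup>2)" "B = \<nu> ^ 4 * (m\<^sup>2 * (m - 2)\<^sup>2)"
      unfolding m2 unfolding m' power2_minus by (rule co)+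
    note ex = best_const_explicit[OF AB p bal co(1) m0 pm Aq ee]
    have x: "2 * (2 + \<alpha>) / (n + \<alpha>) = s / h" "2 * (2 * n + \<alpha> - 2) / (n + \<alpha>) = 4 - s / h"
    proof -
      show "2 * (2 + \<alpha>) / (n + \<alpha>) = s / h" unfolding e' using h0 by simp
      have "2 * n + \<alpha> - 2 = 4 * h - s" unfolding h_def e by simp
      then show "2 * (2 * n + \<alpha> - 2) / (n + \<alpha>) = 4 - s / h" unfolding e'(3) using h0
        by (simp only: diff_divide_distrib mult_divide_mult_cancel_left) simp
    qed
    show ?thesis unfolding x by (intro conjI ex)
  qed
  have third: "best_const \<beta> p N nrm =
           surface_measure (sphere (0 :: real ^ 'n) 1) powr (- 2 * (2 + \<alpha>) / (n - 4 - \<alpha>)) *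
           phi m \<nu> (2 * (2 * n - \<alpha> - 6) / (n - 4 - \<alpha>)) (- 2 * (2 + \<alpha>) / (n - 4 - \<alpha>)) \<and>
         (\<exists>C>0. C powr (p - 1) = m * (m - 1) * (m - 2) * (m - 3) * \<nu> ^ 4 \<and>
            best_const_achieved_by \<beta> p N nrm (extremal \<alpha> C m \<nu>))"
    if hyp: "(n + \<alpha>) * (n + \<beta>) = (n - 4 - \<alpha>)\<^sup>2" "\<alpha> < - 2" "D \<ge> 0"
         "\<exists>\<sigma>\<in>{1, -1}. lam / (n - 2)\<^sup>2 =
            ((p + 1)\<^sup>2 * (16 - (p + 1) ^ 4) + \<sigma> * sqrt D) / (8 * (p + 1)\<^sup>2 * (p + 3)\<^sup>2)"
      and D: "D = (p + 1) ^ 4 * ((p + 1) ^ 4 - 16)\<^sup>2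
              + 16 * (p + 1)\<^sup>2 * (p + 3) ^ 4 * ((p + 1)\<^sup>2 + 4)\<^sup>2 * (\<mu> / (n - 2) ^ 4)"
      and m: "m = (n + \<alpha>) / (2 + \<alpha>)"
      and \<nu>: "\<nu> = - (2 + \<alpha>) / 2 * sqrt (1 - 2 * lam / ((n - 2)\<^sup>2 + (2 + \<alpha>)\<^sup>2))"
    for D m \<nu>
  proof -
    have s0: "s < 0" using hyp(2) by (simp add: s_def)
    have gh: "g = h - s" by (simp add: h_def)
    \<comment> \<open>Since s < 0, g and h exchange roles: \<open>- m * \<nu>\<close> now belongs to
      h and \<open>(2 - m) * \<nu>\<close> to g.\<close>
    have m': "m = 2 * (g + s) / s" unfolding m e' h_def by simp
    have m2: "m - 2 = 2 * g / s" unfolding m' using s0 by (simp add: field_simps)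
    have P': "p + 1 = 2 * g / h"
    proof -
      \<comment> \<open>The hypothesis on the exponents reads
        \<open>2 h * g (p + 1) = 4 g\<^sup>2\<close>.\<close>
      have "h * (p + 1) = 2 * g" using hyp(1) g0 unfolding P e' by (simp add: power2_eq_square)
      then show ?thesis using h0 by (simp add: field_simps)
    qed
    have rel: "(g\<^sup>2 + h\<^sup>2)\<^sup>2 * \<mu> = g\<^sup>2 * h\<^sup>2 * lam\<^sup>2 - g\<^sup>2 * (h\<^sup>2 - g\<^sup>2) * (g\<^sup>2 + h\<^sup>2) * lam"
      by (rule parameter_relation_second[OF g0 h0 P' D[unfolded e'(1) p3] hyp(3) hyp(4)[unfolded e'(1) p3]])
    have \<nu>': "\<nu> = \<bar>s\<bar> / 2 * sqrt (1 - 2 * lam / ((2 * g + s)\<^sup>2 + s\<^sup>2))"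
      unfolding \<nu> e'(2,5) using s0 by simp
    have sn: "s \<noteq> 0" using s0 by simp
    note co = soliton_coefficients[OF g0 h0[unfolded h_def] sn A' AB(1) B' rel[unfolded h_def] \<nu>']
    have m0: "m < 0" unfolding m' using h0[unfolded h_def] s0 by (simp add: divide_pos_neg)
    have pm: "p = 1 - 4 / m"
    proof -
      have "4 / m = 2 * s / h" unfolding m' h_def[symmetric] using h0 s0 by (simp add: field_simps)
      moreover have "p = 2 * g / h - 1" using P' by simp
      moreover have "2 * g / h - 1 = 1 - 2 * s / h" unfolding gh using h0 by (simp add: diff_divide_distrib right_diff_distrib)
      ultimately show ?thesis by linarith
    qed
    have ee: "- s / g = (p - 1) / (p + 1)"
    proof -
      have "p - 1 = 2 * g / h - 2" using P' by simp
      also have "\<dots> = - 2 * s / h" unfolding gh using h0 by (simp add: diff_divide_distrib right_diff_distrib)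
      finally have "p - 1 = - 2 * s / h" .
      then show ?thesis unfolding P' using h0 by simp
    qed
    have Aq: "A = \<nu>\<^sup>2 * (m\<^sup>2 + (m - 2)\<^sup>2)" "B = \<nu> ^ 4 * (m\<^sup>2 * (m - 2)\<^sup>2)"
      unfolding m2 unfolding m' using co(2,3) by (simp_all only: add.commute mult.commute)
    note ex = best_const_explicit[OF AB p bal co(1) m0 pm Aq ee]
    have x: "- 2 * (2 + \<alpha>) / (n - 4 - \<alpha>) = - s / g" "2 * (2 * n - \<alpha> - 6) / (n - 4 - \<alpha>) = 4 - - s / g"
    proof -
      show "- 2 * (2 + \<alpha>) / (n - 4 - \<alpha>) = - s / g" unfolding e' using g0 by simp
      have "2 * n - \<alpha> - 6 = 4 * g + s" unfolding e by simp
      then show "2 * (2 * n - \<alpha> - 6) / (n - 4 - \<alpha>) = 4 - - s / g" unfolding e'(4) using g0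
        by (simp only: add_divide_distrib mult_divide_mult_cancel_left) simp
    qed
    show ?thesis unfolding x by (intro conjI ex)
  qed
  show ?thesis
    unfolding Let_def
    by (rule conjI[OF first], rule conjI; rule impI, elim conjE)
       (rule second[OF _ _ _ _ refl refl refl] third[OF _ _ _ _ refl refl refl]; assumption)+
qed

end
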